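(* Let $k\in\mathbb N$, $r\in\mathbb N_0$, $1\le p\le\infty$, and let $\alpha,\beta\in J_p$ be such that $r/2+\alpha\ge 0$ and $r/2+\beta\ge 0$. There is a constant $c$ depending only on $k,r,p,\alpha,\beta$ such that, for every $f\in\mathbb B_p^r(w_{\alpha,\beta})$, $$E_n(f)_{\alpha,\beta,p}\le\frac{c}{n^r}\,\omega_{k,r}^{\varphi}(f^{(r)},1/n)_{\alpha,\beta,p}\quad\text{for all integers } n\ge k+r.$$
   Context: $J_p=(-1/p,\infty)$ if $0<p<\infty$ and $J_\infty=[0,\infty)$. Jacobi weight: $w_{\alpha,\beta}(x)=(1-x)^\alpha(1+x)^\beta$. $\varphi(x)=\sqrt{1-x^2}$. $\|\cdot\|_p$ is the usual $L_p$ norm on $[-1,1]$ (essential supremum if $p=\infty$). $L_p^{\alpha,\beta}=\{f:\|w_{\alpha,\beta}f\|_p<\infty\}$ (functions on $[-1,1]$, identified if equal a.e.). $\mathbb P_n$ is the set of algebraic polynomials of degree not more than $n-1$, and $E_n(f)_{\alpha,\beta,p}=\inf_{p_n\in\mathbb P_n}\|w_{\alpha,\beta}(f-p_n)\|_p$ (also written $E_n(f)_{w_{\alpha,\beta},p}$). $\mathbb B_p^0(w_{\alpha,\beta})=L_p^{\alpha,\beta}$ and, for $r\ge1$, $\mathbb B_p^r(w_{\alpha,\beta})=\{f: f^{(r-1)}\in AC_{loc}(-1,1)\text{ and }\varphi^rf^{(r)}\in L_p^{\alpha,\beta}\}$, where $AC_{loc}(-1,1)$ is the set of functions locally absolutely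 continuous in $(-1,1)$. A function in $\mathbb B_p^r(w_{\alpha,\beta})$ is not distinguished from functions equal to it a.e. Symmetric difference: $\Delta_h^k(g,x)=\sum_{i=0}^k\binom ki(-1)^{k-i}g(x-\frac{kh}2+ih)$ if $[x-\frac{kh}2,x+\frac{kh}2]\subseteq[-1,1]$, and $\Delta_h^k(g,x)=0$ otherwise. $\mathcal W_\delta^{\xi,\zeta}(x)=(1-x-\delta\varphi(x)/2)^\xi(1+x-\delta\varphi(x)/2)^\zeta$. Modulus: for $k\in\mathbb N$, $r\in\mathbb N_0$, $f\in\mathbb B_p^r(w_{\alpha,\beta})$ and $t>0$, $$\omega_{k,r}^{\varphi}(f^{(r)},t)_{\alpha,\beta,p}=\sup_{0\le h\le t}\big\|\mathcal W_{kh}^{r/2+\alpha,r/2+\beta}(\cdot)\,\Delta_{h\varphi(\cdot)}^k(f^{(r)},\cdot)\big\|_p,$$ where the expression under the norm is understood to be $0$ at points $x$ where $\Delta^k_{h\varphi(x)}(f^{(r)},x)$ is set to $0$ because $[x-\frac{kh\varphi(x)}{2},x+\frac{kh\varphi(x)}{2}]\not\subseteq[-1,1]$. *)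

theory Defs
  imports
    "HOL-Analysis.Analysis"
    "HOL-Probability.Essential_Supremum"
    "HOL-Computational_Algebra.Polynomial"
begin

text \<open>
  Exponents \<open>p\<close> have type \<^typ>\<open>ennreal\<close>, and norms, best approximation errors and moduli take
  values in \<^typ>\<open>ennreal\<close>. The \<open>L\<^sub>p\<close> norm is the usual one for Lebesgue measurable functions.
\<close>

definition Lp_norm :: "ennreal \<Rightarrow> (real \<Rightarrow> real) \<Rightarrow> ennreal" where
  "Lp_norm p g =
    (if p = \<infinity> then esssup (lebesgue_on {-1..1}) (\<lambda>x. ennreal \<bar>g x\<bar>)
     else (let I = (\<integral>\<^sup>+x. ennreal (\<bar>g x\<bar> powr enn2real p) \<partial>lebesgue_on {-1..1})
           in if I = \<infinity> then \<infinity> else ennreal (enn2real I powr (1 / enn2real p))))"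

definition J_set :: "ennreal \<Rightarrow> real set" where
  "J_set p = (if p = \<infinity> then {0..} else {- (1 / enn2real p)<..})"

definition varphi :: "real \<Rightarrow> real" where
  "varphi x = sqrt (1 - x\<^sup>2)"

text \<open>
  In HOL, \<open>0 powr a = 0\<close> for every \<open>a\<close>, including \<open>a \<le> 0\<close>. Below, this convention differs from
  the usual one only on a finite set of points, which is invisible to \<^const>\<open>Lp_norm\<close>.
\<close>

definition jacobi_weight :: "real \<Rightarrow> real \<Rightarrow> real \<Rightarrow> real" where
  "jacobi_weight \<alpha> \<beta> x = (1 - x) powr \<alpha> * (1 + x) powr \<beta>"

definition Lp_weighted :: "ennreal \<Rightarrow> real \<Rightarrow> real \<Rightarrow> (real \<Rightarrow> real) set" where
  "Lp_weighted p \<alpha> \<beta> =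
    {f. f \<in> borel_measurable (lebesgue_on {-1..1}) \<and>
        Lp_norm p (\<lambda>x. jacobi_weight \<alpha> \<beta> x * f x) < \<infinity>}"

definition polys :: "nat \<Rightarrow> real poly set" where
  "polys n = {q. q = 0 \<or> degree q < n}"

definition best_approx :: "nat \<Rightarrow> (real \<Rightarrow> real) \<Rightarrow> real \<Rightarrow> real \<Rightarrow> ennreal \<Rightarrow> ennreal" where
  "best_approx n f \<alpha> \<beta> p =
    (INF q\<in>polys n. Lp_norm p (\<lambda>x. jacobi_weight \<alpha> \<beta> x * (f x - poly q x)))"

definition AC_on :: "real \<Rightarrow> real \<Rightarrow> (real \<Rightarrow> real) \<Rightarrow> bool" where
  "AC_on a b g \<longleftrightarrow>
    (\<forall>\<epsilon>>0. \<exists>\<delta>>0. \<forall>(m::nat) u v.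
       (\<forall>i<m. a \<le> u i \<and> u i \<le> v i \<and> v i \<le> b) \<longrightarrow>
       disjoint_family_on (\<lambda>i. {u i<..<v i}) {..<m} \<longrightarrow>
       (\<Sum>i<m. v i - u i) < \<delta> \<longrightarrow>
       (\<Sum>i<m. \<bar>g (v i) - g (u i)\<bar>) < \<epsilon>)"

definition AC_loc :: "(real \<Rightarrow> real) set" where
  "AC_loc = {g. \<forall>a b. -1 < a \<and> a \<le> b \<and> b < 1 \<longrightarrow> AC_on a b g}"

text \<open>
  Functions are identified when equal a.e. For \<open>r \<ge> 1\<close>, the set \<open>AC_reps r f\<close> consists of the
  functions \<open>g\<close> that are a.e. equal to \<open>f\<close> and for which \<open>g\<^sup>(\<^sup>r\<^sup>-\<^sup>1\<^sup>)\<close> exists everywhere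
  on \<open>(-1,1)\<close> and is locally absolutely continuous there. Such a \<open>g\<close> is continuous on \<open>(-1,1)\<close>,
  hence unique there, so the choice made in \<open>rderiv\<close> below does not affect its values on \<open>(-1,1)\<close>.
\<close>

definition AC_reps :: "nat \<Rightarrow> (real \<Rightarrow> real) \<Rightarrow> (real \<Rightarrow> real) set" where
  "AC_reps r f =
    {g. (AE x in lebesgue_on {-1..1}. f x = g x) \<and>
        (\<forall>i<r - 1. \<forall>x\<in>{-1<..<1}. (deriv ^^ i) g differentiable at x) \<and>
        (deriv ^^ (r - 1)) g \<in> AC_loc}"

text \<open>
  The derivative \<open>f\<^sup>(\<^sup>r\<^sup>)\<close>. It exists a.e. when \<open>AC_reps r f\<close> is nonempty; at the remaining points
  \<^const>\<open>deriv\<close> has a fixed unspecified value.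
\<close>

definition rderiv :: "nat \<Rightarrow> (real \<Rightarrow> real) \<Rightarrow> real \<Rightarrow> real" where
  "rderiv r f = (if r = 0 then f else (deriv ^^ r) (SOME g. g \<in> AC_reps r f))"

definition B_space :: "ennreal \<Rightarrow> nat \<Rightarrow> real \<Rightarrow> real \<Rightarrow> (real \<Rightarrow> real) set" where
  "B_space p r \<alpha> \<beta> =
    (if r = 0 then Lp_weighted p \<alpha> \<beta>
     else {f. AC_reps r f \<noteq> {} \<and> (\<lambda>x. varphi x ^ r * rderiv r f x) \<in> Lp_weighted p \<alpha> \<beta>})"

definition sym_diff :: "nat \<Rightarrow> real \<Rightarrow> (real \<Rightarrow> real) \<Rightarrow> real \<Rightarrow> real" where
  "sym_diff k h g x =
    (if {x - real k * h / 2 .. x + real k * h / 2} \<subseteq> {-1..1}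
     then (\<Sum>i\<le>k. real (k choose i) * (-1) ^ (k - i) * g (x - real k * h / 2 + real i * h))
     else 0)"

definition W_weight :: "real \<Rightarrow> real \<Rightarrow> real \<Rightarrow> real \<Rightarrow> real" where
  "W_weight \<delta> \<xi> \<zeta> x =
    (1 - x - \<delta> * varphi x / 2) powr \<xi> * (1 + x - \<delta> * varphi x / 2) powr \<zeta>"

text \<open>
  \<open>dt_modulus k r g t \<alpha> \<beta> p\<close> is the weighted modulus with \<open>g\<close> in the role of \<open>f\<^sup>(\<^sup>r\<^sup>)\<close>. Where
  \<^const>\<open>sym_diff\<close> is set to \<open>0\<close> the product vanishes, whatever value \<^const>\<open>W_weight\<close>
  (whose bases may be negative there) has.
\<close>

definition dt_modulus ::
  "nat \<Rightarrow> nat \<Rightarrow> (real \<Rightarrow> real) \<Rightarrow> real \<Rightarrow> real \<Rightarrow> real \<Rightarrow> ennreal \<Rightarrow> ennreal" where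
  "dt_modulus k r g t \<alpha> \<beta> p =
    (SUP h\<in>{0..t}. Lp_norm p
       (\<lambda>x. W_weight (real k * h) (real r / 2 + \<alpha>) (real r / 2 + \<beta>) x
             * sym_diff k (h * varphi x) g x))"

end

theory Submission
 imports Defs
begin

text \<open>
  The theorem combines two estimates. The first is a Favard inequality
  \<open>E\<^sub>n(g)\<^sub>w \<le> C/n \<parallel>w\<phi>g'\<parallel>\<^sub>p\<close>, applied \<open>r\<close> times to trade \<open>f\<close> for \<open>f\<^sup>(\<^sup>r\<^sup>)\<close> with the weight
  \<open>w\<phi>\<^sup>r\<close>. Its proof replaces a step function by a Jackson polynomial with an error that decays like a
  power of the angular distance, so that the remainder is an integral operator bounded by Schur's test;
  jumps too close to an endpoint are not approximated at all. The second is a direct estimate for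
  \<open>f\<^sup>(\<^sup>r\<^sup>)\<close>, whose weight has nonnegative exponents: on cells of angular length about \<open>1/n\<close> a Whitney
  polynomial is controlled by averages of forward differences, hence by the modulus averaged over
  \<open>h \<in> [0,1/n]\<close>, and the differences of neighbouring local polynomials are glued with Jackson steps,
  whose decay beats the polynomial growth of these differences and of the weight ratio.
\<close>

text \<open>The degree count explains the range of \<open>n\<close>: gluing with Jackson steps of
  degree below \<open>m\<close> gives degree at most \<open>m+k-2\<close>, and \<open>r\<close>
  integrations add \<open>r\<close>, so \<open>m = n-r-k+1\<close> uses all of
  \<open>polys n\<close>, and \<open>n >= k+r\<close> says that \<open>m >= 1\<close>. The Jackson
  remainder cannot serve up to the endpoints: for fixed \<open>n\<close> and \<open>z\<close>
  tending to an endpoint, \<open>w(z)\<phi>(z)\<close> may tend to 0 while the column integral of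
  the remainder does not. Freezing the function there leaves a Hardy operator, whose columns are
  tails of the weight and do shrink. Negative exponents occur only in the Favard part. For finite
  \<open>p\<close> its rows are unweighted and \<open>w^p\<close> enters the columns alone, so the
  integrability of \<open>w^p\<close>, which is what \<open>J_p\<close> expresses, is enough.
  Averaging over \<open>h\<close> serves twice: a good step for the Whitney construction is found in
  the mean, and Fubini lets a Borel representative replace \<open>f^(r)\<close>, which is known only
  almost everywhere. A convex modular in place of the norm makes such averages harmless for every
  \<open>p\<close>.\<close>

abbreviation borel_functions ("\<B>") where "\<B> \<equiv> borel_measurable borel"

abbreviation jw where "jw \<equiv> jacobi_weight"

abbreviation open_interval ("\<I>") where "\<I> \<equiv> {-1<..<1::real}"

syntax
 "_lborel_nn" :: "pttrn \<Rightarrow> ennreal \<Rightarrow> ennreal" ("(2\<integral>_./ _)" [0, 10] 10)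
 "_lborel_set_nn" :: "pttrn \<Rightarrow> 'a set \<Rightarrow> ennreal \<Rightarrow> ennreal" ("(2\<integral>_\<in>_./ _)" [0, 51, 10] 10)
translations
 "\<integral>x. f" == "CONST nn_integral (CONST lborel) (\<lambda>x. f)"
 "\<integral>x\<in>A. f" == "CONST set_nn_integral (CONST lborel) A (\<lambda>x. f)"

section \<open>Differentiability and integration of absolutely continuous functions\<close>

lemma strict_mono_on_image_interval:
 fixes G :: "real => real"
 assumes "strict_mono_on {a<..<b} G" "{u..v} \<subseteq> {a<..<b}" "{u'..v'} \<subseteq> {a<..<b}"
  "u <= v" "u' <= v'" "{u..v} \<inter> {u'..v'} = {}"
 shows "{G u..G v} \<inter> {G u'..G v'} = {}"
proof -
 have "v < u' \<or> v' < u"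
 proof (rule ccontr)
  assume "\<not> ?thesis"
  then have "max u u' \<in> {u..v} \<inter> {u'..v'}" using assms(4,5) by auto
  then show False using assms(6) by blast
 qed
 then have "G v < G u' \<or> G v' < G u"
  using assms(1-5) unfolding strict_mono_on_def by (metis atLeastAtMost_iff order_refl subset_iff)
 then show ?thesis by auto
qed

text \<open>In the applications one of \<open>G\<close>, \<open>H\<close> is the identity; comparing two images avoids inverse functions.\<close>

lemma outer_measure_image_le:
 fixes G H :: "real => real" and p :: real
 assumes G: "strict_mono_on {a<..<b} G" and H: "strict_mono_on {a<..<b} H" and p: "p > 0"
  and A: "A \<subseteq> {a<..<b}"
  and cG: "\<And>x. x \<in> A ==> isCont G x" and cH: "\<And>x. x \<in> A ==> isCont H x"
  and sl: "\<And>x d. x \<in> A ==> d > 0 ==> \<exists>u v. u <= x \<and> x <= v \<and> u < v \<and> v - u < d \<and> a < u \<and> v < b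
       \<and> H v - H u < p * (G v - G u)"
 shows "outer_measure_of lebesgue (H ` A) <= ennreal p * outer_measure_of lebesgue (G ` A)"
proof (rule ennreal_le_epsilon)
 fix e :: real assume e: "0 < e"
 obtain E where E: "E \<in> sets lebesgue" "G ` A \<subseteq> E" "outer_measure_of lebesgue (G ` A) = emeasure lebesgue E"
  using outer_measure_of_attain[of "G ` A" lebesgue] by auto
 \<comment> \<open>The excess \<open>e / p\<close> becomes \<open>e\<close> after multiplication by
   \<open>p\<close>.\<close>
 obtain U where U: "open U" "E \<subseteq> U" "U - E \<in> lmeasurable" "emeasure lebesgue (U - E) < ennreal (e / p)"
  using sets_lebesgue_outer_open[OF E(1), of "e/p"] e p by (auto)
 have emU: "emeasure lebesgue U <= emeasure lebesgue E + ennreal (e / p)"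
 proof -
  have "emeasure lebesgue U <= emeasure lebesgue E + emeasure lebesgue (U - E)"
  proof -
   have "U = E \<union> (U - E)" using U(2) by auto
   moreover have "emeasure lebesgue (E \<union> (U - E)) = emeasure lebesgue E + emeasure lebesgue (U - E)"
    using E(1) U by (intro plus_emeasure[symmetric]) auto
   ultimately show ?thesis by simp
  qed
  then show ?thesis using U(4) by (meson add_left_mono less_imp_le order_trans)
 qed
 define K where "K = {(u,v). a < u \<and> u < v \<and> v < b \<and> {G u..G v} \<subseteq> U \<and> H v - H u < p * (G v - G u)}"
 have HK: "H (fst i) < H (snd i)" "G (fst i) < G (snd i)" if "i \<in> K" for i
  using that G H unfolding K_def strict_mono_on_def by auto
 let ?a = "\<lambda>i::real\<times>real. (H (fst i) + H (snd i)) / 2" and ?r = "\<lambda>i::real\<times>real. (H (snd i) - H (fst i)) / 2"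
 have cb: "cball (?a i) (?r i) = {H (fst i)..H (snd i)}" for i
  unfolding cball_eq_atLeastAtMost by (simp add: field_simps)
 have fine: "\<exists>i. i \<in> K \<and> y \<in> cball (?a i) (?r i) \<and> ?r i < d" if y: "y \<in> H ` A" and d: "0 < d" for y d
 proof -
  from y obtain x where x: "y = H x" "x \<in> A" by (rule imageE)
  note x = x(2,1)
  obtain r where r: "r > 0" "ball (G x) r \<subseteq> U" 
  proof -
   have "G x \<in> U" using U(2) E(2) x(1) by blast
   then show ?thesis using that U(1) open_contains_ball by blast
  qed
  obtain d1 where d1: "d1 > 0" "\<And>z. \<bar>z - x\<bar> < d1 ==> \<bar>G z - G x\<bar> < r"
   using cG[OF x(1)] r(1) unfolding continuous_at_eps_delta dist_real_def by blast
  obtain d2 where d2: "d2 > 0" "\<And>z. \<bar>z - x\<bar> < d2 ==> \<bar>H z - H x\<bar> < d"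
   using cH[OF x(1)] d unfolding continuous_at_eps_delta dist_real_def by blast
  obtain u v where uv: "u <= x" "x <= v" "u < v" "v - u < min d1 d2" "a < u" "v < b" "H v - H u < p * (G v - G u)"
   using sl[OF x(1), of "min d1 d2"] d1(1) d2(1) by auto
  have *: "\<bar>G u - G x\<bar> < r" "\<bar>G v - G x\<bar> < r" "\<bar>H u - H x\<bar> < d" "\<bar>H v - H x\<bar> < d"
   using uv d1(2) d2(2) by auto
  have "{G u..G v} \<subseteq> ball (G x) r" using * by (auto simp: dist_real_def)
  then have "(u,v) \<in> K" unfolding K_def using uv r(2) by auto
  moreover have "H u <= H x" "H x <= H v"
   using H uv A x(1) unfolding strict_mono_on_def
   by (metis greaterThanLessThan_iff less_eq_real_def order.strict_trans1 order.strict_trans2 subsetD)+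
  ultimately show ?thesis using * x(2) by (intro exI[of _ "(u,v)"]) (auto simp: cb[of "(u,v)", simplified])
 qed
 obtain C where C: "countable C" "C \<subseteq> K"
  "pairwise (\<lambda>i j. disjnt (cball (?a i) (?r i)) (cball (?a j) (?r j))) C"
  "negligible (H ` A - (\<Union>i \<in> C. cball (?a i) (?r i)))"
  by (rule Vitali_covering_theorem_cballs[of K ?r "H ` A" ?a]) (use HK fine in auto)
 let ?I = "\<lambda>F i. {F (fst i)..F (snd i)} :: real set"
 have disjH: "disjoint_family_on (?I H) C"
  using C(3) unfolding disjoint_family_on_def pairwise_def disjnt_def cb by auto
 \<comment> \<open>Disjointness passes from the \<open>H\<close>-images back to the intervals, since
   a common point would have its \<open>H\<close>-value in both images, and from there on to the
   \<open>G\<close>-images.\<close>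
 have disjG: "disjoint_family_on (?I G) C"
  unfolding disjoint_family_on_def
 proof (intro ballI impI)
  fix i j assume ij: "i \<in> C" "j \<in> C" "i ~= j"
  have K: "i \<in> K" "j \<in> K" using ij C(2) by auto
  have "?I H i \<inter> ?I H j = {}" using disjH ij unfolding disjoint_family_on_def by blast
  moreover have sub: "{fst i..snd i} \<subseteq> {a<..<b}" "{fst j..snd j} \<subseteq> {a<..<b}" using K unfolding K_def by auto
  moreover have "{fst i..snd i} \<inter> {fst j..snd j} = {}"
  proof (rule ccontr)
   assume "\<not> ?thesis"
   then obtain s where s: "s \<in> {fst i..snd i}" "s \<in> {fst j..snd j}" by blast
   have m: "mono_on {a<..<b} H" using H by (simp add: strict_mono_on_imp_mono_on)
   have "fst i \<in> {a<..<b}" "snd i \<in> {a<..<b}" "fst j \<in> {a<..<b}" "snd j \<in> {a<..<b}" "s \<in> {a<..<b}"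
    using K s unfolding K_def by auto
   then have "H s \<in> ?I H i" "H s \<in> ?I H j" using s m by (auto simp: mono_on_def)
   with \<open>?I H i \<inter> ?I H j = {}\<close> show False by blast
  qed
  ultimately show "?I G i \<inter> ?I G j = {}"
   using K by (intro strict_mono_on_image_interval[OF G]) (auto simp: K_def)
 qed
 let ?N = "H ` A - (\<Union>i \<in> C. ?I H i)"
 have N: "?N \<in> null_sets lebesgue" using C(4) unfolding cb by (simp add: negligible_iff_null_sets)
 have meas: "(\<Union>i\<in>C. ?I F i) \<in> sets lebesgue" for F :: "real => real"
  using C(1) by (intro sets.countable_UN') auto
 have "outer_measure_of lebesgue (H ` A) <= outer_measure_of lebesgue ((\<Union>i\<in>C. ?I H i) \<union> ?N)"
  by (rule outer_measure_of_mono) auto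
 also have "... = emeasure lebesgue ((\<Union>i\<in>C. ?I H i) \<union> ?N)" using N meas by (intro outer_measure_of_eq sets.Un) (auto dest: null_setsD2)
 also have "... = emeasure lebesgue (\<Union>i\<in>C. ?I H i)" by (rule emeasure_Un_null_set[OF meas N])
 also have "... = (\<integral>\<^sup>+i. emeasure lebesgue (?I H i) \<partial>count_space C)"
  using C(1) disjH by (intro emeasure_UN_countable) auto
 also have "... <= (\<integral>\<^sup>+i. ennreal p * emeasure lebesgue (?I G i) \<partial>count_space C)"
 proof (rule nn_integral_mono)
  fix i assume "i \<in> space (count_space C)"
  then have i: "i \<in> K" using C(2) by auto
  have "H (snd i) - H (fst i) <= p * (G (snd i) - G (fst i))" using i unfolding K_def by auto
  then show "emeasure lebesgue (?I H i) <= ennreal p * emeasure lebesgue (?I G i)"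
   using HK[OF i] p by (simp add: ennreal_mult[symmetric] less_imp_le)
 qed
 also have "... = ennreal p * (\<integral>\<^sup>+i. emeasure lebesgue (?I G i) \<partial>count_space C)"
  by (rule nn_integral_cmult) auto
 also have "... = ennreal p * emeasure lebesgue (\<Union>i\<in>C. ?I G i)"
  using C(1) disjG by (subst emeasure_UN_countable) auto
 also have "... <= ennreal p * (emeasure lebesgue E + ennreal (e / p))"
 proof (rule mult_left_mono)
  have "?I G i \<subseteq> U" if "i \<in> K" for i using that unfolding K_def by auto
  then have "(\<Union>i\<in>C. ?I G i) \<subseteq> U" using C(2) by blast
  then have "emeasure lebesgue (\<Union>i\<in>C. ?I G i) <= emeasure lebesgue U"
   by (rule emeasure_mono) (use U(1) in auto)
  then show "emeasure lebesgue (\<Union>i\<in>C. ?I G i) <= emeasure lebesgue E + ennreal (e / p)"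
   using emU by (rule order_trans)
 qed simp
 also have "... = ennreal p * outer_measure_of lebesgue (G ` A) + ennreal e"
  using p e E(3) by (simp add: distrib_left ennreal_mult[symmetric])
 finally show "outer_measure_of lebesgue (H ` A) <= ennreal p * outer_measure_of lebesgue (G ` A) + ennreal e" .
qed

lemma negligible_if_outer_measure_zero:
 fixes A :: "'a::euclidean_space set"
 assumes "outer_measure_of lebesgue A = 0" shows "negligible A"
proof -
 obtain E where E: "E \<in> sets lebesgue" "A \<subseteq> E" "outer_measure_of lebesgue A = emeasure lebesgue E"
  using outer_measure_of_attain[of A lebesgue] by auto
 have "negligible E" using E assms by (simp add: negligible_iff_null_sets null_sets_def)
 then show ?thesis using E(2) negligible_subset by blast
qed

text \<open>One end of the interval is \<open>x\<close> itself; for a point to the left of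
  \<open>x\<close> the difference quotient is unchanged when both differences change sign. The
  predicate \<open>P\<close> covers upper and lower slope bounds at once.\<close>

lemma slope_near:
 fixes H :: "real => real"
 assumes fr: "\<exists>\<^sub>F y in at x. P ((H y - H x) / (y - x))" and "d > 0" "x \<in> {a<..<b}"
 shows "\<exists>u v. u <= x \<and> x <= v \<and> u < v \<and> v - u < d \<and> a < u \<and> v < b \<and> P ((H v - H u) / (v - u))"
proof -
 have "\<forall>\<^sub>F y in at x. \<bar>y - x\<bar> < min d (min (x - a) (b - x)) \<and> y ~= x"
  using assms by (auto simp: eventually_at dist_real_def intro!: exI[of _ "min d (min (x - a) (b - x))"])
 then have "\<exists>\<^sub>F y in at x. P ((H y - H x) / (y - x)) \<and> \<bar>y - x\<bar> < min d (min (x - a) (b - x)) \<and> y ~= x"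
  using frequently_eventually_conj[OF fr, of "\<lambda>y. \<bar>y - x\<bar> < min d (min (x - a) (b - x)) \<and> y ~= x"]
  by (simp add: conj_ac)
 then obtain y where y: "P ((H y - H x) / (y - x))" "\<bar>y - x\<bar> < min d (min (x - a) (b - x))" "y ~= x"
  by (blast dest: frequently_ex)
 show ?thesis
 proof (cases "y < x")
  case True
  have "(H x - H y) / (x - y) = (H y - H x) / (y - x)" using y(3) by (simp add: field_simps)
  then show ?thesis using y True by (intro exI[of _ y] exI[of _ x]) auto
 next
  case False
  then show ?thesis using y by (intro exI[of _ x] exI[of _ y]) auto
 qed
qed

text \<open>Slopes of a monotone function are nonnegative, so the lower limit cannot be
  \<open>-\<infinity>\<close>. If the upper limit is finite, equality of the two limits would give a
  derivative, hence they differ. Rational separators keep the number of exceptional sets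
  countable.\<close>

lemma slope_dichotomy:
 fixes H :: "real => real"
 assumes mono: "mono_on {a<..<b} H" and x: "x \<in> {a<..<b}" and nd: "\<not> H differentiable at x"
 shows "(\<exists>p q. p \<in> \<rat> \<and> q \<in> \<rat> \<and> p < q \<and> (\<exists>\<^sub>F y in at x. (H y - H x) / (y - x) < p)
      \<and> (\<exists>\<^sub>F y in at x. (H y - H x) / (y - x) > q))
   \<or> (\<forall>q. \<exists>\<^sub>F y in at x. (H y - H x) / (y - x) > q)"
proof -
 define Q where "Q y = (H y - H x) / (y - x)" for y
 have nb: "at x ~= bot" by simp
 have Q0: "\<forall>\<^sub>F y in at x. 0 <= Q y"
 proof -
  have "\<forall>\<^sub>F y in at x. y \<in> {a<..<b} \<and> y ~= x"
   using x eventually_at_in_open'[of "{a<..<b}" x] eventually_neq_at_within[of x x UNIV] by (intro eventually_conj) auto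
  then show ?thesis
  proof eventually_elim
   case (elim y)
   then show ?case unfolding Q_def using mono x
    by (cases "y < x") (auto simp: mono_on_def divide_nonpos_neg)
  qed
 qed
 let ?i = "Liminf (at x) (\<lambda>y. ereal (Q y))" and ?s = "Limsup (at x) (\<lambda>y. ereal (Q y))"
 have i0: "0 <= ?i" by (rule Liminf_bounded) (use Q0 in \<open>simp add: eventually_mono\<close>)
 have le: "?i <= ?s" by (rule Liminf_le_Limsup) simp
 have freq_less: "\<exists>\<^sub>F y in at x. Q y < c" if "?i < ereal c" for c
 proof (rule ccontr)
  assume "\<not> ?thesis"
  then have "\<forall>\<^sub>F y in at x. ereal c <= ereal (Q y)" by (simp add: frequently_def not_less)
  then have "ereal c <= ?i" by (rule Liminf_bounded)
  with that show False by simp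
 qed
 have freq_gr: "\<exists>\<^sub>F y in at x. Q y > c" if "?s > ereal c" for c
 proof (rule ccontr)
  assume "\<not> ?thesis"
  then have "\<forall>\<^sub>F y in at x. ereal (Q y) <= ereal c" by (simp add: frequently_def not_less)
  then have "?s <= ereal c" by (rule Limsup_bounded)
  with that show False by simp
 qed
 show ?thesis
 proof (cases "?s = \<infinity>")
  case True
  then show ?thesis using freq_gr unfolding Q_def by simp
 next
  case False
  with i0 le obtain s where s: "?s = ereal s" by (cases "?s") auto
  obtain i where i: "?i = ereal i" using i0 le s by (cases "?i") auto
  have "?i ~= ?s"
  proof
   assume eq: "?i = ?s"
   have "((\<lambda>y. ereal (Q y)) \<longlongrightarrow> ereal s) (at x)"
    by (rule Liminf_eq_Limsup) (use eq s in auto)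
   then have "(Q \<longlongrightarrow> s) (at x)" by simp
   then have "(H has_real_derivative s) (at x)"
    unfolding has_field_derivative_iff Q_def .
   with nd show False by (simp add: real_differentiable_def)
  qed
  then have "i < s" using le i s by simp
  obtain q where q: "q \<in> \<rat>" "i < q" "q < s" using Rats_dense_in_real[OF \<open>i < s\<close>] by auto
  obtain p where p: "p \<in> \<rat>" "i < p" "p < q" using Rats_dense_in_real[OF q(2)] by auto
  show ?thesis using freq_less[of p] freq_gr[of q] i s p q unfolding Q_def by auto
 qed
qed

text \<open>Lebesgue's theorem. Where slopes fall below \<open>p\<close> and exceed
  \<open>q > p\<close>, the outer measure is at most \<open>p/q\<close> times itself; where slopes
  are unbounded, it is at most \<open>(H b - H a)/n\<close> for every \<open>n\<close>. Adding the
  identity makes the function strictly increasing, as the comparison of images requires, and does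
  not change where it is differentiable.\<close>

lemma mono_on_negligible_nondifferentiable:
 fixes g :: "real => real"
 assumes g: "mono_on {a..b} g"
 shows "negligible {x\<in>{a<..<b}. \<not> g differentiable at x}"
proof (cases "a < b")
 case False then show ?thesis by simp
next
 case True
 define H where "H x = g x + x" for x
 have Hs: "strict_mono_on {a..b} H" using g unfolding H_def strict_mono_on_def mono_on_def
  by (simp add: add_le_less_mono)
 have Hs': "strict_mono_on {a<..<b} H" using Hs unfolding strict_mono_on_def by auto
 have Hm: "mono_on {a<..<b} H" using Hs' by (simp add: strict_mono_on_imp_mono_on)
 have ids: "strict_mono_on {a<..<b} (\<lambda>x::real. x)" by (simp add: strict_mono_on_def)
 have diff: "g differentiable at x" if "H differentiable at x" for x
 proof -
  have "(\<lambda>x. H x - x) differentiable at x" using that by (intro differentiable_diff) auto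
  then show ?thesis unfolding H_def by simp
 qed
 define Dc where "Dc = {x\<in>{a<..<b}. \<not> isCont H x}"
 have "countable Dc" unfolding Dc_def
  using mono_on_ctble_discont_open[OF _ Hm] by simp
 then have Dcn: "negligible Dc" unfolding negligible_iff_null_sets by (intro null_sets_completionI countable_imp_null_set_lborel)
 define S where "S P = {x\<in>{a<..<b}. isCont H x \<and> (\<exists>\<^sub>F y in at x. P ((H y - H x) / (y - x)))}" for P
 have fin: "outer_measure_of lebesgue A < \<infinity>" if "A \<subseteq> {a<..<b}" for A
 proof -
  have "outer_measure_of lebesgue A <= emeasure lebesgue {a<..<b}"
   using outer_measure_of_mono[OF that, of lebesgue] by simp
  then show ?thesis using True by (simp add: ennreal_less_top order_le_less_trans)
 qed
 have up: "outer_measure_of lebesgue (H ` A) <= ennreal p * outer_measure_of lebesgue A"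
  if "A \<subseteq> S (\<lambda>s. s < p)" "0 < p" for A p
 proof -
  have "outer_measure_of lebesgue (H ` A) <= ennreal p * outer_measure_of lebesgue ((\<lambda>x. x) ` A)"
  proof (rule outer_measure_image_le[OF ids Hs' that(2)])
   note sub = that(1)
   fix x d :: real assume x: "x \<in> A" and d: "0 < d"
   obtain u v where "u <= x \<and> x <= v \<and> u < v \<and> v - u < d \<and> a < u \<and> v < b \<and> (H v - H u) / (v - u) < p"
    using slope_near[where P="\<lambda>s. s < p" and x=x and H=H and a=a and b=b, OF _ d] subsetD[OF sub x] unfolding S_def by blast
   then show "\<exists>u v. u <= x \<and> x <= v \<and> u < v \<and> v - u < d \<and> a < u \<and> v < b \<and> H v - H u < p * (v - u)"
    by (intro exI[of _ u] exI[of _ v]) (auto simp: field_simps)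
  qed (use that in \<open>auto simp: S_def\<close>)
  then show ?thesis by simp
 qed
 have lo: "outer_measure_of lebesgue A <= ennreal (1/q) * outer_measure_of lebesgue (H ` A)"
  if "A \<subseteq> S (\<lambda>s. s > q)" "0 < q" for A q
 proof -
  have "outer_measure_of lebesgue ((\<lambda>x. x) ` A) <= ennreal (1/q) * outer_measure_of lebesgue (H ` A)"
  proof (rule outer_measure_image_le[OF Hs' ids])
   note sub = that(1)
   fix x d :: real assume x: "x \<in> A" and d: "0 < d"
   obtain u v where "u <= x \<and> x <= v \<and> u < v \<and> v - u < d \<and> a < u \<and> v < b \<and> (H v - H u) / (v - u) > q"
    using slope_near[where P="\<lambda>s. s > q" and x=x and H=H and a=a and b=b, OF _ d] subsetD[OF sub x] unfolding S_def by blast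
   then show "\<exists>u v. u <= x \<and> x <= v \<and> u < v \<and> v - u < d \<and> a < u \<and> v < b \<and> v - u < 1 / q * (H v - H u)"
    using that(2) by (intro exI[of _ u] exI[of _ v]) (auto simp: field_simps)
  qed (use that in \<open>auto simp: S_def\<close>)
  then show ?thesis by simp
 qed
 have neg1: "negligible (S (\<lambda>s. s < p) \<inter> S (\<lambda>s. s > q))" if "0 < p" "p < q" for p q
 proof -
  let ?A = "S (\<lambda>s. s < p) \<inter> S (\<lambda>s. s > q)" 
  let ?m = "outer_measure_of lebesgue ?A"
  have "?m <= ennreal (1/q) * outer_measure_of lebesgue (H ` ?A)" using lo[of ?A q] that by auto
  also have "... <= ennreal (1/q) * (ennreal p * ?m)" using up[of ?A p] that by (intro mult_left_mono) auto
  also have "... = ennreal (p/q) * ?m" using that by (simp add: mult.assoc[symmetric] ennreal_mult[symmetric])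
  finally have *: "?m <= ennreal (p/q) * ?m" .
  have "?m < \<infinity>" by (rule fin) (auto simp: S_def)
  then obtain r where r: "?m = ennreal r" "r >= 0" by (cases ?m) auto
  have "r <= p/q * r" using * r that by (simp add: ennreal_mult[symmetric])
  moreover have "p/q * r < 1 * r" if "r > 0" using \<open>0 < p\<close> \<open>p < q\<close> that by (intro mult_strict_right_mono) auto
  ultimately have "r = 0" using r(2) by fastforce
  then show ?thesis using r by (intro negligible_if_outer_measure_zero) simp
 qed
 have neg2: "negligible (\<Inter>n::nat. S (\<lambda>s. s > real n))"
 proof -
  let ?A = "\<Inter>n::nat. S (\<lambda>s. s > real n)"
  let ?m = "outer_measure_of lebesgue ?A"
  have A: "?A \<subseteq> {a<..<b}" unfolding S_def by auto
  have "outer_measure_of lebesgue (H ` ?A) <= emeasure lebesgue {H a..H b}"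
  proof -
   have "H ` ?A \<subseteq> {H a..H b}"
   proof (rule image_subsetI)
    fix x assume "x \<in> ?A"
    then have "x \<in> {a<..<b}" using A by blast
    then show "H x \<in> {H a..H b}" using Hs True unfolding strict_mono_on_def by (auto intro!: less_imp_le)
   qed
   then have "outer_measure_of lebesgue (H ` ?A) <= outer_measure_of lebesgue {H a..H b}" by (rule outer_measure_of_mono)
   then show ?thesis by simp
  qed
  also have "... = ennreal (H b - H a)" using Hs True unfolding strict_mono_on_def by (simp add: less_imp_le)
  finally have hm: "outer_measure_of lebesgue (H ` ?A) <= ennreal (H b - H a)" .
  have Hba: "H b - H a > 0" using Hs True unfolding strict_mono_on_def by simp
  have "?m <= ennreal e" if e: "e > 0" for e
  proof -
   obtain n :: nat where n: "real n > (H b - H a) / e" using reals_Archimedean2 by blast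
   have n0: "real n > 0" using n e Hba by (meson divide_pos_pos order.strict_trans)
   have "?m <= ennreal (1/real n) * ennreal (H b - H a)"
   proof -
    have "?A \<subseteq> S (\<lambda>s. s > real n)" by blast
    from lo[OF this n0] show ?thesis by (rule order_trans) (rule mult_left_mono[OF hm zero_le])
   qed
   also have "... <= ennreal e" using n n0 e Hba by (auto simp: ennreal_mult[symmetric] field_simps)
   finally show ?thesis .
  qed
  then have "?m <= 0 + ennreal e" if "e > 0" for e using that by simp
  then have "?m <= 0" by (rule ennreal_le_epsilon)
  then show ?thesis by (intro negligible_if_outer_measure_zero) simp
 qed
 define I :: "(real \<times> real) set" where "I = {i \<in> \<rat> \<times> \<rat>. 0 < fst i \<and> fst i < snd i}"
 let ?T = "\<lambda>i. S (\<lambda>s. s < fst i) \<inter> S (\<lambda>s. s > snd i)"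
 let ?U = "\<Union>(?T ` I)"
 have "countable I"
 proof -
  have "I \<subseteq> \<rat> \<times> \<rat>" by (auto simp: I_def)
  moreover have "countable (\<rat> \<times> \<rat> :: (real \<times> real) set)" by (intro countable_SIGMA countable_rat)
  ultimately show ?thesis by (rule countable_subset)
 qed
 moreover have "negligible (?T i)" if "i \<in> I" for i
  using neg1[of "fst i" "snd i"] that by (simp add: I_def)
 ultimately have "negligible ?U"
  
 proof (intro negligible_countable_Union countable_image)
  fix T assume "T \<in> ?T ` I"
  then obtain i where "i \<in> I" "T = ?T i" by (rule imageE)
  then show "negligible T" using \<open>\<And>i. i \<in> I ==> negligible (?T i)\<close> by simp
 qed
 then have neg: "negligible (Dc \<union> ?U \<union> (\<Inter>n::nat. S (\<lambda>s. s > real n)))"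
  using Dcn neg2 by (intro negligible_Un)
 show ?thesis
 proof (rule negligible_subset[OF neg], rule subsetI)
  fix x assume "x \<in> {x \<in> {a<..<b}. \<not> g differentiable at x}"
  then have x: "x \<in> {a<..<b}" "\<not> H differentiable at x" using diff by auto
  show "x \<in> Dc \<union> ?U \<union> (\<Inter>n::nat. S (\<lambda>s. s > real n))"
  proof (cases "isCont H x")
   case False then show ?thesis using x by (simp add: Dc_def)
  next
   case c: True
   from slope_dichotomy[OF Hm x] show ?thesis
   proof
    assume "\<forall>q. \<exists>\<^sub>F y in at x. (H y - H x) / (y - x) > q"
    then show ?thesis using c x by (simp add: S_def)
   next
    assume "\<exists>p q. p \<in> \<rat> \<and> q \<in> \<rat> \<and> p < q \<and> (\<exists>\<^sub>F y in at x. (H y - H x) / (y - x) < p)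
      \<and> (\<exists>\<^sub>F y in at x. (H y - H x) / (y - x) > q)"
    then obtain p q where pq: "p \<in> \<rat>" "q \<in> \<rat>" "p < q" "\<exists>\<^sub>F y in at x. (H y - H x) / (y - x) < p"
      "\<exists>\<^sub>F y in at x. (H y - H x) / (y - x) > q" by blast
    \<comment> \<open>Some slope of \<open>H\<close> lies below \<open>p\<close>, and all slopes of
      \<open>H\<close> are positive; hence \<open>p > 0\<close>, as membership in \<open>I\<close>
      demands.\<close>
    have "\<exists>u v. u <= x \<and> x <= v \<and> u < v \<and> v - u < 1 \<and> a < u \<and> v < b \<and> (H v - H u) / (v - u) < p"
     by (rule slope_near[where P="\<lambda>s. s < p"]) (use pq x in auto)
    then obtain u v where "u < v" "a < u" "v < b" "(H v - H u) / (v - u) < p" by auto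
    moreover have "H u < H v" using Hs' \<open>u < v\<close> \<open>a < u\<close> \<open>v < b\<close> by (auto simp: strict_mono_on_def)
    moreover have "0 < (H v - H u) / (v - u)" using \<open>u < v\<close> \<open>H u < H v\<close> by simp
    ultimately have "0 < p" by linarith
    then have "(p, q) \<in> I" using pq by (simp add: I_def)
    moreover have "x \<in> ?T (p, q)" using pq x c by (simp add: S_def)
    ultimately have "x \<in> ?U" by blast
    then show ?thesis by blast
   qed
  qed
 qed
qed

section \<open>Absolute continuity and the fundamental theorem for the gauge integral\<close>

lemma sum_lengths_le:
 fixes u v :: "nat => real"
 assumes uv: "\<And>i. i < m ==> u i <= v i" and S: "\<And>i. i < m ==> {u i<..<v i} \<subseteq> S" "S \<in> lmeasurable"
  and disj: "disjoint_family_on (\<lambda>i. {u i<..<v i}) {..<m}"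
 shows "(\<Sum>i<m. v i - u i) <= measure lebesgue S"
proof -
 have "(\<Sum>i<m. v i - u i) = (\<Sum>i<m. measure lebesgue {u i<..<v i})"
  using uv by (intro sum.cong) auto
 also have "... = measure lebesgue (\<Union>i<m. {u i<..<v i})"
  using disj by (intro measure_finite_Union[symmetric]) (auto simp: uv)
 also have "... <= measure lebesgue S"
  using S by (intro measure_mono_fmeasurable) auto
 finally show ?thesis .
qed

text \<open>Jordan decomposition: \<open>V\<close> is the variation from \<open>c\<close> to
  \<open>x\<close>, finite by the uniform bound \<open>B\<close>. Both \<open>V\<close> and
  \<open>V - g\<close> are increasing, so Lebesgue's theorem applies to each, and \<open>g\<close>
  is their difference.\<close>

lemma AC_on_short_interval_nondifferentiable:
 fixes g :: "real => real"
 assumes bd: "\<And>m u v. (\<forall>i<(m::nat). c <= u i \<and> u i <= v i \<and> v i <= d) ==>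
   disjoint_family_on (\<lambda>i. {u i<..<v i}) {..<m} ==> (\<Sum>i<m. \<bar>g (v i) - g (u i)\<bar>) <= B"
 shows "negligible {x\<in>{c<..<d}. \<not> g differentiable at x}"
proof -
 define fam where "fam x m u v \<longleftrightarrow> (\<forall>i<(m::nat). c <= u i \<and> u i <= v i \<and> v i <= x) \<and>
   disjoint_family_on (\<lambda>i. {u i<..<v i}) {..<m}" for x :: real and m and u v :: "nat => real"
 define VS where "VS x = {s. \<exists>m u v. fam x m u v \<and> s = (\<Sum>i<m. \<bar>g (v i) - g (u i)\<bar>)}" for x
 define V where "V x = Sup (VS x)" for x
 have bdd: "bdd_above (VS x)" if "x <= d" for x
 proof (rule bdd_aboveI)
  fix s assume "s \<in> VS x"
  then obtain m u v where f: "fam x m u v" and seq: "s = (\<Sum>i<m. \<bar>g (v i) - g (u i)\<bar>)"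
   unfolding VS_def by blast
  have "\<forall>i<m. c <= u i \<and> u i <= v i \<and> v i <= d" using f that unfolding fam_def by fastforce
  then show "s <= B" unfolding seq using f by (intro bd) (simp_all add: fam_def)
 qed
 have ne: "VS x ~= {}" for x
 proof -
  have "fam x 0 (\<lambda>_. 0) (\<lambda>_. 0)" by (simp add: fam_def disjoint_family_on_def)
  then show ?thesis unfolding VS_def by blast
 qed
 have step: "V x + \<bar>g y - g x\<bar> <= V y" if xy: "c <= x" "x <= y" "y <= d" for x y
 proof -
  have "s <= V y - \<bar>g y - g x\<bar>" if s: "s \<in> VS x" for s
  proof -
   obtain m u v where f: "fam x m u v" and seq: "s = (\<Sum>i<m. \<bar>g (v i) - g (u i)\<bar>)"
    using s unfolding VS_def by blast
   have "fam y (Suc m) (u(m := x)) (v(m := y))"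
    using f xy unfolding fam_def disjoint_family_on_def
    by (auto simp: less_Suc_eq) fastforce?
   moreover have "s + \<bar>g y - g x\<bar> = (\<Sum>i<Suc m. \<bar>g ((v(m := y)) i) - g ((u(m := x)) i)\<bar>)"
    unfolding seq by simp
   ultimately have "s + \<bar>g y - g x\<bar> \<in> VS y" unfolding VS_def by blast
   then have "s + \<bar>g y - g x\<bar> <= V y" unfolding V_def by (rule cSup_upper[OF _ bdd[OF xy(3)]])
   then show ?thesis by simp
  qed
  then have "V x <= V y - \<bar>g y - g x\<bar>" unfolding V_def using ne by (intro cSup_least) auto
  then show ?thesis by simp
 qed
 have "mono_on {c..d} V" using step by (intro mono_onI) (smt (verit) atLeastAtMost_iff)
 then have n1: "negligible {x\<in>{c<..<d}. \<not> V differentiable at x}" by (rule mono_on_negligible_nondifferentiable)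
 have "mono_on {c..d} (\<lambda>x. V x - g x)" using step by (intro mono_onI) (smt (verit) atLeastAtMost_iff)
 then have n2: "negligible {x\<in>{c<..<d}. \<not> (\<lambda>x. V x - g x) differentiable at x}" by (rule mono_on_negligible_nondifferentiable)
 show ?thesis
 proof (rule negligible_subset[OF negligible_Un[OF n1 n2]], rule subsetI)
  fix x assume x: "x \<in> {x \<in> {c<..<d}. \<not> g differentiable at x}"
  have "g differentiable at x" if "V differentiable at x" "(\<lambda>x. V x - g x) differentiable at x"
   using differentiable_diff[OF that] by simp
  then show "x \<in> {x \<in> {c<..<d}. \<not> V differentiable at x} \<union> {x \<in> {c<..<d}. \<not> (\<lambda>x. V x - g x) differentiable at x}"
   using x by blast
 qed
qed

lemma AC_onD:
 assumes "AC_on a b g" "0 < e"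
 shows "\<exists>\<delta>>0. \<forall>m u v. (\<forall>i<(m::nat). a <= u i \<and> u i <= v i \<and> v i <= b) -->
   disjoint_family_on (\<lambda>i. {u i<..<v i}) {..<m} -->
   (\<Sum>i<m. v i - u i) < \<delta> --> (\<Sum>i<m. \<bar>g (v i) - g (u i)\<bar>) < e"
 using assms unfolding AC_on_def by simp

text \<open>Disjoint intervals inside an interval shorter than the \<open>\<delta>\<close> belonging
  to \<open>\<epsilon> = 1\<close> have total length below \<open>\<delta>\<close>, so the variation
  is locally at most 1; negligibility is a local property.\<close>

lemma AC_on_negligible_nondifferentiable:
 assumes "AC_on a b g"
 shows "negligible {x\<in>{a<..<b}. \<not> g differentiable at x}" (is "negligible ?S")
proof -
 obtain \<delta> where \<delta>: "\<delta> > 0" "\<And>m u v. (\<forall>i<(m::nat). a <= u i \<and> u i <= v i \<and> v i <= b) ==>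
   disjoint_family_on (\<lambda>i. {u i<..<v i}) {..<m} ==>
   (\<Sum>i<m. v i - u i) < \<delta> ==> (\<Sum>i<m. \<bar>g (v i) - g (u i)\<bar>) < 1"
  using AC_onD[OF assms zero_less_one] by blast
 show ?thesis
 proof (rule locally_negligible_alt[THEN iffD2], intro ballI)
  fix x assume x: "x \<in> ?S"
  define c where "c = max a (x - \<delta>/4)"
  define d where "d = min b (x + \<delta>/4)"
  have cd: "c < x" "x < d" "a <= c" "d <= b" "d - c < \<delta>" using x \<delta>(1) by (auto simp: c_def d_def)
  have "negligible {x\<in>{c<..<d}. \<not> g differentiable at x}"
  proof (rule AC_on_short_interval_nondifferentiable)
   fix m :: nat and u v :: "nat => real"
   assume uv: "\<forall>i<m. c <= u i \<and> u i <= v i \<and> v i <= d" and dj: "disjoint_family_on (\<lambda>i. {u i<..<v i}) {..<m}"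
   have "(\<Sum>i<m. v i - u i) <= measure lebesgue {c..d}"
    using uv dj by (intro sum_lengths_le) fastforce+
   also have "... < \<delta>" using cd by simp
   finally have "(\<Sum>i<m. v i - u i) < \<delta>" .
   moreover have "\<forall>i<m. a <= u i \<and> u i <= v i \<and> v i <= b" using uv cd by force
   ultimately show "(\<Sum>i<m. \<bar>g (v i) - g (u i)\<bar>) <= 1" using \<delta>(2) dj by (simp add: less_imp_le)
  qed
  then have "negligible (?S \<inter> {c<..<d})" by (rule negligible_subset) auto
  then show "\<exists>U. openin (top_of_set ?S) U \<and> x \<in> U \<and> negligible U"
   using x cd by (intro exI[of _ "?S \<inter> {c<..<d}"]) (auto intro: openin_open_Int)
 qed
qed

text \<open>Absolute continuity for families indexed by any finite set, here the tagged pieces of a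
  division, instead of an initial segment of the naturals.\<close>

lemma AC_on_finite_sum:
 assumes "finite T" and "\<And>K. K \<in> T ==> a <= l K \<and> l K <= r K \<and> r K <= b"
  and "\<And>K L. K \<in> T ==> L \<in> T ==> K ~= L ==> {l K<..<r K} \<inter> {l L<..<r L} = {}"
  and "\<And>K. K \<in> T ==> {l K<..<r K} \<subseteq> S" "S \<in> lmeasurable" "measure lebesgue S < \<delta>"
  and ac: "\<And>m u v. (\<forall>i<(m::nat). a <= u i \<and> u i <= v i \<and> v i <= b) ==>
   disjoint_family_on (\<lambda>i. {u i<..<v i}) {..<m} ==>
   (\<Sum>i<m. v i - u i) < \<delta> ==> (\<Sum>i<m. \<bar>g (v i) - g (u i)\<bar>) < (e::real)"
 shows "(\<Sum>K\<in>T. \<bar>g (r K) - g (l K)\<bar>) < e"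
proof -
 obtain h where h: "bij_betw h {..<card T} T" using ex_bij_betw_nat_finite[OF assms(1)] by (auto simp: atLeast0LessThan)
 have hT: "h i \<in> T" if "i < card T" for i using h that by (auto simp: bij_betw_def)
 have dj: "disjoint_family_on (\<lambda>i. {l (h i)<..<r (h i)}) {..<card T}"
  unfolding disjoint_family_on_def
 proof (intro ballI impI)
  fix i j assume "i \<in> {..<card T}" "j \<in> {..<card T}" "i ~= j"
  then show "{l (h i)<..<r (h i)} \<inter> {l (h j)<..<r (h j)} = {}"
   using h hT by (intro assms(3)) (auto simp: bij_betw_def inj_on_def)
 qed
 have "(\<Sum>i<card T. r (h i) - l (h i)) <= measure lebesgue S"
  using assms(2,4)[OF hT] by (intro sum_lengths_le dj assms(5)) auto
 then have "(\<Sum>i<card T. \<bar>g (r (h i)) - g (l (h i))\<bar>) < e"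
  using assms(6) assms(2)[OF hT] by (intro ac dj) auto
 then show ?thesis by (subst (asm) sum.reindex_bij_betw[OF h])
qed

text \<open>For a tag outside \<open>N\<close> the derivative bounds the error by \<open>e1\<close>
  times the length of the piece. For a tag in \<open>N\<close> the gauge forces the piece into an
  open set of measure below \<open>\<delta>\<close>, so absolute continuity bounds the total
  increment over all these pieces.\<close>

lemma AC_on_has_integral:
 assumes AC: "AC_on a b g" and ab: "a <= b" and N: "negligible N"
  and D: "\<And>x. x \<in> {a..b} - N ==> (g has_real_derivative D x) (at x)"
 shows "(D has_integral (g b - g a)) {a..b}"
proof -
 \<comment> \<open>With value 0 on \<open>N\<close>, a piece tagged in \<open>N\<close> contributes
   only its increment of \<open>g\<close>; changing the integrand on \<open>N\<close> restores
   \<open>D\<close> at the end.\<close>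
 define D' where "D' x = (if x \<in> N then 0 else D x)" for x
 have "(D' has_integral (g b - g a)) (cbox a b)"
  unfolding has_integral
 proof (intro allI impI)
  fix e :: real assume e: "e > 0"
  define e1 where "e1 = e / (2 * (b - a + 1))"
  have e1: "e1 > 0" "e1 * (b - a) < e / 2" using e ab by (auto simp: e1_def field_simps)
  obtain \<delta> where \<delta>: "\<delta> > 0" "\<And>m u v. (\<forall>i<(m::nat). a <= u i \<and> u i <= v i \<and> v i <= b) ==>
    disjoint_family_on (\<lambda>i. {u i<..<v i}) {..<m} ==>
    (\<Sum>i<m. v i - u i) < \<delta> ==> (\<Sum>i<m. \<bar>g (v i) - g (u i)\<bar>) < e/2"
   using AC_onD[OF AC half_gt_zero[OF e]] by blast
  obtain U where U: "open U" "N \<subseteq> U" "U \<in> lmeasurable" "measure lebesgue U < \<delta>"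
  proof -
   obtain T where T: "open T" "N \<subseteq> T" "T - N \<in> lmeasurable" "emeasure lebesgue (T - N) < ennreal \<delta>"
    using sets_lebesgue_outer_open[of N \<delta>] N \<delta>(1) negligible_imp_sets by blast
   have "T = (T - N) \<union> N" using T by auto
   then have "emeasure lebesgue T = emeasure lebesgue (T - N)"
    using emeasure_Un_null_set[of "T - N" lebesgue N] T(3) N by (auto simp: negligible_iff_null_sets)
   then have "emeasure lebesgue T < ennreal \<delta>" using T by simp
   moreover have "T \<in> lmeasurable" using calculation T(1) by (intro fmeasurableI) (auto elim!: order_less_trans)
   ultimately show ?thesis using that[of T] T \<delta>(1) by (simp add: emeasure_eq_measure2 ennreal_less_iff)
  qed
  have "\<exists>r>0. (x \<in> N --> ball x r \<subseteq> U) \<and>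
    (x \<in> {a..b} - N --> (\<forall>y. \<bar>y - x\<bar> < r --> \<bar>g y - g x - (y - x) * D x\<bar> <= e1 * \<bar>y - x\<bar>))" for x
  proof (cases "x \<in> N")
   case True then show ?thesis using U(1,2) by (meson DiffD2 open_contains_ball subsetD)
  next
   case False
   show ?thesis
   proof (cases "x \<in> {a..b}")
    case True
    have "(g has_derivative (\<lambda>h. h * D x)) (at x)" using D[of x] True False
     by (simp add: has_field_derivative_def mult.commute[of "D x"] mult_commute_abs)
    then obtain r where "r > 0" "\<forall>y. norm (y - x) < r --> norm (g y - g x - (y - x) * D x) <= e1 * norm (y - x)"
     unfolding has_derivative_at_alt using e1(1) by blast
    then show ?thesis using False by auto
   qed (use False zero_less_one in blast)
  qed
  then obtain \<rho> where \<rho>: "\<And>x. \<rho> x > 0" "\<And>x. x \<in> N ==> ball x (\<rho> x) \<subseteq> U"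
   "\<And>x y. x \<in> {a..b} - N ==> \<bar>y - x\<bar> < \<rho> x ==> \<bar>g y - g x - (y - x) * D x\<bar> <= e1 * \<bar>y - x\<bar>"
   by metis
  show "\<exists>\<gamma>. gauge \<gamma> \<and> (\<forall>\<D>. \<D> tagged_division_of cbox a b \<and> \<gamma> fine \<D> -->
       norm ((\<Sum>(x, k)\<in>\<D>. measure lborel k *\<^sub>R D' x) - (g b - g a)) < e)"
  proof (intro exI conjI allI impI)
   show "gauge (\<lambda>x. ball x (\<rho> x))" using \<rho>(1) gauge_ball_dependent by blast
   fix \<D> assume as: "\<D> tagged_division_of cbox a b \<and> (\<lambda>x. ball x (\<rho> x)) fine \<D>"
   then have td: "\<D> tagged_division_of {a..b}" and fn: "(\<lambda>x. ball x (\<rho> x)) fine \<D>" by auto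
   have fin: "finite \<D>" using td by auto
   have K: "\<exists>u v. K = {u..v} \<and> u <= x \<and> x <= v \<and> a <= u \<and> v <= b \<and> {u..v} \<subseteq> ball x (\<rho> x)" if "(x,K) \<in> \<D>" for x K
   proof -
    have "x \<in> K" "K \<subseteq> {a..b}" "\<exists>u v. K = cbox u v" using tagged_division_ofD[OF td] that by blast+
    moreover have "K \<subseteq> ball x (\<rho> x)" using fn that by (auto simp: fine_def)
    ultimately show ?thesis by (auto; metis atLeastAtMost_iff order_refl order_trans atLeastatMost_subset_iff)
   qed
   have KI: "Inf K <= x" "x <= Sup K" "a <= Inf K" "Sup K <= b" "K = {Inf K..Sup K}" "{Inf K..Sup K} \<subseteq> ball x (\<rho> x)"
     "measure lborel K = Sup K - Inf K" if "(x,K) \<in> \<D>" for x K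
    using K[OF that] by auto
   let ?T = "{(x,K)\<in>\<D>. x \<in> N}" and ?R = "{(x,K)\<in>\<D>. x \<notin> N}"
   have sp: "\<D> = ?T \<union> ?R" "?T \<inter> ?R = {}" by auto
   have finT: "finite ?T" "finite ?R" by (rule finite_subset[OF _ fin], auto)+
   have gb: "g b - g a = (\<Sum>(x,K)\<in>\<D>. g (Sup K) - g (Inf K))" "b - a = (\<Sum>(x,K)\<in>\<D>. Sup K - Inf K)"
    using additive_tagged_division_1[OF ab td, of g] additive_tagged_division_1[OF ab td, of "\<lambda>x. x"] by auto
   have "(\<Sum>(x, k)\<in>\<D>. measure lborel k *\<^sub>R D' x) - (g b - g a) = (\<Sum>(x,K)\<in>\<D>. measure lborel K *\<^sub>R D' x - (g (Sup K) - g (Inf K)))"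
    unfolding gb by (simp add: sum_subtractf split_def)
   then have "\<bar>(\<Sum>(x, k)\<in>\<D>. measure lborel k *\<^sub>R D' x) - (g b - g a)\<bar> <= (\<Sum>(x,K)\<in>\<D>. \<bar>measure lborel K *\<^sub>R D' x - (g (Sup K) - g (Inf K))\<bar>)"
    by (simp add: split_def sum_abs)
   also have "... = (\<Sum>(x,K)\<in>?T. \<bar>measure lborel K *\<^sub>R D' x - (g (Sup K) - g (Inf K))\<bar>) + (\<Sum>(x,K)\<in>?R. \<bar>measure lborel K *\<^sub>R D' x - (g (Sup K) - g (Inf K))\<bar>)"
    by (subst sp(1), rule sum.union_disjoint[OF finT sp(2)])
   also have "... < e/2 + e/2"
   proof (rule add_less_le_mono)
    have "(\<Sum>i\<in>?T. \<bar>g (Sup (snd i)) - g (Inf (snd i))\<bar>) < e/2"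
    proof (rule AC_on_finite_sum[where a=a and b=b and S=U and \<delta>=\<delta> and l="\<lambda>i. Inf (snd i)" and r="\<lambda>i. Sup (snd i)"])
     fix i j assume ij: "i \<in> ?T" "j \<in> ?T" "i ~= j"
     obtain x1 K1 x2 K2 where e: "i = (x1,K1)" "j = (x2,K2)" by (cases i, cases j) auto
     have "interior K1 \<inter> interior K2 = {}" using tagged_division_ofD(5)[OF td, of x1 K1 x2 K2] ij e by auto
     then show "{Inf (snd i)<..<Sup (snd i)} \<inter> {Inf (snd j)<..<Sup (snd j)} = {}"
      using KI(5)[of x1 K1] KI(5)[of x2 K2] ij e interior_atLeastAtMost_real by (metis (no_types, lifting) mem_Collect_eq case_prodD snd_conv)
    next
     fix i assume i: "i \<in> ?T"
     obtain x K where e: "i = (x,K)" "(x,K) \<in> \<D>" "x \<in> N" using i by auto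
     have "{Inf K<..<Sup K} \<subseteq> {Inf K..Sup K}" by auto
     then show "{Inf (snd i)<..<Sup (snd i)} \<subseteq> U" using KI(6)[OF e(2)] \<rho>(2)[OF e(3)] e(1) by simp
     show "a <= Inf (snd i) \<and> Inf (snd i) <= Sup (snd i) \<and> Sup (snd i) <= b" using KI[OF e(2)] e(1) by auto
    qed (rule finT(1) U(3,4) \<delta>(2); assumption)+
    moreover have "(\<Sum>(x,K)\<in>?T. \<bar>measure lborel K *\<^sub>R D' x - (g (Sup K) - g (Inf K))\<bar>) = (\<Sum>i\<in>?T. \<bar>g (Sup (snd i)) - g (Inf (snd i))\<bar>)"
     by (intro sum.cong) (auto simp: D'_def)
    ultimately show "(\<Sum>(x,K)\<in>?T. \<bar>measure lborel K *\<^sub>R D' x - (g (Sup K) - g (Inf K))\<bar>) < e/2" by simp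
   next
    have "(\<Sum>(x,K)\<in>?R. \<bar>measure lborel K *\<^sub>R D' x - (g (Sup K) - g (Inf K))\<bar>) <= (\<Sum>(x,K)\<in>?R. e1 * (Sup K - Inf K))"
    proof (intro sum_mono, clarify)
     fix x K assume xK: "(x,K) \<in> \<D>" "x \<notin> N"
     note k = KI[OF xK(1)]
     have x: "x \<in> {a..b} - N" using k xK by auto
     have "\<bar>Inf K - x\<bar> < \<rho> x" "\<bar>Sup K - x\<bar> < \<rho> x" 
      using k(1,2) subsetD[OF k(6), of "Inf K"] subsetD[OF k(6), of "Sup K"] by (auto simp: dist_real_def)
     then have "\<bar>g (Inf K) - g x - (Inf K - x) * D x\<bar> <= e1 * \<bar>Inf K - x\<bar>" "\<bar>g (Sup K) - g x - (Sup K - x) * D x\<bar> <= e1 * \<bar>Sup K - x\<bar>"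
      using \<rho>(3)[OF x] by auto
     moreover have "measure lborel K *\<^sub>R D' x - (g (Sup K) - g (Inf K)) = (g (Inf K) - g x - (Inf K - x) * D x) - (g (Sup K) - g x - (Sup K - x) * D x)"
      unfolding k(7) using xK(2) by (simp add: D'_def algebra_simps)
     moreover have "e1 * \<bar>Inf K - x\<bar> + e1 * \<bar>Sup K - x\<bar> = e1 * (Sup K - Inf K)" using k(1,2) by (simp add: algebra_simps)
     ultimately show "\<bar>measure lborel K *\<^sub>R D' x - (g (Sup K) - g (Inf K))\<bar> <= e1 * (Sup K - Inf K)" by linarith
    qed
    also have "... <= (\<Sum>(x,K)\<in>\<D>. e1 * (Sup K - Inf K))"
    proof (rule sum_mono2[OF fin])
     fix i assume "i \<in> \<D> - ?R"
     then obtain x K where "i = (x,K)" "(x,K) \<in> \<D>" by (cases i) auto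
     then show "0 <= (case i of (x,K) => e1 * (Sup K - Inf K))"
      using KI(1,2)[of x K] e1(1) by simp
    qed auto
    also have "... = e1 * (b - a)" unfolding gb(2) by (simp add: sum_distrib_left split_def)
    also have "... <= e/2" using e1(2) by simp
    finally show "(\<Sum>(x,K)\<in>?R. \<bar>measure lborel K *\<^sub>R D' x - (g (Sup K) - g (Inf K))\<bar>) <= e/2" .
   qed
   finally show "norm ((\<Sum>(x, k)\<in>\<D>. measure lborel k *\<^sub>R D' x) - (g b - g a)) < e" by simp
  qed
 qed
 then have "(D' has_integral (g b - g a)) {a..b}" by simp
 then show ?thesis by (rule has_integral_spike[OF N, rotated]) (simp add: D'_def)
qed

theorem AC_loc_has_integral_deriv:
 assumes "g \<in> AC_loc" "-1 < a" "a <= b" "b < 1"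
 shows "(deriv g has_integral (g b - g a)) {a..b}"
proof -
 \<comment> \<open>The larger interval makes \<open>a\<close> and \<open>b\<close> interior points,
   so that a possible failure of differentiability there is also covered by the negligible
   set.\<close>
 define a' where "a' = (a - 1) / 2"
 define b' where "b' = (b + 1) / 2"
 have ab: "-1 < a'" "a' < a" "b < b'" "b' < 1" "a' <= b'" using assms by (auto simp: a'_def b'_def)
 have 1: "AC_on a b g" and 2: "AC_on a' b' g" using assms ab unfolding AC_loc_def by auto
 show ?thesis
  by (rule AC_on_has_integral[OF 1 \<open>a <= b\<close> AC_on_negligible_nondifferentiable[OF 2]])
   (use ab in \<open>auto simp: DERIV_deriv_iff_real_differentiable\<close>)
qed

section \<open>Weighted norms as modulars\<close>

text \<open>The Young function of \<open>L_p\<close>. For \<open>p = \<infinity>\<close> it is the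
  indicator of \<open>[0,1]\<close> in the sense of convex analysis.\<close>

definition Phi :: "ennreal => ennreal => ennreal" where
 "Phi p x = (if p = \<infinity> then (if x <= 1 then 0 else \<infinity>)
  else if x = \<infinity> then \<infinity> else ennreal (enn2real x powr enn2real p))"

text \<open>A pair \<open>(a,b)\<close> stands for the affine minorant \<open>a*x - b\<close> of
  \<open>Phi\<close>: the tangent at \<open>c\<close> for finite \<open>p\<close>, a line of slope
  \<open>n\<close> through \<open>(1,0)\<close> for \<open>p = \<infinity>\<close>. Since
  subtraction truncates in \<open>ennreal\<close>, \<open>b\<close> is always kept on the other
  side.\<close>

definition Phi_lines :: "ennreal => (ennreal \<times> ennreal) set" where
 "Phi_lines p = (if p = \<infinity> then range (\<lambda>n::nat. (of_nat n, of_nat n))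
  else {(ennreal (enn2real p * c powr (enn2real p - 1)), ennreal ((enn2real p - 1) * c powr enn2real p)) | c. 0 < c})"

lemma enn2real_ge1: "1 <= p ==> p ~= \<infinity> ==> 1 <= enn2real p"
 by (cases p) auto

text \<open>The tangent line inequality for the power \<open>q\<close> at \<open>c\<close>, from the
  weighted inequality between geometric and arithmetic mean.\<close>

lemma Youngs_power:
 fixes r c q :: real
 assumes "1 <= q" "0 <= r" "0 < c"
 shows "q * c powr (q - 1) * r <= r powr q + (q - 1) * c powr q"
proof (cases "r = 0")
 case True then show ?thesis using assms by simp
next
 case False
 then have r: "0 < r" using assms by simp
 have "(r powr q) powr (1/q) * (c powr q) powr (1 - 1/q) <= (1/q) * r powr q + (1 - 1/q) * c powr q"
  using assms r by (intro Youngs_inequality_0) auto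
 moreover have "(r powr q) powr (1/q) = r" using assms r by (simp add: powr_powr)
 moreover have "(c powr q) powr (1 - 1/q) = c powr (q - 1)" using assms by (simp add: powr_powr algebra_simps)
 ultimately have "r * c powr (q - 1) <= (1/q) * r powr q + (1 - 1/q) * c powr q" by simp
 then have "q * (r * c powr (q - 1)) <= q * ((1/q) * r powr q + (1 - 1/q) * c powr q)"
  using assms by (intro mult_left_mono) auto
 then show ?thesis using assms by (simp add: algebra_simps)
qed

lemma Phi_line_le:
 assumes p: "1 <= p" and ab: "(a,b) \<in> Phi_lines p"
 shows "a * x <= Phi p x + b"
proof (cases "p = \<infinity>")
 case True
 then obtain n :: nat where n: "a = of_nat n" "b = of_nat n" using ab by (auto simp: Phi_lines_def)
 show ?thesis
 proof (cases "x <= 1")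
  case t: True
  have "of_nat n * x <= of_nat n * 1" using t by (rule mult_left_mono) simp
  then show ?thesis using n by (simp add: add_increasing)
 qed (use True in \<open>simp add: Phi_def\<close>)
next
 case False
 define q where "q = enn2real p"
 have q: "1 <= q" using enn2real_ge1 p False by (simp add: q_def)
 obtain c where c: "c > 0" "a = ennreal (q * c powr (q - 1))" "b = ennreal ((q - 1) * c powr q)"
  using ab False by (auto simp: Phi_lines_def q_def)
 show ?thesis
 proof (cases x)
  case (real r)
  have "a * x = ennreal (q * c powr (q - 1) * r)" using real c q by (simp add: ennreal_mult)
  also have "... <= ennreal (r powr q + (q - 1) * c powr q)"
   using Youngs_power[OF q real(1) c(1)] by (rule ennreal_leI)
  also have "... = Phi p x + b" using real c q False by (simp add: Phi_def q_def)
  finally show ?thesis .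
 qed (use False in \<open>simp add: Phi_def\<close>)
qed

text \<open>\<open>Phi\<close> is the supremum of its lines, so convexity arguments reduce to affine
  functions. For finite \<open>p\<close> the tangent at a positive finite \<open>x\<close> already
  attains the value; for \<open>p = \<infinity>\<close> and \<open>x > 1\<close> the slopes
  \<open>n\<close> tend to infinity.\<close>

lemma Phi_leI:
 assumes p: "1 <= p" and le: "\<And>a b. (a,b) \<in> Phi_lines p ==> a * x <= y + b"
 shows "Phi p x <= y"
proof (cases "p = \<infinity>")
 case True
 show ?thesis
 proof (cases "x <= 1 \<or> y = \<infinity>")
  case False
  then have xy: "x > 1" "y ~= \<infinity>" by auto
  obtain s where s: "y = ennreal s" "s >= 0" using xy(2) by (cases y) auto
  obtain r :: real where r: "1 < r" "ennreal r <= x"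
  proof (cases x)
   case (real r) then show ?thesis using that[of r] xy(1) by (auto simp flip: ennreal_1 simp: ennreal_less_iff)
  next
   case top then show ?thesis using that[of 2] by simp
  qed
  obtain n :: nat where n: "real n > s / (r - 1)" using reals_Archimedean2 by blast
  have "of_nat n * ennreal r <= of_nat n * x" using r(2) by (rule mult_left_mono) simp
  also have "... <= y + of_nat n" using le True by (simp add: Phi_lines_def)
  finally have "ennreal (real n * r) <= ennreal (s + real n)"
   using s r by (simp add: ennreal_of_nat_eq_real_of_nat ennreal_mult)
  then have "real n * r <= s + real n" using s by (subst (asm) ennreal_le_iff) auto
  moreover have "real n * (r - 1) > s" using n r by (simp add: field_simps)
  ultimately show ?thesis by (simp add: algebra_simps)
 qed (use True in \<open>auto simp: Phi_def\<close>)
next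
 case False
 define q where "q = enn2real p"
 have q: "1 <= q" using enn2real_ge1 p False by (simp add: q_def)
 have le': "ennreal (q * c powr (q - 1)) * x <= y + ennreal ((q - 1) * c powr q)" if "c > 0" for c
  using le that False by (auto simp: Phi_lines_def q_def)
 show ?thesis
 proof (cases x)
  case (real r)
  show ?thesis
  proof (cases "r = 0 \<or> y = \<infinity>")
   case False
   then have r: "r > 0" using real by simp
   obtain s where s: "y = ennreal s" "s >= 0" using False by (cases y) auto
   have "ennreal (q * r powr (q - 1) * r) <= ennreal (s + (q - 1) * r powr q)"
    using le'[OF r] s real q by (simp add: ennreal_mult)
   then have "q * r powr (q - 1) * r <= s + (q - 1) * r powr q" using s q by (subst (asm) ennreal_le_iff) auto
   moreover have "r powr (q - 1) * r = r powr q" using r by (simp add: powr_diff)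
   ultimately have "r powr q <= s" by (simp add: algebra_simps mult.assoc) 
   then show ?thesis using real s \<open>p ~= \<infinity>\<close> by (simp add: Phi_def q_def ennreal_leI)
  qed (use real \<open>p ~= \<infinity>\<close> q in \<open>auto simp: Phi_def q_def\<close>)
 next
  case top
  have "y + ennreal (q - 1) = \<infinity>" using le'[of 1] top q by (simp add: top_unique ennreal_mult_top)
  then show ?thesis by simp
 qed
qed

lemma Phi_mono: assumes "1 <= p" "x <= y" shows "Phi p x <= Phi p y"
proof (rule Phi_leI[OF assms(1)])
 fix a b assume "(a,b) \<in> Phi_lines p"
 then have "a * y <= Phi p y + b" by (rule Phi_line_le[OF assms(1)])
 then show "a * x <= Phi p y + b" using mult_left_mono[OF assms(2), of a] by (meson order_trans zero_le)
qed

lemma Phi_0 [simp]: "Phi p 0 = 0"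
 by (simp add: Phi_def)

lemma Phi_measurable [measurable]: "Phi p \<in> \<B>"
 unfolding Phi_def by measurable

lemma Phi_convex2:
 assumes p: "1 <= p" and st: "s + t <= 1"
 shows "Phi p (s * x + t * y) <= s * Phi p x + t * Phi p y"
proof (rule Phi_leI[OF p])
 fix a b assume ab: "(a,b) \<in> Phi_lines p"
 have "a * (s * x + t * y) = s * (a * x) + t * (a * y)" by (simp add: algebra_simps)
 also have "... <= s * (Phi p x + b) + t * (Phi p y + b)"
  using Phi_line_le[OF p ab] by (intro add_mono mult_left_mono) auto
 also have "... = s * Phi p x + t * Phi p y + (s + t) * b" by (simp add: algebra_simps)
 also have "... <= s * Phi p x + t * Phi p y + 1 * b" using st by (intro add_left_mono mult_right_mono) auto
 finally show "a * (s * x + t * y) <= s * Phi p x + t * Phi p y + b" by simp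
qed

lemma Phi_scale: "1 <= p ==> t <= 1 ==> Phi p (t * x) <= t * Phi p x"
 using Phi_convex2[of p t 0 x 0] by simp

text \<open>Jensen's inequality for total mass at most 1: each line passes through the integral by
  linearity, and missing mass only helps because every line has \<open>b >= 0\<close>.\<close>

lemma Phi_nn_integral:
 assumes p: "1 <= p" and [measurable]: "k \<in> borel_measurable M" "u \<in> borel_measurable M" and k: "(\<integral>\<^sup>+y. k y \<partial>M) <= 1"
 shows "Phi p (\<integral>\<^sup>+y. k y * u y \<partial>M) <= (\<integral>\<^sup>+y. k y * Phi p (u y) \<partial>M)"
proof (rule Phi_leI[OF p])
 fix a b assume ab: "(a,b) \<in> Phi_lines p"
 have "a * (\<integral>\<^sup>+y. k y * u y \<partial>M) = (\<integral>\<^sup>+y. k y * (a * u y) \<partial>M)"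
  by (subst nn_integral_cmult[symmetric]) (auto simp: mult_ac)
 also have "... <= (\<integral>\<^sup>+y. k y * (Phi p (u y) + b) \<partial>M)"
  using Phi_line_le[OF p ab] by (intro nn_integral_mono mult_left_mono) auto
 also have "... = (\<integral>\<^sup>+y. k y * Phi p (u y) \<partial>M) + (\<integral>\<^sup>+y. k y \<partial>M) * b"
  by (simp add: distrib_left nn_integral_add nn_integral_multc)
 also have "... <= (\<integral>\<^sup>+y. k y * Phi p (u y) \<partial>M) + 1 * b"
  using k by (intro add_left_mono mult_right_mono) auto
 finally show "a * (\<integral>\<^sup>+y. k y * u y \<partial>M) <= (\<integral>\<^sup>+y. k y * Phi p (u y) \<partial>M) + b" by simp
qed

text \<open>\<open>Lp_le p u c\<close> means \<open>\<parallel>u\<parallel>\<^sub>p \<le> c\<close> on \<open>(-1,1)\<close>; this modular form treats \<open>p = \<infinity>\<close> like finite \<open>p\<close>.\<close>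

definition Lp_le :: "ennreal => (real => ennreal) => real => bool" where
 "Lp_le p u c \<longleftrightarrow> (\<integral>x\<in>\<I>. Phi p (u x / ennreal c)) <= 1"

lemma divide_ennreal_mult: "c > 0 ==> x / ennreal c = ennreal (1 / c) * x"
 by (simp add: divide_ennreal_def inverse_ennreal mult.commute divide_inverse)

lemma divide_mono_ennreal:
 assumes "x <= y" "0 < c" "c <= d" shows "x / ennreal d <= y / ennreal c"
 using assms by (simp add: divide_ennreal_mult mult_mono ennreal_leI frac_le)

lemma Lp_le_mono_AE:
 assumes "1 <= p" "Lp_le p v c" "c > 0" "c <= d" "AE x in lborel. x \<in> \<I> --> u x <= v x"
 shows "Lp_le p u d"
proof -
 have "(\<integral>x\<in>\<I>. Phi p (u x / ennreal d)) <= (\<integral>x\<in>\<I>. Phi p (v x / ennreal c))"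
  by (rule nn_integral_mono_AE, use assms(5) in eventually_elim)
   (use assms in \<open>auto simp: indicator_def intro!: Phi_mono divide_mono_ennreal ennreal_leI\<close>)
 then show ?thesis using assms(2) unfolding Lp_le_def by (rule order_trans)
qed

lemma Lp_le_mono:
 assumes "1 <= p" "Lp_le p v c" "c > 0" "c <= d" "\<And>x. x \<in> \<I> ==> u x <= v x"
 shows "Lp_le p u d"
 using assms by (intro Lp_le_mono_AE[of p v c d u]) auto

text \<open>Minkowski's inequality, from convexity with the weights \<open>c/(c+d)\<close> and
  \<open>d/(c+d)\<close>.\<close>

lemma Lp_le_add:
 assumes p: "1 <= p" and u: "Lp_le p u c" "c > 0" and v: "Lp_le p v d" "d > 0"
  and [measurable]: "u \<in> \<B>" "v \<in> \<B>"
 shows "Lp_le p (\<lambda>x. u x + v x) (c + d)"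
proof -
 let ?s = "ennreal (c / (c + d))" and ?t = "ennreal (d / (c + d))"
 have st: "?s + ?t = 1" using u v by (simp add: ennreal_plus[symmetric] add_divide_distrib[symmetric] del: ennreal_plus)
 have e: "(u x + v x) / ennreal (c + d) = ?s * (u x / ennreal c) + ?t * (v x / ennreal d)" for x
  using u v by (simp add: divide_ennreal_mult distrib_left mult.assoc[symmetric] ennreal_mult[symmetric] add_pos_pos
   del: ennreal_plus)
 have "(\<integral>x\<in>\<I>. Phi p ((u x + v x) / ennreal (c + d)))
   <= (\<integral>x. ?s * (Phi p (u x / ennreal c) * indicator \<I> x) + ?t * (Phi p (v x / ennreal d) * indicator \<I> x))"
  unfolding e using Phi_convex2[OF p] st
  by (intro nn_integral_mono) (auto simp: indicator_def)
 also have "... = ?s * (\<integral>x\<in>\<I>. Phi p (u x / ennreal c)) + ?t * (\<integral>x\<in>\<I>. Phi p (v x / ennreal d))"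
  by (subst nn_integral_add) (auto simp: nn_integral_cmult)
 also have "... <= ?s * 1 + ?t * 1"
  using u v unfolding Lp_le_def by (intro add_mono mult_left_mono) auto
 finally show ?thesis using st by (simp add: Lp_le_def)
qed

lemma Lp_le_cmult:
 assumes "Lp_le p u c" "c > 0" "a > 0"
 shows "Lp_le p (\<lambda>x. ennreal a * u x) (a * c)"
proof -
 have "ennreal a * u x / ennreal (a * c) = u x / ennreal c" for x
  using assms by (simp add: divide_ennreal_mult mult.assoc[symmetric] ennreal_mult[symmetric])
 then show ?thesis using assms by (simp add: Lp_le_def)
qed

text \<open>Schur's test: Jensen in \<open>y\<close> uses the rows, and after Fubini the columns
  remain.\<close>

lemma Lp_le_kernel:
 fixes K :: "real => real => ennreal"
 assumes p: "1 <= p" and A: "A > 0" and u: "Lp_le p u c" "c > 0"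
  and [measurable]: "u \<in> \<B>" "case_prod K \<in> borel_measurable (borel \<Otimes>\<^sub>M borel)"
  and K1: "\<And>x. x \<in> \<I> ==> (\<integral>y\<in>\<I>. K x y) <= ennreal A"
  and K2: "\<And>y. y \<in> \<I> ==> (\<integral>x\<in>\<I>. K x y) <= ennreal A"
 shows "Lp_le p (\<lambda>x. \<integral>\<^sup>+y\<in>\<I>. K x y * u y \<partial>lborel) (A * c)"
proof -
 let ?i = "indicator \<I> :: real => ennreal"
 let ?k = "\<lambda>x y. ennreal (1/A) * (K x y * ?i y)"
 have [measurable]: "(\<lambda>y. K x y) \<in> \<B>" for x by measurable
 have e: "(\<integral>y\<in>\<I>. K x y * u y) / ennreal (A * c) = (\<integral>y. ?k x y * (u y / ennreal c))" for x
 proof -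
  have "(\<integral>y\<in>\<I>. K x y * u y) / ennreal (A * c) = (\<integral>y. ennreal (1/(A*c)) * (K x y * u y * ?i y))"
   using A u by (simp add: divide_ennreal_mult nn_integral_cmult)
  also have "... = (\<integral>y. ?k x y * (u y / ennreal c))"
  proof (rule nn_integral_cong)
   fix y
   have "ennreal (1 / (A * c)) = ennreal (1/A) * ennreal (1/c)" using A u by (simp add: ennreal_mult[symmetric])
   then show "ennreal (1/(A*c)) * (K x y * u y * ?i y) = ?k x y * (u y / ennreal c)"
    using u by (simp add: divide_ennreal_mult mult_ac)
  qed
  finally show ?thesis .
 qed
 have one: "ennreal (1/A) * ennreal A = 1" using A by (simp add: ennreal_mult[symmetric])
 have "(\<integral>x\<in>\<I>. Phi p ((\<integral>y\<in>\<I>. K x y * u y) / ennreal (A * c)))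
   <= (\<integral>x\<in>\<I>. (\<integral>y. ?k x y * Phi p (u y / ennreal c)))"
 proof (rule nn_integral_mono)
  fix x :: real
  have "Phi p ((\<integral>y\<in>\<I>. K x y * u y) / ennreal (A * c)) <= (\<integral>y. ?k x y * Phi p (u y / ennreal c))"
   if x: "x \<in> \<I>"
   unfolding e
  proof (rule Phi_nn_integral[OF p])
   have "(\<integral>y. ?k x y) = ennreal (1/A) * (\<integral>y\<in>\<I>. K x y)" by (simp add: nn_integral_cmult)
   also have "... <= ennreal (1/A) * ennreal A" using K1[OF x] by (rule mult_left_mono) simp
   finally show "(\<integral>y. ?k x y) <= 1" using one by simp
  qed measurable
  then show "Phi p ((\<integral>y\<in>\<I>. K x y * u y) / ennreal (A * c)) * ?i x <= (\<integral>y. ?k x y * Phi p (u y / ennreal c)) * ?i x"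
   by (auto simp: indicator_def)
 qed
 also have "... = (\<integral>x. (\<integral>y. ?i x * (?k x y * Phi p (u y / ennreal c))))"
  by (intro nn_integral_cong) (simp add: nn_integral_cmult mult.commute)
 also have "... = (\<integral>y. (\<integral>x. ?i x * (?k x y * Phi p (u y / ennreal c))))"
  by (rule lborel_pair.Fubini') measurable
 also have "... = (\<integral>y\<in>\<I>. ennreal (1/A) * (\<integral>x\<in>\<I>. K x y) * Phi p (u y / ennreal c))"
 proof (rule nn_integral_cong)
  fix y :: real
  have "(\<integral>x. ?i x * (?k x y * Phi p (u y / ennreal c))) = (\<integral>x. (ennreal (1/A) * ?i y * Phi p (u y / ennreal c)) * (K x y * ?i x))"
   by (intro nn_integral_cong) (simp add: mult_ac)
  also have "... = (ennreal (1/A) * ?i y * Phi p (u y / ennreal c)) * (\<integral>x\<in>\<I>. K x y)"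
   by (rule nn_integral_cmult) measurable
  finally show "(\<integral>x. ?i x * (?k x y * Phi p (u y / ennreal c)))
   = ennreal (1/A) * (\<integral>x\<in>\<I>. K x y) * Phi p (u y / ennreal c) * ?i y" by (simp add: mult_ac)
 qed
 also have "... <= (\<integral>y\<in>\<I>. Phi p (u y / ennreal c))"
 proof (rule nn_integral_mono)
  fix y :: real
  have "ennreal (1/A) * (\<integral>x\<in>\<I>. K x y) <= 1" if "y \<in> \<I>"
   using mult_left_mono[OF K2[OF that], of "ennreal (1/A)"] one by simp
  then show "ennreal (1/A) * (\<integral>x\<in>\<I>. K x y) * Phi p (u y / ennreal c) * ?i y <= Phi p (u y / ennreal c) * ?i y"
   using mult_right_mono[of "ennreal (1/A) * (\<integral>x\<in>\<I>. K x y)" 1 "Phi p (u y / ennreal c)"]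
   by (auto simp: indicator_def)
 qed
 also have "... <= 1" using u by (simp add: Lp_le_def)
 finally show ?thesis by (simp add: Lp_le_def)
qed

section \<open>Passage between the norm on \<open>[-1,1]\<close> and the modular on
  \<open>(-1,1)\<close>\<close>

lemma AE_lebesgue_on_iff:
 "(AE x in lebesgue_on {-1..1::real}. P x) \<longleftrightarrow> (AE x in lborel. x \<in> \<I> --> P x)"
proof -
 have "(AE x in lebesgue_on {-1..1::real}. P x) \<longleftrightarrow> (AE x in lborel. x \<in> {-1..1} --> P x)"
  by (subst AE_restrict_space_iff) (auto simp: AE_completion_iff)
 also have "... \<longleftrightarrow> (AE x in lborel. x \<in> \<I> --> P x)"
 proof -
  have n: "AE x::real in lborel. x ~= -1 \<and> x ~= 1"
   by (intro AE_conjI AE_lborel_singleton)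
  show ?thesis
  proof
   assume "AE x in lborel. x \<in> \<I> --> P x"
   with n show "AE x in lborel. x \<in> {-1..1} --> P x" by eventually_elim auto
  qed (auto elim: eventually_mono)
 qed
 finally show ?thesis .
qed

lemma nn_integral_lebesgue_on:
 assumes [measurable]: "f \<in> \<B>"
 shows "(\<integral>\<^sup>+x. f x \<partial>lebesgue_on {-1..1::real}) = (\<integral>x\<in>\<I>. f x)"
proof -
 have "(\<integral>\<^sup>+x. f x \<partial>lebesgue_on {-1..1::real}) = (\<integral>x\<in>{-1..1}. f x)"
  by (subst nn_integral_restrict_space) (auto simp: nn_integral_completion)
 also have "... = (\<integral>x\<in>\<I>. f x)"
 proof (rule nn_integral_cong_AE)
  have n: "AE x::real in lborel. x ~= -1 \<and> x ~= 1"
   by (intro AE_conjI AE_lborel_singleton)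
  then show "AE x in lborel. f x * indicator {-1..1} x = f x * indicator \<I> x"
   by eventually_elim (auto simp: indicator_def)
 qed
 finally show ?thesis .
qed

lemma borel_measurable_lebesgue_on: "f \<in> \<B> ==> f \<in> borel_measurable (lebesgue_on S)"
 by (intro measurable_restrict_space1) (simp add: measurable_completion)

lemma Lp_norm_cong_AE:
 assumes [measurable]: "f \<in> borel_measurable (lebesgue_on {-1..1})" "g \<in> borel_measurable (lebesgue_on {-1..1})"
  and ae: "AE x in lebesgue_on {-1..1}. f x = g x"
 shows "Lp_norm p f = Lp_norm p g"
proof -
 have 1: "esssup (lebesgue_on {-1..1}) (\<lambda>x. ennreal \<bar>f x\<bar>) = esssup (lebesgue_on {-1..1}) (\<lambda>x. ennreal \<bar>g x\<bar>)"
 proof -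
  have "(AE x in lebesgue_on {-1..1}. ennreal \<bar>f x\<bar> <= z) = (AE x in lebesgue_on {-1..1}. ennreal \<bar>g x\<bar> <= z)" for z
   by (rule eventually_cong[OF ae]) simp
  then show ?thesis by (subst (1 2) esssup_eq_AE) (simp_all del: AE_conj_iff)
 qed
 have 2: "(\<integral>\<^sup>+x. ennreal (\<bar>f x\<bar> powr q) \<partial>lebesgue_on {-1..1}) = (\<integral>\<^sup>+x. ennreal (\<bar>g x\<bar> powr q) \<partial>lebesgue_on {-1..1})" for q
  using ae by (intro nn_integral_cong_AE) (auto elim: eventually_mono)
 show ?thesis unfolding Lp_norm_def 1 2 ..
qed

lemma Lp_norm_le_iff:
 assumes p: "1 <= p" and g [measurable]: "g \<in> \<B>" and c: "c > 0"
 shows "Lp_norm p g <= ennreal c \<longleftrightarrow> Lp_le p (\<lambda>x. ennreal \<bar>g x\<bar>) c"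
proof (cases "p = \<infinity>")
 case True
 have m: "(\<lambda>x. ennreal \<bar>g x\<bar>) \<in> borel_measurable (lebesgue_on {-1..1})"
  by (rule borel_measurable_lebesgue_on) measurable
 have le: "ennreal \<bar>g x\<bar> / ennreal c <= 1 \<longleftrightarrow> \<bar>g x\<bar> <= c" for x
  using c by (simp add: divide_ennreal flip: ennreal_1)
 have "Lp_norm p g <= ennreal c \<longleftrightarrow> (AE x in lebesgue_on {-1..1}. ennreal \<bar>g x\<bar> <= ennreal c)"
 proof
  assume "Lp_norm p g <= ennreal c"
  then have "esssup (lebesgue_on {-1..1}) (\<lambda>x. ennreal \<bar>g x\<bar>) <= ennreal c" using True by (simp add: Lp_norm_def)
  then show "AE x in lebesgue_on {-1..1}. ennreal \<bar>g x\<bar> <= ennreal c"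
   using esssup_AE[of "\<lambda>x. ennreal \<bar>g x\<bar>" "lebesgue_on {-1..1}"] by (auto elim!: eventually_mono intro: order_trans)
 next
  assume "AE x in lebesgue_on {-1..1}. ennreal \<bar>g x\<bar> <= ennreal c"
  then show "Lp_norm p g <= ennreal c" using True m by (auto simp: Lp_norm_def intro: esssup_I)
 qed
 also have "... \<longleftrightarrow> (AE x in lborel. x \<in> \<I> --> \<bar>g x\<bar> <= c)"
  using c by (simp add: AE_lebesgue_on_iff ennreal_le_iff)
 also have "... \<longleftrightarrow> Lp_le p (\<lambda>x. ennreal \<bar>g x\<bar>) c"
 proof
  assume "AE x in lborel. x \<in> \<I> --> \<bar>g x\<bar> <= c"
  then have "(\<integral>x\<in>\<I>. Phi p (ennreal \<bar>g x\<bar> / ennreal c)) = (\<integral>(x::real). 0)"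
   by (intro nn_integral_cong_AE) (auto elim!: eventually_mono simp: indicator_def Phi_def True le)
  then show "Lp_le p (\<lambda>x. ennreal \<bar>g x\<bar>) c" by (simp add: Lp_le_def)
 next
  assume "Lp_le p (\<lambda>x. ennreal \<bar>g x\<bar>) c"
  then have "(\<integral>x\<in>\<I>. Phi p (ennreal \<bar>g x\<bar> / ennreal c)) ~= \<infinity>"
   unfolding Lp_le_def by (auto simp: top_unique)
  then have "AE x in lborel. Phi p (ennreal \<bar>g x\<bar> / ennreal c) * indicator \<I> x ~= \<infinity>"
   by (intro nn_integral_noteq_infinite) auto
  then show "AE x in lborel. x \<in> \<I> --> \<bar>g x\<bar> <= c"
   by eventually_elim (auto simp: indicator_def Phi_def True le split: if_splits)
 qed
 finally show ?thesis .
next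
 case False
 define q where "q = enn2real p"
 have q: "1 <= q" using enn2real_ge1 p False by (simp add: q_def)
 define I where "I = (\<integral>\<^sup>+x. ennreal (\<bar>g x\<bar> powr q) \<partial>lebesgue_on {-1..1})"
 have I: "I = (\<integral>x\<in>\<I>. ennreal (\<bar>g x\<bar> powr q))"
  unfolding I_def by (rule nn_integral_lebesgue_on) measurable
 have "(\<integral>x\<in>\<I>. Phi p (ennreal \<bar>g x\<bar> / ennreal c)) = (\<integral>x. ennreal (1 / c powr q) * (ennreal (\<bar>g x\<bar> powr q) * indicator \<I> x))"
  using c q False by (intro nn_integral_cong)
   (auto simp: Phi_def divide_ennreal q_def[symmetric] powr_divide indicator_def ennreal_mult[symmetric])
 also have "... = ennreal (1 / c powr q) * I" unfolding I by (rule nn_integral_cmult) measurable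
 finally have *: "Lp_le p (\<lambda>x. ennreal \<bar>g x\<bar>) c \<longleftrightarrow> ennreal (1 / c powr q) * I <= 1" by (simp add: Lp_le_def)
 show ?thesis
 proof (cases I)
  case top
  then show ?thesis using * c False by (simp add: Lp_norm_def Let_def I_def[symmetric] q_def[symmetric] ennreal_mult_top top_unique)
 next
  case (real r)
  have "Lp_norm p g <= ennreal c \<longleftrightarrow> r powr (1/q) <= c"
   using real False c by (simp add: Lp_norm_def Let_def I_def[symmetric] q_def[symmetric] ennreal_le_iff)
  also have "... \<longleftrightarrow> r <= c powr q"
  proof
   assume "r powr (1/q) <= c"
   then have "(r powr (1/q)) powr q <= c powr q" using q by (intro powr_mono2) auto
   then show "r <= c powr q" using q real by (simp add: powr_powr)
  next
   assume "r <= c powr q"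
   then have "r powr (1/q) <= (c powr q) powr (1/q)" using q real by (intro powr_mono2) auto
   then show "r powr (1/q) <= c" using q c by (simp add: powr_powr)
  qed
  also have "... \<longleftrightarrow> ennreal (1 / c powr q) * I <= 1"
   using real c by (simp add: ennreal_mult[symmetric] field_simps flip: ennreal_1)
  finally show ?thesis using * by simp
 qed
qed

section \<open>Jackson kernels\<close>

lemma cos_three_term: "cos (real (Suc (Suc i)) * t) + cos (real i * t) = 2 * cos t * cos (real (Suc i) * t)"
proof -
 have "real (Suc (Suc i)) * t = real (Suc i) * t + t" "real i * t = real (Suc i) * t - t"
  by (simp_all add: algebra_simps)
 then show ?thesis by (simp only: cos_add cos_diff) simp
qed

lemma cheb_exists: "\<exists>T::real poly. degree T <= j \<and> (\<forall>t. poly T (cos t) = cos (real j * t))"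
proof (induction j rule: less_induct)
 case (less j)
 show ?case
 proof (cases "j <= 1")
  case True
  then consider "j = 0" | "j = 1" by linarith
  then show ?thesis
  proof cases
   case 1 then show ?thesis by (intro exI[of _ 1]) auto
  next
   case 2 then show ?thesis by (intro exI[of _ "[:0,1:]"]) auto
  qed
 next
  case False
  then obtain i where i: "j = Suc (Suc i)" by (metis One_nat_def le_SucI not0_implies_Suc not_less_eq_eq le_zero_eq)
  obtain T where T: "degree T <= Suc i" "\<And>t. poly T (cos t) = cos (real (Suc i) * t)" using less[of "Suc i"] i by auto
  obtain S where S: "degree S <= i" "\<And>t. poly S (cos t) = cos (real i * t)" using less[of i] i by auto
  have "degree ([:0,2:] * T - S) <= j"
  proof (rule degree_diff_le)
   have "degree ([:0,2:] * T) <= degree [:0,2::real:] + degree T" by (rule degree_mult_le)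
   then show "degree ([:0,2:] * T) <= j" using T(1) i by simp
  qed (use S i in simp)
  moreover have "poly ([:0,2:] * T - S) (cos t) = cos (real j * t)" for t
  proof -
   have "cos (real j * t) + cos (real i * t) = 2 * cos t * cos (real (Suc i) * t)"
    using cos_three_term[of i t] i by simp
   then show ?thesis using T(2) S(2) by simp
  qed
  ultimately show ?thesis by blast
 qed
qed

definition cheb :: "nat => real poly" where
 "cheb j = (SOME T. degree T <= j \<and> (\<forall>t. poly T (cos t) = cos (real j * t)))"

lemma degree_cheb: "degree (cheb j) <= j" and poly_cheb: "poly (cheb j) (cos t) = cos (real j * t)"
 using someI_ex[OF cheb_exists[of j]] unfolding cheb_def by auto

text \<open>In Horner form, one more factor \<open>cos t\<close> sends the frequency
  \<open>j\<close> to \<open>j-1\<close> and \<open>j+1\<close>.\<close>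

lemma cos_expansion: "\<exists>a. \<forall>t. poly q (cos t) = (\<Sum>j\<le>degree q. a j * cos (real j * t))" for q :: "real poly"
proof -
 have "\<exists>a. \<forall>t. poly q (cos t) = (\<Sum>j\<le>d. a j * cos (real j * t))" if "degree q <= d" for d
  using that
 proof (induction d arbitrary: q)
  case 0
  then obtain c where "q = [:c:]" by (auto elim: degree_eq_zeroE)
  then show ?case by (intro exI[of _ "\<lambda>_. c"]) simp
 next
  case (Suc d)
  obtain c q' where q: "q = pCons c q'" by (cases q)
  have "degree q' <= d" using Suc.prems q by (cases "q' = 0") auto
  then obtain a where a: "\<And>t. poly q' (cos t) = (\<Sum>j\<le>d. a j * cos (real j * t))" using Suc.IH by blast
  define A where "A j = (if j <= d then a j else 0)" for j
  \<comment> \<open>The four summands are the constant \<open>c\<close>, the frequency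
    \<open>j-1\<close> moved up, the frequency \<open>j+1\<close> moved down, and frequency 0 moved
    down to \<open>-1\<close>, which is \<open>cos t\<close> again.\<close>
  define b where "b j = (if j = 0 then c else 0) + (if j >= 1 then A (j - 1) / 2 else 0) + (A (Suc j) / 2) + (if j = 1 then A 0 / 2 else 0)" for j
  have "poly q (cos t) = (\<Sum>j\<le>Suc d. b j * cos (real j * t))" for t
  proof -
   have "poly q (cos t) = c + (\<Sum>j\<le>d. A j * (cos t * cos (real j * t)))"
    by (simp add: q a sum_distrib_left A_def mult_ac)
   also have "(\<Sum>j\<le>d. A j * (cos t * cos (real j * t))) = (\<Sum>j\<le>d. A j / 2 * cos (real (Suc j) * t)) + (\<Sum>j\<le>d. A j / 2 * cos ((real j - 1) * t))"
    unfolding sum.distrib[symmetric]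
   proof (rule sum.cong)
    fix j
    have "cos t * cos (real j * t) = (cos (t - real j * t) + cos (t + real j * t)) / 2" by (rule cos_times_cos)
    moreover have "cos (t - real j * t) = cos ((real j - 1) * t)"
     by (subst cos_minus[symmetric]) (simp add: algebra_simps)
    ultimately show "A j * (cos t * cos (real j * t)) = A j / 2 * cos (real (Suc j) * t) + A j / 2 * cos ((real j - 1) * t)"
    proof -
     have e: "t + real j * t = real (Suc j) * t" by (simp add: algebra_simps)
     have "cos t * cos (real j * t) = (cos ((real j - 1) * t) + cos (real (Suc j) * t)) / 2"
      unfolding cos_times_cos e \<open>cos (t - real j * t) = cos ((real j - 1) * t)\<close> ..
     then show ?thesis by (simp only:) (simp add: field_simps)
    qed
   qed simp
   also have "(\<Sum>j\<le>d. A j / 2 * cos ((real j - 1) * t)) = (\<Sum>j\<le>Suc d. A (Suc j) / 2 * cos (real j * t)) + A 0 / 2 * cos t"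
   proof -
    have "(\<Sum>j\<le>d. A j / 2 * cos ((real j - 1) * t)) = (\<Sum>j\<le>Suc (Suc d). A j / 2 * cos ((real j - 1) * t))"
     by (simp add: A_def)
    also have "... = A 0 / 2 * cos t + (\<Sum>j\<le>Suc d. A (Suc j) / 2 * cos (real j * t))"
     by (subst sum.atMost_Suc_shift) simp
    finally show ?thesis by simp
   qed
   also have "(\<Sum>j\<le>d. A j / 2 * cos (real (Suc j) * t)) = (\<Sum>j\<le>Suc d. (if j >= 1 then A (j - 1) / 2 else 0) * cos (real j * t))"
    by (subst sum.atMost_Suc_shift) simp
   finally have "poly q (cos t) = (\<Sum>j\<le>Suc d. (if j = 0 then c else 0) * cos (real j * t)) + (\<Sum>j\<le>Suc d. (if j >= 1 then A (j - 1) / 2 else 0) * cos (real j * t))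
    + (\<Sum>j\<le>Suc d. A (Suc j) / 2 * cos (real j * t)) + (\<Sum>j\<le>Suc d. (if j = 1 then A 0 / 2 else 0) * cos (real j * t))"
    by (simp add: if_distrib[of "\<lambda>x. x * _"] sum.delta cong: if_cong)
   then show ?thesis unfolding b_def by (simp only: sum.distrib[symmetric] distrib_right[symmetric])
  qed
  then show ?case by blast
 qed
 then show ?thesis by blast
qed

text \<open>\<open>m\<close> times the usual Fejer kernel; where \<open>sin (t/2)\<close> is nonzero
  it equals \<open>(sin (m*t/2) / sin (t/2))^2\<close>.\<close>

definition fejer :: "nat => real => real" where
 "fejer m t = real m + 2 * (\<Sum>j<m. (if j = 0 then 0 else real (m - j)) * cos (real j * t))"

text \<open>The Dirichlet kernel times \<open>1 - cos t\<close> is a difference of consecutive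
  cosines, so that summing over \<open>m\<close> telescopes in \<open>fejer_eq\<close>.\<close>

lemma dirichlet_sum: "(1 - cos t) * (1 + 2 * (\<Sum>j\<in>{1..m}. cos (real j * t))) = cos (real m * t) - cos (real (Suc m) * t)"
proof (induction m)
 case (Suc m)
 have "cos (real (Suc (Suc m)) * t) + cos (real m * t) = 2 * cos t * cos (real (Suc m) * t)"
  by (rule cos_three_term)
 then show ?case using Suc by (simp add: algebra_simps)
qed simp

lemma fejer_Suc: "fejer (Suc m) t = fejer m t + (1 + 2 * (\<Sum>j\<in>{1..m}. cos (real j * t)))"
proof -
 have "(\<Sum>j<Suc m. (if j = 0 then 0 else real (Suc m - j)) * cos (real j * t))
  = (\<Sum>j<Suc m. (if j = 0 then 0 else real (m - j)) * cos (real j * t) + (if j = 0 then 0 else cos (real j * t)))"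
  by (intro sum.cong) (auto simp: Suc_diff_le algebra_simps)
 also have "... = (\<Sum>j<m. (if j = 0 then 0 else real (m - j)) * cos (real j * t)) + (\<Sum>j<Suc m. if j = 0 then 0 else cos (real j * t))"
  by (subst sum.distrib) simp
 also have "(\<Sum>j<Suc m. if j = 0 then 0 else cos (real j * t)) = (\<Sum>j\<in>{1..m}. cos (real j * t))"
  by (rule sum.mono_neutral_cong_right) auto
 finally show ?thesis by (simp add: fejer_def)
qed

lemma fejer_eq: "(1 - cos t) * fejer m t = 1 - cos (real m * t)"
proof (induction m)
 case 0 then show ?case by (simp add: fejer_def)
next
 case (Suc m)
 then show ?case using dirichlet_sum[of t m] by (simp add: fejer_Suc algebra_simps)
qed

lemma sum_real_diff: "real m + 2 * (\<Sum>j<m. (if j = 0 then 0 else real (m - j))) = real m ^ 2"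
proof -
 have "real m + 2 * (\<Sum>j<m. (if j = 0 then 0 else real (m - j))) = fejer m 0" by (simp add: fejer_def)
 also have "... = real m ^ 2"
  by (induction m) (simp add: fejer_def, simp add: fejer_Suc power2_eq_square algebra_simps)
 finally show ?thesis .
qed

lemma abs_fejer_le: "\<bar>fejer m t\<bar> <= real m ^ 2"
proof -
 have "\<bar>fejer m t\<bar> <= real m + 2 * \<bar>\<Sum>j<m. (if j = 0 then 0 else real (m - j)) * cos (real j * t)\<bar>"
  unfolding fejer_def by (simp add: abs_triangle_ineq[THEN order_trans] abs_mult)
 also have "\<bar>\<Sum>j<m. (if j = 0 then 0 else real (m - j)) * cos (real j * t)\<bar> <= (\<Sum>j<m. \<bar>(if j = 0 then 0 else real (m - j)) * cos (real j * t)\<bar>)"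
  by (rule sum_abs)
 also have "... <= (\<Sum>j<m. (if j = 0 then 0 else real (m - j)))"
  by (intro sum_mono) (auto simp: abs_mult mult_left_le)
 finally show ?thesis using sum_real_diff[of m] by simp
qed

lemma fejer_nonneg: "0 <= fejer m t"
proof (cases "cos t = 1")
 case True
 have "cos (real j * t) = 1" for j
 proof (induction j)
  case (Suc j)
  have "sin t = 0" using True sin_cos_squared_add[of t] by simp
  then show ?case using Suc True by (simp add: distrib_right cos_add)
 qed simp
 then show ?thesis by (simp add: fejer_def sum_nonneg)
next
 case False
 then have "1 - cos t > 0" using cos_le_one[of t] by linarith
 moreover have "0 <= (1 - cos t) * fejer m t" unfolding fejer_eq by simp
 ultimately show ?thesis by (simp add: zero_le_mult_iff)
qed

lemma jordan_sin: assumes "0 <= x" "x <= pi/2" shows "2 / pi * x <= sin x"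
proof -
 have "concave_on {0..pi/2} sin"
  by (rule f''_le0_imp_concave[where f'=cos and f''="\<lambda>x. - sin x"])
   (auto intro!: derivative_eq_intros sin_ge_zero)
 then have "(1 - 2/pi*x) * sin 0 + (2/pi*x) * sin (pi/2) <= sin ((1 - 2/pi*x) *\<^sub>R 0 + (2/pi*x) *\<^sub>R (pi/2))"
  using assms pi_gt_zero by (intro concave_onD) (auto simp: field_simps)
 then show ?thesis using pi_gt_zero by simp
qed

lemma one_minus_cos_ge: assumes "\<bar>t\<bar> <= pi" shows "2 * t\<^sup>2 / pi\<^sup>2 <= 1 - cos t"
proof -
 have "2 / pi * (\<bar>t\<bar>/2) <= sin (\<bar>t\<bar>/2)" using assms by (intro jordan_sin) auto
 then have "(2 / pi * (\<bar>t\<bar>/2))\<^sup>2 <= (sin (\<bar>t\<bar>/2))\<^sup>2" using pi_gt_zero by (intro power_mono) auto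
 moreover have "cos t = 1 - 2 * (sin (\<bar>t\<bar>/2))\<^sup>2"
  using cos_double_sin[of "\<bar>t\<bar>/2"] by simp
 moreover have "2 * (2 / pi * (\<bar>t\<bar>/2))\<^sup>2 = 2 * t\<^sup>2 / pi\<^sup>2" by (simp add: power_mult_distrib power_divide)
 ultimately show ?thesis by linarith
qed

lemma one_minus_cos_le: fixes t :: real shows "1 - cos t <= t\<^sup>2 / 2"
proof -
 have "\<bar>sin (t/2)\<bar> <= \<bar>t/2\<bar>" by (rule abs_sin_x_le_abs_x)
 then have "(sin (t/2))\<^sup>2 <= (t/2)\<^sup>2" by (simp only: abs_le_square_iff)
 moreover have "cos t = 1 - 2 * (sin (t/2))\<^sup>2" using cos_double_sin[of "t/2"] by simp
 ultimately show ?thesis by (simp add: power_divide)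
qed

lemma pi_sq_le: "pi\<^sup>2 <= 10"
proof -
 have "pi < 3.1416" using pi_approx(2) by simp
 then have "pi\<^sup>2 <= 3.1416\<^sup>2" using pi_gt_zero by (intro power_mono) auto
 then show ?thesis by (simp add: power2_eq_square)
qed

text \<open>For \<open>m*d <= 1\<close> the trivial bound \<open>m^2\<close> is enough; otherwise
  \<open>(1 - cos t) * fejer m t <= 2\<close> is divided by \<open>1 - cos d >= d^2/5\<close>. The
  hypothesis compares cosines instead of angles so that it also admits \<open>t = v + s\<close>,
  which may exceed \<open>\<pi>\<close>.\<close>

lemma fejer_upper:
 assumes m: "m >= 1" and d: "0 <= d" "d <= pi" and t: "cos t <= cos d"
 shows "fejer m t <= 40 * (real m)\<^sup>2 / (1 + real m * d)\<^sup>2"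
proof (cases "real m * d <= 1")
 case True
 then have "(1 + real m * d)\<^sup>2 <= 2\<^sup>2" using d by (intro power_mono) auto
 then have "(real m)\<^sup>2 * (1 + real m * d)\<^sup>2 <= (real m)\<^sup>2 * 40" by (intro mult_left_mono) auto
 moreover have "fejer m t <= (real m)\<^sup>2" using abs_fejer_le[of m t] by simp
 moreover have "(1 + real m * d)\<^sup>2 > 0" using d by (intro zero_less_power add_pos_nonneg) auto
 ultimately have "fejer m t * (1 + real m * d)\<^sup>2 <= 40 * (real m)\<^sup>2"
  by (smt (verit) mult_right_mono mult.commute)
 then show ?thesis using \<open>(1 + real m * d)\<^sup>2 > 0\<close> by (simp add: pos_le_divide_eq)
next
 case False
 then have dp: "d > 0" using d m by (cases "d = 0") auto
 have "2 * d\<^sup>2 / pi\<^sup>2 <= 1 - cos d" using d by (intro one_minus_cos_ge) auto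
 moreover have "2 * d\<^sup>2 / 10 <= 2 * d\<^sup>2 / pi\<^sup>2" using pi_sq_le by (intro divide_left_mono) auto
 ultimately have "d\<^sup>2 / 5 <= 1 - cos t" using t by linarith
 then have "d\<^sup>2 / 5 * fejer m t <= (1 - cos t) * fejer m t" using fejer_nonneg by (rule mult_right_mono)
 also have "... <= 2" unfolding fejer_eq using cos_ge_minus_one[of "real m * t"] by linarith
 finally have f: "fejer m t * d\<^sup>2 <= 10" by (simp add: mult.commute)
 have "1 + real m * d <= 2 * (real m * d)" using False by linarith
 then have "(1 + real m * d)\<^sup>2 <= (2 * (real m * d))\<^sup>2" using d by (intro power_mono) auto
 then have "fejer m t * (1 + real m * d)\<^sup>2 <= fejer m t * (2 * (real m * d))\<^sup>2" using fejer_nonneg by (rule mult_left_mono)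
 also have "... = 4 * (real m)\<^sup>2 * (fejer m t * d\<^sup>2)" by (simp add: power_mult_distrib)
 also have "... <= 4 * (real m)\<^sup>2 * 10" using f by (intro mult_left_mono) auto
 finally have "fejer m t * (1 + real m * d)\<^sup>2 <= 40 * (real m)\<^sup>2" by simp
 moreover have "(1 + real m * d)\<^sup>2 > 0" using d by (intro zero_less_power add_pos_nonneg) auto
 ultimately show ?thesis by (simp add: pos_le_divide_eq)
qed

text \<open>For \<open>m*s <= 1\<close> the numerator \<open>1 - cos (m*s)\<close> is still of order
  \<open>(m*s)^2\<close>, while the denominator is at most \<open>s^2/2\<close>.\<close>

lemma fejer_lower:
 assumes m: "m >= 1" and s: "0 < s" "s <= 1 / real m"
 shows "2/5 * (real m)\<^sup>2 <= fejer m s"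
proof -
 have ms: "real m * s <= 1" using s m by (simp add: field_simps)
 have "2 * (real m * s)\<^sup>2 / pi\<^sup>2 <= 1 - cos (real m * s)" using ms s pi_gt3 by (intro one_minus_cos_ge) auto
 moreover have "2 * (real m * s)\<^sup>2 / 10 <= 2 * (real m * s)\<^sup>2 / pi\<^sup>2" using pi_sq_le by (intro divide_left_mono) auto
 ultimately have "2 * (real m * s)\<^sup>2 / 10 <= (1 - cos s) * fejer m s" unfolding fejer_eq by linarith
 also have "... <= s\<^sup>2 / 2 * fejer m s" using one_minus_cos_le fejer_nonneg by (rule mult_right_mono)
 finally have "(2/5 * (real m)\<^sup>2) * s\<^sup>2 <= fejer m s * s\<^sup>2" by (simp add: power_mult_distrib algebra_simps)
 then show ?thesis using s by simp
qed

lemma has_integral_cos_0_pi: "((\<lambda>s. cos (real j * s)) has_integral (if j = 0 then pi else 0)) {0..pi}"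
proof (cases "j = 0")
 case True
 have "((\<lambda>s::real. 1::real) has_integral pi) {0..pi}"
  using has_integral_const_real[of "1::real" 0 pi] by simp
 then show ?thesis using True by simp
next
 case False
 have "((\<lambda>s. cos (real j * s)) has_integral (sin (real j * pi) / real j - sin (real j * 0) / real j)) {0..pi}"
  using False by (intro fundamental_theorem_of_calculus)
   (auto intro!: derivative_eq_intros simp: has_real_derivative_iff_has_vector_derivative[symmetric])
 then show ?thesis using False by (simp add: sin_npi)
qed


lemma poly_fejer: "\<exists>q. degree q <= m - 1 \<and> (\<forall>t. poly q (cos t) = fejer m t)"
proof -
 define q where "q = [:real m:] + smult 2 (\<Sum>j<m. smult (if j = 0 then 0 else real (m - j)) (cheb j))"
 have "degree (\<Sum>j<m. smult (if j = 0 then 0 else real (m - j)) (cheb j)) <= m - 1"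
 proof (rule degree_sum_le)
  fix j assume "j \<in> {..<m}"
  then show "degree (smult (if j = 0 then 0 else real (m - j)) (cheb j)) <= m - 1"
   using degree_cheb[of j] by (auto intro: degree_smult_le[THEN order_trans])
 qed simp
 then have "degree q <= m - 1"
  unfolding q_def by (intro degree_add_le) (auto intro: degree_smult_le[THEN order_trans])
 moreover have "poly q (cos t) = fejer m t" for t by (simp add: q_def fejer_def poly_sum poly_cheb)
 ultimately show ?thesis by blast
qed

lemma cos_reflect_le:
 assumes "t \<in> {0..pi}" "s \<in> {0..pi}"
 shows "cos (t + s) <= cos \<bar>t - s\<bar>"
proof -
 have "0 <= sin t * sin s" using assms by (intro mult_nonneg_nonneg sin_ge_zero) auto
 then show ?thesis by (simp add: cos_add cos_diff)
qed

text \<open>The \<open>\<kappa>\<close>-th power of a Fejer kernel of order about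
  \<open>n/\<kappa>\<close> has degree below \<open>n\<close> and decay of order
  \<open>2*\<kappa>\<close>. Adding the value at \<open>v + s\<close> to that at
  \<open>v - s\<close> leaves only products of cosines, so integration against it yields a
  polynomial in \<open>cos v\<close>; since \<open>cos (v+s) <= cos (v-s)\<close>, the added term
  obeys the same bound.\<close>

lemma jackson_kernel:
 assumes \<kappa>: "\<kappa> >= 1"
 shows "\<exists>C>0. \<forall>n\<ge>1. \<exists>(B :: real => real => real) a.
  (\<forall>v s. B v s = (\<Sum>j<n. a j * cos (real j * s) * cos (real j * v))) \<and>
  (\<forall>v\<in>{0..pi}. \<forall>s\<in>{0..pi}. 0 <= B v s \<and> B v s <= C * real n / (1 + real n * \<bar>v - s\<bar>) ^ (2 * \<kappa>)) \<and>
  (\<forall>v. (B v has_integral 1) {0..pi})"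
proof (rule exI[of _ "100 ^ \<kappa> * real \<kappa> ^ (2 * \<kappa>)"], intro conjI allI impI)
 \<comment> \<open>\<open>100\<close> is the quotient of \<open>40\<close> from the upper and
   \<open>2/5\<close> from the lower Fejer bound; \<open>\<kappa> ^ (2 * \<kappa>)\<close> pays for
   \<open>n <= \<kappa> * m\<close>.\<close>
 let ?C = "100 ^ \<kappa> * real \<kappa> ^ (2 * \<kappa>)"
 show "0 < ?C" using \<kappa> by simp
 fix n :: nat assume n: "n >= 1"
 define m where "m = (n - 1) div \<kappa> + 1"
 have m1: "m >= 1" by (simp add: m_def)
 have mn: "\<kappa> * (m - 1) < n" using n \<kappa> by (simp add: m_def) (metis div_times_less_eq_dividend le_imp_less_Suc Suc_diff_1 mult.commute less_eq_Suc_le One_nat_def)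
 have "m <= n"
 proof -
  have "(n - 1) div \<kappa> <= n - 1" by simp
  then show ?thesis using n unfolding m_def by linarith
 qed
 have nm: "n <= \<kappa> * m"
 proof -
  have "n - 1 < \<kappa> * ((n - 1) div \<kappa> + 1)" using \<kappa> by (simp add: dividend_less_times_div)
  then show ?thesis unfolding m_def by linarith
 qed
 obtain q where q: "degree q <= m - 1" "\<And>t. poly q (cos t) = fejer m t" using poly_fejer by blast
 have dq: "degree (q ^ \<kappa>) < n"
 proof -
  have "degree (q ^ \<kappa>) <= degree q * \<kappa>" by (rule degree_power_le)
  also have "... <= (m - 1) * \<kappa>" using q(1) by (rule mult_le_mono1)
  finally show ?thesis using mn by (simp add: mult.commute)
 qed
 obtain b where b: "\<And>t. poly (q ^ \<kappa>) (cos t) = (\<Sum>j\<le>degree (q ^ \<kappa>). b j * cos (real j * t))"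
  using cos_expansion by blast
 define b' where "b' j = (if j <= degree (q ^ \<kappa>) then b j else 0)" for j
 have J: "fejer m t ^ \<kappa> = (\<Sum>j<n. b' j * cos (real j * t))" for t
 proof -
  have "fejer m t ^ \<kappa> = (\<Sum>j\<le>degree (q ^ \<kappa>). b' j * cos (real j * t))" using b[of t] q(2) by (simp add: b'_def)
  also have "... = (\<Sum>j<n. b' j * cos (real j * t))"
   using dq by (intro sum.mono_neutral_left) (auto simp: b'_def)
  finally show ?thesis .
 qed
 define B0 where "B0 v s = fejer m (v - s) ^ \<kappa> + fejer m (v + s) ^ \<kappa>" for v s
 have B0: "B0 v s = (\<Sum>j<n. 2 * b' j * cos (real j * s) * cos (real j * v))" for v s
  unfolding B0_def J sum.distrib[symmetric]
  by (intro sum.cong) (auto simp: cos_add cos_diff algebra_simps)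
 \<comment> \<open>Only frequency 0 survives integration over \<open>[0,\<pi>]\<close>, so the total
   mass is the same for every \<open>v\<close>.\<close>
 define Z where "Z = 2 * b' 0 * pi"
 have intB0: "(B0 v has_integral Z) {0..pi}" for v
 proof -
  have "((\<lambda>s. \<Sum>j<n. (2 * b' j * cos (real j * v)) * cos (real j * s)) has_integral
   (\<Sum>j<n. (2 * b' j * cos (real j * v)) * (if j = 0 then pi else 0))) {0..pi}"
   by (intro has_integral_sum has_integral_mult_right has_integral_cos_0_pi) auto
  moreover have "(\<Sum>j<n. (2 * b' j * cos (real j * v)) * (if j = 0 then pi else 0)) = Z"
   using n by (simp add: Z_def if_distrib[of "\<lambda>x. _ * x"] sum.delta cong: if_cong)
  moreover have "B0 v = (\<lambda>s. \<Sum>j<n. (2 * b' j * cos (real j * v)) * cos (real j * s))"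
   unfolding B0 by (intro ext sum.cong) (auto simp: mult_ac)
  ultimately show ?thesis by simp
 qed
 have mpos: "real m > 0" using m1 by simp
 \<comment> \<open>The mass may be estimated at \<open>v = 0\<close>, where both summands coincide,
   and on \<open>(0,1/m)\<close> alone.\<close>
 have Zlow: "2 * (2/5) ^ \<kappa> * real m ^ (2 * \<kappa>) / real m <= Z"
 proof -
  define c where "c = 2 * (2/5 * (real m)\<^sup>2) ^ \<kappa>"
  have "1 / real m <= 1" using m1 by simp
  then have sub: "{0..1/real m} \<subseteq> {0..pi}" using pi_gt3 by (simp del: divide_le_eq_1_pos)
  have pos: "0 <= B0 0 s" for s unfolding B0_def using fejer_nonneg by simp
  have int1: "B0 0 integrable_on {0..1/real m}"
   using integrable_on_subinterval[OF has_integral_integrable[OF intB0[of 0]] sub] .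
  have "c * (1/real m) = integral {0..1/real m} (\<lambda>s. c)" using mpos by simp
  also have "... = integral {0<..<1/real m} (\<lambda>s. c)" by (simp only: integral_open_interval_real)
  also have "... <= integral {0<..<1/real m} (B0 0)"
  proof (rule integral_le)
   show "(\<lambda>s. c) integrable_on {0<..<1/real m}" by (subst integrable_on_open_interval_real) auto
   show "B0 0 integrable_on {0<..<1/real m}" using int1 by (subst integrable_on_open_interval_real)
   fix s assume "s \<in> {0<..<1/real m}"
   then have "2/5 * (real m)\<^sup>2 <= fejer m s" by (intro fejer_lower m1) auto
   moreover have "fejer m (- s) = fejer m s" by (simp add: fejer_def)
   ultimately show "c <= B0 0 s" unfolding c_def B0_def using power_mono[of "2/5 * (real m)\<^sup>2" "fejer m s" \<kappa>] by simp
  qed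
  also have "... = integral {0..1/real m} (B0 0)" by (simp only: integral_open_interval_real)
  also have "... <= integral {0..pi} (B0 0)"
   using pos by (intro integral_subset_le sub int1 has_integral_integrable[OF intB0[of 0]]) auto
  also have "... = Z" using intB0[of 0] by (rule integral_unique)
  finally have "c * (1/real m) <= Z" .
  moreover have "c * (1/real m) = 2 * (2/5) ^ \<kappa> * real m ^ (2 * \<kappa>) / real m"
   by (simp only: c_def power_mult_distrib power_mult mult.assoc times_divide_eq_right mult_1_right)
  ultimately show ?thesis by (simp only:)
 qed
 have Zpos: "Z > 0"
 proof -
  have "0 < 2 * (2/5) ^ \<kappa> * real m ^ (2 * \<kappa>) / real m" using mpos by simp
  then show ?thesis using Zlow by linarith
 qed
 let ?B = "\<lambda>v s. B0 v s / Z" and ?a = "\<lambda>j. 2 * b' j / Z"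
 have 1: "?B v s = (\<Sum>j<n. ?a j * cos (real j * s) * cos (real j * v))" for v s
  unfolding B0 by (simp add: sum_divide_distrib)
 have 2: "(?B v has_integral 1) {0..pi}" for v
  using has_integral_divide[OF intB0[of v], of Z] Zpos by simp
 have 3: "\<forall>v\<in>{0..pi}. \<forall>s\<in>{0..pi}. 0 <= ?B v s \<and> ?B v s <= ?C * real n / (1 + real n * \<bar>v - s\<bar>) ^ (2 * \<kappa>)"
 proof (intro ballI conjI)
  fix v s assume ts: "v \<in> {0..pi}" "s \<in> {0..pi}"
  show "0 <= ?B v s" unfolding B0_def using fejer_nonneg Zpos by simp
  define d where "d = \<bar>v - s\<bar>"
  have d: "0 <= d" "d <= pi" using ts by (auto simp: d_def)
  have e: "1 + real m * d > 0" "1 + real n * d > 0" using d by (auto intro: add_pos_nonneg)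
  have f: "fejer m (v - s) ^ \<kappa> <= (40 * (real m)\<^sup>2 / (1 + real m * d)\<^sup>2) ^ \<kappa>"
      "fejer m (v + s) ^ \<kappa> <= (40 * (real m)\<^sup>2 / (1 + real m * d)\<^sup>2) ^ \<kappa>"
   using cos_reflect_le[OF ts] by (intro power_mono fejer_upper m1 d fejer_nonneg; simp add: d_def)+
  have "B0 v s <= 2 * (40 * (real m)\<^sup>2 / (1 + real m * d)\<^sup>2) ^ \<kappa>" unfolding B0_def using f by linarith
  also have "... = 2 * (40 ^ \<kappa> * real m ^ (2 * \<kappa>)) / (1 + real m * d) ^ (2 * \<kappa>)"
   by (simp add: power_divide power_mult_distrib power_mult)
  finally have up: "B0 v s <= 2 * (40 ^ \<kappa> * real m ^ (2 * \<kappa>)) / (1 + real m * d) ^ (2 * \<kappa>)" .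
  have "?B v s <= B0 v s / (2 * (2/5) ^ \<kappa> * real m ^ (2 * \<kappa>) / real m)"
   using Zlow mpos by (intro divide_left_mono) (auto simp: B0_def fejer_nonneg Zpos)
  also have "... <= (2 * (40 ^ \<kappa> * real m ^ (2 * \<kappa>)) / (1 + real m * d) ^ (2 * \<kappa>)) / (2 * (2/5) ^ \<kappa> * real m ^ (2 * \<kappa>) / real m)"
   using up mpos by (intro divide_right_mono) auto
  also have "... = (40 ^ \<kappa> / (2/5) ^ \<kappa>) * real m / (1 + real m * d) ^ (2 * \<kappa>)"
   using mpos e by (simp add: field_simps)
  also have "40 ^ \<kappa> / (2/5 :: real) ^ \<kappa> = 100 ^ \<kappa>" by (simp add: power_divide[symmetric])
  also have "100 ^ \<kappa> * real m / (1 + real m * d) ^ (2 * \<kappa>) <= 100 ^ \<kappa> * real n / ((1 + real n * d) / real \<kappa>) ^ (2 * \<kappa>)"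
  proof (intro frac_le mult_left_mono power_mono)
   have "real n <= real \<kappa> * real m" using nm by (metis of_nat_le_iff of_nat_mult)
   then have "real n * d <= real \<kappa> * real m * d" using d by (intro mult_right_mono) auto
   then show "(1 + real n * d) / real \<kappa> <= 1 + real m * d" using \<kappa> by (simp add: field_simps) 
  qed (use \<open>m <= n\<close> e \<kappa> in \<open>auto intro!: divide_nonneg_pos less_imp_le\<close>)
  also have "... = ?C * real n / (1 + real n * d) ^ (2 * \<kappa>)" by (simp add: power_divide)
  finally show "?B v s <= ?C * real n / (1 + real n * \<bar>v - s\<bar>) ^ (2 * \<kappa>)" unfolding d_def .
 qed
 show "\<exists>(B :: real => real => real) a.
  (\<forall>v s. B v s = (\<Sum>j<n. a j * cos (real j * s) * cos (real j * v))) \<and>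
  (\<forall>v\<in>{0..pi}. \<forall>s\<in>{0..pi}. 0 <= B v s \<and> B v s <= ?C * real n / (1 + real n * \<bar>v - s\<bar>) ^ (2 * \<kappa>)) \<and>
  (\<forall>v. (B v has_integral 1) {0..pi})"
  using 1 2 3 by (intro exI[of _ ?B] exI[of _ ?a]) blast
qed

lemma nn_integral_decay:
 fixes n t :: real
 assumes n: "n > 0"
 shows "(\<integral>s. ennreal (n / (1 + n * \<bar>t - s\<bar>)\<^sup>2)) <= 2"
proof -
 let ?f = "\<lambda>s::real. ennreal (n / (1 + n * \<bar>s\<bar>)\<^sup>2)"
 have "(\<integral>s. ennreal (n / (1 + n * \<bar>t - s\<bar>)\<^sup>2)) = (\<integral>s. ?f s)"
  using nn_integral_real_affine[of ?f "-1" t] by simp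
 have half: "(\<integral>s. ennreal (n / (1 + n * s)\<^sup>2) * indicator {0..} s) = ennreal (0 - (- 1 / (1 + n * 0)))"
 proof (rule nn_integral_FTC_atLeast)
  show "DERIV (\<lambda>s. - 1 / (1 + n * s)) s :> n / (1 + n * s)\<^sup>2" if "0 <= s" for s
   using n that by (auto intro!: derivative_eq_intros simp: power2_eq_square add_nonneg_eq_0_iff divide_simps)
  show "((\<lambda>s. - 1 / (1 + n * s)) \<longlongrightarrow> 0) at_top"
   using n by (intro real_tendsto_divide_at_top[OF tendsto_const] filterlim_tendsto_add_at_top[OF tendsto_const]
     filterlim_tendsto_pos_mult_at_top[OF tendsto_const]) (auto simp: filterlim_ident)
 qed (use n in auto)
 have "(\<integral>s. ?f s) <= (\<integral>s. (?f s * indicator {0..} s + ?f (-s) * indicator {0..} (-s)))"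
  by (intro nn_integral_mono) (auto simp: indicator_def)
 also have "... = (\<integral>s. ?f s * indicator {0..} s) + (\<integral>s. ?f (-s) * indicator {0..} (-s))"
  by (rule nn_integral_add) measurable
 also have "(\<integral>s. ?f (-s) * indicator {0..} (-s)) = (\<integral>s. ?f s * indicator {0..} s)"
  using nn_integral_real_affine[of "\<lambda>s. ?f s * indicator {0..} s" "-1" 0] by simp
 also have "(\<integral>s. ?f s * indicator {0..} s) = (\<integral>s. ennreal (n / (1 + n * s)\<^sup>2) * indicator {0..} s)"
  by (intro nn_integral_cong) (auto simp: indicator_def)
 also have "... = 1" unfolding half by simp
 finally show ?thesis using \<open>(\<integral>s. ennreal (n / (1 + n * \<bar>t - s\<bar>)\<^sup>2)) = (\<integral>s. ?f s)\<close>
  by simp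
qed

lemma nn_integral_cos_substitution:
 fixes f :: "real => ennreal"
 assumes [measurable]: "f \<in> \<B>"
 shows "(\<integral>x\<in>{-1..1}. f x) = (\<integral>t\<in>{0..pi}. f (cos t) * ennreal (sin t))"
proof -
 have "(\<integral>x\<in>{-1..1}. f x) = (\<integral>x. f (-x) * indicator {-1..1} (-x))"
  using nn_integral_real_affine[of "\<lambda>x. f x * indicator {-1..1} x" "-1" 0] by simp
 also have "... = (\<integral>x. f (-x) * indicator {- cos 0..- cos pi} x)"
  by (intro nn_integral_cong) (auto simp: indicator_def)
 also have "... = (\<integral>t. f (- (- cos t)) * ennreal (sin t) * indicator {0..pi} t)"
  by (rule nn_integral_substitution_aux[of "\<lambda>x. f (-x)" 0 pi "\<lambda>t. - cos t" sin])
   (auto intro!: derivative_eq_intros continuous_intros sin_ge_zero)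
 finally show ?thesis by simp
qed

section \<open>The angular distance at scale \<open>1/n\<close>\<close>

definition dfac :: "nat => real => real => real" where
 "dfac n x y = 1 + real n * \<bar>arccos x - arccos y\<bar>"

lemma dfac_ge1: "1 <= dfac n x y"
 by (simp add: dfac_def)

lemma dfac_pos: "0 < dfac n x y"
 using dfac_ge1[of n x y] by linarith

lemma borel_measurable_arccos [measurable]: "(\<lambda>x. arccos x * indicator {-1..1} x) \<in> \<B>"
proof -
 have "continuous_on {-1..1} arccos" by (rule continuous_on_arccos')
 then show ?thesis
  using borel_measurable_continuous_on_indicator[of "{-1..1::real}" arccos] by (simp add: mult.commute)
qed

lemma varphi_cos: "s \<in> {0..pi} ==> varphi (cos s) = sin s"
 using sin_squared_eq[of s] sin_ge_zero[of s] unfolding varphi_def by (metis atLeastAtMost_iff real_sqrt_abs abs_of_nonneg)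

lemma varphi_measurable [measurable]: "varphi \<in> \<B>"
 unfolding varphi_def by measurable

lemma dfac_cos: "s \<in> {0..pi} ==> dfac n x (cos s) = 1 + real n * \<bar>arccos x - s\<bar>"
 by (simp add: dfac_def arccos_cos)

lemma dfac_commute: "dfac n x y = dfac n y x"
 by (simp add: dfac_def abs_minus_commute)

text \<open>Outside \<open>[-1,1]\<close> the function \<^const>\<open>arccos\<close> is unspecified, so measurability statements are
  about the following modification.\<close>

definition arccos' :: "real => real" where
 "arccos' x = arccos x * indicator {-1..1} x"

lemma arccos'_measurable [measurable]: "arccos' \<in> \<B>"
 unfolding arccos'_def by (rule borel_measurable_arccos)

lemma arccos'_eq [simp]: "x \<in> {-1..1} ==> arccos' x = arccos x"
 by (simp add: arccos'_def)

definition dfac' :: "nat => real => real => real" where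
 "dfac' n x y = 1 + real n * \<bar>arccos' x - arccos' y\<bar>"

lemma dfac'_measurable [measurable]: "case_prod (dfac' n) \<in> borel_measurable (borel \<Otimes>\<^sub>M borel)"
 unfolding dfac'_def by measurable

lemma dfac'_eq: "x \<in> {-1..1} ==> y \<in> {-1..1} ==> dfac' n x y = dfac n x y"
 by (simp add: dfac'_def dfac_def)

lemma dfac'_ge1: "1 <= dfac' n x y"
 by (simp add: dfac'_def)

lemma dfac'_pos: "0 < dfac' n x y"
 using dfac'_ge1[of n x y] by linarith

lemma dfac'_commute: "dfac' n x y = dfac' n y x"
 by (simp add: dfac'_def abs_minus_commute)

lemma dfac'_cos: "x \<in> {-1..1} ==> s \<in> {0..pi} ==> dfac' n x (cos s) = 1 + real n * \<bar>arccos x - s\<bar>"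
 by (simp add: dfac'_eq dfac_cos)

lemma nn_integral_dfac:
 assumes n: "n >= 1" and x: "x \<in> {-1..1}"
 shows "(\<integral>y\<in>\<I>. ennreal (1 / (varphi y * (dfac' n x y)\<^sup>2))) <= ennreal (2 / real n)"
proof -
 have "(\<integral>y\<in>\<I>. ennreal (1 / (varphi y * (dfac' n x y)\<^sup>2)))
  <= (\<integral>y\<in>{-1..1}. ennreal (1 / (varphi y * (dfac' n x y)\<^sup>2)))"
  by (intro nn_integral_mono) (auto simp: indicator_def)
 also have "... = (\<integral>s\<in>{0..pi}. ennreal (1 / (varphi (cos s) * (dfac' n x (cos s))\<^sup>2)) * ennreal (sin s))"
  by (rule nn_integral_cos_substitution) measurable
 also have "... <= (\<integral>s. ennreal (1 / real n) * ennreal (real n / (1 + real n * \<bar>arccos x - s\<bar>)\<^sup>2))"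
 proof (rule nn_integral_mono)
  fix s
  show "ennreal (1 / (varphi (cos s) * (dfac' n x (cos s))\<^sup>2)) * ennreal (sin s) * indicator {0..pi} s
   <= ennreal (1 / real n) * ennreal (real n / (1 + real n * \<bar>arccos x - s\<bar>)\<^sup>2)"
  proof (cases "s \<in> {0..pi}")
   case True
   have "1 / (sin s * (1 + real n * \<bar>arccos x - s\<bar>)\<^sup>2) * sin s <= 1 / (1 + real n * \<bar>arccos x - s\<bar>)\<^sup>2" by simp
   then show ?thesis using True n x sin_ge_zero[of s]
    by (auto simp: varphi_cos dfac'_cos ennreal_mult[symmetric] intro!: ennreal_leI)
  qed simp
 qed
 also have "... = ennreal (1 / real n) * (\<integral>s. ennreal (real n / (1 + real n * \<bar>arccos x - s\<bar>)\<^sup>2))"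
  by (rule nn_integral_cmult) measurable
 also have "... <= ennreal (1 / real n) * 2"
  using n by (intro mult_left_mono nn_integral_decay) auto
 also have "... = ennreal (2 / real n)"
  using ennreal_mult[of "1 / real n" 2] by simp
 finally show ?thesis .
qed

section \<open>Jackson operators and their remainders\<close>

lemma polys_sum: "(\<And>i. i \<in> I ==> q i \<in> polys n) ==> (\<Sum>i\<in>I. q i) \<in> polys n"
proof (induction I rule: infinite_finite_induct)
 case (insert i I)
 then have "q i \<in> polys n" "sum q I \<in> polys n" by auto
 then have "q i + sum q I \<in> polys n"
  unfolding polys_def by (auto intro: degree_add_less)
 then show ?case using insert by simp
qed (auto simp: polys_def)

lemma polys_smult: "q \<in> polys n ==> smult c q \<in> polys n"
 by (auto simp: polys_def)

lemma cheb_in_polys: "j < n ==> cheb j \<in> polys n"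
 using degree_cheb[of j] by (auto simp: polys_def)

text \<open>\<open>Q (cos t)\<close> is the integral of \<open>B t s * G s\<close> over
  \<open>s\<close>; the product form of \<open>B\<close> makes it a combination of Chebyshev
  polynomials, and unit mass turns the error into an integral of \<open>G t - G s\<close>.
  Boundedness of \<open>G\<close> supplies integrability.\<close>

lemma kernel_poly:
 fixes B :: "real => real => real"
 assumes B: "\<And>t s. B t s = (\<Sum>j<n. a j * cos (real j * s) * cos (real j * t))"
  and pos: "\<And>t s. t \<in> {0..pi} ==> s \<in> {0..pi} ==> 0 <= B t s"
  and int: "\<And>t. (B t has_integral 1) {0..pi}"
  and G [measurable]: "G \<in> \<B>" and bd: "\<And>s. \<bar>G s\<bar> <= (b::real)"
 shows "\<exists>Q\<in>polys n. \<forall>t\<in>{0..pi}. ennreal \<bar>G t - poly Q (cos t)\<bar> <= (\<integral>s\<in>{0..pi}. ennreal (B t s) * ennreal \<bar>G t - G s\<bar>)"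
proof -
 define I where "I f = (\<integral>s. indicator {0..pi} s *\<^sub>R f s \<partial>lborel)" for f :: "real => real"
 have bdd: "integrable lborel (\<lambda>s. indicator {0..pi} s *\<^sub>R f s)" if "f \<in> \<B>" "\<And>s. \<bar>f s\<bar> <= c" for f :: "real => real" and c
 proof -
  have [measurable]: "f \<in> \<B>" by (rule that)
  have "integrable lborel (\<lambda>s. indicator {0..pi} s *\<^sub>R c)" by simp
  moreover have "(\<lambda>s. indicator {0..pi} s *\<^sub>R f s) \<in> borel_measurable lborel" by measurable
  moreover have "AE x in lborel. norm (indicator {0..pi} x *\<^sub>R f x) <= norm (indicator {0..pi} x *\<^sub>R c)"
   using that(2) by (intro AE_I2) (auto simp: indicator_def intro: order_trans[OF _ abs_ge_self])
  ultimately show ?thesis by (rule Bochner_Integration.integrable_bound)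
 qed
 define Q where "Q = (\<Sum>j<n. smult (a j * I (\<lambda>s. cos (real j * s) * G s)) (cheb j))"
 have "Q \<in> polys n" unfolding Q_def by (intro polys_sum polys_smult cheb_in_polys) auto
 have b0: "b >= 0" using bd[of 0] by linarith
 have cG: "integrable lborel (\<lambda>s. indicator {0..pi} s *\<^sub>R (cos (real j * s) * G s))" for j
 proof (rule bdd[of _ b])
  show "\<bar>cos (real j * s) * G s\<bar> <= b" for s
   using mult_mono[OF abs_cos_le_one[of "real j * s"] bd[of s]] by (simp add: abs_mult)
 qed measurable
 have [measurable]: "B t \<in> \<B>" for t unfolding B by measurable
 have Bbd: "\<bar>B t s\<bar> <= (\<Sum>j<n. \<bar>a j\<bar>)" for t s
  unfolding B by (intro order_trans[OF sum_abs] sum_mono) (auto simp: abs_mult mult.assoc intro!: mult_left_le mult_le_one)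
 have BG: "integrable lborel (\<lambda>s. indicator {0..pi} s *\<^sub>R (B t s * G s))" for t
  by (rule bdd[of _ "(\<Sum>j<n. \<bar>a j\<bar>) * b"]) (use Bbd bd b0 in \<open>auto simp: abs_mult intro!: mult_mono sum_nonneg\<close>)
 have B1: "integrable lborel (\<lambda>s. indicator {0..pi} s *\<^sub>R B t s)" for t
  by (rule bdd[OF _ Bbd]) measurable
 have IB: "I (B t) = 1" for t
 proof -
  have "(B t has_integral I (B t)) {0..pi}"
   using has_integral_set_lebesgue[of "{0..pi}" "B t"] B1[of t]
   unfolding I_def set_integrable_def set_lebesgue_integral_def integrable_completion[symmetric]
   by (simp add: integrable_completion integral_completion)
  then show ?thesis using int[of t] has_integral_unique by blast
 qed
 have Q: "poly Q (cos t) = I (\<lambda>s. B t s * G s)" for t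
 proof -
  have "I (\<lambda>s. B t s * G s) = (\<integral>s. (\<Sum>j<n. (a j * cos (real j * t)) * (indicator {0..pi} s *\<^sub>R (cos (real j * s) * G s))) \<partial>lborel)"
   unfolding I_def B by (intro Bochner_Integration.integral_cong) (auto simp: sum_distrib_left sum_distrib_right mult_ac)
  also have "... = (\<Sum>j<n. (a j * cos (real j * t)) * I (\<lambda>s. cos (real j * s) * G s))"
   unfolding I_def using cG by (subst Bochner_Integration.integral_sum) auto
  finally show ?thesis by (simp add: Q_def poly_sum poly_cheb mult_ac)
 qed
 have "ennreal \<bar>G t - poly Q (cos t)\<bar> <= (\<integral>s\<in>{0..pi}. ennreal (B t s) * ennreal \<bar>G t - G s\<bar>)" if t: "t \<in> {0..pi}" for t
 proof -
  have "G t - poly Q (cos t) = G t * I (B t) - I (\<lambda>s. B t s * G s)" by (simp add: IB Q)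
  also have "... = (\<integral>s. indicator {0..pi} s *\<^sub>R (B t s * (G t - G s)) \<partial>lborel)"
   unfolding I_def using B1[of t] BG[of t]
   by (subst Bochner_Integration.integral_mult_right_zero[symmetric], subst Bochner_Integration.integral_diff[symmetric])
    (auto simp: algebra_simps)
  finally have "ennreal \<bar>G t - poly Q (cos t)\<bar> = ennreal (norm (\<integral>s. indicator {0..pi} s *\<^sub>R (B t s * (G t - G s)) \<partial>lborel))" by simp
  also have "... <= (\<integral>s. ennreal (norm (indicator {0..pi} s *\<^sub>R (B t s * (G t - G s)))))"
   by (rule integral_norm_bound_ennreal) (rule Bochner_Integration.integrable_bound[OF Bochner_Integration.integrable_add[OF integrable_abs[OF BG[of t]] integrable_mult_right[OF B1[of t], of "\<bar>G t\<bar>"]]];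
     use pos[OF t] in \<open>auto simp: indicator_def abs_mult algebra_simps intro!: order_trans[OF abs_triangle_ineq4]\<close>)
  also have "... = (\<integral>s\<in>{0..pi}. ennreal (B t s) * ennreal \<bar>G t - G s\<bar>)"
   using pos[OF t] by (intro nn_integral_cong) (auto simp: indicator_def abs_mult ennreal_mult)
  finally show ?thesis .
 qed
 then show ?thesis using \<open>Q \<in> polys n\<close> by blast
qed

text \<open>The pointwise decay is replaced by the mass of the kernel beyond the distance
  \<open>d\<close>, the only form used later. The power \<open>\<kappa> = M + 1\<close> gives decay
  \<open>2*M + 2\<close>: at least \<open>M\<close> for the bound and two more orders for the
  integration.\<close>

lemma jackson_operator:
 "\<exists>C>0. \<forall>n\<ge>1. \<exists>B :: real => real => real. case_prod B \<in> borel_measurable (borel \<Otimes>\<^sub>M borel) \<and>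
  (\<forall>v\<in>{0..pi}. \<forall>d\<ge>0. (\<integral>s\<in>{0..pi}. ennreal (B v s) * indicator {s. d <= \<bar>v - s\<bar>} s) <= ennreal (C / (1 + real n * d) ^ M)) \<and>
  (\<forall>G b. G \<in> \<B> --> (\<forall>s. \<bar>G s\<bar> <= b) --> (\<exists>Q\<in>polys n. \<forall>v\<in>{0..pi}.
    ennreal \<bar>G v - poly Q (cos v)\<bar> <= (\<integral>s\<in>{0..pi}. ennreal (B v s) * ennreal \<bar>G v - G s\<bar>)))"
proof -
 obtain C where C: "C > 0" and K: "\<And>n. n >= 1 ==> \<exists>(B :: real => real => real) a.
  (\<forall>v s. B v s = (\<Sum>j<n. a j * cos (real j * s) * cos (real j * v))) \<and>
  (\<forall>v\<in>{0..pi}. \<forall>s\<in>{0..pi}. 0 <= B v s \<and> B v s <= C * real n / (1 + real n * \<bar>v - s\<bar>) ^ (2 * (M + 1))) \<and>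
  (\<forall>v. (B v has_integral 1) {0..pi})"
  using jackson_kernel[of "M + 1"] by auto
 show ?thesis
 proof (intro exI[of _ "2 * C"] conjI allI impI)
  show "0 < 2 * C" using C by simp
  fix n :: nat assume n: "n >= 1"
  obtain B :: "real => real => real" and a where B: "\<And>v s. B v s = (\<Sum>j<n. a j * cos (real j * s) * cos (real j * v))"
   "\<And>v s. v \<in> {0..pi} ==> s \<in> {0..pi} ==> 0 <= B v s"
   "\<And>v s. v \<in> {0..pi} ==> s \<in> {0..pi} ==> B v s <= C * real n / (1 + real n * \<bar>v - s\<bar>) ^ (2 * (M + 1))"
   "\<And>v. (B v has_integral 1) {0..pi}"
   using K[OF n] by blast
  have m: "case_prod B \<in> borel_measurable (borel \<Otimes>\<^sub>M borel)" unfolding B(1) by measurable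
  have t: "(\<integral>s\<in>{0..pi}. ennreal (B v s) * indicator {s. d <= \<bar>v - s\<bar>} s) <= ennreal (2 * C / (1 + real n * d) ^ M)"
   if v: "v \<in> {0..pi}" and d: "d >= 0" for v d
  proof -
   have "(\<integral>s\<in>{0..pi}. ennreal (B v s) * indicator {s. d <= \<bar>v - s\<bar>} s)
    <= (\<integral>s. ennreal (C / (1 + real n * d) ^ M) * ennreal (real n / (1 + real n * \<bar>v - s\<bar>)\<^sup>2))"
   proof (rule nn_integral_mono)
    fix s
    show "ennreal (B v s) * indicator {s. d <= \<bar>v - s\<bar>} s * indicator {0..pi} s
     <= ennreal (C / (1 + real n * d) ^ M) * ennreal (real n / (1 + real n * \<bar>v - s\<bar>)\<^sup>2)"
    proof (cases "s \<in> {0..pi} \<and> d <= \<bar>v - s\<bar>")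
     case True
     let ?x = "1 + real n * \<bar>v - s\<bar>" and ?y = "1 + real n * d"
     have xy: "1 <= ?y" "?y <= ?x" using True d by (auto intro: mult_left_mono)
     have "B v s <= C * real n / ?x ^ (2 * (M + 1))" using B(3) v True by blast
     also have "... <= C * real n / (?y ^ M * ?x\<^sup>2)"
     proof (rule divide_left_mono)
      have "?y ^ M * ?x\<^sup>2 <= ?x ^ (2 * M) * ?x\<^sup>2"
      proof (rule mult_right_mono)
       have "?y ^ M <= ?x ^ M" using xy by (intro power_mono) auto
       also have "... <= ?x ^ (2 * M)" using xy by (intro power_increasing) auto
       finally show "?y ^ M <= ?x ^ (2 * M)" .
      qed simp
      then show "?y ^ M * ?x\<^sup>2 <= ?x ^ (2 * (M + 1))" by (simp only: power_add[symmetric]) simp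
     qed (use xy C in \<open>auto intro!: mult_pos_pos zero_less_power\<close>)
     also have "... = (C / ?y ^ M) * (real n / ?x\<^sup>2)" by simp
     finally have "ennreal (B v s) <= ennreal ((C / ?y ^ M) * (real n / ?x\<^sup>2))" by (rule ennreal_leI)
     also have "... = ennreal (C / ?y ^ M) * ennreal (real n / ?x\<^sup>2)"
      using xy C by (intro ennreal_mult) auto
     finally show ?thesis using True by simp
    qed auto
   qed
   also have "... = ennreal (C / (1 + real n * d) ^ M) * (\<integral>s. ennreal (real n / (1 + real n * \<bar>v - s\<bar>)\<^sup>2))"
    by (rule nn_integral_cmult) measurable
   also have "... <= ennreal (C / (1 + real n * d) ^ M) * 2"
    using n by (intro mult_left_mono nn_integral_decay) auto
   also have "... = ennreal (2 * C / (1 + real n * d) ^ M)"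
    using ennreal_mult[of "C / (1 + real n * d) ^ M" 2] C d by (simp add: mult.commute)
   finally show ?thesis .
  qed
  show "\<exists>B :: real => real => real. case_prod B \<in> borel_measurable (borel \<Otimes>\<^sub>M borel) \<and>
  (\<forall>v\<in>{0..pi}. \<forall>d\<ge>0. (\<integral>s\<in>{0..pi}. ennreal (B v s) * indicator {s. d <= \<bar>v - s\<bar>} s) <= ennreal (2 * C / (1 + real n * d) ^ M)) \<and>
  (\<forall>G b. G \<in> \<B> --> (\<forall>s. \<bar>G s\<bar> <= b) --> (\<exists>Q\<in>polys n. \<forall>v\<in>{0..pi}.
    ennreal \<bar>G v - poly Q (cos v)\<bar> <= (\<integral>s\<in>{0..pi}. ennreal (B v s) * ennreal \<bar>G v - G s\<bar>)))"
   using m t kernel_poly[OF B(1,2,4)] by (intro exI[of _ B]) blast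
 qed
qed

text \<open>The step has different values at \<open>v\<close> and \<open>s\<close> only when the
  jump \<open>\<tau>\<close> separates them, and then \<open>s\<close> is at least as far from
  \<open>v\<close> as \<open>\<tau>\<close> is. As \<open>arccos\<close> decreases,
  \<open>z < x\<close> becomes an upper bound on the angle.\<close>

lemma jackson_step:
 "\<exists>C>0. \<forall>n\<ge>1. \<forall>z\<in>{-1..1}. \<exists>R\<in>polys n. \<forall>x\<in>{-1..1}. \<bar>(if z < x then 1 else 0) - poly R x\<bar> <= C / dfac n x z ^ M"
proof -
 obtain C where C: "C > 0" and K: "\<And>n. n >= 1 ==> \<exists>B :: real => real => real. case_prod B \<in> borel_measurable (borel \<Otimes>\<^sub>M borel) \<and>
  (\<forall>v\<in>{0..pi}. \<forall>d\<ge>0. (\<integral>s\<in>{0..pi}. ennreal (B v s) * indicator {s. d <= \<bar>v - s\<bar>} s) <= ennreal (C / (1 + real n * d) ^ M)) \<and>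
  (\<forall>G b. G \<in> \<B> --> (\<forall>s. \<bar>G s\<bar> <= b) --> (\<exists>Q\<in>polys n. \<forall>v\<in>{0..pi}.
    ennreal \<bar>G v - poly Q (cos v)\<bar> <= (\<integral>s\<in>{0..pi}. ennreal (B v s) * ennreal \<bar>G v - G s\<bar>)))"
  using jackson_operator[of M] by blast
 show ?thesis
 proof (intro exI[of _ C] conjI C allI impI ballI)
  fix n :: nat and z :: real assume n: "n >= 1" and z: "z \<in> {-1..1}"
  obtain B :: "real => real => real" where
  t: "\<And>v d. v \<in> {0..pi} ==> d >= 0 ==> (\<integral>s\<in>{0..pi}. ennreal (B v s) * indicator {s. d <= \<bar>v - s\<bar>} s) <= ennreal (C / (1 + real n * d) ^ M)" and
  q: "\<And>G b. G \<in> \<B> ==> (\<And>s. \<bar>G s\<bar> <= b) ==> (\<exists>Q\<in>polys n. \<forall>v\<in>{0..pi}.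
    ennreal \<bar>G v - poly Q (cos v)\<bar> <= (\<integral>s\<in>{0..pi}. ennreal (B v s) * ennreal \<bar>G v - G s\<bar>))"
   using K[OF n] by blast
  define \<tau> where "\<tau> = arccos z"
  have \<tau>: "\<tau> \<in> {0..pi}" using z by (simp add: \<tau>_def arccos_lbound arccos_ubound)
  define G where "G s = (if s < \<tau> then 1 else 0 :: real)" for s
  have "\<exists>Q\<in>polys n. \<forall>v\<in>{0..pi}.
    ennreal \<bar>G v - poly Q (cos v)\<bar> <= (\<integral>s\<in>{0..pi}. ennreal (B v s) * ennreal \<bar>G v - G s\<bar>)"
   
  proof (rule q[of G 1])
   show "G \<in> \<B>" unfolding G_def by measurable
  qed (simp add: G_def)
  then obtain R where R: "R \<in> polys n" "\<And>v. v \<in> {0..pi} ==>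
    ennreal \<bar>G v - poly R (cos v)\<bar> <= (\<integral>s\<in>{0..pi}. ennreal (B v s) * ennreal \<bar>G v - G s\<bar>)" by blast
  show "\<exists>R\<in>polys n. \<forall>x\<in>{-1..1}. \<bar>(if z < x then 1 else 0) - poly R x\<bar> <= C / dfac n x z ^ M"
  proof (intro bexI[OF _ R(1)] ballI)
   fix x :: real assume x: "x \<in> {-1..1}"
   define v where "v = arccos x"
   have v: "v \<in> {0..pi}" "cos v = x" using x by (simp_all add: v_def arccos_lbound arccos_ubound)
   have Gx: "G v = (if z < x then 1 else 0)"
    using x z by (auto simp: G_def v_def \<tau>_def arccos_less_mono)
   have "ennreal \<bar>G v - poly R (cos v)\<bar> <= (\<integral>s\<in>{0..pi}. ennreal (B v s) * ennreal \<bar>G v - G s\<bar>)" by (rule R(2)[OF v(1)])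
   also have "... <= (\<integral>s\<in>{0..pi}. ennreal (B v s) * indicator {s. \<bar>v - \<tau>\<bar> <= \<bar>v - s\<bar>} s)"
    by (intro nn_integral_mono mult_right_mono mult_left_mono) (auto simp: G_def indicator_def)
   also have "... <= ennreal (C / (1 + real n * \<bar>v - \<tau>\<bar>) ^ M)" by (rule t[OF v(1)]) simp
   finally have "\<bar>G v - poly R (cos v)\<bar> <= C / (1 + real n * \<bar>v - \<tau>\<bar>) ^ M"
    using C by (subst (asm) ennreal_le_iff) (auto intro!: divide_nonneg_nonneg)
   then show "\<bar>(if z < x then 1 else 0) - poly R x\<bar> <= C / dfac n x z ^ M"
    unfolding Gx v(2) by (simp add: dfac_def v_def \<tau>_def)
  qed
 qed
qed

text \<open>A superposition of jumps: \<open>u\<close> bounds the density of the variation of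
  \<open>g\<close>, and Fubini exchanges the kernel variable \<open>s\<close> with a point
  \<open>z\<close> between \<open>x\<close> and \<open>cos s\<close>. Such a \<open>z\<close> is at
  most as far from \<open>x\<close> in angle as \<open>s\<close>, so the inner integral is a tail of
  the kernel.\<close>

lemma jackson_integral:
 "\<exists>C>0. \<forall>n\<ge>1. \<forall>g\<in>\<B>. \<forall>b::real. (\<forall>x. \<bar>g x\<bar> <= b) --> (\<exists>Q\<in>polys n. \<forall>x\<in>{-1..1}.
  \<forall>u\<in>\<B>. (\<forall>y\<in>{-1..1}. ennreal \<bar>g x - g y\<bar> <= (\<integral>z\<in>{min x y..max x y}. u z)) -->
   ennreal \<bar>g x - poly Q x\<bar> <= (\<integral>z\<in>{-1..1}. ennreal (C / dfac' n x z ^ M) * u z))"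
proof -
 obtain C where C: "C > 0" and K: "\<And>n. n >= 1 ==> \<exists>B :: real => real => real. case_prod B \<in> borel_measurable (borel \<Otimes>\<^sub>M borel) \<and>
  (\<forall>v\<in>{0..pi}. \<forall>d\<ge>0. (\<integral>s\<in>{0..pi}. ennreal (B v s) * indicator {s. d <= \<bar>v - s\<bar>} s) <= ennreal (C / (1 + real n * d) ^ M)) \<and>
  (\<forall>G b. G \<in> \<B> --> (\<forall>s. \<bar>G s\<bar> <= b) --> (\<exists>Q\<in>polys n. \<forall>v\<in>{0..pi}.
    ennreal \<bar>G v - poly Q (cos v)\<bar> <= (\<integral>s\<in>{0..pi}. ennreal (B v s) * ennreal \<bar>G v - G s\<bar>)))"
  using jackson_operator[of M] by blast
 show ?thesis
 proof (intro exI[of _ C] conjI C allI impI ballI)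
  fix n :: nat and g :: "real => real" and b assume n: "n >= 1" and g [measurable]: "g \<in> \<B>" and b: "\<forall>x. \<bar>g x\<bar> <= b"
  obtain B :: "real => real => real" where
  [measurable]: "case_prod B \<in> borel_measurable (borel \<Otimes>\<^sub>M borel)" and
  t: "\<And>v d. v \<in> {0..pi} ==> d >= 0 ==> (\<integral>s\<in>{0..pi}. ennreal (B v s) * indicator {s. d <= \<bar>v - s\<bar>} s) <= ennreal (C / (1 + real n * d) ^ M)" and
  q: "\<And>G b. G \<in> \<B> ==> (\<And>s. \<bar>G s\<bar> <= b) ==> (\<exists>Q\<in>polys n. \<forall>v\<in>{0..pi}.
    ennreal \<bar>G v - poly Q (cos v)\<bar> <= (\<integral>s\<in>{0..pi}. ennreal (B v s) * ennreal \<bar>G v - G s\<bar>))"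
   using K[OF n] by blast
  have "\<exists>Q\<in>polys n. \<forall>v\<in>{0..pi}.
    ennreal \<bar>g (cos v) - poly Q (cos v)\<bar> <= (\<integral>s\<in>{0..pi}. ennreal (B v s) * ennreal \<bar>g (cos v) - g (cos s)\<bar>)"
   by (rule q[of "\<lambda>s. g (cos s)" b]) (use b in auto)
  then obtain Q where Q: "Q \<in> polys n" "\<And>v. v \<in> {0..pi} ==>
    ennreal \<bar>g (cos v) - poly Q (cos v)\<bar> <= (\<integral>s\<in>{0..pi}. ennreal (B v s) * ennreal \<bar>g (cos v) - g (cos s)\<bar>)" by blast
  show "\<exists>Q\<in>polys n. \<forall>x\<in>{-1..1}. \<forall>u\<in>\<B>. (\<forall>y\<in>{-1..1}. ennreal \<bar>g x - g y\<bar> <= (\<integral>z\<in>{min x y..max x y}. u z)) -->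
   ennreal \<bar>g x - poly Q x\<bar> <= (\<integral>z\<in>{-1..1}. ennreal (C / dfac' n x z ^ M) * u z)"
  proof (intro bexI[OF _ Q(1)] ballI impI)
   fix x :: real and u :: "real => ennreal" assume x: "x \<in> {-1..1}" and [measurable]: "u \<in> \<B>"
    and u: "\<forall>y\<in>{-1..1}. ennreal \<bar>g x - g y\<bar> <= (\<integral>z\<in>{min x y..max x y}. u z)"
   define v where "v = arccos x"
   have v: "v \<in> {0..pi}" "cos v = x" using x by (simp_all add: v_def arccos_lbound arccos_ubound)
   have "ennreal \<bar>g x - poly Q x\<bar> <= (\<integral>s\<in>{0..pi}. ennreal (B v s) * ennreal \<bar>g x - g (cos s)\<bar>)" using Q(2)[OF v(1)] v(2) by simp
   also have "... <= (\<integral>s. (\<integral>z. (ennreal (B v s) * indicator {s. \<bar>v - arccos' z\<bar> <= \<bar>v - s\<bar>} s * indicator {0..pi} s) * (u z * indicator {-1..1} z)))"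
   proof (rule nn_integral_mono)
    fix s :: real
    show "ennreal (B v s) * ennreal \<bar>g x - g (cos s)\<bar> * indicator {0..pi} s \<le>
     (\<integral>z. (ennreal (B v s) * indicator {s. \<bar>v - arccos' z\<bar> <= \<bar>v - s\<bar>} s * indicator {0..pi} s) * (u z * indicator {-1..1} z))"
    proof (cases "s \<in> {0..pi}")
     case s: True
     have "ennreal (B v s) * ennreal \<bar>g x - g (cos s)\<bar> <= ennreal (B v s) * (\<integral>z\<in>{min x (cos s)..max x (cos s)}. u z)"
      using u by (intro mult_left_mono) auto
     also have "... = (\<integral>z. ennreal (B v s) * (u z * indicator {min x (cos s)..max x (cos s)} z))"
      by (rule nn_integral_cmult[symmetric]) measurable
     also have "... <= (\<integral>z. (ennreal (B v s) * indicator {s. \<bar>v - arccos' z\<bar> <= \<bar>v - s\<bar>} s * indicator {0..pi} s) * (u z * indicator {-1..1} z))"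
     proof (rule nn_integral_mono)
      fix z :: real
      have "\<bar>v - arccos' z\<bar> <= \<bar>v - s\<bar> \<and> z \<in> {-1..1}" if z: "z \<in> {min x (cos s)..max x (cos s)}"
      proof -
       have z1: "z \<in> {-1..1}" 
       proof -
        have "-1 <= min x (cos s)" "max x (cos s) <= 1" using x by auto
        then show ?thesis using z by (meson atLeastAtMost_iff order_trans)
       qed
       have as: "arccos (cos s) = s" using s by (simp add: arccos_cos)
       consider "x <= z" "z <= cos s" | "cos s <= z" "z <= x" using z by (auto simp: min_def max_def split: if_splits)
       then have "\<bar>v - arccos z\<bar> <= \<bar>v - s\<bar>"
       proof cases
        case 1
        then have "arccos z <= v" "s <= arccos z"
         using x z1 as arccos_le_arccos[of x z] arccos_le_arccos[of z "cos s"] by (auto simp: v_def)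
        then show ?thesis by simp
       next
        case 2
        then have "v <= arccos z" "arccos z <= s"
         using x z1 as arccos_le_arccos[of z x] arccos_le_arccos[of "cos s" z] by (auto simp: v_def)
        then show ?thesis by simp
       qed
       then show ?thesis using z1 by simp
      qed
      then show "ennreal (B v s) * (u z * indicator {min x (cos s)..max x (cos s)} z)
       <= (ennreal (B v s) * indicator {s. \<bar>v - arccos' z\<bar> <= \<bar>v - s\<bar>} s * indicator {0..pi} s) * (u z * indicator {-1..1} z)"
       using s by (auto simp: indicator_def)
     qed
     finally show ?thesis using s by simp
    qed simp
   qed
   also have "... = (\<integral>z. (\<integral>s. (ennreal (B v s) * indicator {s. \<bar>v - arccos' z\<bar> <= \<bar>v - s\<bar>} s * indicator {0..pi} s) * (u z * indicator {-1..1} z)))"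
    by (rule lborel_pair.Fubini'[symmetric]) measurable
   also have "... <= (\<integral>z\<in>{-1..1}. ennreal (C / dfac' n x z ^ M) * u z)"
   proof (rule nn_integral_mono)
    fix z :: real
    have "(\<integral>s. (ennreal (B v s) * indicator {s. \<bar>v - arccos' z\<bar> <= \<bar>v - s\<bar>} s * indicator {0..pi} s) * (u z * indicator {-1..1} z))
     = (\<integral>s\<in>{0..pi}. ennreal (B v s) * indicator {s. \<bar>v - arccos' z\<bar> <= \<bar>v - s\<bar>} s) * (u z * indicator {-1..1} z)"
     by (rule nn_integral_multc) measurable
    also have "... <= ennreal (C / (1 + real n * \<bar>v - arccos' z\<bar>) ^ M) * (u z * indicator {-1..1} z)"
     by (intro mult_right_mono t[OF v(1)]) auto
    also have "... = ennreal (C / dfac' n x z ^ M) * u z * indicator {-1..1} z"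
     using x by (simp add: dfac'_def v_def mult.assoc)
    finally show "(\<integral>s. (ennreal (B v s) * indicator {s. \<bar>v - arccos' z\<bar> <= \<bar>v - s\<bar>} s * indicator {0..pi} s) * (u z * indicator {-1..1} z))
     <= ennreal (C / dfac' n x z ^ M) * u z * indicator {-1..1} z" .
   qed
   finally show "ennreal \<bar>g x - poly Q x\<bar> <= (\<integral>z\<in>{-1..1}. ennreal (C / dfac' n x z ^ M) * u z)" .
  qed
 qed
qed

section \<open>Jacobi weights and a Favard inequality\<close>

lemma varphi_pos: "x \<in> \<I> ==> 0 < varphi x"
 unfolding varphi_def by (auto simp: abs_square_less_1)

lemma Phi_mult:
 assumes "1 <= p" "p ~= \<infinity>" "0 < w"
 shows "Phi p (ennreal w * x) = ennreal (w powr enn2real p) * Phi p x"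
 using assms
 by (cases x) (auto simp: Phi_def ennreal_mult[symmetric] powr_mult ennreal_mult_eq_top_iff ennreal_mult_top)

text \<open>Jensen is applied to \<open>\<phi>*u\<close> with the measure
  \<open>K(x,z)/\<phi>(z) dz\<close>, which contains no \<open>w\<close>. The weight enters only
  through the columns, as \<open>w^p\<close>, so a weight that is unbounded but has integrable
  \<open>p\<close>-th power can be treated.\<close>

lemma schur_finite:
 fixes K :: "real => real => ennreal" and w :: "real => real"
 assumes p: "1 <= p" "p ~= \<infinity>" and A: "A > 0" and c: "c > 0"
  and [measurable]: "w \<in> \<B>" "u \<in> \<B>" "case_prod K \<in> borel_measurable (borel \<Otimes>\<^sub>M borel)"
  and w: "\<And>x. x \<in> \<I> ==> 0 < w x"
  and K1: "\<And>x. x \<in> \<I> ==> (\<integral>z\<in>\<I>. K x z * ennreal (1 / varphi z)) <= ennreal A"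
  and K2: "\<And>z. z \<in> \<I> ==> (\<integral>x\<in>\<I>. ennreal (w x powr enn2real p) * K x z) <= ennreal (A * (w z powr enn2real p * varphi z))"
  and u: "Lp_le p (\<lambda>z. ennreal (w z * varphi z) * u z) c"
 shows "Lp_le p (\<lambda>x. ennreal (w x) * (\<integral>z\<in>\<I>. K x z * u z)) (A * c)"
proof -
 let ?i = "indicator \<I> :: real => ennreal"
 let ?q = "enn2real p"
 let ?k = "\<lambda>x z. ennreal (1/A) * (K x z * ennreal (1 / varphi z) * ?i z)"
 let ?v = "\<lambda>z. ennreal (varphi z) * u z / ennreal c"
 have [measurable]: "(\<lambda>y. K x y) \<in> \<B>" for x by measurable
 have phi1: "ennreal (1 / varphi z) * ennreal (varphi z) = 1" if "z \<in> \<I>" for z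
  using varphi_pos[OF that] by (simp add: ennreal_mult[symmetric])
 have e: "(\<integral>z\<in>\<I>. K x z * u z) / ennreal (A * c) = (\<integral>z. ?k x z * ?v z)" for x
 proof -
  have "(\<integral>z\<in>\<I>. K x z * u z) / ennreal (A * c) = (\<integral>z. ennreal (1/(A*c)) * (K x z * u z * ?i z))"
   using A c by (simp add: divide_ennreal_mult nn_integral_cmult)
  also have "... = (\<integral>z. ?k x z * ?v z)"
  proof (rule nn_integral_cong)
   fix z
   have "ennreal (1 / (A * c)) = ennreal (1/A) * ennreal (1/c)" using A c by (simp add: ennreal_mult[symmetric])
   moreover have "?k x z * ?v z = ennreal (1/A) * ennreal (1/c) * (K x z * u z * ?i z) * (if z \<in> \<I> then ennreal (1 / varphi z) * ennreal (varphi z) else 1)"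
    using c by (auto simp: divide_ennreal_mult mult_ac indicator_def)
   ultimately show "ennreal (1/(A*c)) * (K x z * u z * ?i z) = ?k x z * ?v z"
    using phi1[of z] by (simp add: mult_ac split: if_splits)
  qed
  finally show ?thesis .
 qed
 have one: "ennreal (1/A) * ennreal A = 1" using A by (simp add: ennreal_mult[symmetric])
 have "(\<integral>x\<in>\<I>. Phi p (ennreal (w x) * (\<integral>z\<in>\<I>. K x z * u z) / ennreal (A * c)))
   <= (\<integral>x. (\<integral>z. ?i x * (ennreal (w x powr ?q) * (?k x z * Phi p (?v z)))))"
 proof (rule nn_integral_mono)
  fix x :: real
  show "Phi p (ennreal (w x) * (\<integral>z\<in>\<I>. K x z * u z) / ennreal (A * c)) * ?i x
   <= (\<integral>z. ?i x * (ennreal (w x powr ?q) * (?k x z * Phi p (?v z))))"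
  proof (cases "x \<in> \<I>")
   case x: True
   have "Phi p (\<integral>z. ?k x z * ?v z) <= (\<integral>z. ?k x z * Phi p (?v z))"
   proof (rule Phi_nn_integral[OF p(1)])
    have "(\<integral>z. ?k x z) = ennreal (1/A) * (\<integral>z\<in>\<I>. K x z * ennreal (1 / varphi z))"
     by (rule nn_integral_cmult) measurable
    also have "... <= ennreal (1/A) * ennreal A" using K1[OF x] by (rule mult_left_mono) simp
    finally show "(\<integral>z. ?k x z) <= 1" using one by simp
   qed measurable
   then have "ennreal (w x powr ?q) * Phi p (\<integral>z. ?k x z * ?v z) <= ennreal (w x powr ?q) * (\<integral>z. ?k x z * Phi p (?v z))"
    by (rule mult_left_mono) simp
   also have "... = (\<integral>z. ennreal (w x powr ?q) * (?k x z * Phi p (?v z)))"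
    by (rule nn_integral_cmult[symmetric]) measurable
   finally have "Phi p (ennreal (w x) * (\<integral>z. ?k x z * ?v z)) <= (\<integral>z. ennreal (w x powr ?q) * (?k x z * Phi p (?v z)))"
    using Phi_mult[OF p w[OF x]] by simp
   moreover have "ennreal (w x) * (\<integral>z\<in>\<I>. K x z * u z) / ennreal (A * c) = ennreal (w x) * (\<integral>z. ?k x z * ?v z)"
    unfolding e[symmetric] using A c by (simp add: divide_ennreal_mult mult_ac)
   ultimately show ?thesis using x by simp
  qed simp
 qed
 also have "... = (\<integral>z. (\<integral>x. ?i x * (ennreal (w x powr ?q) * (?k x z * Phi p (?v z)))))"
  by (rule lborel_pair.Fubini') measurable
 also have "... <= (\<integral>z\<in>\<I>. Phi p (ennreal (w z * varphi z) * u z / ennreal c))"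
 proof (rule nn_integral_mono)
  fix z :: real
  show "(\<integral>x. ?i x * (ennreal (w x powr ?q) * (?k x z * Phi p (?v z))))
   <= Phi p (ennreal (w z * varphi z) * u z / ennreal c) * ?i z"
  proof (cases "z \<in> \<I>")
   case z: True
   have "(\<integral>x. ?i x * (ennreal (w x powr ?q) * (?k x z * Phi p (?v z))))
    = (\<integral>x. (ennreal (1/A) * ennreal (1 / varphi z) * Phi p (?v z)) * (ennreal (w x powr ?q) * K x z * ?i x))"
    using z by (intro nn_integral_cong) (simp add: mult_ac)
   also have "... = (ennreal (1/A) * ennreal (1 / varphi z) * Phi p (?v z)) * (\<integral>x\<in>\<I>. ennreal (w x powr ?q) * K x z)"
    by (rule nn_integral_cmult) measurable
   also have "... <= (ennreal (1/A) * ennreal (1 / varphi z) * Phi p (?v z)) * ennreal (A * (w z powr ?q * varphi z))"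
    by (intro mult_left_mono K2 z) auto
   also have "... = ennreal (1/A * (1 / varphi z) * (A * (w z powr ?q * varphi z))) * Phi p (?v z)"
   proof -
    have "ennreal (1/A * (1 / varphi z) * (A * (w z powr ?q * varphi z))) = ennreal (1/A) * ennreal (1 / varphi z) * ennreal (A * (w z powr ?q * varphi z))"
     using A varphi_pos[OF z] by (subst ennreal_mult, simp, simp, subst ennreal_mult) auto
    then show ?thesis by (simp only: mult_ac)
   qed
   also have "1/A * (1 / varphi z) * (A * (w z powr ?q * varphi z)) = w z powr ?q"
    using A varphi_pos[OF z] by simp
   also have "ennreal (w z powr ?q) * Phi p (?v z) = Phi p (ennreal (w z) * ?v z)"
    by (rule Phi_mult[OF p w[OF z], symmetric])
   also have "ennreal (w z) * ?v z = ennreal (w z * varphi z) * u z / ennreal c"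
    using c w[OF z] varphi_pos[OF z] by (simp add: divide_ennreal_mult ennreal_mult mult_ac)
   finally show ?thesis using z by simp
  qed simp
 qed
 also have "... <= 1" using u by (simp add: Lp_le_def)
 finally show ?thesis by (simp add: Lp_le_def)
qed

lemma Lp_le_inf_iff:
 assumes [measurable]: "u \<in> \<B>" and c: "c > 0"
 shows "Lp_le \<infinity> u c \<longleftrightarrow> (AE x in lborel. x \<in> \<I> --> u x <= ennreal c)"
proof -
 have le: "x / ennreal c <= 1 \<longleftrightarrow> x <= ennreal c" for x
  using c by (cases x) (auto simp: divide_ennreal ennreal_top_divide top_unique simp flip: ennreal_1)
 show ?thesis
 proof
  assume "AE x in lborel. x \<in> \<I> --> u x <= ennreal c"
  then have "(\<integral>x\<in>\<I>. Phi \<infinity> (u x / ennreal c)) = (\<integral>(x::real). 0)"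
   by (intro nn_integral_cong_AE) (auto elim!: eventually_mono simp: indicator_def Phi_def le)
  then show "Lp_le \<infinity> u c" by (simp add: Lp_le_def)
 next
  assume "Lp_le \<infinity> u c"
  then have "(\<integral>x\<in>\<I>. Phi \<infinity> (u x / ennreal c)) ~= \<infinity>"
   unfolding Lp_le_def by (auto simp: top_unique)
  then have "AE x in lborel. Phi \<infinity> (u x / ennreal c) * indicator \<I> x ~= \<infinity>"
   by (intro nn_integral_noteq_infinite) auto
  then show "AE x in lborel. x \<in> \<I> --> u x <= ennreal c"
   by eventually_elim (auto simp: indicator_def Phi_def le split: if_splits)
 qed
qed

text \<open>For a supremum the rows decide: the essential bound of \<open>w*\<phi>*u\<close> is
  pulled out and the ratio \<open>w(x)/w(z)\<close> stays under the row integral.\<close>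

lemma schur_inf:
 fixes K :: "real => real => ennreal" and w :: "real => real"
 assumes A: "A > 0" and c: "c > 0"
  and [measurable]: "w \<in> \<B>" "u \<in> \<B>" "case_prod K \<in> borel_measurable (borel \<Otimes>\<^sub>M borel)"
  and w: "\<And>x. x \<in> \<I> ==> 0 < w x"
  and K1: "\<And>x. x \<in> \<I> ==> (\<integral>z\<in>\<I>. ennreal (w x) * K x z * ennreal (1 / (w z * varphi z))) <= ennreal A"
  and u: "Lp_le \<infinity> (\<lambda>z. ennreal (w z * varphi z) * u z) c"
 shows "Lp_le \<infinity> (\<lambda>x. ennreal (w x) * (\<integral>z\<in>\<I>. K x z * u z)) (A * c)"
proof -
 let ?i = "indicator \<I> :: real => ennreal"
 have [measurable]: "(\<lambda>y. K x y) \<in> \<B>" for x by measurable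
 have Ac: "A * c > 0" using A c by simp
 have ae: "AE z in lborel. z \<in> \<I> --> ennreal (w z * varphi z) * u z <= ennreal c"
  using u c by (subst (asm) Lp_le_inf_iff) auto
 have "ennreal (w x) * (\<integral>z\<in>\<I>. K x z * u z) <= ennreal (A * c)" if x: "x \<in> \<I>" for x
 proof -
  have "ennreal (w x) * (\<integral>z\<in>\<I>. K x z * u z) = (\<integral>z. ennreal (w x) * (K x z * u z * ?i z))"
   by (rule nn_integral_cmult[symmetric]) measurable
  also have "... <= (\<integral>z. ennreal c * (ennreal (w x) * K x z * ennreal (1 / (w z * varphi z)) * ?i z))"
  proof (rule nn_integral_mono_AE, use ae in eventually_elim)
   case (elim z)
   show ?case
   proof (cases "z \<in> \<I>")
    case z: True
    have "ennreal (1 / (w z * varphi z)) * ennreal (w z * varphi z) = 1"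
     using w[OF z] varphi_pos[OF z] by (simp add: ennreal_mult[symmetric])
    then have "ennreal (w x) * (K x z * u z) = ennreal (w x) * K x z * ennreal (1 / (w z * varphi z)) * (ennreal (w z * varphi z) * u z)"
     by (metis (no_types, opaque_lifting) mult.assoc mult.commute mult_1)
    also have "... <= ennreal (w x) * K x z * ennreal (1 / (w z * varphi z)) * ennreal c"
     using elim z by (intro mult_left_mono) auto
    finally show ?thesis using z by (simp add: mult_ac)
   qed simp
  qed
  also have "... = ennreal c * (\<integral>z\<in>\<I>. ennreal (w x) * K x z * ennreal (1 / (w z * varphi z)))"
   by (rule nn_integral_cmult) measurable
  also have "... <= ennreal c * ennreal A" using K1[OF x] by (rule mult_left_mono) simp
  also have "... = ennreal (A * c)" using A c by (simp add: ennreal_mult mult.commute)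
  finally show ?thesis .
 qed
 then show ?thesis using Ac by (subst Lp_le_inf_iff) auto
qed

text \<open>A gauge integral may exist without absolute convergence, in which case the right side is
  infinite; otherwise it coincides with the Lebesgue integral.\<close>

lemma has_integral_abs_le_nn_integral:
 fixes D :: "real => real"
 assumes I: "(D has_integral I) {a..b}" and [measurable]: "D \<in> \<B>"
 shows "ennreal \<bar>I\<bar> <= (\<integral>z\<in>{a..b}. ennreal \<bar>D z\<bar>)"
proof (cases "(\<integral>z\<in>{a..b}. ennreal \<bar>D z\<bar>) = \<infinity>")
 case False
 have eq: "(\<integral>z. ennreal (norm (indicator {a..b} z *\<^sub>R D z))) = (\<integral>z\<in>{a..b}. ennreal \<bar>D z\<bar>)"
  by (intro nn_integral_cong) (auto simp: indicator_def)
 have int: "integrable lborel (\<lambda>z. indicator {a..b} z *\<^sub>R D z)"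
 proof (rule integrableI_bounded)
  show "(\<integral>z. ennreal (norm (indicator {a..b} z *\<^sub>R D z))) < \<infinity>"
   unfolding eq using False by (simp add: less_top)
 qed measurable
 then have "(D has_integral (\<integral>z. indicator {a..b} z *\<^sub>R D z \<partial>lborel)) {a..b}"
  using has_integral_set_lebesgue[of "{a..b}" D]
  by (simp add: set_integrable_def set_lebesgue_integral_def integrable_completion integral_completion)
 then have "I = (\<integral>z. indicator {a..b} z *\<^sub>R D z \<partial>lborel)" using I has_integral_unique by blast
 then have "ennreal \<bar>I\<bar> = ennreal (norm (\<integral>z. indicator {a..b} z *\<^sub>R D z \<partial>lborel))" by simp
 also have "... <= (\<integral>z. ennreal (norm (indicator {a..b} z *\<^sub>R D z)))" by (rule integral_norm_bound_ennreal[OF int])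
 finally show ?thesis unfolding eq .
qed simp

section \<open>Jacobi weights under angular displacement\<close>

lemma sin_half: "x \<in> {-1..1} ==> 1 - x = 2 * (sin (arccos x / 2))\<^sup>2"
 using cos_double_sin[of "arccos x / 2"] by (simp add: cos_arccos)

lemma sin_half_diff: "\<bar>sin (a/2) - sin (b/2)\<bar> <= \<bar>a - b\<bar> / 2" for a b :: real
proof -
 have "(a/2 - b/2)/2 = (a - b)/4" by simp
 then have "sin (a/2) - sin (b/2) = 2 * sin ((a - b)/4) * cos ((a/2 + b/2)/2)"
  using sin_diff_sin[of "a/2" "b/2"] by (simp only:)
 then have "\<bar>sin (a/2) - sin (b/2)\<bar> = 2 * \<bar>sin ((a - b)/4)\<bar> * \<bar>cos ((a/2 + b/2)/2)\<bar>" by (simp only: abs_mult abs_numeral)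
 also have "... <= 2 * \<bar>(a - b)/4\<bar> * 1"
  by (intro mult_mono abs_sin_x_le_abs_x abs_cos_le_one) auto
 also have "... = \<bar>a - b\<bar> / 2" by simp
 finally show ?thesis .
qed

text \<open>In the angle, \<open>1 - x\<close> is \<open>2 sin^2(v/2)\<close>, and
  \<open>sin(v/2)\<close> moves by at most half the angular distance, which is measured against
  \<open>sin(\<tau>/2) >= \<tau>/\<pi>\<close>. The factor with \<open>1/(n arccos y)\<close> is the
  price for \<open>y\<close> close to the endpoint 1.\<close>

lemma one_minus_ratio:
 assumes n: "n >= 1" and x: "x \<in> \<I>" and y: "y \<in> \<I>"
 shows "1 - x <= 4 * (dfac n x y)\<^sup>2 * (1 + 1 / (real n * arccos y))\<^sup>2 * (1 - y)"
proof -
 define v where "v = arccos x"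
 define \<tau> where "\<tau> = arccos y"
 have t: "0 < v" "v < pi" "0 < \<tau>" "\<tau> < pi" using x y arccos_lt_bounded[of x] arccos_lt_bounded[of y] by (auto simp: v_def \<tau>_def)
 have s: "\<tau> / pi <= sin (\<tau>/2)" using jordan_sin[of "\<tau>/2"] t by simp
 have s0: "0 < sin (\<tau>/2)" "0 < sin (v/2)" using t by (auto intro!: sin_gt_zero)
 have "sin (v/2) <= sin (\<tau>/2) + \<bar>v - \<tau>\<bar> / 2" using sin_half_diff[of v \<tau>] by linarith
 also have "\<bar>v - \<tau>\<bar> / 2 <= 2 * (real n * \<bar>v - \<tau>\<bar>) * (1 / (real n * \<tau>)) * (\<tau> / pi)"
 proof -
  have "2 * (real n * \<bar>v - \<tau>\<bar>) * (1 / (real n * \<tau>)) * (\<tau> / pi) = 2 / pi * \<bar>v - \<tau>\<bar>" using n t by simp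
  moreover have "1/2 <= 2 / pi" using pi_less_4 by (simp add: field_simps)
  ultimately show ?thesis using mult_right_mono[of "1/2" "2/pi" "\<bar>v - \<tau>\<bar>"] by simp
 qed
 also have "... <= 2 * (real n * \<bar>v - \<tau>\<bar>) * (1 / (real n * \<tau>)) * sin (\<tau>/2)" using s t by (intro mult_left_mono) auto
 finally have "sin (v/2) <= (1 + 2 * (real n * \<bar>v - \<tau>\<bar>) * (1 / (real n * \<tau>))) * sin (\<tau>/2)" by (simp add: algebra_simps)
 also have "... <= (2 * (1 + real n * \<bar>v - \<tau>\<bar>) * (1 + 1 / (real n * \<tau>))) * sin (\<tau>/2)"
  using s0 t by (intro mult_right_mono) (auto simp: algebra_simps)
 finally have "(sin (v/2))\<^sup>2 <= (2 * (1 + real n * \<bar>v - \<tau>\<bar>) * (1 + 1 / (real n * \<tau>)) * sin (\<tau>/2))\<^sup>2"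
  using s0 by (intro power_mono) auto
 also have "... = 4 * (dfac n x y)\<^sup>2 * (1 + 1 / (real n * arccos y))\<^sup>2 * (sin (\<tau>/2))\<^sup>2"
  unfolding dfac_def v_def[symmetric] \<tau>_def[symmetric] power_mult_distrib by simp
 finally have "2 * (sin (v/2))\<^sup>2 <= 4 * (dfac n x y)\<^sup>2 * (1 + 1 / (real n * arccos y))\<^sup>2 * (2 * (sin (\<tau>/2))\<^sup>2)"
  by (simp add: mult_ac)
 then show ?thesis using sin_half[of x] sin_half[of y] x y by (simp add: v_def \<tau>_def)
qed

lemma power2_powr: "0 < X ==> (X\<^sup>2) powr a = X powr (2 * a)" for X a :: real
 using powr_powr[of X 2 a] by simp

text \<open>For \<open>a >= 0\<close> the degenerate factor sits at \<open>y\<close>, where it is at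
  most 2. For \<open>a < 0\<close> the ratio is used with \<open>x\<close> and \<open>y\<close>
  exchanged, so the degenerate factor falls on \<open>x\<close>, to the power
  \<open>-2*a <= e < 1\<close>, which is integrable in the angle.\<close>

lemma one_minus_powr_ratio:
 assumes n: "n >= 1" and x: "x \<in> \<I>" and y: "y \<in> \<I>" and ny: "1 <= real n * arccos y"
  and e: "e >= 0" "e < 1" "- 2 * a <= e"
 shows "(1 - x) powr a <= (4 * dfac n x y) powr (2 * \<bar>a\<bar>) * (2 * (1 + (real n * arccos x) powr (- e))) * (1 - y) powr a"
proof -
 let ?D = "dfac n x y"
 have D: "1 <= ?D" by (rule dfac_ge1)
 have px: "0 < 1 - x" "0 < 1 - y" using x y by auto
 have t: "0 < real n * arccos x" using n x arccos_lt_bounded[of x] by auto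
 show ?thesis
 proof (cases "0 <= a")
  case True
  have "(1 + 1 / (real n * arccos y)) <= 2" using ny by (simp add: field_simps)
  then have "(1 + 1 / (real n * arccos y))\<^sup>2 <= 2\<^sup>2" using ny by (intro power_mono) auto
  then have "4 * ?D\<^sup>2 * (1 + 1 / (real n * arccos y))\<^sup>2 * (1 - y) <= 4 * ?D\<^sup>2 * 2\<^sup>2 * (1 - y)"
   using px by (intro mult_right_mono mult_left_mono) auto
  also have "4 * ?D\<^sup>2 * 2\<^sup>2 * (1 - y) = (4 * ?D)\<^sup>2 * (1 - y)" by (simp add: power_mult_distrib)
  finally have "1 - x <= (4 * ?D)\<^sup>2 * (1 - y)" using one_minus_ratio[OF n x y] by (rule order_trans[rotated])
  then have "(1 - x) powr a <= ((4 * ?D)\<^sup>2 * (1 - y)) powr a" using px True by (intro powr_mono2) auto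
  also have "... = (4 * ?D) powr (2 * \<bar>a\<bar>) * (1 - y) powr a"
   using px D True power2_powr[of "4 * ?D" a] by (subst powr_mult) auto
  also have "... <= (4 * ?D) powr (2 * \<bar>a\<bar>) * (2 * (1 + (real n * arccos x) powr (- e))) * (1 - y) powr a"
   by (intro mult_right_mono) (auto simp: mult_le_cancel_left1 intro: add_increasing2)
  finally show ?thesis .
 next
  case False
  let ?t = "1 / (real n * arccos x)"
  have "1 - y <= 4 * ?D\<^sup>2 * (1 + ?t)\<^sup>2 * (1 - x)" using one_minus_ratio[OF n y x] by (simp add: dfac_commute)
  also have "... <= (4 * ?D)\<^sup>2 * (1 + ?t)\<^sup>2 * (1 - x)"
   using px by (intro mult_right_mono) (auto simp: power_mult_distrib)
  finally have "(1 - y) <= ((4 * ?D) * (1 + ?t))\<^sup>2 * (1 - x)" by (simp add: power_mult_distrib)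
  then have "(((4 * ?D) * (1 + ?t))\<^sup>2 * (1 - x)) powr a <= (1 - y) powr a"
   using px False by (intro powr_mono2') auto
  moreover have "(((4 * ?D) * (1 + ?t))\<^sup>2 * (1 - x)) powr a = (4 * ?D) powr (2 * a) * (1 + ?t) powr (2 * a) * (1 - x) powr a"
  proof -
   have p: "0 < 4 * ?D" "0 < 1 + ?t" using D t by (auto intro: add_pos_pos)
   have "(((4 * ?D) * (1 + ?t))\<^sup>2) powr a = ((4 * ?D) * (1 + ?t)) powr (2 * a)"
    by (rule power2_powr[OF mult_pos_pos[OF p]])
   also have "... = (4 * ?D) powr (2 * a) * (1 + ?t) powr (2 * a)" by (rule powr_mult)
   finally show ?thesis using px by (subst powr_mult) auto
  qed
  ultimately have 1: "(4 * ?D) powr (2 * a) * (1 + ?t) powr (2 * a) * (1 - x) powr a <= (1 - y) powr a" by simp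
  have pp: "(4 * ?D) powr (2 * a) > 0" "(1 + ?t) powr (2 * a) > 0"
  proof -
   have "0 < 1 + ?t" using t by (intro add_pos_pos) auto
   then show "(4 * ?D) powr (2 * a) > 0" "(1 + ?t) powr (2 * a) > 0" using D by auto
  qed
  have "(1 - x) powr a <= (1 - y) powr a / ((4 * ?D) powr (2 * a) * (1 + ?t) powr (2 * a))"
   using 1 pp by (simp add: field_simps)
  also have "... = (4 * ?D) powr (2 * \<bar>a\<bar>) * (1 + ?t) powr (- 2 * a) * (1 - y) powr a"
   using False by (simp add: powr_minus divide_inverse)
  also have "(1 + ?t) powr (- 2 * a) <= 2 * (1 + (real n * arccos x) powr (- e))"
  proof -
   have t0: "0 < ?t" using t by simp
   have "(1 + ?t) powr (- 2 * a) <= 2 * (1 + ?t powr e)"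
   proof -
    have "(1 + ?t) powr (- 2 * a) <= (1 + ?t) powr e" using t0 e by (intro powr_mono) auto
    also have "... <= 2 * (1 + ?t powr e)"
    proof (cases "?t <= 1")
     case True
     have "(1 + ?t) powr e <= 2 powr e" using True t0 e by (intro powr_mono2) auto
     also have "... <= 2 powr 1" using e by (intro powr_mono) auto
     finally show ?thesis by (simp add: add_increasing2)
    next
     case False
     have "1 + s <= 2 * s" if "\<not> s <= 1" for s :: real using that by simp
     then have "1 + ?t <= 2 * ?t" using False .
     then have "(1 + ?t) powr e <= (2 * ?t) powr e" using t0 e(1) by (intro powr_mono2) simp_all
     also have "... = 2 powr e * ?t powr e" by (rule powr_mult)
     also have "... <= 2 powr 1 * ?t powr e" using e by (intro mult_right_mono powr_mono) auto
     finally show ?thesis by simp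
    qed
    finally show ?thesis .
   qed
   moreover have "?t powr e = (real n * arccos x) powr (- e)" using t by (simp add: powr_divide powr_minus_divide)
   ultimately show ?thesis by simp
  qed
  finally show ?thesis using D px by (simp add: mult_right_mono mult_left_mono)
 qed
qed


lemma jacobi_measurable [measurable]: "jw a b \<in> \<B>"
 unfolding jacobi_weight_def by measurable

lemma jacobi_pos: "x \<in> \<I> ==> 0 < jw a b x"
 by (simp add: jacobi_weight_def)

lemma jacobi_powr: "x \<in> \<I> ==> jw a b x powr q = jw (a * q) (b * q) x"
 by (simp add: jacobi_weight_def powr_mult powr_powr)

lemma jacobi_varphi: "x \<in> \<I> ==> jw a b x * varphi x = jw (a + 1/2) (b + 1/2) x"
proof -
 assume x: "x \<in> \<I>"
 have "1 - x\<^sup>2 = (1 - x) * (1 + x)" by (simp add: power2_eq_square algebra_simps)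
 then have "varphi x = sqrt (1 - x) * sqrt (1 + x)" unfolding varphi_def by (simp add: real_sqrt_mult)
 also have "... = (1 - x) powr (1/2) * (1 + x) powr (1/2)" using x by (simp add: powr_half_sqrt)
 finally show ?thesis using x by (simp add: jacobi_weight_def powr_add)
qed

lemma jacobi_reflect: "jw a b (- x) = jw b a x"
 by (simp add: jacobi_weight_def mult.commute)

lemma varphi_reflect: "varphi (- x) = varphi x"
 by (simp add: varphi_def)

lemma dfac_reflect: "x \<in> {-1..1} ==> y \<in> {-1..1} ==> dfac n (- x) (- y) = dfac n x y"
 by (simp add: dfac_def arccos_minus abs_minus_commute)

text \<open>The factors with exponent \<open>-e\<close> are only needed for weights that are unbounded at an endpoint.\<close>

lemma jacobi_ratio:
 assumes n: "n >= 1" and x: "x \<in> \<I>" and y: "y \<in> \<I>"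
  and ny: "1 <= real n * arccos y" "1 <= real n * (pi - arccos y)"
  and e: "e >= 0" "e < 1" "- 2 * a <= e" "- 2 * b <= e"
 shows "jw a b x <= (4 * dfac n x y) powr (2 * \<bar>a\<bar> + 2 * \<bar>b\<bar>)
   * (8 * (1 + (real n * arccos x) powr (- e) + (real n * (pi - arccos x)) powr (- e))) * jw a b y"
proof -
 let ?D = "dfac n x y"
 have D: "1 <= ?D" by (rule dfac_ge1)
 let ?P = "(real n * arccos x) powr (- e)" and ?Q = "(real n * (pi - arccos x)) powr (- e)"
 have 1: "(1 - x) powr a <= (4 * ?D) powr (2 * \<bar>a\<bar>) * (2 * (1 + ?P)) * (1 - y) powr a"
  by (rule one_minus_powr_ratio[OF n x y ny(1) e(1,2,3)])
 have "(1 - (- x)) powr b <= (4 * dfac n (- x) (- y)) powr (2 * \<bar>b\<bar>) * (2 * (1 + (real n * arccos (- x)) powr (- e))) * (1 - (- y)) powr b"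
  using x y ny(2) by (intro one_minus_powr_ratio[OF n]) (use e in \<open>auto simp: arccos_minus\<close>)
 then have 2: "(1 + x) powr b <= (4 * ?D) powr (2 * \<bar>b\<bar>) * (2 * (1 + ?Q)) * (1 + y) powr b"
  using x y by (simp add: dfac_reflect arccos_minus)
 \<comment> \<open>\<open>x\<close> cannot be close to both endpoints, so one of the two singular
   factors is at most 1 and their product is bounded by their sum.\<close>
 have PQ: "?P <= 1 \<or> ?Q <= 1"
 proof -
  have "real n * arccos x + real n * (pi - arccos x) = real n * pi" by (simp add: algebra_simps)
  moreover have "real n * pi >= 2" using n pi_gt3 mult_mono[of 1 "real n" 2 pi] by simp
  ultimately have "1 <= real n * arccos x \<or> 1 <= real n * (pi - arccos x)" by linarith
  then show ?thesis using e(1) by (auto simp: powr_minus intro!: inverse_le_1_iff[THEN iffD2] ge_one_powr_ge_zero)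
 qed
 have pq0: "0 <= ?P" "0 <= ?Q" by auto
 have pq: "(2 * (1 + ?P)) * (2 * (1 + ?Q)) <= 8 * (1 + ?P + ?Q)"
 proof -
  have "?P * ?Q <= ?P + ?Q" using PQ
  proof
   assume "?P <= 1"
   then have "?P * ?Q <= 1 * ?Q" using pq0(2) by (rule mult_right_mono)
   then show ?thesis using pq0 by linarith
  next
   assume "?Q <= 1"
   then have "?P * ?Q <= ?P * 1" using pq0(1) by (rule mult_left_mono)
   then show ?thesis using pq0 by linarith
  qed
  then show ?thesis using pq0 by (simp add: algebra_simps)
 qed
 have "jw a b x <= ((4 * ?D) powr (2 * \<bar>a\<bar>) * (2 * (1 + ?P)) * (1 - y) powr a) * ((4 * ?D) powr (2 * \<bar>b\<bar>) * (2 * (1 + ?Q)) * (1 + y) powr b)"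
  unfolding jacobi_weight_def using 1 2 by (intro mult_mono) auto
 also have "... = (4 * ?D) powr (2 * \<bar>a\<bar> + 2 * \<bar>b\<bar>) * ((2 * (1 + ?P)) * (2 * (1 + ?Q))) * jw a b y"
  by (simp add: jacobi_weight_def powr_add mult_ac)
 also have "... <= (4 * ?D) powr (2 * \<bar>a\<bar> + 2 * \<bar>b\<bar>) * (8 * (1 + ?P + ?Q)) * jw a b y"
  using pq jacobi_pos[OF y, of a b] by (intro mult_right_mono mult_left_mono) auto
 finally show ?thesis .
qed

lemma nn_integral_powr_near_0:
 assumes n: "n > 0" and e: "0 <= e" "e < 1"
 shows "(\<integral>t\<in>{0..1/n}. ennreal ((n * t) powr (- e))) = ennreal (1 / (n * (1 - e)))"
proof -
 have "((\<lambda>x. x powr (- e)) has_integral ((1/n) powr (- e + 1) / (- e + 1))) {0..1/n}"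
  using n e by (intro has_integral_powr_from_0) auto
 then have "((\<lambda>x. n powr (- e) * x powr (- e)) has_integral (n powr (- e) * ((1/n) powr (- e + 1) / (- e + 1)))) {0..1/n}"
  by (rule has_integral_mult_right)
 moreover have "n powr (- e) * ((1/n) powr (- e + 1) / (- e + 1)) = 1 / (n * (1 - e))"
 proof -
  have "(1/n) powr (- e + 1) = n powr (e - 1)" using n powr_minus_divide[of n "1 - e"] by (simp add: powr_divide)
  then have "n powr (- e) * (1/n) powr (- e + 1) = n powr (- 1)" by (simp add: powr_add[symmetric])
  also have "... = 1 / n" using n by (simp add: powr_minus_divide)
  finally have "n powr (- e) * (1/n) powr (- e + 1) = 1 / n" .
  then have "n powr (- e) * (1/n) powr (- e + 1) / (- e + 1) = 1 / n / (- e + 1)" by (rule arg_cong)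
  then show ?thesis by (simp add: mult.commute)
 qed
 ultimately have "((\<lambda>x. (n * x) powr (- e)) has_integral (1 / (n * (1 - e)))) {0..1/n}"
  using n by (subst has_integral_cong[of _ _ "\<lambda>x. n powr (- e) * x powr (- e)"]) (auto simp: powr_mult)
 then show ?thesis by (intro nn_integral_has_integral_lebesgue') auto
qed

text \<open>The singular factor exceeds 1 only on \<open>[0,1/n]\<close>, where the decay is dropped
  instead; elsewhere the singular factor is dropped.\<close>

lemma nn_integral_powr_decay:
 assumes n: "n > 0" and e: "0 <= e" "e < 1"
 shows "(\<integral>t\<in>{0..pi}. ennreal ((n * t) powr (- e) / (1 + n * \<bar>t - \<tau>\<bar>)\<^sup>2)) <= ennreal (1 / (n * (1 - e)) + 2 / n)"
proof -
 have "(\<integral>t\<in>{0..pi}. ennreal ((n * t) powr (- e) / (1 + n * \<bar>t - \<tau>\<bar>)\<^sup>2))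
  <= (\<integral>t. ennreal ((n * t) powr (- e)) * indicator {0..1/n} t + ennreal (1/n) * ennreal (n / (1 + n * \<bar>\<tau> - t\<bar>)\<^sup>2))"
 proof (rule nn_integral_mono)
  fix t :: real
  let ?d = "(1 + n * \<bar>t - \<tau>\<bar>)\<^sup>2"
  have d: "1 <= ?d" using n by simp
  have e2: "ennreal (1/n) * ennreal (n / (1 + n * \<bar>\<tau> - t\<bar>)\<^sup>2) = ennreal (1 / ?d)"
   using n by (simp add: ennreal_mult[symmetric] abs_minus_commute)
  show "ennreal ((n * t) powr (- e) / ?d) * indicator {0..pi} t
   <= ennreal ((n * t) powr (- e)) * indicator {0..1/n} t + ennreal (1/n) * ennreal (n / (1 + n * \<bar>\<tau> - t\<bar>)\<^sup>2)"
  proof (cases "0 <= t \<and> t <= 1/n")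
   case True
   have "(n * t) powr (- e) / ?d <= (n * t) powr (- e)" using d by (simp add: divide_le_eq mult_left_mono mult_le_cancel_left1)
   then have "ennreal ((n * t) powr (- e) / ?d) <= ennreal ((n * t) powr (- e))" by (rule ennreal_leI)
   then show ?thesis using True by (simp add: indicator_def add_increasing2)
  next
   case False
   show ?thesis
   proof (cases "t < 0")
    case F: False
    then have "1 <= n * t" using False n by (simp add: field_simps)
    then have "(n * t) powr (- e) <= 1" using e by (simp add: powr_minus inverse_le_1_iff ge_one_powr_ge_zero)
    then have "(n * t) powr (- e) / ?d <= 1 / ?d" by (rule divide_right_mono) simp
    then have "ennreal ((n * t) powr (- e) / ?d) <= ennreal (1 / ?d)" by (rule ennreal_leI)
    then show ?thesis unfolding e2 by (simp add: indicator_def add_increasing)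
   qed simp
  qed
 qed
 also have "... = (\<integral>t\<in>{0..1/n}. ennreal ((n * t) powr (- e))) + ennreal (1/n) * (\<integral>t. ennreal (n / (1 + n * \<bar>\<tau> - t\<bar>)\<^sup>2))"
  by (simp add: nn_integral_add nn_integral_cmult)
 also have "... <= ennreal (1 / (n * (1 - e))) + ennreal (1/n) * 2"
  unfolding nn_integral_powr_near_0[OF assms] using n by (intro add_left_mono mult_left_mono nn_integral_decay) auto
 also have "... = ennreal (1 / (n * (1 - e)) + 2 / n)"
  using n e ennreal_mult[of "1/n" 2] by (subst ennreal_plus) auto
 finally show ?thesis .
qed

lemma nn_integral_powr_decay':
 assumes n: "n > 0" and e: "0 <= e" "e < 1"
 shows "(\<integral>t\<in>{0..pi}. ennreal ((n * (pi - t)) powr (- e) / (1 + n * \<bar>t - \<tau>\<bar>)\<^sup>2)) <= ennreal (1 / (n * (1 - e)) + 2 / n)"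
proof -
 let ?f = "\<lambda>t. ennreal ((n * t) powr (- e) / (1 + n * \<bar>t - (pi - \<tau>)\<bar>)\<^sup>2) * indicator {0..pi} t"
 have "(\<integral>t. ?f t) = (\<integral>t. ?f (pi + (-1) * t))"
  using nn_integral_real_affine[of ?f "-1" pi] by simp
 also have "... = (\<integral>t\<in>{0..pi}. ennreal ((n * (pi - t)) powr (- e) / (1 + n * \<bar>t - \<tau>\<bar>)\<^sup>2))"
  by (intro nn_integral_cong) (auto simp: indicator_def abs_minus_commute)
 finally show ?thesis using nn_integral_powr_decay[OF assms, of "pi - \<tau>"] by simp
qed

lemma arccos_in_0_pi: "x \<in> \<I> ==> 0 < arccos x \<and> arccos x < pi"
 using arccos_lt_bounded[of x] by auto

text \<open>Decay of order \<open>M\<close> pays for a weight ratio of order \<open>A\<close> and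
  leaves an integrable order 2.\<close>

lemma powr_decay:
 fixes D A :: real
 assumes "1 <= D" "A + 2 <= real M" "0 <= A"
 shows "(4 * D) powr A / D ^ M <= 4 powr A / D\<^sup>2"
proof -
 have "D powr A * D\<^sup>2 = D powr (A + 2)" using assms by (simp add: powr_add)
 also have "... <= D powr (real M)" using assms by (intro powr_mono) auto
 also have "... = D ^ M" using assms by (simp add: powr_realpow)
 finally have "4 powr A * (D powr A * D\<^sup>2) <= 4 powr A * D ^ M" by (intro mult_left_mono) auto
 moreover have "(4 * D) powr A = 4 powr A * D powr A" by (rule powr_mult)
 ultimately have "(4 * D) powr A * D\<^sup>2 <= 4 powr A * D ^ M" by (simp add: mult.assoc)
 then show ?thesis using assms by (simp add: field_simps)
qed

text \<open>Substituting the angle multiplies the weight by \<open>sin v\<close>, which raises both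
  exponents by \<open>1/2\<close>. Hence \<open>a > -1\<close> leaves a singularity of order
  \<open>-2*(a + 1/2) < 1\<close>, and the same half power taken at \<open>y\<close> is the factor
  \<open>\<phi>(y)\<close> of the bound.\<close>

lemma jacobi_kernel_column:
 assumes a: "a > -1" and b: "b > -1"
 shows "\<exists>C>0. \<exists>M0. \<forall>M\<ge>M0. \<forall>n\<ge>1. \<forall>y\<in>\<I>. 1 <= real n * arccos y --> 1 <= real n * (pi - arccos y) -->
  (\<integral>x\<in>\<I>. ennreal (jw a b x / dfac' n x y ^ M)) <= ennreal (C / real n * (jw a b y * varphi y))"
proof -
 define a' where "a' = a + 1/2"
 define b' where "b' = b + 1/2"
 define e where "e = max 0 (max (- 2 * a') (- 2 * b'))"
 have e: "0 <= e" "e < 1" "- 2 * a' <= e" "- 2 * b' <= e" using a b by (auto simp: e_def a'_def b'_def)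
 define A where "A = 2 * \<bar>a'\<bar> + 2 * \<bar>b'\<bar>"
 have A0: "0 <= A" by (simp add: A_def)
 define C where "C = 4 powr A * 8 * (2 + 2 * (1 / (1 - e) + 2))"
 have C: "C > 0" using e by (auto simp: C_def intro!: mult_pos_pos add_pos_pos divide_pos_pos)
 show ?thesis
 proof (intro exI[of _ C] exI[of _ "nat \<lceil>A\<rceil> + 2"] conjI C allI impI ballI)
  fix M n :: nat and y :: real
  assume M: "nat \<lceil>A\<rceil> + 2 <= M" and n: "1 <= n" and y: "y \<in> \<I>" and ny: "1 <= real n * arccos y" "1 <= real n * (pi - arccos y)"
  have AM: "A + 2 <= real M" using M by linarith
  let ?P = "\<lambda>v. (real n * v) powr (- e)" and ?Q = "\<lambda>v. (real n * (pi - v)) powr (- e)"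
  let ?d = "\<lambda>v. (1 + real n * \<bar>v - arccos y\<bar>)"
  let ?J = "jw a' b' y"
  have J: "0 < ?J" by (rule jacobi_pos[OF y])
  let ?c = "4 powr A * 8 * ?J"
  have "(\<integral>x\<in>\<I>. ennreal (jw a b x / dfac' n x y ^ M))
   <= (\<integral>x\<in>{-1..1}. ennreal (jw a b x / dfac' n x y ^ M))"
   by (intro nn_integral_mono) (auto simp: indicator_def)
  also have "... = (\<integral>v\<in>{0..pi}. ennreal (jw a b (cos v) / dfac' n (cos v) y ^ M) * ennreal (sin v))"
   by (rule nn_integral_cos_substitution) measurable
  also have "... <= (\<integral>v. ennreal ?c * (ennreal (1 / real n) * ennreal (real n / (1 + real n * \<bar>arccos y - v\<bar>)\<^sup>2)
     + (ennreal (?P v / (?d v)\<^sup>2) * indicator {0..pi} v + ennreal (?Q v / (?d v)\<^sup>2) * indicator {0..pi} v)))"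
  proof (rule nn_integral_mono)
   fix v :: real
   show "ennreal (jw a b (cos v) / dfac' n (cos v) y ^ M) * ennreal (sin v) * indicator {0..pi} v
    <= ennreal ?c * (ennreal (1 / real n) * ennreal (real n / (1 + real n * \<bar>arccos y - v\<bar>)\<^sup>2)
     + (ennreal (?P v / (?d v)\<^sup>2) * indicator {0..pi} v + ennreal (?Q v / (?d v)\<^sup>2) * indicator {0..pi} v))"
   proof (cases "v \<in> {0<..<pi}")
    case True
    then have t: "v \<in> {0..pi}" "0 < sin v" by (auto intro: sin_gt_zero)
    have cx: "cos v \<in> \<I>"
     using True cos_monotone_0_pi[of 0 v] cos_monotone_0_pi[of v pi] by auto
    have ac: "arccos (cos v) = v" using t by (simp add: arccos_cos)
    let ?D = "dfac n (cos v) y"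
    have D: "1 <= ?D" by (rule dfac_ge1)
    have Dd: "?D = ?d v" by (simp add: dfac_def ac)
    have D': "dfac' n (cos v) y = ?D" using cx y by (simp add: dfac'_eq)
    have "jw a b (cos v) * sin v = jw a' b' (cos v)"
     using jacobi_varphi[OF cx, of a b] t by (simp add: varphi_cos a'_def b'_def)
    also have "... <= (4 * ?D) powr A * (8 * (1 + ?P v + ?Q v)) * ?J"
     using jacobi_ratio[OF n cx y ny e] by (simp add: ac A_def)
    finally have "jw a b (cos v) * sin v / ?D ^ M <= (4 * ?D) powr A * (8 * (1 + ?P v + ?Q v)) * ?J / ?D ^ M"
     using D by (intro divide_right_mono) auto
    also have "... = (4 * ?D) powr A / ?D ^ M * (8 * (1 + ?P v + ?Q v) * ?J)" by simp
    also have "... <= 4 powr A / ?D\<^sup>2 * (8 * (1 + ?P v + ?Q v) * ?J)"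
     using powr_decay[OF D AM A0] J by (intro mult_right_mono) (auto intro!: mult_nonneg_nonneg add_nonneg_nonneg)
    also have "... = ?c * (1 / (?d v)\<^sup>2 + (?P v / (?d v)\<^sup>2 + ?Q v / (?d v)\<^sup>2))"
     unfolding Dd by (simp add: add_divide_distrib[symmetric] mult_ac) 
    finally have "ennreal (jw a b (cos v) * sin v / ?D ^ M) <= ennreal (?c * (1 / (?d v)\<^sup>2 + (?P v / (?d v)\<^sup>2 + ?Q v / (?d v)\<^sup>2)))"
     by (rule ennreal_leI)
    moreover have "ennreal (?c * (1 / (?d v)\<^sup>2 + (?P v / (?d v)\<^sup>2 + ?Q v / (?d v)\<^sup>2))) = ennreal ?c * (ennreal (1 / (?d v)\<^sup>2) + (ennreal (?P v / (?d v)\<^sup>2) + ennreal (?Q v / (?d v)\<^sup>2)))"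
     using J by (simp add: ennreal_mult ennreal_plus)
    moreover have "ennreal (1 / (?d v)\<^sup>2) = ennreal (1 / real n) * ennreal (real n / (1 + real n * \<bar>arccos y - v\<bar>)\<^sup>2)"
     using n by (simp add: ennreal_mult[symmetric] abs_minus_commute)
    moreover have "ennreal (jw a b (cos v) / ?D ^ M) * ennreal (sin v) = ennreal (jw a b (cos v) * sin v / ?D ^ M)"
     using t D jacobi_pos[OF cx, of a b] by (simp add: ennreal_mult[symmetric] less_imp_le)
    ultimately show ?thesis using t unfolding D' by simp
   next
    case False
    then consider "v \<notin> {0..pi}" | "v = 0" | "v = pi" by fastforce
    then show ?thesis by cases simp_all
   qed
  qed
  also have "... = ennreal ?c * (ennreal (1 / real n) * (\<integral>v. ennreal (real n / (1 + real n * \<bar>arccos y - v\<bar>)\<^sup>2))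
   + ((\<integral>v\<in>{0..pi}. ennreal (?P v / (?d v)\<^sup>2)) + (\<integral>v\<in>{0..pi}. ennreal (?Q v / (?d v)\<^sup>2))))"
   by (simp add: nn_integral_add nn_integral_cmult)
  also have "... <= ennreal ?c * (ennreal (1 / real n) * 2 + (ennreal (1 / (real n * (1 - e)) + 2 / real n) + ennreal (1 / (real n * (1 - e)) + 2 / real n)))"
   using n e by (intro mult_left_mono add_mono nn_integral_decay nn_integral_powr_decay nn_integral_powr_decay') auto
  also have "ennreal (1 / real n) * 2 = ennreal (2 / real n)" using ennreal_mult[of "1 / real n" 2] by simp
  also have "ennreal (2 / real n) + (ennreal (1 / (real n * (1 - e)) + 2 / real n) + ennreal (1 / (real n * (1 - e)) + 2 / real n))
   = ennreal (2 / real n + ((1 / (real n * (1 - e)) + 2 / real n) + (1 / (real n * (1 - e)) + 2 / real n)))"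
   using n e by (subst ennreal_plus[symmetric], simp, simp, subst ennreal_plus[symmetric]) auto
  also have "2 / real n + ((1 / (real n * (1 - e)) + 2 / real n) + (1 / (real n * (1 - e)) + 2 / real n)) = (2 + 2 * (1 / (1 - e) + 2)) / real n"
  proof -
   have "z1 / N + (x + 2 / N + (x + 2 / N)) = (z1 + 2 * (z + 2)) / N" if "x = z / N" for x z z1 N :: real
    unfolding that by (simp add: add_divide_distrib)
   moreover have "1 / (real n * (1 - e)) = 1 / (1 - e) / real n" by (simp add: mult.commute)
   ultimately show ?thesis by blast
  qed
  also have "ennreal ?c * ennreal ((2 + 2 * (1 / (1 - e) + 2)) / real n) = ennreal (C / real n * (jw a b y * varphi y))"
  proof -
   have "jw a b y * varphi y = ?J" using jacobi_varphi[OF y] by (simp add: a'_def b'_def)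
   then show ?thesis using J e n by (subst ennreal_mult[symmetric]) (auto simp: C_def mult_ac)
  qed
  finally show "(\<integral>x\<in>\<I>. ennreal (jw a b x / dfac' n x y ^ M)) <= ennreal (C / real n * (jw a b y * varphi y))" .
 qed
qed

lemma one_plus_powr_compare:
 assumes "0 <= x" "x < 1" "0 <= y" "y < (1::real)"
 shows "(1 + x) powr b <= 2 powr \<bar>b\<bar> * (1 + y) powr b"
proof (cases "0 <= b")
 case True
 have "(1 + x) powr b <= 2 powr b * 1" using assms True by (auto intro!: powr_mono2)
 also have "... <= 2 powr b * (1 + y) powr b" using assms True by (intro mult_left_mono ge_one_powr_ge_zero) auto
 finally show ?thesis using True by simp
next
 case False
 have "(1 + x) powr b <= 1" using assms False powr_mono2'[of b 1 "1 + x"] by simp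
 also have "1 = 2 powr \<bar>b\<bar> * 2 powr b" using False by (simp add: powr_add[symmetric])
 also have "... <= 2 powr \<bar>b\<bar> * (1 + y) powr b" using assms False by (intro mult_left_mono powr_mono2') auto
 finally show ?thesis .
qed

text \<open>The tail is of order \<open>(1 - y) * w(y)\<close>, and
  \<open>1 - y <= \<phi>(y)/n\<close> as soon as \<open>y\<close> lies within angle
  \<open>1/n\<close> of the endpoint.\<close>

lemma jacobi_tail:
 assumes a: "a > -1" and b: "b > -1" and n: "n >= 1" and y: "y \<in> \<I>" and ny: "real n * arccos y <= 1"
 shows "(\<integral>x\<in>{y..<1}. ennreal (jw a b x)) <= ennreal (2 powr \<bar>b\<bar> / (a + 1) / real n * (jw a b y * varphi y))"
proof -
 have t: "0 < arccos y" "arccos y <= 1 / real n" using arccos_in_0_pi[OF y] ny n by (auto simp: field_simps)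
 have "1 - y = 1 - cos (arccos y)" using y by simp
 also have "... <= (arccos y)\<^sup>2 / 2" by (rule one_minus_cos_le)
 finally have y2: "1 - y <= (arccos y)\<^sup>2 / 2" .
 have tn: "(arccos y)\<^sup>2 <= (1 / real n)\<^sup>2" using t by (intro power_mono) auto
 have "(1 / real n)\<^sup>2 <= 1\<^sup>2" using n by (intro power_mono) auto
 then have y0: "0 <= y" using y2 tn by simp
 have sq: "sqrt (1 - y) <= 1 / real n"
 proof (rule real_le_lsqrt)
  show "1 - y <= (1 / real n)\<^sup>2" using y2 tn zero_le_power2[of "arccos y"] by linarith
 qed simp
 have vp: "sqrt (1 - y) <= varphi y"
  unfolding varphi_def using y y0 by (intro real_sqrt_le_mono) (auto simp: power2_eq_square mult_left_le)
 have d: "1 - y <= 1 / real n * varphi y"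
 proof -
  have "1 - y = sqrt (1 - y) * sqrt (1 - y)" using y by simp
  also have "... <= 1 / real n * varphi y" using sq vp y by (intro mult_mono) auto
  finally show ?thesis .
 qed
 let ?c = "2 powr \<bar>b\<bar> * (1 + y) powr b"
 have "((\<lambda>x. x powr a) has_integral ((1 - y) powr (a + 1) / (a + 1))) {0..1 - y}"
  using a y by (intro has_integral_powr_from_0) auto
 then have I: "(\<integral>x. ennreal (x powr a) * indicator {0..1-y} x) = ennreal ((1 - y) powr (a + 1) / (a + 1))"
  by (intro nn_integral_has_integral_lebesgue') auto
 have "(\<integral>x\<in>{y..<1}. ennreal (jw a b x)) <= (\<integral>x. ennreal ?c * (ennreal ((1 + (-1) * x) powr a) * indicator {0..1-y} (1 + (-1) * x)))"
 proof (rule nn_integral_mono)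
  fix x
  show "ennreal (jw a b x) * indicator {y..<1} x <= ennreal ?c * (ennreal ((1 + (-1) * x) powr a) * indicator {0..1-y} (1 + (-1) * x))"
  proof (cases "x \<in> {y..<1}")
   case True
   have "jw a b x <= (1 - x) powr a * ?c"
    unfolding jacobi_weight_def using True y y0 by (intro mult_left_mono one_plus_powr_compare) auto
   then have "ennreal (jw a b x) <= ennreal (?c * (1 - x) powr a)" by (intro ennreal_leI) (simp add: mult.commute)
   then show ?thesis using True by (simp add: ennreal_mult)
  qed simp
 qed
 also have "... = ennreal ?c * (\<integral>x. (ennreal ((1 + (-1) * x) powr a) * indicator {0..1-y} (1 + (-1) * x)))"
  by (rule nn_integral_cmult) measurable
 also have "(\<integral>x. (ennreal ((1 + (-1) * x) powr a) * indicator {0..1-y} (1 + (-1) * x))) = (\<integral>x. ennreal (x powr a) * indicator {0..1-y} x)"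
  using nn_integral_real_affine[of "\<lambda>x. ennreal (x powr a) * indicator {0..1-y} x" "-1" 1] by simp
 also have "ennreal ?c * ... = ennreal (?c * ((1 - y) powr (a + 1) / (a + 1)))"
  unfolding I using a by (intro ennreal_mult[symmetric]) auto
 also have "... <= ennreal (2 powr \<bar>b\<bar> / (a + 1) / real n * (jw a b y * varphi y))"
 proof (rule ennreal_leI)
  have "?c * ((1 - y) powr (a + 1) / (a + 1)) = 2 powr \<bar>b\<bar> / (a + 1) * jw a b y * (1 - y)"
   using y by (simp add: jacobi_weight_def powr_add)
  also have "... <= 2 powr \<bar>b\<bar> / (a + 1) * jw a b y * (1 / real n * varphi y)"
   using d a jacobi_pos[OF y, of a b] by (intro mult_left_mono) auto
  also have "... = 2 powr \<bar>b\<bar> / (a + 1) / real n * (jw a b y * varphi y)" by simp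
  finally show "?c * ((1 - y) powr (a + 1) / (a + 1)) <= 2 powr \<bar>b\<bar> / (a + 1) / real n * (jw a b y * varphi y)" .
 qed
 finally show ?thesis .
qed

lemma jacobi_tail':
 assumes a: "a > -1" and b: "b > -1" and n: "n >= 1" and y: "y \<in> \<I>" and ny: "real n * (pi - arccos y) <= 1"
 shows "(\<integral>x\<in>{-1<..y}. ennreal (jw a b x)) <= ennreal (2 powr \<bar>a\<bar> / (b + 1) / real n * (jw a b y * varphi y))"
proof -
 have "(\<integral>x\<in>{-1<..y}. ennreal (jw a b x)) = (\<integral>x\<in>{-y..<1}. ennreal (jw b a x))"
 proof -
  have "(\<integral>x\<in>{-1<..y}. ennreal (jw a b x)) = (\<integral>x. ennreal (jw a b (-x)) * indicator {-1<..y} (-x))"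
   using nn_integral_real_affine[of "\<lambda>x. ennreal (jw a b x) * indicator {-1<..y} x" "-1" 0] by simp
  also have "... = (\<integral>x\<in>{-y..<1}. ennreal (jw b a x))"
   by (intro nn_integral_cong) (auto simp: indicator_def jacobi_reflect)
  finally show ?thesis .
 qed
 also have "... <= ennreal (2 powr \<bar>a\<bar> / (b + 1) / real n * (jw b a (-y) * varphi (-y)))"
  using assms by (intro jacobi_tail) (auto simp: arccos_minus)
 finally show ?thesis by (simp add: jacobi_reflect varphi_reflect)
qed


text \<open>On \<open>\<bar>z\<bar> \<le> cos (1/n)\<close> the kernel comes from the Jackson operator; nearer to the endpoints the
  approximated function is first made constant, which gives the indicator of a Hardy operator.\<close>

definition favard_kernel :: "real => nat => nat => real => real => real" where
 "favard_kernel C M n x z = (if \<bar>z\<bar> <= cos (1 / real n) then C / dfac' n x z ^ M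
  else if cos (1 / real n) < z \<and> z <= x \<or> x <= z \<and> z < - cos (1 / real n) then 1 else 0)"

lemma favard_kernel_measurable [measurable]:
 "case_prod (favard_kernel C M n) \<in> borel_measurable (borel \<Otimes>\<^sub>M borel)"
 unfolding favard_kernel_def by measurable

lemma cos_inverse_nat: assumes "n >= (1::nat)" shows "0 < cos (1 / real n)" "cos (1 / real n) < 1"
proof -
 have n: "0 < 1 / real n" "1 / real n <= 1" using assms by auto
 then have "1 / real n < pi / 2" using pi_gt3 by linarith
 then show "0 < cos (1 / real n)" using n by (intro cos_gt_zero) auto
 have "1 / real n <= pi" using n(2) pi_gt3 by linarith
 then have "cos (1 / real n) < cos 0" using n by (intro cos_monotone_0_pi) auto
 then show "cos (1 / real n) < 1" by simp
qed

lemma arccos_inverse_nat: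
 assumes n: "n >= (1::nat)" and z: "z \<in> \<I>"
 shows "z <= cos (1 / real n) \<longleftrightarrow> 1 <= real n * arccos z"
  and "- cos (1 / real n) <= z \<longleftrightarrow> 1 <= real n * (pi - arccos z)"
proof -
 have "1 / real n <= 1" using n by simp
 then have n1: "1 / real n <= pi" using pi_gt3 by linarith
 then have a: "arccos (cos (1 / real n)) = 1 / real n" using n by (simp add: arccos_cos)
 have *: "z <= cos (1 / real n) \<longleftrightarrow> 1 <= real n * arccos z" if "z \<in> \<I>" for z
 proof -
  have "z <= cos (1 / real n) \<longleftrightarrow> arccos (cos (1 / real n)) <= arccos z"
   using that cos_le_one[of "1 / real n"] cos_ge_minus_one[of "1 / real n"] by (subst arccos_le_mono) auto
  also have "... \<longleftrightarrow> 1 <= real n * arccos z" unfolding a using n by (simp add: field_simps)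
  finally show ?thesis .
 qed
 show "z <= cos (1 / real n) \<longleftrightarrow> 1 <= real n * arccos z" by (rule *[OF z])
 have "- cos (1 / real n) <= z \<longleftrightarrow> - z <= cos (1 / real n)" by linarith
 also have "... \<longleftrightarrow> 1 <= real n * (pi - arccos z)" using *[of "- z"] z by (simp add: arccos_minus)
 finally show "- cos (1 / real n) <= z \<longleftrightarrow> 1 <= real n * (pi - arccos z)" .
qed

text \<open>On the Hardy part both points lie within angle \<open>1/n\<close> of the same endpoint.
  Hence the indicator is at most \<open>4 / dfac'^2\<close>, which is why the row estimates take
  \<open>C >= 4\<close>.\<close>

lemma favard_kernel_tail_dfac:
 assumes n: "n >= 1" and x: "x \<in> \<I>" and z: "z \<in> \<I>"
  and "cos (1 / real n) < z \<and> z <= x \<or> x <= z \<and> z < - cos (1 / real n)"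
 shows "dfac' n x z <= 2"
proof -
 have "real n * \<bar>arccos x - arccos z\<bar> <= 1"
  using assms(4)
 proof
  assume h: "cos (1 / real n) < z \<and> z <= x"
  then have "real n * arccos z <= 1" using arccos_inverse_nat(1)[OF n z] by linarith
  moreover have "arccos x <= arccos z" "0 <= arccos x" using h x z by (auto intro: arccos_le_arccos arccos_lbound)
  then have "\<bar>arccos x - arccos z\<bar> <= arccos z" by linarith
  then have "real n * \<bar>arccos x - arccos z\<bar> <= real n * arccos z" by (rule mult_left_mono) simp
  ultimately show ?thesis by linarith
 next
  assume h: "x <= z \<and> z < - cos (1 / real n)"
  then have "real n * (pi - arccos z) <= 1" using arccos_inverse_nat(2)[OF n z] by linarith
  moreover have "arccos z <= arccos x" "arccos x <= pi" using h x z by (auto intro: arccos_le_arccos arccos_ubound)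
  then have "\<bar>arccos x - arccos z\<bar> <= pi - arccos z" by linarith
  then have "real n * \<bar>arccos x - arccos z\<bar> <= real n * (pi - arccos z)" by (rule mult_left_mono) simp
  ultimately show ?thesis by linarith
 qed
 then show ?thesis using x z by (simp add: dfac'_eq dfac_def)
qed

section \<open>Rows and columns of the Favard kernel\<close>

lemma dfac'_power_le: "2 <= M ==> 0 <= C ==> C / dfac' n x z ^ M <= C / (dfac' n x z)\<^sup>2"
 using dfac'_ge1[of n x z] by (intro divide_left_mono power_increasing) (auto intro!: mult_pos_pos zero_less_power)

lemma favard_kernel_row:
 assumes n: "n >= 1" and x: "x \<in> \<I>" and C: "C >= 4" and M: "M >= 2" and z: "z \<in> \<I>"
 shows "0 <= favard_kernel C M n x z \<and> favard_kernel C M n x z <= C / (dfac' n x z)\<^sup>2"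
proof -
 have D: "1 <= dfac' n x z" by (rule dfac'_ge1)
 have 1: "C / dfac' n x z ^ M <= C / (dfac' n x z)\<^sup>2" using M C by (intro dfac'_power_le) auto
 have 2: "1 <= C / (dfac' n x z)\<^sup>2" if "dfac' n x z <= 2"
 proof -
  have "(dfac' n x z)\<^sup>2 <= 2\<^sup>2" using that D by (intro power_mono) auto
  then show ?thesis using C D by (simp add: field_simps)
 qed
 show ?thesis
  using 1 2 favard_kernel_tail_dfac[OF n x z] C D unfolding favard_kernel_def by auto
qed

lemma favard_row:
 assumes n: "n >= 1" and x: "x \<in> \<I>" and C: "C >= 4" and M: "M >= 2"
 shows "(\<integral>z\<in>\<I>. ennreal (favard_kernel C M n x z) * ennreal (1 / varphi z)) <= ennreal (2 * C / real n)"
proof -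
 have "(\<integral>z\<in>\<I>. ennreal (favard_kernel C M n x z) * ennreal (1 / varphi z))
  <= (\<integral>z. ennreal C * (ennreal (1 / (varphi z * (dfac' n x z)\<^sup>2)) * indicator \<I> z))"
 proof (rule nn_integral_mono)
  fix z :: real
  show "ennreal (favard_kernel C M n x z) * ennreal (1 / varphi z) * indicator \<I> z
   <= ennreal C * (ennreal (1 / (varphi z * (dfac' n x z)\<^sup>2)) * indicator \<I> z)"
  proof (cases "z \<in> \<I>")
   case True
   have v: "0 < varphi z" by (rule varphi_pos[OF True])
   have "favard_kernel C M n x z * (1 / varphi z) <= C / (dfac' n x z)\<^sup>2 * (1 / varphi z)"
    using favard_kernel_row[OF n x C M True] v by (intro mult_right_mono) auto
   also have "... = C * (1 / (varphi z * (dfac' n x z)\<^sup>2))" by simp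
   finally have "ennreal (favard_kernel C M n x z * (1 / varphi z)) <= ennreal (C * (1 / (varphi z * (dfac' n x z)\<^sup>2)))" by (rule ennreal_leI)
   then show ?thesis using True v C favard_kernel_row[OF n x C M True] by (simp add: ennreal_mult[symmetric])
  qed simp
 qed
 also have "... = ennreal C * (\<integral>z\<in>\<I>. ennreal (1 / (varphi z * (dfac' n x z)\<^sup>2)))"
  by (rule nn_integral_cmult) measurable
 also have "... <= ennreal C * ennreal (2 / real n)"
  using x n by (intro mult_left_mono nn_integral_dfac) auto
 also have "... = ennreal (2 * C / real n)" using C by (simp add: ennreal_mult[symmetric] mult.commute)
 finally show ?thesis .
qed


text \<open>Every column is of a single kind: a Jackson column if \<open>z\<close> is in the middle,
  a tail of the weight if \<open>z\<close> is near an endpoint. The dependence on \<open>C\<close>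
  is explicit because \<open>C\<close> is fixed only after \<open>M\<close>.\<close>

lemma favard_column:
 assumes a: "a > -1" and b: "b > -1"
 shows "\<exists>C1>0. \<exists>C2>0. \<exists>M0. \<forall>M\<ge>M0. \<forall>C>0. \<forall>n\<ge>1. \<forall>z\<in>\<I>.
  (\<integral>x\<in>\<I>. ennreal (jw a b x) * ennreal (favard_kernel C M n x z))
   <= ennreal ((C * C1 + C2) / real n * (jw a b z * varphi z))"
proof -
 obtain C1 M0 where C1: "C1 > 0" and K: "\<And>M n y. M >= M0 ==> n >= 1 ==> y \<in> \<I> ==> 1 <= real n * arccos y ==> 1 <= real n * (pi - arccos y) ==>
  (\<integral>x\<in>\<I>. ennreal (jw a b x / dfac' n x y ^ M)) <= ennreal (C1 / real n * (jw a b y * varphi y))"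
  using jacobi_kernel_column[OF a b] by blast
 define R where "R = 2 powr \<bar>b\<bar> / (a + 1)"
 define L where "L = 2 powr \<bar>a\<bar> / (b + 1)"
 have RL: "R > 0" "L > 0" using a b by (auto simp: R_def L_def)
 have "\<forall>M\<ge>M0. \<forall>C>0. \<forall>n\<ge>1. \<forall>z\<in>\<I>.
  (\<integral>x\<in>\<I>. ennreal (jw a b x) * ennreal (favard_kernel C M n x z))
   <= ennreal ((C * C1 + (R + L)) / real n * (jw a b z * varphi z))"
 proof (intro allI impI ballI)
  fix M n :: nat and C z :: real assume M: "M0 <= M" and C: "0 < C" and n: "1 <= n" and z: "z \<in> \<I>"
  let ?J = "jw a b z * varphi z"
  have J: "0 < ?J" using jacobi_pos[OF z, of a b] varphi_pos[OF z] by simp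
  have fin: "X <= ennreal ((C * C1 + (R + L)) / real n * ?J)" if "X <= ennreal (T / real n * ?J)" "T <= C * C1 + (R + L)" for X T
   using that J n by (elim order_trans) (intro ennreal_leI mult_right_mono divide_right_mono, auto)
  consider "\<bar>z\<bar> <= cos (1 / real n)" | "cos (1 / real n) < z" | "z < - cos (1 / real n)" by linarith
  then show "(\<integral>x\<in>\<I>. ennreal (jw a b x) * ennreal (favard_kernel C M n x z))
   <= ennreal ((C * C1 + (R + L)) / real n * ?J)"
  proof cases
   case 1
   have "(\<integral>x\<in>\<I>. ennreal (jw a b x) * ennreal (favard_kernel C M n x z))
    = (\<integral>x. ennreal C * (ennreal (jw a b x / dfac' n x z ^ M) * indicator \<I> x))"
   proof (rule nn_integral_cong)
    fix x :: real
    have "ennreal (jw a b x) * ennreal (C / dfac' n x z ^ M) = ennreal C * ennreal (jw a b x / dfac' n x z ^ M)" if "x \<in> \<I>"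
     using C jacobi_pos[OF that, of a b] dfac'_pos[of n x z] by (simp add: ennreal_mult[symmetric] mult.commute)
    then show "ennreal (jw a b x) * ennreal (favard_kernel C M n x z) * indicator \<I> x = ennreal C * (ennreal (jw a b x / dfac' n x z ^ M) * indicator \<I> x)"
     using 1 by (auto simp: favard_kernel_def indicator_def)
   qed
   also have "... = ennreal C * (\<integral>x\<in>\<I>. ennreal (jw a b x / dfac' n x z ^ M))"
    by (rule nn_integral_cmult) measurable
   also have "... <= ennreal C * ennreal (C1 / real n * ?J)"
    using 1 arccos_inverse_nat[OF n z] by (intro mult_left_mono K M n z) (auto simp: abs_le_iff minus_le_iff)
   also have "... = ennreal ((C * C1) / real n * ?J)" using C C1 J n by (simp add: ennreal_mult[symmetric])
   finally show ?thesis by (rule fin) (use RL in auto)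
  next
   case 2
   have c: "0 < cos (1 / real n)" by (rule cos_inverse_nat[OF n])
   have "(\<integral>x\<in>\<I>. ennreal (jw a b x) * ennreal (favard_kernel C M n x z))
    <= (\<integral>x\<in>{z..<1}. ennreal (jw a b x))"
    using 2 c by (intro nn_integral_mono) (auto simp: favard_kernel_def indicator_def)
   also have "... <= ennreal (R / real n * ?J)"
    unfolding R_def using 2 arccos_inverse_nat(1)[OF n z] by (intro jacobi_tail a b n z) auto
   finally show ?thesis by (rule fin) (use RL C C1 in auto)
  next
   case 3
   have c: "0 < cos (1 / real n)" by (rule cos_inverse_nat[OF n])
   have "(\<integral>x\<in>\<I>. ennreal (jw a b x) * ennreal (favard_kernel C M n x z))
    <= (\<integral>x\<in>{-1<..z}. ennreal (jw a b x))"
    using 3 c by (intro nn_integral_mono) (auto simp: favard_kernel_def indicator_def)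
   also have "... <= ennreal (L / real n * ?J)"
    unfolding L_def using 3 arccos_inverse_nat(2)[OF n z] by (intro jacobi_tail' a b n z) auto
   finally show ?thesis by (rule fin) (use RL C C1 in auto)
  qed
 qed
 moreover have "0 < R + L" using RL by simp
 ultimately show ?thesis using C1 by blast
qed

lemma jacobi_ratio_nonneg:
 assumes n: "n >= 1" and x: "x \<in> \<I>" and y: "y \<in> \<I>"
  and ny: "1 <= real n * arccos y" "1 <= real n * (pi - arccos y)"
  and ab: "0 <= a" "0 <= b"
 shows "jw a b x <= 24 * (4 * dfac n x y) powr (2 * a + 2 * b) * jw a b y"
proof -
 have "0 < real n * arccos x" "0 < real n * (pi - arccos x)" using n arccos_in_0_pi[OF x] by auto
 moreover have "n ~= 0" "arccos x ~= 0" "arccos x ~= pi" using n arccos_in_0_pi[OF x] by auto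
 ultimately show ?thesis using jacobi_ratio[OF n x y ny, of 0 a b] ab by (simp add: mult_ac)
qed

lemma jacobi_le_tail:
 assumes ab: "0 <= a" "0 <= b" and "0 <= z" "z <= x" "x < 1"
 shows "jw a b x <= 2 powr b * jw a b z"
proof -
 have "(1 - x) powr a * (1 + x) powr b <= (1 - z) powr a * (2 powr \<bar>b\<bar> * (1 + z) powr b)"
  using assms by (intro mult_mono powr_mono2 one_plus_powr_compare) auto
 then show ?thesis using ab by (simp add: jacobi_weight_def mult_ac)
qed

text \<open>In the middle the ratio \<open>w(x)/w(z)\<close> is absorbed by the decay of order
  \<open>M\<close>. On the Hardy part \<open>x\<close> is closer to the endpoint than
  \<open>z\<close>, and a weight with nonnegative exponents grows towards an endpoint by at most a
  constant factor.\<close>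

lemma favard_row_inf:
 assumes ab: "0 <= a" "0 <= b"
 shows "\<exists>M0. \<forall>M\<ge>M0. \<forall>C>0. \<exists>B>0. \<forall>n\<ge>1. \<forall>x\<in>\<I>.
  (\<integral>z\<in>\<I>. ennreal (jw a b x) * ennreal (favard_kernel C M n x z) * ennreal (1 / (jw a b z * varphi z))) <= ennreal (B / real n)"
proof (intro exI[of _ "nat \<lceil>2 * a + 2 * b\<rceil> + 2"] allI impI)
 fix M :: nat and C :: real assume M: "nat \<lceil>2 * a + 2 * b\<rceil> + 2 <= M" and C: "0 < C"
 define A where "A = 2 * a + 2 * b"
 have A: "0 <= A" "A + 2 <= real M" using ab M by (simp add: A_def, unfold A_def, linarith)
 \<comment> \<open>One summand for each kind of kernel value; the factors \<open>4\<close> come from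
   \<open>dfac' <= 2\<close> on the Hardy parts.\<close>
 define E where "E = C * 24 * 4 powr A + 4 * 2 powr a + 4 * 2 powr b"
 have E: "E > 0" "C * 24 * 4 powr A <= E" "4 * 2 powr a <= E" "4 * 2 powr b <= E"
  using C by (auto simp: E_def intro!: add_pos_pos add_nonneg_nonneg mult_nonneg_nonneg)
 have key: "jw a b x * favard_kernel C M n x z <= E / (dfac' n x z)\<^sup>2 * jw a b z"
  if n: "n >= 1" and x: "x \<in> \<I>" and z: "z \<in> \<I>" for n x z
 proof -
  let ?D = "dfac' n x z"
  have D: "1 <= ?D" "?D = dfac n x z" using dfac'_ge1[of n x z] x z by (simp, simp add: dfac'_eq)
  have J: "0 < jw a b z" "0 < jw a b x" using x z by (auto intro: jacobi_pos)
  have c: "0 < cos (1 / real n)" by (rule cos_inverse_nat[OF n])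
  have tail: "jw a b x <= E / ?D\<^sup>2 * jw a b z" if "jw a b x <= B * jw a b z" "4 * B <= E" "?D <= 2" "0 <= B" for B
  proof -
   have "?D\<^sup>2 <= 2\<^sup>2" using D that by (intro power_mono) auto
   then have "B * ?D\<^sup>2 <= B * 4" using that by (intro mult_left_mono) auto
   then have "B <= E / ?D\<^sup>2" using that D by (simp add: pos_le_divide_eq)
   then show ?thesis using that(1) J by (meson mult_right_mono less_imp_le order_trans)
  qed
  consider "\<bar>z\<bar> <= cos (1 / real n)" | "cos (1 / real n) < z" "z <= x" | "z < - cos (1 / real n)" "x <= z"
   | "favard_kernel C M n x z = 0"
   by (cases "\<bar>z\<bar> <= cos (1 / real n)"; cases "cos (1 / real n) < z \<and> z <= x"; cases "x <= z \<and> z < - cos (1 / real n)")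
    (auto simp: favard_kernel_def)
  then show ?thesis
  proof cases
   case 1
   have "jw a b x <= 24 * (4 * ?D) powr A * jw a b z"
   proof -
    have "z <= cos (1 / real n)" "- cos (1 / real n) <= z" using 1 by linarith+
    then show ?thesis using jacobi_ratio_nonneg[OF n x z _ _ ab] arccos_inverse_nat[OF n z] D(2) by (simp add: A_def)
   qed
   then have "jw a b x * (C / ?D ^ M) <= 24 * (4 * ?D) powr A * jw a b z * (C / ?D ^ M)"
    using C D by (intro mult_right_mono) auto
   also have "... = C * 24 * ((4 * ?D) powr A / ?D ^ M) * jw a b z" by simp
   also have "... <= C * 24 * (4 powr A / ?D\<^sup>2) * jw a b z"
    using powr_decay[OF D(1) A(2,1)] C J by (intro mult_right_mono mult_left_mono) auto
   also have "... = (C * 24 * 4 powr A) / ?D\<^sup>2 * jw a b z" by simp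
   also have "... <= E / ?D\<^sup>2 * jw a b z"
    using E J D by (intro mult_right_mono divide_right_mono) auto
   finally show ?thesis using 1 by (simp add: favard_kernel_def)
  next
   case 2
   have "jw a b x <= E / ?D\<^sup>2 * jw a b z"
    by (rule tail[of "2 powr b"]) (use 2 c ab x z E favard_kernel_tail_dfac[OF n x z] in \<open>auto intro!: jacobi_le_tail\<close>)
   then show ?thesis using 2 c by (simp add: favard_kernel_def)
  next
   case 3
   have "jw b a (-x) <= 2 powr a * jw b a (-z)"
    using 3 c ab x z by (intro jacobi_le_tail) auto
   then have "jw a b x <= E / ?D\<^sup>2 * jw a b z"
    by (intro tail[of "2 powr a"]) (use 3 c x z E favard_kernel_tail_dfac[OF n x z] in \<open>auto simp: jacobi_reflect\<close>)
   then show ?thesis using 3 c by (simp add: favard_kernel_def)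
  next
   case 4 then show ?thesis using E J D by simp
  qed
 qed
 show "\<exists>B>0. \<forall>n\<ge>1. \<forall>x\<in>\<I>.
  (\<integral>z\<in>\<I>. ennreal (jw a b x) * ennreal (favard_kernel C M n x z) * ennreal (1 / (jw a b z * varphi z))) <= ennreal (B / real n)"
 proof (intro exI[of _ "2 * E"] conjI allI impI ballI)
  show "0 < 2 * E" using E by simp
  fix n :: nat and x :: real assume n: "1 <= n" and x: "x \<in> \<I>"
  have "(\<integral>z\<in>\<I>. ennreal (jw a b x) * ennreal (favard_kernel C M n x z) * ennreal (1 / (jw a b z * varphi z)))
   <= (\<integral>z. ennreal E * (ennreal (1 / (varphi z * (dfac' n x z)\<^sup>2)) * indicator \<I> z))"
  proof (rule nn_integral_mono)
   fix z :: real
   show "ennreal (jw a b x) * ennreal (favard_kernel C M n x z) * ennreal (1 / (jw a b z * varphi z)) * indicator \<I> z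
    <= ennreal E * (ennreal (1 / (varphi z * (dfac' n x z)\<^sup>2)) * indicator \<I> z)"
   proof (cases "z \<in> \<I>")
    case z: True
    have v: "0 < varphi z" "0 < jw a b z" "0 < jw a b x" using varphi_pos jacobi_pos x z by auto
    have k0: "0 <= favard_kernel C M n x z" using C dfac'_pos[of n x z] by (auto simp: favard_kernel_def)
    have "jw a b x * favard_kernel C M n x z * (1 / (jw a b z * varphi z))
     <= E / (dfac' n x z)\<^sup>2 * jw a b z * (1 / (jw a b z * varphi z))"
     using key[OF n x z] v by (intro mult_right_mono) auto
    also have "... = E * (1 / (varphi z * (dfac' n x z)\<^sup>2))" using v by simp
    finally have "ennreal (jw a b x * favard_kernel C M n x z * (1 / (jw a b z * varphi z))) <= ennreal (E * (1 / (varphi z * (dfac' n x z)\<^sup>2)))"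
     by (rule ennreal_leI)
    moreover have "ennreal (jw a b x * favard_kernel C M n x z * (1 / (jw a b z * varphi z))) = ennreal (jw a b x) * ennreal (favard_kernel C M n x z) * ennreal (1 / (jw a b z * varphi z))"
     using v k0 by (subst ennreal_mult, simp, simp, subst ennreal_mult) auto
    moreover have "ennreal (E * (1 / (varphi z * (dfac' n x z)\<^sup>2))) = ennreal E * ennreal (1 / (varphi z * (dfac' n x z)\<^sup>2))"
     using E v by (intro ennreal_mult) auto
    ultimately show ?thesis using z by simp
   qed simp
  qed
  also have "... = ennreal E * (\<integral>z\<in>\<I>. ennreal (1 / (varphi z * (dfac' n x z)\<^sup>2)))"
   by (rule nn_integral_cmult) measurable
  also have "... <= ennreal E * ennreal (2 / real n)"
   using x n by (intro mult_left_mono nn_integral_dfac) auto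
  also have "... = ennreal (2 * E / real n)" using E by (simp add: ennreal_mult[symmetric] mult.commute)
  finally show "(\<integral>z\<in>\<I>. ennreal (jw a b x) * ennreal (favard_kernel C M n x z) * ennreal (1 / (jw a b z * varphi z))) <= ennreal (2 * E / real n)" .
 qed
qed


text \<open>The derivative relation in integrated form, with the gauge integral: insensitive to null
  sets, and meaningful for \<open>D\<close> that is not absolutely integrable.\<close>

definition primitive_on :: "real set => (real => real) => (real => real) => bool" where
 "primitive_on S g D \<longleftrightarrow> (\<forall>x\<in>S. \<forall>y\<in>S. x <= y --> (D has_integral (g y - g x)) {x..y})"

lemma primitive_on_continuous:
 assumes "primitive_on S g D" "{a..b} \<subseteq> S"
 shows "continuous_on {a..b} g"
proof (cases "a <= b")
 case True
 then have ab: "a \<in> S" using assms by auto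
 have I: "(D has_integral (g y - g a)) {a..y}" if "y \<in> {a..b}" for y
  using assms that ab unfolding primitive_on_def by (meson atLeastAtMost_iff subsetD)
 have "D integrable_on {a..b}" using I[of b] True by (auto simp: integrable_on_def)
 then have "continuous_on {a..b} (\<lambda>y. integral {a..y} D)" by (rule indefinite_integral_continuous_1)
 then have "continuous_on {a..b} (\<lambda>y. g a + integral {a..y} D)" by (intro continuous_intros)
 then show ?thesis
 proof (rule continuous_on_eq)
  fix y assume "y \<in> {a..b}"
  then show "g a + integral {a..y} D = g y" using integral_unique[OF I] by simp
 qed
qed simp

lemma primitive_on_abs_diff_le:
 assumes "primitive_on S g D" "x \<in> S" "y \<in> S" and [measurable]: "D \<in> \<B>"
 shows "ennreal \<bar>g x - g y\<bar> <= (\<integral>z\<in>{min x y..max x y}. ennreal \<bar>D z\<bar>)"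
proof (cases "x <= y")
 case True
 then have "(D has_integral (g y - g x)) {x..y}" using assms unfolding primitive_on_def by blast
 from has_integral_abs_le_nn_integral[OF this] show ?thesis using True assms(4) by (simp add: abs_minus_commute)
next
 case False
 then have "(D has_integral (g x - g y)) {y..x}" using assms unfolding primitive_on_def by auto
 from has_integral_abs_le_nn_integral[OF this] show ?thesis using False assms(4) by simp
qed

section \<open>The weighted Favard inequality\<close>

text \<open>The Jackson operator acts on \<open>g\<close> frozen outside \<open>[-c,c]\<close>,
  \<open>c = cos (1/n)\<close>, which is bounded and continuous on the whole line although
  \<open>g\<close> may be unbounded. The error of freezing is an integral of \<open>D\<close>
  between \<open>x\<close> and its projection to \<open>[-c,c]\<close>, that is, the indicator part
  of the kernel.\<close>

lemma favard_pointwise: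
 "\<exists>C>0. \<forall>n\<ge>1. \<forall>g D. D \<in> \<B> --> primitive_on \<I> g D -->
  (\<exists>Q\<in>polys n. \<forall>x\<in>\<I>. ennreal \<bar>g x - poly Q x\<bar> <= (\<integral>z\<in>\<I>. ennreal (favard_kernel C M n x z) * ennreal \<bar>D z\<bar>))"
proof -
 obtain C where C: "C > 0" and K: "\<And>n g b. n >= 1 ==> g \<in> \<B> ==> (\<And>x. \<bar>g x\<bar> <= (b::real)) ==> (\<exists>Q\<in>polys n. \<forall>x\<in>{-1..1}.
  \<forall>u\<in>\<B>. (\<forall>y\<in>{-1..1}. ennreal \<bar>g x - g y\<bar> <= (\<integral>z\<in>{min x y..max x y}. u z)) -->
   ennreal \<bar>g x - poly Q x\<bar> <= (\<integral>z\<in>{-1..1}. ennreal (C / dfac' n x z ^ M) * u z))"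
  using jackson_integral[of M] by blast
 show ?thesis
 proof (intro exI[of _ C] conjI C allI impI)
  fix n :: nat and g D :: "real => real"
  assume n: "1 <= n" and D [measurable]: "D \<in> \<B>" and gD: "primitive_on \<I> g D"
  define c where "c = cos (1 / real n)"
  have c: "0 < c" "c < 1" using cos_inverse_nat[OF n] by (auto simp: c_def)
  define cl where "cl x = max (- c) (min c x)" for x
  define g1 where "g1 x = g (cl x)" for x
  have cl: "cl x \<in> {-c..c}" for x using c by (auto simp: cl_def)
  have cl1: "cl x \<in> \<I>" for x using c cl[of x] by auto
  have cont: "continuous_on {-c..c} g" by (rule primitive_on_continuous[OF gD]) (use c in auto)
  have "continuous_on UNIV g1"
   unfolding g1_def
  proof (rule continuous_on_compose2[OF cont])
   show "continuous_on UNIV cl" unfolding cl_def by (intro continuous_intros)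
  qed (use cl in auto)
  then have g1m: "g1 \<in> \<B>" by (rule borel_measurable_continuous_onI)
  have "bounded (g ` {-c..c})" by (rule compact_imp_bounded[OF compact_continuous_image[OF cont compact_Icc]])
  then obtain b where b: "\<And>y. y \<in> {-c..c} ==> \<bar>g y\<bar> <= b"
   unfolding bounded_iff real_norm_def by blast
  obtain Q where Q: "Q \<in> polys n" "\<And>x u. x \<in> {-1..1} ==> u \<in> \<B> ==> (\<And>y. y \<in> {-1..1} ==> ennreal \<bar>g1 x - g1 y\<bar> <= (\<integral>z\<in>{min x y..max x y}. u z)) ==>
   ennreal \<bar>g1 x - poly Q x\<bar> <= (\<integral>z\<in>{-1..1}. ennreal (C / dfac' n x z ^ M) * u z)"
   using K[OF n g1m, of b] b cl unfolding g1_def by blast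
  show "\<exists>Q\<in>polys n. \<forall>x\<in>\<I>. ennreal \<bar>g x - poly Q x\<bar> <= (\<integral>z\<in>\<I>. ennreal (favard_kernel C M n x z) * ennreal \<bar>D z\<bar>)"
  proof (intro bexI[OF _ Q(1)] ballI)
   fix x :: real assume x: "x \<in> \<I>"
   let ?u = "\<lambda>z. ennreal \<bar>D z\<bar> * indicator {-c..c} z"
   have 1: "ennreal \<bar>g1 x - poly Q x\<bar> <= (\<integral>z\<in>{-1..1}. ennreal (C / dfac' n x z ^ M) * ?u z)"
   proof (rule Q(2))
    fix y :: real
    have "ennreal \<bar>g1 x - g1 y\<bar> <= (\<integral>z\<in>{min (cl x) (cl y)..max (cl x) (cl y)}. ennreal \<bar>D z\<bar>)"
     unfolding g1_def by (rule primitive_on_abs_diff_le[OF gD cl1 cl1 D])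
    also have "... <= (\<integral>z\<in>{min x y..max x y}. ?u z)"
    proof (rule nn_integral_mono_AE)
     \<comment> \<open>If \<open>cl x = cl y\<close>, the interval between them is one point that
       need not lie between \<open>x\<close> and \<open>y\<close>; as a null set it can be left
       out.\<close>
     have "AE z::real in lborel. z ~= cl x" by (rule AE_lborel_singleton)
     then show "AE z in lborel. ennreal \<bar>D z\<bar> * indicator {min (cl x) (cl y)..max (cl x) (cl y)} z <= ?u z * indicator {min x y..max x y} z"
     proof eventually_elim
      case (elim z)
      have "z \<in> {min x y..max x y} \<and> z \<in> {-c..c}" if "z \<in> {min (cl x) (cl y)..max (cl x) (cl y)}"
       using that c elim unfolding cl_def by (auto simp: min_def max_def split: if_splits)
      then show ?case by (auto simp: indicator_def)
     qed
    qed
    finally show "ennreal \<bar>g1 x - g1 y\<bar> <= (\<integral>z\<in>{min x y..max x y}. ?u z)" .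
   qed (use x in auto)
   have 2: "ennreal \<bar>g x - g1 x\<bar> <= (\<integral>z\<in>{min x (cl x)..max x (cl x)}. ennreal \<bar>D z\<bar>)"
    unfolding g1_def by (rule primitive_on_abs_diff_le[OF gD x cl1 D])
   have [measurable]: "(\<lambda>z. favard_kernel C M n x z) \<in> \<B>" "(\<lambda>z. dfac' n x z) \<in> \<B>" by measurable
   have "ennreal \<bar>g x - poly Q x\<bar> <= ennreal (\<bar>g x - g1 x\<bar> + \<bar>g1 x - poly Q x\<bar>)" by (intro ennreal_leI) linarith
   also have "... = ennreal \<bar>g x - g1 x\<bar> + ennreal \<bar>g1 x - poly Q x\<bar>" by simp
   also have "... <= (\<integral>z\<in>{min x (cl x)..max x (cl x)}. ennreal \<bar>D z\<bar>) + (\<integral>z\<in>{-1..1}. ennreal (C / dfac' n x z ^ M) * ?u z)"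
    by (intro add_mono 1 2)
   also have "... = (\<integral>z. ennreal \<bar>D z\<bar> * indicator {min x (cl x)..max x (cl x)} z + ennreal (C / dfac' n x z ^ M) * ?u z * indicator {-1..1} z)"
    by (rule nn_integral_add[symmetric]) measurable
   also have "... <= (\<integral>z\<in>\<I>. ennreal (favard_kernel C M n x z) * ennreal \<bar>D z\<bar>)"
   proof (rule nn_integral_mono_AE)
    have "AE z::real in lborel. z ~= c \<and> z ~= - c \<and> z ~= x" by (intro AE_conjI AE_lborel_singleton)
    then show "AE z in lborel. ennreal \<bar>D z\<bar> * indicator {min x (cl x)..max x (cl x)} z + ennreal (C / dfac' n x z ^ M) * ?u z * indicator {-1..1} z
     <= ennreal (favard_kernel C M n x z) * ennreal \<bar>D z\<bar> * indicator \<I> z"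
    proof eventually_elim
     case (elim z)
     show ?case
     proof (cases "z \<in> {-c..c}")
      case True
      then have "z \<notin> {min x (cl x)..max x (cl x)}" using elim c unfolding cl_def by (auto simp: min_def max_def split: if_splits)
      then show ?thesis using True c by (auto simp: favard_kernel_def c_def[symmetric] indicator_def)
     next
      case False
      have "z \<in> \<I> \<and> favard_kernel C M n x z = 1" if "z \<in> {min x (cl x)..max x (cl x)}"
       using that False c x unfolding cl_def favard_kernel_def c_def[symmetric] by (auto simp: min_def max_def split: if_splits)
      then show ?thesis using False by (auto simp: indicator_def)
     qed
    qed
   qed
   finally show "ennreal \<bar>g x - poly Q x\<bar> <= (\<integral>z\<in>\<I>. ennreal (favard_kernel C M n x z) * ennreal \<bar>D z\<bar>)" .
  qed
 qed
qed

text \<open>For finite \<open>p\<close> the columns see the weight with exponents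
  \<open>\<alpha>*p\<close> and \<open>\<beta>*p\<close>, and \<open>J_p\<close> says exactly that
  these exceed \<open>-1\<close>; for \<open>p = \<infinity>\<close> it says that the exponents are
  nonnegative, as the row estimate requires.\<close>

theorem favard:
 assumes p: "1 <= p" and \<alpha>: "\<alpha> \<in> J_set p" and \<beta>: "\<beta> \<in> J_set p"
 shows "\<exists>C>0. \<forall>n\<ge>1. \<forall>g D c. 0 < c --> D \<in> \<B> --> primitive_on \<I> g D -->
  Lp_le p (\<lambda>z. ennreal (jw \<alpha> \<beta> z * varphi z) * ennreal \<bar>D z\<bar>) c -->
  (\<exists>Q\<in>polys n. Lp_le p (\<lambda>x. ennreal (jw \<alpha> \<beta> x) * ennreal \<bar>g x - poly Q x\<bar>) (C / real n * c))"
proof -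
 have main: "\<exists>M. \<forall>C\<ge>4. \<exists>B>0. \<forall>n\<ge>1. \<forall>u c. 0 < c --> u \<in> \<B> --> Lp_le p (\<lambda>z. ennreal (jw \<alpha> \<beta> z * varphi z) * u z) c -->
  Lp_le p (\<lambda>x. ennreal (jw \<alpha> \<beta> x) * (\<integral>z\<in>\<I>. ennreal (favard_kernel C M n x z) * u z)) (B / real n * c)"
 proof (cases "p = \<infinity>")
  case True
  then have ab: "0 <= \<alpha>" "0 <= \<beta>" using \<alpha> \<beta> by (auto simp: J_set_def)
  obtain M where M: "\<And>C. C > 0 ==> \<exists>B>0. \<forall>n\<ge>1. \<forall>x\<in>\<I>.
  (\<integral>z\<in>\<I>. ennreal (jw \<alpha> \<beta> x) * ennreal (favard_kernel C M n x z) * ennreal (1 / (jw \<alpha> \<beta> z * varphi z))) <= ennreal (B / real n)"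
   using favard_row_inf[OF ab] by blast
  show ?thesis
  proof (rule exI[of _ M], intro allI impI)
   fix C :: real assume C: "4 <= C"
   then obtain B where B: "B > 0" "\<And>n x. n >= 1 ==> x \<in> \<I> ==>
    (\<integral>z\<in>\<I>. ennreal (jw \<alpha> \<beta> x) * ennreal (favard_kernel C M n x z) * ennreal (1 / (jw \<alpha> \<beta> z * varphi z))) <= ennreal (B / real n)"
    using M[of C] by auto
   show "\<exists>B>0. \<forall>n\<ge>1. \<forall>u c. 0 < c --> u \<in> \<B> --> Lp_le p (\<lambda>z. ennreal (jw \<alpha> \<beta> z * varphi z) * u z) c -->
  Lp_le p (\<lambda>x. ennreal (jw \<alpha> \<beta> x) * (\<integral>z\<in>\<I>. ennreal (favard_kernel C M n x z) * u z)) (B / real n * c)"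
   proof (intro exI[of _ B] conjI B(1) allI impI)
    fix n :: nat and u c assume n: "1 <= n" and c: "0 < (c::real)" and [measurable]: "u \<in> \<B>"
     and u: "Lp_le p (\<lambda>z. ennreal (jw \<alpha> \<beta> z * varphi z) * u z) c"
    show "Lp_le p (\<lambda>x. ennreal (jw \<alpha> \<beta> x) * (\<integral>z\<in>\<I>. ennreal (favard_kernel C M n x z) * u z)) (B / real n * c)"
     unfolding True
    proof (rule schur_inf)
     show "0 < B / real n" using B n by simp
     show "Lp_le \<infinity> (\<lambda>z. ennreal (jw \<alpha> \<beta> z * varphi z) * u z) c" using u True by simp
    qed (use B(2)[OF n] c jacobi_pos in \<open>simp_all\<close>)
   qed
  qed
 next
  case False
  define q where "q = enn2real p"
  have q: "1 <= q" using enn2real_ge1 p False by (simp add: q_def)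
  have ab: "\<alpha> * q > -1" "\<beta> * q > -1" using \<alpha> \<beta> False q by (auto simp: J_set_def q_def[symmetric] field_simps)
  obtain C1 C2 M0 where C12: "C1 > 0" "C2 > 0" and col: "\<forall>M\<ge>M0. \<forall>C>0. \<forall>n\<ge>1. \<forall>z\<in>\<I>.
   (\<integral>x\<in>\<I>. ennreal (jw (\<alpha> * q) (\<beta> * q) x) * ennreal (favard_kernel C M n x z))
   <= ennreal ((C * C1 + C2) / real n * (jw (\<alpha> * q) (\<beta> * q) z * varphi z))"
   using favard_column[OF ab] by (elim exE conjE) (rule that)
  define M where "M = max M0 2"
  show ?thesis
  proof (rule exI[of _ M], intro allI impI)
   fix C :: real assume C: "4 <= C"
   define B where "B = C * C1 + C2 + 2 * C"
   have B: "B > 0" "C * C1 + C2 <= B" "2 * C <= B" using C C12 by (auto simp: B_def intro!: add_pos_pos)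
   show "\<exists>B>0. \<forall>n\<ge>1. \<forall>u c. 0 < c --> u \<in> \<B> --> Lp_le p (\<lambda>z. ennreal (jw \<alpha> \<beta> z * varphi z) * u z) c -->
  Lp_le p (\<lambda>x. ennreal (jw \<alpha> \<beta> x) * (\<integral>z\<in>\<I>. ennreal (favard_kernel C M n x z) * u z)) (B / real n * c)"
   proof (intro exI[of _ B] conjI B(1) allI impI)
    fix n :: nat and u c assume n: "1 <= n" and c: "0 < (c::real)" and [measurable]: "u \<in> \<B>"
     and u: "Lp_le p (\<lambda>z. ennreal (jw \<alpha> \<beta> z * varphi z) * u z) c"
    show "Lp_le p (\<lambda>x. ennreal (jw \<alpha> \<beta> x) * (\<integral>z\<in>\<I>. ennreal (favard_kernel C M n x z) * u z)) (B / real n * c)"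
    proof (rule schur_finite[OF p False])
     fix x :: real assume x: "x \<in> \<I>"
     show "0 < jw \<alpha> \<beta> x" by (rule jacobi_pos[OF x])
     have "(\<integral>z\<in>\<I>. ennreal (favard_kernel C M n x z) * ennreal (1 / varphi z)) <= ennreal (2 * C / real n)"
      using n x C by (intro favard_row) (auto simp: M_def)
     also have "... <= ennreal (B / real n)" using B by (intro ennreal_leI divide_right_mono) auto
     finally show "(\<integral>z\<in>\<I>. ennreal (favard_kernel C M n x z) * ennreal (1 / varphi z)) <= ennreal (B / real n)" .
    next
     fix z :: real assume z: "z \<in> \<I>"
     have "(\<integral>x\<in>\<I>. ennreal (jw \<alpha> \<beta> x powr enn2real p) * ennreal (favard_kernel C M n x z))
      = (\<integral>x\<in>\<I>. ennreal (jw (\<alpha> * q) (\<beta> * q) x) * ennreal (favard_kernel C M n x z))"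
      by (intro nn_integral_cong) (auto simp: indicator_def jacobi_powr q_def)
     also have "... <= ennreal ((C * C1 + C2) / real n * (jw (\<alpha> * q) (\<beta> * q) z * varphi z))"
      using n z C by (intro col[rule_format]) (auto simp: M_def)
     also have "... <= ennreal (B / real n * (jw (\<alpha> * q) (\<beta> * q) z * varphi z))"
      using B jacobi_pos[OF z, of "\<alpha> * q" "\<beta> * q"] varphi_pos[OF z] by (intro ennreal_leI mult_right_mono divide_right_mono) auto
     finally show "(\<integral>x\<in>\<I>. ennreal (jw \<alpha> \<beta> x powr enn2real p) * ennreal (favard_kernel C M n x z))
      <= ennreal (B / real n * (jw \<alpha> \<beta> z powr enn2real p * varphi z))"
      using z by (simp add: jacobi_powr q_def)
    qed (use B n c u in auto)
   qed
  qed
 qed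
 then obtain M where M: "\<And>C. 4 <= C ==> \<exists>B>0. \<forall>n\<ge>1. \<forall>u c. 0 < c --> u \<in> \<B> --> Lp_le p (\<lambda>z. ennreal (jw \<alpha> \<beta> z * varphi z) * u z) c -->
  Lp_le p (\<lambda>x. ennreal (jw \<alpha> \<beta> x) * (\<integral>z\<in>\<I>. ennreal (favard_kernel C M n x z) * u z)) (B / real n * c)"
  by blast
 obtain C0 where C0: "C0 > 0" and P: "\<And>n g D. n >= 1 ==> D \<in> \<B> ==> primitive_on \<I> g D ==>
  (\<exists>Q\<in>polys n. \<forall>x\<in>\<I>. ennreal \<bar>g x - poly Q x\<bar> <= (\<integral>z\<in>\<I>. ennreal (favard_kernel C0 M n x z) * ennreal \<bar>D z\<bar>))"
  using favard_pointwise[of M] by blast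
 \<comment> \<open>The kernel increases with \<open>C\<close>, so the Jackson constant may be raised
   to at least 4.\<close>
 define C where "C = max 4 C0"
 obtain B where B: "B > 0" "\<And>n u c. n >= 1 ==> 0 < c ==> u \<in> \<B> ==> Lp_le p (\<lambda>z. ennreal (jw \<alpha> \<beta> z * varphi z) * u z) c ==>
  Lp_le p (\<lambda>x. ennreal (jw \<alpha> \<beta> x) * (\<integral>z\<in>\<I>. ennreal (favard_kernel C M n x z) * u z)) (B / real n * c)"
  using M[of C] by (auto simp: C_def)
 show ?thesis
 proof (intro exI[of _ B] conjI B(1) allI impI)
  fix n :: nat and g D :: "real => real" and c :: real
  assume n: "1 <= n" and c: "0 < c" and D [measurable]: "D \<in> \<B>" and gD: "primitive_on \<I> g D"
   and u: "Lp_le p (\<lambda>z. ennreal (jw \<alpha> \<beta> z * varphi z) * ennreal \<bar>D z\<bar>) c"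
  obtain Q where Q: "Q \<in> polys n" "\<And>x. x \<in> \<I> ==> ennreal \<bar>g x - poly Q x\<bar> <= (\<integral>z\<in>\<I>. ennreal (favard_kernel C0 M n x z) * ennreal \<bar>D z\<bar>)"
   using P[OF n D gD] by blast
  show "\<exists>Q\<in>polys n. Lp_le p (\<lambda>x. ennreal (jw \<alpha> \<beta> x) * ennreal \<bar>g x - poly Q x\<bar>) (B / real n * c)"
  proof (rule bexI[OF _ Q(1)])
   have L: "Lp_le p (\<lambda>x. ennreal (jw \<alpha> \<beta> x) * (\<integral>z\<in>\<I>. ennreal (favard_kernel C M n x z) * ennreal \<bar>D z\<bar>)) (B / real n * c)"
    by (rule B(2)[OF n c _ u]) measurable
   show "Lp_le p (\<lambda>x. ennreal (jw \<alpha> \<beta> x) * ennreal \<bar>g x - poly Q x\<bar>) (B / real n * c)"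
   proof (rule Lp_le_mono[OF p L _ order_refl])
    show "0 < B / real n * c" using B n c by simp
    fix x :: real assume x: "x \<in> \<I>"
    have "favard_kernel C0 M n x z <= favard_kernel C M n x z" for z
     unfolding favard_kernel_def C_def using dfac'_pos[of n x z] by (auto intro!: divide_right_mono)
    then have "(\<integral>z\<in>\<I>. ennreal (favard_kernel C0 M n x z) * ennreal \<bar>D z\<bar>) <= (\<integral>z\<in>\<I>. ennreal (favard_kernel C M n x z) * ennreal \<bar>D z\<bar>)"
     by (intro nn_integral_mono mult_right_mono ennreal_leI) auto
    then show "ennreal (jw \<alpha> \<beta> x) * ennreal \<bar>g x - poly Q x\<bar> <= ennreal (jw \<alpha> \<beta> x) * (\<integral>z\<in>\<I>. ennreal (favard_kernel C M n x z) * ennreal \<bar>D z\<bar>)"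
     using Q(2)[OF x] by (intro mult_left_mono) auto
   qed
  qed
 qed
qed

section \<open>Local Whitney estimates\<close>

definition fdiff1 :: "real => (real => real) => real => real" where
 "fdiff1 s F x = F (x + s) - F x"

definition fdiff :: "nat => real => (real => real) => real => real" where
 "fdiff k s F x = (\<Sum>i\<le>k. real (k choose i) * (-1) ^ (k - i) * F (x + real i * s))"

lemma fdiff_iterate: "(fdiff1 s ^^ k) F x = fdiff k s F x"
proof (induction k arbitrary: x)
 case 0 then show ?case by (simp add: fdiff_def)
next
 case (Suc k)
 let ?f = "\<lambda>i. F (x + real i * s)"
 have "(fdiff1 s ^^ Suc k) F x = fdiff k s F (x + s) - fdiff k s F x" by (simp add: fdiff1_def Suc)
 also have "fdiff k s F (x + s) = (\<Sum>i\<le>k. real (k choose i) * (-1) ^ (k - i) * ?f (Suc i))"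
  unfolding fdiff_def by (intro sum.cong) (auto simp: algebra_simps)
 also have "... = (\<Sum>i\<le>Suc k. (if i = 0 then 0 else real (k choose (i - 1)) * (-1) ^ (Suc k - i) * ?f i))"
  by (subst sum.atMost_Suc_shift) simp
 also have "fdiff k s F x = (\<Sum>i\<le>Suc k. - (real (k choose i) * (-1) ^ (Suc k - i) * ?f i))"
  unfolding fdiff_def by (simp add: Suc_diff_le binomial_eq_0)
 also have "(\<Sum>i\<le>Suc k. (if i = 0 then 0 else real (k choose (i - 1)) * (-1) ^ (Suc k - i) * ?f i)) - (\<Sum>i\<le>Suc k. - (real (k choose i) * (-1) ^ (Suc k - i) * ?f i))
  = (\<Sum>i\<le>Suc k. real (Suc k choose i) * (-1) ^ (Suc k - i) * ?f i)"
  unfolding sum_subtractf[symmetric]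
 proof (rule sum.cong)
  fix i
  show "(if i = 0 then 0 else real (k choose (i - 1)) * (-1) ^ (Suc k - i) * ?f i) - - (real (k choose i) * (-1) ^ (Suc k - i) * ?f i)
   = real (Suc k choose i) * (-1) ^ (Suc k - i) * ?f i"
   by (cases i) (auto simp: algebra_simps)
 qed simp
 finally show ?case by (simp add: fdiff_def)
qed

definition locint :: "real => real => (real => real) => bool" where
 "locint a b F \<longleftrightarrow> (\<forall>x y. a < x \<and> x <= y \<and> y <= b --> F integrable_on {x..y})"

lemma locint_mono: "locint a b F ==> b' <= b ==> locint a b' F"
 unfolding locint_def by auto

text \<open>The Steklov mean without its normalizing factor \<open>1/s\<close>.\<close>

definition winint :: "real => (real => real) => real => real" where
 "winint s F x = integral {x..x + s} F"

lemma winint_Suc: "(winint s ^^ Suc k) F x = integral {x..x + s} ((winint s ^^ k) F)"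
 by (simp add: winint_def[of s "(winint s ^^ k) F"])

lemma primitive_on_winint:
 assumes F: "locint a (b + s) F" and s: "0 <= s"
 shows "primitive_on {a<..b} (winint s F) (fdiff1 s F)"
 unfolding primitive_on_def
proof (intro ballI impI)
 fix x y assume xy: "x \<in> {a<..b}" "y \<in> {a<..b}" "x <= y"
 have I: "F integrable_on {u..v}" if "a < u" "v <= b + s" for u v
  using F that unfolding locint_def by (cases "u <= v") auto
 have 1: "(F has_integral integral {x..y} F) {x..y}" using xy s by (intro integrable_integral I) auto
 have "(F has_integral integral {x + s..y + s} F) {x + s..y + s}" using xy s by (intro integrable_integral I) auto
 then have "((F \<circ> (+) s) has_integral integral {x + s..y + s} F) {x..y}" by (simp only: has_integral_shift_Icc_real)
 then have 2: "((\<lambda>z. F (z + s)) has_integral integral {x + s..y + s} F) {x..y}" by (simp add: o_def add.commute)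
 have "((\<lambda>z. F (z + s) - F z) has_integral (integral {x + s..y + s} F - integral {x..y} F)) {x..y}"
  by (rule has_integral_diff[OF 2 1])
 moreover have "integral {x + s..y + s} F - integral {x..y} F = winint s F y - winint s F x"
 proof -
  have "integral {x..x + s} F + integral {x + s..y + s} F = integral {x..y + s} F"
   using xy s by (intro Henstock_Kurzweil_Integration.integral_combine I) auto
  moreover have "integral {x..y} F + integral {y..y + s} F = integral {x..y + s} F"
   using xy s by (intro Henstock_Kurzweil_Integration.integral_combine I) auto
  ultimately show ?thesis by (simp add: winint_def)
 qed
 ultimately show "(fdiff1 s F has_integral winint s F y - winint s F x) {x..y}" by (simp add: fdiff1_def[abs_def])
qed

lemma primitive_on_locint:
 assumes "primitive_on {a<..b} g D" shows "locint a b g"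
 unfolding locint_def
proof (intro allI impI)
 fix x y assume "a < x \<and> x <= y \<and> y <= b"
 then have "continuous_on {x..y} g" by (intro primitive_on_continuous[OF assms]) auto
 then show "g integrable_on {x..y}" by (rule integrable_continuous_interval)
qed

lemma locint_winint: "locint a (b + s) F ==> 0 <= s ==> locint a b (winint s F)"
 by (rule primitive_on_locint[OF primitive_on_winint])

lemma locint_winint_iter: "locint a (b + real k * s) F ==> 0 <= s ==> locint a b ((winint s ^^ k) F)"
proof (induction k arbitrary: b)
 case (Suc k)
 have "locint a (b + s) ((winint s ^^ k) F)" using Suc.prems by (intro Suc.IH) (auto simp: algebra_simps)
 then show ?case using Suc.prems by (simp add: locint_winint)
qed simp

text \<open>\<open>h\<close> arises from \<open>v\<close> by \<open>j\<close> successive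
  integrations with arbitrary constants; the intermediate functions stay hidden. This replaces
  statements about \<open>j\<close>-th derivatives.\<close>

primrec iprim :: "nat => real set => (real => real) => (real => real) => bool" where
 "iprim 0 S v h = (\<forall>x\<in>S. h x = v x)"
| "iprim (Suc j) S v h = (\<exists>h'. iprim j S v h' \<and> primitive_on S h h')"

lemma primitive_on_fdiff1:
 assumes "primitive_on {a<..b + s} h D" "0 <= s"
 shows "primitive_on {a<..b} (fdiff1 s h) (fdiff1 s D)"
 unfolding primitive_on_def
proof (intro ballI impI)
 fix x y assume xy: "x \<in> {a<..b}" "y \<in> {a<..b}" "x <= y"
 have 1: "(D has_integral h y - h x) {x..y}" using assms xy unfolding primitive_on_def by auto
 have "(D has_integral h (y + s) - h (x + s)) {x + s..y + s}" using assms xy unfolding primitive_on_def by auto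
 then have "((D \<circ> (+) s) has_integral h (y + s) - h (x + s)) {x..y}" by (simp only: has_integral_shift_Icc_real)
 then have 2: "((\<lambda>z. D (z + s)) has_integral h (y + s) - h (x + s)) {x..y}" by (simp add: o_def add.commute)
 have "((\<lambda>z. D (z + s) - D z) has_integral ((h (y + s) - h (x + s)) - (h y - h x))) {x..y}" by (rule has_integral_diff[OF 2 1])
 then show "(fdiff1 s D has_integral fdiff1 s h y - fdiff1 s h x) {x..y}" by (simp add: fdiff1_def[abs_def] algebra_simps)
qed

lemma iprim_fdiff1:
 "iprim j {a<..b + s} v h ==> 0 <= s ==> iprim j {a<..b} (fdiff1 s v) (fdiff1 s h)"
proof (induction j arbitrary: h)
 case 0 then show ?case by (auto simp: fdiff1_def)
next
 case (Suc j)
 then obtain h' where h': "iprim j {a<..b + s} v h'" "primitive_on {a<..b + s} h h'" by auto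
 then show ?case using Suc.IH[OF h'(1) Suc.prems(2)] primitive_on_fdiff1[OF h'(2) Suc.prems(2)] by auto
qed

text \<open>Integrating over a window turns differentiation into a difference, and differences pass
  through a whole chain of primitives. So the \<open>k\<close>-th derivative of the
  \<open>k\<close>-fold window integral is the \<open>k\<close>-th difference, without any
  smoothness of \<open>F\<close>.\<close>

lemma iprim_winint:
 "locint a (b + real k * s) F ==> 0 <= s ==> iprim k {a<..b} ((fdiff1 s ^^ k) F) ((winint s ^^ k) F)"
proof (induction k arbitrary: b)
 case (Suc k)
 have l: "locint a ((b + s) + real k * s) F" using Suc.prems by (simp add: algebra_simps)
 have "iprim k {a<..b + s} ((fdiff1 s ^^ k) F) ((winint s ^^ k) F)" by (rule Suc.IH[OF l Suc.prems(2)])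
 then have "iprim k {a<..b} ((fdiff1 s ^^ Suc k) F) (fdiff1 s ((winint s ^^ k) F))" using iprim_fdiff1 Suc.prems by auto
 moreover have "primitive_on {a<..b} ((winint s ^^ Suc k) F) (fdiff1 s ((winint s ^^ k) F))"
  using primitive_on_winint[OF locint_winint_iter[OF l Suc.prems(2)] Suc.prems(2)] by simp
 ultimately show ?case by auto
qed simp

lemma pderiv_sum: "pderiv (sum f I) = (\<Sum>i\<in>I. pderiv (f i))"
 by (induction I rule: infinite_finite_induct) (simp_all add: pderiv_add)

lemma poly_primitive:
 fixes P :: "real poly" assumes "P \<in> polys k"
 shows "\<exists>R\<in>polys (Suc k). poly R b = c \<and> (\<forall>x y. x <= y --> (poly P has_integral (poly R y - poly R x)) {x..y})"
proof -
 have ex: "\<exists>R0\<in>polys (Suc k). pderiv R0 = P"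
 proof -
  define R0 where "R0 = (\<Sum>i\<le>degree P. monom (coeff P i / real (Suc i)) (Suc i))"
  have "pderiv R0 = (\<Sum>i\<le>degree P. monom (coeff P i) i)"
   by (simp add: R0_def pderiv_sum pderiv_monom)
  also have "... = P" by (rule poly_as_sum_of_monoms)
  finally have d: "pderiv R0 = P" .
  have "R0 \<in> polys (Suc k)"
  proof (cases "P = 0")
   case True then show ?thesis by (simp add: R0_def polys_def)
  next
   case False
   then have "degree P < k" using assms by (auto simp: polys_def)
   then show ?thesis unfolding R0_def
    by (intro polys_sum) (auto simp: polys_def intro: le_less_trans[OF degree_monom_le])
  qed
  then show ?thesis using d by blast
 qed
 then obtain R0 where R0: "R0 \<in> polys (Suc k)" "pderiv R0 = P" by blast
 define R where "R = R0 + [:c - poly R0 b:]"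
 have "R \<in> polys (Suc k)"
  using R0(1) degree_add_le[of R0 k "[:c - poly R0 b:]"] by (auto simp: R_def polys_def less_Suc_eq_le)
 moreover have "pderiv R = P" using R0(2) by (simp add: R_def pderiv_add pderiv_pCons)
 then have "(poly P has_integral (poly R y - poly R x)) {x..y}" if "x <= y" for x y
  using that poly_DERIV[of R] by (intro fundamental_theorem_of_calculus)
   (auto simp: has_real_derivative_iff_has_vector_derivative[symmetric] intro: has_field_derivative_at_within)
 ultimately show ?thesis by (intro bexI[of _ R]) (auto simp: R_def)
qed

text \<open>Taylor expansion about the right end, which belongs to the interval while the left one
  does not: the polynomial for the derivative is integrated with the value at \<open>b\<close>
  matched, and each integration gains a factor \<open>b - x\<close>.\<close>

lemma iprim_taylor:
 assumes "iprim (Suc k) {a<..b} v h" "a < b" and v [measurable]: "v \<in> \<B>"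
 shows "\<exists>P\<in>polys (Suc k). \<forall>x\<in>{a<..b}. ennreal \<bar>h x - poly P x\<bar> <= ennreal ((b - x) ^ k) * (\<integral>z\<in>{x..b}. ennreal \<bar>v z\<bar>)"
 using assms(1)
proof (induction k arbitrary: h)
 case 0
 then obtain h' where h': "\<forall>x\<in>{a<..b}. h' x = v x" "primitive_on {a<..b} h h'" by auto
 show ?case
 proof (rule bexI[of _ "[:h b:]"], rule ballI)
  fix x assume x: "x \<in> {a<..b}"
  have "(h' has_integral h b - h x) {x..b}" using h'(2) x unfolding primitive_on_def by auto
  then have "(v has_integral h b - h x) {x..b}"
   by (rule has_integral_eq[rotated]) (use x h'(1) in auto)
  from has_integral_abs_le_nn_integral[OF this v]
  show "ennreal \<bar>h x - poly [:h b:] x\<bar> <= ennreal ((b - x) ^ 0) * (\<integral>z\<in>{x..b}. ennreal \<bar>v z\<bar>)"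
   by (simp add: abs_minus_commute)
 qed (simp add: polys_def)
next
 case (Suc k)
 then obtain h' where h': "iprim (Suc k) {a<..b} v h'" "primitive_on {a<..b} h h'" by auto
 obtain P where P: "P \<in> polys (Suc k)" "\<And>x. x \<in> {a<..b} ==> ennreal \<bar>h' x - poly P x\<bar> <= ennreal ((b - x) ^ k) * (\<integral>z\<in>{x..b}. ennreal \<bar>v z\<bar>)"
  using Suc.IH[OF h'(1)] by blast
 obtain R where R: "R \<in> polys (Suc (Suc k))" "poly R b = h b" "\<And>x y. x <= y ==> (poly P has_integral (poly R y - poly R x)) {x..y}"
  using poly_primitive[OF P(1), of b "h b"] by blast
 show ?case
 proof (rule bexI[OF _ R(1)], rule ballI)
  fix x assume x: "x \<in> {a<..b}"
  let ?I = "\<integral>\<^sup>+z\<in>{x..b}. ennreal \<bar>v z\<bar> \<partial>lborel"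
  show "ennreal \<bar>h x - poly R x\<bar> <= ennreal ((b - x) ^ Suc k) * ?I"
  proof (cases ?I)
   case top
   then show ?thesis using x R(2) by (cases "x = b") (auto simp: ennreal_mult_top)
  next
   case (real I)
   have bd: "\<bar>h' y - poly P y\<bar> <= (b - x) ^ k * I" if y: "y \<in> {x..b}" for y
   proof -
    have "ennreal \<bar>h' y - poly P y\<bar> <= ennreal ((b - y) ^ k) * (\<integral>z\<in>{y..b}. ennreal \<bar>v z\<bar>)"
     using x y by (intro P(2)) auto
    also have "... <= ennreal ((b - x) ^ k) * ?I"
     using x y by (intro mult_mono ennreal_leI power_mono nn_integral_mono) (auto simp: indicator_def)
    also have "... = ennreal ((b - x) ^ k * I)" using real x by (simp add: ennreal_mult)
    finally show ?thesis using real x by (subst (asm) ennreal_le_iff) auto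
   qed
   have "(h' has_integral h b - h x) {x..b}" using h'(2) x unfolding primitive_on_def by auto
   then have "((\<lambda>z. h' z - poly P z) has_integral ((h b - h x) - (poly R b - poly R x))) {x..b}"
    using R(3)[of x b] x by (intro has_integral_diff) auto
   then have "((\<lambda>z. h' z - poly P z) has_integral (poly R x - h x)) (cbox x b)" using R(2) by simp
   then have "norm (poly R x - h x) <= ((b - x) ^ k * I) * measure lborel (cbox x b)"
    by (rule has_integral_bound[rotated]) (use bd real x in auto)
   then have "\<bar>h x - poly R x\<bar> <= (b - x) ^ Suc k * I" using x by (simp add: abs_minus_commute mult_ac)
   then have "ennreal \<bar>h x - poly R x\<bar> <= ennreal ((b - x) ^ Suc k * I)" by (rule ennreal_leI)
   then show ?thesis using real x by (simp add: ennreal_mult)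
  qed
 qed
qed

text \<open>Integrability of either side implies that of the other, and otherwise both integrals are
  0 by convention; so the identity holds unconditionally and can be iterated freely.\<close>

lemma integral_scale:
 fixes f :: "real => real"
 assumes \<sigma>: "\<sigma> > 0"
 shows "integral {x + \<sigma> * t..x + \<sigma> * t + \<sigma>} f = \<sigma> * integral {t..t + 1} (\<lambda>u. f (x + \<sigma> * u))"
proof -
 let ?A = "{x + \<sigma> * t..x + \<sigma> * t + \<sigma>}" and ?g = "\<lambda>u. f (x + \<sigma> * u)"
 have e: "(x + \<sigma> * t - x) /\<^sub>R \<sigma> = t" "(x + \<sigma> * t + \<sigma> - x) /\<^sub>R \<sigma> = t + 1" using \<sigma> by (auto simp: field_simps)
 have iff: "(?g has_integral (I / \<sigma>)) {t..t + 1} \<longleftrightarrow> (f has_integral I) ?A" for I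
  using has_integral_affinity_iff[OF \<sigma>, of f x I "x + \<sigma> * t" "x + \<sigma> * t + \<sigma>"] unfolding e
  by (simp add: add.commute divide_inverse mult.commute)
 show ?thesis
 proof (cases "f integrable_on ?A")
  case True
  then have "(f has_integral integral ?A f) ?A" by (rule integrable_integral)
  then have "(?g has_integral (integral ?A f / \<sigma>)) {t..t + 1}" using iff by blast
  then have "integral {t..t + 1} ?g = integral ?A f / \<sigma>" by (rule integral_unique)
  then show ?thesis using \<sigma> by simp
 next
  case False
  have "\<not> ?g integrable_on {t..t + 1}"
  proof
   assume "?g integrable_on {t..t + 1}"
   then obtain J where "(?g has_integral J) {t..t + 1}" by (auto simp: integrable_on_def)
   then have "(?g has_integral (J * \<sigma> / \<sigma>)) {t..t + 1}" using \<sigma> by simp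
   then have "(f has_integral J * \<sigma>) ?A" using iff by blast
   then show False using False by (auto simp: integrable_on_def)
  qed
  then show ?thesis using False by (simp add: not_integrable_integral)
 qed
qed

lemma winint_iter_scale:
 assumes \<sigma>: "\<sigma> > 0"
 shows "(winint \<sigma> ^^ k) F (x + \<sigma> * t) = \<sigma> ^ k * (winint 1 ^^ k) (\<lambda>u. F (x + \<sigma> * u)) t"
proof (induction k arbitrary: t)
 case (Suc k)
 have "(winint \<sigma> ^^ Suc k) F (x + \<sigma> * t) = integral {x + \<sigma> * t..x + \<sigma> * t + \<sigma>} ((winint \<sigma> ^^ k) F)" by (rule winint_Suc)
 also have "... = \<sigma> * integral {t..t + 1} (\<lambda>u. (winint \<sigma> ^^ k) F (x + \<sigma> * u))" by (rule integral_scale[OF \<sigma>])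
 also have "... = \<sigma> * (\<sigma> ^ k * integral {t..t + 1} ((winint 1 ^^ k) (\<lambda>u. F (x + \<sigma> * u))))" by (simp add: Suc)
 finally show ?case unfolding winint_Suc by (simp add: mult.assoc)
qed simp

text \<open>Closed intervals are enough here: the following functions live on \<open>[0,k]\<close>.\<close>

lemma winint1_iter_linear:
 assumes "finite I" "\<And>l. l \<in> I ==> f l integrable_on {0..real k + r}" "0 <= r"
 shows "\<forall>t\<in>{0..r}. (winint 1 ^^ k) (\<lambda>u. \<Sum>l\<in>I. c l * f l u) t = (\<Sum>l\<in>I. c l * (winint 1 ^^ k) (f l) t)"
  and "\<And>l. l \<in> I ==> (winint 1 ^^ k) (f l) integrable_on {0..r}"
proof -
 have int: "(winint 1 ^^ k) g integrable_on {0..r}" if "g integrable_on {0..real k + r}" "0 <= r" for g r and k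
  using that
 proof (induction k arbitrary: r)
  case (Suc k)
  have i: "(winint 1 ^^ k) g integrable_on {0..1 + r}" using Suc.prems by (intro Suc.IH) (auto simp: algebra_simps)
  let ?h = "(winint 1 ^^ k) g"
  have "continuous_on {0..r} (\<lambda>t. integral {0..t + 1} ?h - integral {0..t} ?h)"
  proof (intro continuous_intros)
   have c: "continuous_on {0..1 + r} (\<lambda>t. integral {0..t} ?h)" by (rule indefinite_integral_continuous_1[OF i])
   show "continuous_on {0..r} (\<lambda>t. integral {0..t} ?h)" by (rule continuous_on_subset[OF c]) auto
   show "continuous_on {0..r} (\<lambda>t. integral {0..t + 1} ?h)"
    by (rule continuous_on_compose2[OF c, of _ "\<lambda>t. t + 1"]) (auto intro!: continuous_intros)
  qed
  moreover have "(winint 1 ^^ Suc k) g t = integral {0..t + 1} ?h - integral {0..t} ?h" if "t \<in> {0..r}" for t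
  proof -
   have "integral {0..t} ?h + integral {t..t + 1} ?h = integral {0..t + 1} ?h"
    using that by (intro Henstock_Kurzweil_Integration.integral_combine integrable_on_subinterval[OF i]) auto
   then show ?thesis unfolding winint_Suc by linarith
  qed
  ultimately have "continuous_on {0..r} ((winint 1 ^^ Suc k) g)" by (subst continuous_on_cong[OF refl]) auto
  then show ?case by (rule integrable_continuous_interval)
 qed simp
 show "(winint 1 ^^ k) (f l) integrable_on {0..r}" if "l \<in> I" for l using int assms that by blast
 have "\<forall>t\<in>{0..r}. (winint 1 ^^ k) (\<lambda>u. \<Sum>l\<in>I. c l * f l u) t = (\<Sum>l\<in>I. c l * (winint 1 ^^ k) (f l) t)"
  if "\<And>l. l \<in> I ==> f l integrable_on {0..real k + r}" "0 <= r" for r k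
  using that
 proof (induction k arbitrary: r)
  case (Suc k)
  have p: "f l integrable_on {0..real k + (1 + r)}" if "l \<in> I" for l using Suc.prems(1)[OF that] by (simp add: algebra_simps)
  have eq: "\<forall>t\<in>{0..1 + r}. (winint 1 ^^ k) (\<lambda>u. \<Sum>l\<in>I. c l * f l u) t = (\<Sum>l\<in>I. c l * (winint 1 ^^ k) (f l) t)"
   using p Suc.prems(2) by (intro Suc.IH) auto
  have ii: "(winint 1 ^^ k) (f l) integrable_on {0..1 + r}" if "l \<in> I" for l using int[OF p[OF that]] Suc.prems(2) by auto
  show ?case
  proof
   fix t assume t: "t \<in> {0..r}"
   have "(winint 1 ^^ Suc k) (\<lambda>u. \<Sum>l\<in>I. c l * f l u) t = integral {t..t + 1} (\<lambda>u. \<Sum>l\<in>I. c l * (winint 1 ^^ k) (f l) u)"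
    unfolding winint_Suc using t eq by (intro Henstock_Kurzweil_Integration.integral_cong) auto
   also have "... = (\<Sum>l\<in>I. integral {t..t + 1} (\<lambda>u. c l * (winint 1 ^^ k) (f l) u))"
    using t assms(1) by (intro integral_sum integrable_on_mult_right integrable_on_subinterval[OF ii]) auto
   finally show "(winint 1 ^^ Suc k) (\<lambda>u. \<Sum>l\<in>I. c l * f l u) t = (\<Sum>l\<in>I. c l * (winint 1 ^^ Suc k) (f l) t)"
    unfolding winint_Suc by simp
  qed
 qed simp
 then show "\<forall>t\<in>{0..r}. (winint 1 ^^ k) (\<lambda>u. \<Sum>l\<in>I. c l * f l u) t = (\<Sum>l\<in>I. c l * (winint 1 ^^ k) (f l) t)"
  using assms by blast
qed

lemma winint1_iter_const: "(winint 1 ^^ k) (\<lambda>_. c) = (\<lambda>_. c)"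
 by (induction k) (auto simp: winint_def)

text \<open>Only the first window turns values into an integral; every further window of length one
  is an average and merely widens the interval by one.\<close>

lemma winint1_iter_bound:
 assumes [measurable]: "f \<in> \<B>" and "f integrable_on {0..real (Suc k) + r}" "t \<in> {0..r}"
 shows "ennreal \<bar>(winint 1 ^^ Suc k) f t\<bar> <= (\<integral>u\<in>{t..t + real (Suc k)}. ennreal \<bar>f u\<bar>)"
 using assms(2,3)
proof (induction k arbitrary: t r)
 case 0
 have "f integrable_on {t..t + 1}" by (rule integrable_on_subinterval[OF 0(1)]) (use 0 in auto)
 then have "(f has_integral winint 1 f t) {t..t + 1}" by (simp add: winint_def integrable_integral)
 from has_integral_abs_le_nn_integral[OF this] show ?case by simp
next
 case (Suc k)
 let ?I = "\<integral>\<^sup>+u\<in>{t..t + real (Suc (Suc k))}. ennreal \<bar>f u\<bar> \<partial>lborel"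
 show ?case
 proof (cases ?I)
  case (real I)
  have i: "f integrable_on {0..real (Suc k) + (1 + r)}" using Suc.prems by (simp add: algebra_simps)
  have bd: "\<bar>(winint 1 ^^ Suc k) f y\<bar> <= I" if y: "y \<in> {t..t + 1}" for y
  proof -
   have "ennreal \<bar>(winint 1 ^^ Suc k) f y\<bar> <= (\<integral>u\<in>{y..y + real (Suc k)}. ennreal \<bar>f u\<bar>)"
    using Suc.prems(2) y by (intro Suc.IH[OF i]) auto
   also have "... <= ?I" using y by (intro nn_integral_mono) (auto simp: indicator_def)
   finally show ?thesis using real by (simp add: ennreal_le_iff)
  qed
  have "(winint 1 ^^ Suc k) f integrable_on {0..1 + r}"
   using winint1_iter_linear(2)[of "{()}" "\<lambda>_. f" "Suc k" "1 + r"] i Suc.prems(2) by auto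
  then have "(winint 1 ^^ Suc k) f integrable_on {t..t + 1}" by (rule integrable_on_subinterval) (use Suc.prems in auto)
  then have "((winint 1 ^^ Suc k) f has_integral (winint 1 ^^ Suc (Suc k)) f t) (cbox t (t + 1))"
   unfolding winint_Suc[where k="Suc k"] by (simp only: box_real integrable_integral)
  then have "norm ((winint 1 ^^ Suc (Suc k)) f t) <= I * measure lborel (cbox t (t + 1))"
   by (rule has_integral_bound[rotated]) (use bd real in auto)
  then have "\<bar>(winint 1 ^^ Suc (Suc k)) f t\<bar> <= I" by simp
  then show ?thesis using real by (simp add: ennreal_leI)
 qed simp
qed


lemma fdiff_measurable [measurable]:
 assumes [measurable]: "F \<in> \<B>" "f \<in> borel_measurable M" "g \<in> borel_measurable M"
 shows "(\<lambda>x. fdiff k (f x) F (g x)) \<in> borel_measurable M"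
 unfolding fdiff_def by measurable

section \<open>Whitney's inequality by averaged differences\<close>

text \<open>The \<open>k\<close>-th difference with step \<open>s*u\<close> is averaged over
  \<open>u\<close> by \<open>k\<close> unit windows. Its term \<open>l = 0\<close> is
  \<open>F x\<close>, the others are Steklov means of \<open>F\<close> with windows
  \<open>l*s\<close>. Each mean has a \<open>k\<close>-th difference as \<open>k\<close>-th
  derivative, so Taylor expansion replaces it by a polynomial of degree below
  \<open>k\<close>.\<close>

lemma whitney_step:
 assumes k: "k >= 1" and s: "0 < s" and ab: "a < b" and [measurable]: "F \<in> \<B>"
  and F: "locint a (b + real k * (real k * s)) F"
 shows "\<exists>P\<in>polys k. \<forall>x\<in>{a<..b}. ennreal \<bar>F x - poly P x\<bar> \<le>
  (\<integral>u\<in>{0..real k}. ennreal \<bar>fdiff k (s * u) F x\<bar>)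
  + (\<Sum>l\<in>{1..k}. ennreal (real (k choose l) / (real l * s) ^ k * (b - a) ^ (k - 1)) * (\<integral>z\<in>{x..b}. ennreal \<bar>fdiff k (real l * s) F z\<bar>))"
proof -
 define W where "W l x = (winint (real l * s) ^^ k) F x / (real l * s) ^ k" for l :: nat and x
 obtain j where j: "k = Suc j" using k by (cases k) auto
 have "\<exists>P\<in>polys k. \<forall>x\<in>{a<..b}. ennreal \<bar>(winint (real l * s) ^^ k) F x - poly P x\<bar> <= ennreal ((b - x) ^ j) * (\<integral>z\<in>{x..b}. ennreal \<bar>fdiff k (real l * s) F z\<bar>)"
  if l: "l \<in> {1..k}" for l
 proof -
  have "real k * (real l * s) <= real k * (real k * s)" using l s by (intro mult_left_mono mult_right_mono) auto
  then have "locint a (b + real k * (real l * s)) F" by (intro locint_mono[OF F]) auto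
  then have "iprim k {a<..b} ((fdiff1 (real l * s) ^^ k) F) ((winint (real l * s) ^^ k) F)" using s by (intro iprim_winint) auto
  moreover have "(fdiff1 (real l * s) ^^ k) F = fdiff k (real l * s) F" by (intro ext fdiff_iterate)
  ultimately show ?thesis unfolding j using ab by (intro iprim_taylor) auto
 qed
 then have "\<forall>l\<in>{1..k}. \<exists>P. P \<in> polys k \<and> (\<forall>x\<in>{a<..b}. ennreal \<bar>(winint (real l * s) ^^ k) F x - poly P x\<bar> <= ennreal ((b - x) ^ j) * (\<integral>z\<in>{x..b}. ennreal \<bar>fdiff k (real l * s) F z\<bar>))"
  by blast
 from bchoice[OF this] obtain P where Pall: "\<forall>l\<in>{1..k}. P l \<in> polys k \<and> (\<forall>x\<in>{a<..b}. ennreal \<bar>(winint (real l * s) ^^ k) F x - poly (P l) x\<bar> <= ennreal ((b - x) ^ j) * (\<integral>z\<in>{x..b}. ennreal \<bar>fdiff k (real l * s) F z\<bar>))"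
  by (elim exE) (rule that)
 have P: "P l \<in> polys k" if "l \<in> {1..k}" for l using bspec[OF Pall that] by (rule conjunct1)
 have P2: "ennreal \<bar>(winint (real l * s) ^^ k) F x - poly (P l) x\<bar> <= ennreal ((b - x) ^ j) * (\<integral>z\<in>{x..b}. ennreal \<bar>fdiff k (real l * s) F z\<bar>)"
  if "l \<in> {1..k}" "x \<in> {a<..b}" for l x using bspec[OF Pall that(1), THEN conjunct2] that(2) by (rule bspec)
 \<comment> \<open>The coefficients from solving the averaged difference for its term
   \<open>l = 0\<close>.\<close>
 define c where "c l = (-1) ^ Suc l * real (k choose l) / (real l * s) ^ k" for l :: nat
 define Q where "Q = (\<Sum>l\<in>{1..k}. smult (c l) (P l))"
 have "Q \<in> polys k" unfolding Q_def by (intro polys_sum polys_smult P)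
 moreover have "ennreal \<bar>F x - poly Q x\<bar> <= (\<integral>u\<in>{0..real k}. ennreal \<bar>fdiff k (s * u) F x\<bar>)
  + (\<Sum>l\<in>{1..k}. ennreal (real (k choose l) / (real l * s) ^ k * (b - a) ^ (k - 1)) * (\<integral>z\<in>{x..b}. ennreal \<bar>fdiff k (real l * s) F z\<bar>))"
  if x: "x \<in> {a<..b}" for x
 proof -
  define d where "d l = (winint (real l * s) ^^ k) F x - poly (P l) x" for l
  define f where "f l u = F (x + real l * s * u)" for l :: nat and u
  have fint: "f l integrable_on {0..real k + 0}" if "l \<in> {0..k}" for l
  proof (cases "l = 0")
   case True then show ?thesis by (auto simp: f_def[abs_def])
  next
   case False
   have ls: "0 < real l * s" using False s by simp
   have "real k * (real l * s) <= real k * (real k * s)" using that s by (intro mult_left_mono mult_right_mono) auto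
   then have "F integrable_on {x..x + real k * (real l * s)}" using F x ls unfolding locint_def by auto
   then obtain I where "(F has_integral I) (cbox x (x + real k * (real l * s)))" by (auto simp: integrable_on_def)
   then have "((\<lambda>u. F ((real l * s) *\<^sub>R u + x)) has_integral (I /\<^sub>R (real l * s) ^ DIM(real))) (cbox ((x - x) /\<^sub>R (real l * s)) ((x + real k * (real l * s) - x) /\<^sub>R (real l * s)))"
    by (rule has_integral_affinity'[OF _ ls])
   moreover have "cbox ((x - x) /\<^sub>R (real l * s)) ((x + real k * (real l * s) - x) /\<^sub>R (real l * s)) = {0..real k + 0}"
   proof -
    have "(real k * \<sigma>) / \<sigma> = real k" if "0 < \<sigma>" for \<sigma> using that by simp
    from this[OF ls] show ?thesis by (simp only: box_real real_scaleR_def) (simp add: divide_inverse mult_ac)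
   qed
   moreover have "(\<lambda>u. F ((real l * s) *\<^sub>R u + x)) = f l" by (intro ext) (simp add: f_def add.commute)
   ultimately have "(f l has_integral (I /\<^sub>R (real l * s) ^ DIM(real))) {0..real k + 0}" by (simp only:)
   then show ?thesis unfolding integrable_on_def by blast
  qed
  \<comment> \<open>Scaling \<open>u\<close> by \<open>l*s\<close> turns unit windows into windows
    of length \<open>l*s\<close> in the argument of \<open>F\<close>.\<close>
  have Wf: "(winint 1 ^^ k) (f l) 0 = (winint (real l * s) ^^ k) F x / (real l * s) ^ k" if "l \<in> {1..k}" for l
  proof -
   have ls: "0 < real l * s" using that s by simp
   have "(winint (real l * s) ^^ k) F (x + real l * s * 0) = (real l * s) ^ k * (winint 1 ^^ k) (f l) 0"
    unfolding f_def by (rule winint_iter_scale[OF ls])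
   moreover have "(real l * s) ^ k ~= 0" using ls by (simp only: power_not_zero less_imp_neq[symmetric] not_False_eq_True)
   moreover have "B = A / C" if "A = C * B" "C ~= 0" for A B C :: real using that by simp
   ultimately show ?thesis by (simp only: mult_zero_right add_0_right)
  qed
  define e where "e l = (-1) ^ l * real (k choose l)" for l
  have fd: "\<bar>\<Sum>l\<in>{0..k}. e l * f l u\<bar> = \<bar>fdiff k (s * u) F x\<bar>" for u
  proof -
   have "fdiff k (s * u) F x = (\<Sum>l\<le>k. (-1) ^ k * (e l * f l u))"
    unfolding fdiff_def e_def f_def
   proof (rule sum.cong)
    fix l assume "l \<in> {..k}"
    then have "(-1::real) ^ k = (-1) ^ (k - l) * (-1) ^ l" by (simp add: power_add[symmetric])
    then have "(-1::real) ^ k * (-1) ^ l = (-1) ^ (k - l) * ((-1) ^ l * (-1) ^ l)" by (simp only: mult.assoc)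
    also have "(-1::real) ^ l * (-1) ^ l = 1" by (simp add: power_mult_distrib[symmetric])
    finally have "(-1::real) ^ k * (-1) ^ l = (-1) ^ (k - l)" by simp
    then show "real (k choose l) * (-1) ^ (k - l) * F (x + real l * (s * u)) = (-1) ^ k * ((-1) ^ l * real (k choose l) * F (x + real l * s * u))"
     by (simp add: mult_ac)
   qed simp
   also have "... = (-1) ^ k * (\<Sum>l\<in>{0..k}. e l * f l u)" by (simp add: sum_distrib_left atLeast0AtMost)
   finally show ?thesis by (simp add: abs_mult power_abs)
  qed
  have "(winint 1 ^^ k) (\<lambda>u. \<Sum>l\<in>{0..k}. e l * f l u) 0 = (\<Sum>l\<in>{0..k}. e l * (winint 1 ^^ k) (f l) 0)"
   using winint1_iter_linear(1)[of "{0..k}" f k 0 e] fint by auto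
  also have "... = F x + (\<Sum>l\<in>{1..k}. e l * (winint 1 ^^ k) (f l) 0)"
  proof -
   have "f 0 = (\<lambda>_. F x)" by (intro ext) (simp add: f_def)
   then show ?thesis by (simp add: sum.atLeast_Suc_atMost[of 0 k] winint1_iter_const e_def)
  qed
  also have "(\<Sum>l\<in>{1..k}. e l * (winint 1 ^^ k) (f l) 0) = (\<Sum>l\<in>{1..k}. - (c l * (winint (real l * s) ^^ k) F x))"
   using Wf by (intro sum.cong) (auto simp: e_def c_def)
  finally have main: "(winint 1 ^^ k) (\<lambda>u. \<Sum>l\<in>{0..k}. e l * f l u) 0 = F x - poly Q x - (\<Sum>l\<in>{1..k}. c l * d l)"
   by (simp add: Q_def poly_sum d_def sum_negf right_diff_distrib sum_subtractf)
  have "\<bar>F x - poly Q x\<bar> <= \<bar>(winint 1 ^^ k) (\<lambda>u. \<Sum>l\<in>{0..k}. e l * f l u) 0\<bar> + (\<Sum>l\<in>{1..k}. \<bar>c l\<bar> * \<bar>d l\<bar>)"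
  proof -
   have "\<bar>\<Sum>l\<in>{1..k}. c l * d l\<bar> <= (\<Sum>l\<in>{1..k}. \<bar>c l\<bar> * \<bar>d l\<bar>)" using sum_abs[of "\<lambda>l. c l * d l" "{1..k}"] by (simp add: abs_mult)
   then show ?thesis using main by linarith
  qed
  then have "ennreal \<bar>F x - poly Q x\<bar> <= ennreal (\<bar>(winint 1 ^^ k) (\<lambda>u. \<Sum>l\<in>{0..k}. e l * f l u) 0\<bar> + (\<Sum>l\<in>{1..k}. \<bar>c l\<bar> * \<bar>d l\<bar>))" by (rule ennreal_leI)
  also have "... = ennreal \<bar>(winint 1 ^^ k) (\<lambda>u. \<Sum>l\<in>{0..k}. e l * f l u) 0\<bar> + (\<Sum>l\<in>{1..k}. ennreal (\<bar>c l\<bar> * \<bar>d l\<bar>))"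
   by (subst ennreal_plus) (auto simp: sum_nonneg sum_ennreal)
  also have "... <= (\<integral>u\<in>{0..real k}. ennreal \<bar>fdiff k (s * u) F x\<bar>)
  + (\<Sum>l\<in>{1..k}. ennreal (real (k choose l) / (real l * s) ^ k * (b - a) ^ (k - 1)) * (\<integral>z\<in>{x..b}. ennreal \<bar>fdiff k (real l * s) F z\<bar>))"
  proof (intro add_mono sum_mono)
   have "(\<lambda>u. \<Sum>l\<in>{0..k}. e l * f l u) integrable_on {0..real k + 0}"
    using fint by (intro integrable_sum integrable_on_mult_right) auto
   moreover have [measurable]: "f l \<in> \<B>" for l unfolding f_def by measurable
   ultimately have "ennreal \<bar>(winint 1 ^^ k) (\<lambda>u. \<Sum>l\<in>{0..k}. e l * f l u) 0\<bar> <= (\<integral>u\<in>{0..0 + real k}. ennreal \<bar>\<Sum>l\<in>{0..k}. e l * f l u\<bar>)"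
    unfolding j by (intro winint1_iter_bound[where r=0]) (simp_all del: sum.cl_ivl_Suc of_nat_Suc)
   then show "ennreal \<bar>(winint 1 ^^ k) (\<lambda>u. \<Sum>l\<in>{0..k}. e l * f l u) 0\<bar> <= (\<integral>u\<in>{0..real k}. ennreal \<bar>fdiff k (s * u) F x\<bar>)"
    by (simp only: fd add_0)
  next
   fix l assume l: "l \<in> {1..k}"
   have ls: "0 < real l * s" using l s by simp
   let ?I = "\<integral>\<^sup>+z\<in>{x..b}. ennreal \<bar>fdiff k (real l * s) F z\<bar> \<partial>lborel"
   have "ennreal (\<bar>c l\<bar> * \<bar>d l\<bar>) = ennreal \<bar>c l\<bar> * ennreal \<bar>d l\<bar>" by (simp add: ennreal_mult)
   also have "... <= ennreal \<bar>c l\<bar> * (ennreal ((b - a) ^ j) * ?I)"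
   proof (rule mult_left_mono)
    have "ennreal \<bar>d l\<bar> <= ennreal ((b - x) ^ j) * (\<integral>z\<in>{x..b}. ennreal \<bar>fdiff k (real l * s) F z\<bar>)"
     unfolding d_def by (rule P2[OF l x])
    also have "... <= ennreal ((b - a) ^ j) * ?I"
     using x by (intro mult_mono ennreal_leI power_mono nn_integral_mono) (auto simp: indicator_def)
    finally show "ennreal \<bar>d l\<bar> <= ennreal ((b - a) ^ j) * ?I" .
   qed simp
   also have "... = ennreal (real (k choose l) / (real l * s) ^ k * (b - a) ^ (k - 1)) * ?I"
   proof -
    have "\<bar>c l\<bar> = real (k choose l) / (real l * s) ^ k" using ls s by (simp add: c_def abs_mult power_abs)
    moreover have "k - 1 = j" by (simp add: j)
    moreover have "ennreal (real (k choose l) / (real l * s) ^ k * (b - a) ^ j) = ennreal (real (k choose l) / (real l * s) ^ k) * ennreal ((b - a) ^ j)"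
     using ab ls by (intro ennreal_mult divide_nonneg_nonneg zero_le_power) auto
    ultimately show ?thesis by (simp only: mult.assoc)
   qed
   finally show "ennreal (\<bar>c l\<bar> * \<bar>d l\<bar>) <= ennreal (real (k choose l) / (real l * s) ^ k * (b - a) ^ (k - 1)) * ?I" .
  qed
  finally show ?thesis .
 qed
 ultimately show ?thesis by blast
qed

text \<open>If all values exceeded the threshold, integration would give a strict inequality; the
  threshold is finite because something exceeds it.\<close>

lemma exists_le_average:
 fixes f :: "real => ennreal"
 assumes U: "0 < U" and [measurable]: "f \<in> \<B>" and Y: "(\<integral>s\<in>{U/2..U}. f s) <= Y"
 shows "\<exists>s\<in>{U/2..U}. f s <= ennreal (2 / U) * Y"
proof (rule ccontr)
 let ?c = "ennreal (2 / U) * Y"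
 assume "\<not> ?thesis"
 then have gt: "?c < f s" if "s \<in> {U/2..U}" for s using that by (auto simp: not_le)
 have fin: "?c < \<infinity>" using gt[of U] U by (auto simp: less_top[symmetric] intro: order.strict_trans2)
 have i: "(\<integral>s\<in>{U/2..U}. ?c) = ?c * ennreal (U/2)" using U by (simp add: nn_integral_cmult_indicator)
 also have "... = Y" using U by (simp add: mult_ac ennreal_mult[symmetric] mult.assoc[symmetric])
 finally have eq: "(\<integral>s\<in>{U/2..U}. ?c) = Y" .
 have "(\<integral>s\<in>{U/2..U}. ?c) < (\<integral>s\<in>{U/2..U}. f s)"
 proof (rule nn_integral_less)
  show "(\<integral>s\<in>{U/2..U}. ?c) ~= \<infinity>" 
  proof -
   have "?c * ennreal (U/2) < top" by (subst ennreal_mult_less_top) (use fin in auto)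
   then show ?thesis unfolding i by simp
  qed
  show "AE s in lborel. ?c * indicator {U/2..U} s <= f s * indicator {U/2..U} s"
   using gt by (intro AE_I2) (auto simp: indicator_def less_imp_le)
  show "\<not> (AE s in lborel. f s * indicator {U/2..U} s <= ?c * indicator {U/2..U} s)"
  proof
   assume "AE s in lborel. f s * indicator {U/2..U} s <= ?c * indicator {U/2..U} s"
   then have "AE s in lborel. s \<notin> {U/2..U}"
    by eventually_elim (use gt in \<open>auto simp: indicator_def not_le[symmetric]\<close>)
   then have "{U/2..U} \<in> null_sets lborel" by (subst AE_iff_null_sets) auto
   then show False using U by (simp add: null_sets_def)
  qed
 qed measurable
 then show False using Y eq by simp
qed

text \<open>The terms with one fixed step \<open>s\<close> are controlled by an integral over all
  steps once \<open>s\<close> is chosen in \<open>[U/2,U]\<close> by averaging; the term that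
  already contains all \<open>s*u\<close> needs only a substitution. The Taylor remainder at
  \<open>x\<close> involves points \<open>z >= x\<close> only, so a one-sided comparison of weights
  is enough.\<close>

lemma whitney_cell:
 assumes k: "k >= 1" and U: "0 < U" and ab: "a < b" "b - a <= \<Lambda> * U" and \<Lambda>: "0 <= \<Lambda>" and [measurable]: "F \<in> \<B>" "w \<in> \<B>"
  and F: "locint a (b + real k * (real k * U)) F" and w0: "\<And>x. 0 <= w x"
  and w: "\<And>x z. a < x ==> x <= z ==> z <= b ==> w x <= Cw * w z" and Cw: "0 < Cw"
 shows "\<exists>P\<in>polys k. \<forall>x\<in>{a<..b}. ennreal (w x * \<bar>F x - poly P x\<bar>) \<le>
  ennreal (2 / U) * (\<integral>v\<in>{0..real k * U}. ennreal (w x * \<bar>fdiff k v F x\<bar>))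
  + ennreal (Cw * 4 ^ k * \<Lambda> ^ (k - 1) * 2 * real k / U\<^sup>2) * (\<integral>z\<in>{a<..b}. (\<integral>v\<in>{0..real k * U}. ennreal (w z * \<bar>fdiff k v F z\<bar>)))"
proof -
 let ?M = "\<lambda>x v. ennreal (w x * \<bar>fdiff k v F x\<bar>)"
 let ?X = "\<integral>\<^sup>+z\<in>{a<..b}. (\<integral>v\<in>{0..real k * U}. ?M z v) \<partial>lborel"
 define S where "S s = (\<Sum>l\<in>{1..k}. (\<integral>z\<in>{a<..b}. ?M z (real l * s)))" for s
 have Sm [measurable]: "S \<in> \<B>" unfolding S_def by measurable
 have scale: "(\<integral>s\<in>{U/2..U}. ?M z (real l * s)) <= (\<integral>v\<in>{0..real k * U}. ?M z v)" if l: "l \<in> {1..k}" for l z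
 proof -
  have "(\<integral>v\<in>{0..real k * U}. ?M z v) = ennreal (real l) * (\<integral>s. ?M z (real l * s) * indicator {0..real k * U} (real l * s))"
   using nn_integral_real_affine[of "\<lambda>v. ?M z v * indicator {0..real k * U} v" "real l" 0] l by simp
  moreover have "(\<integral>s\<in>{U/2..U}. ?M z (real l * s)) <= (\<integral>s. ?M z (real l * s) * indicator {0..real k * U} (real l * s))"
  proof (rule nn_integral_mono)
   fix s :: real
   have "real l * s \<in> {0..real k * U}" if "s \<in> {U/2..U}"
    using that l U by (auto intro!: mult_mono)
   then show "?M z (real l * s) * indicator {U/2..U} s <= ?M z (real l * s) * indicator {0..real k * U} (real l * s)"
    by (auto simp: indicator_def)
  qed
  moreover have "1 * (\<integral>s. ?M z (real l * s) * indicator {0..real k * U} (real l * s)) <= ennreal (real l) * (\<integral>s. ?M z (real l * s) * indicator {0..real k * U} (real l * s))"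
   using l by (intro mult_right_mono) (auto simp flip: ennreal_1 intro!: ennreal_leI)
  ultimately show ?thesis by (auto intro: order_trans)
 qed
 have "(\<integral>s\<in>{U/2..U}. S s) = (\<Sum>l\<in>{1..k}. \<integral>\<^sup>+s. (\<integral>z\<in>{a<..b}. ?M z (real l * s)) * indicator {U/2..U} s \<partial>lborel)"
  unfolding S_def sum_distrib_right by (subst nn_integral_sum) auto
 also have "... <= (\<Sum>l\<in>{1..k}. ?X)"
 proof (rule sum_mono)
  fix l assume l: "l \<in> {1..k}"
  have "(\<integral>s. (\<integral>z\<in>{a<..b}. ?M z (real l * s)) * indicator {U/2..U} s)
   = (\<integral>s. (\<integral>z. ?M z (real l * s) * indicator {U/2..U} s * indicator {a<..b} z))"
   by (subst nn_integral_multc[symmetric]) (auto simp: mult_ac)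
  also have "... = (\<integral>z. (\<integral>s. ?M z (real l * s) * indicator {U/2..U} s * indicator {a<..b} z))"
   by (rule lborel_pair.Fubini') measurable
  also have "... = (\<integral>z. (\<integral>s\<in>{U/2..U}. ?M z (real l * s)) * indicator {a<..b} z)"
   by (intro nn_integral_cong nn_integral_multc) measurable
  also have "... <= ?X" 
  proof (rule nn_integral_mono)
   fix z show "(\<integral>s\<in>{U/2..U}. ?M z (real l * s)) * indicator {a<..b} z <= (\<integral>v\<in>{0..real k * U}. ?M z v) * indicator {a<..b} z"
    by (rule mult_right_mono[OF scale[OF l]]) simp
  qed
  finally show "(\<integral>s. (\<integral>z\<in>{a<..b}. ?M z (real l * s)) * indicator {U/2..U} s) <= ?X" .
 qed
 also have "... = ennreal (real k) * ?X" by (simp add: ennreal_of_nat_eq_real_of_nat)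
 finally obtain s where s: "s \<in> {U/2..U}" "S s <= ennreal (2 / U) * (ennreal (real k) * ?X)"
  using exists_le_average[OF U Sm] by blast
 have s0: "0 < s" using s U by auto
 have "real k * (real k * s) <= real k * (real k * U)" using s by (intro mult_left_mono) auto
 then have Fs: "locint a (b + real k * (real k * s)) F" by (intro locint_mono[OF F]) auto
 obtain P where P: "P \<in> polys k" "\<And>x. x \<in> {a<..b} ==> ennreal \<bar>F x - poly P x\<bar> \<le>
  (\<integral>u\<in>{0..real k}. ennreal \<bar>fdiff k (s * u) F x\<bar>)
  + (\<Sum>l\<in>{1..k}. ennreal (real (k choose l) / (real l * s) ^ k * (b - a) ^ (k - 1)) * (\<integral>z\<in>{x..b}. ennreal \<bar>fdiff k (real l * s) F z\<bar>))"
  using whitney_step[OF k s0 ab(1) _ Fs] by auto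
 \<comment> \<open>Of \<open>4 ^ k\<close>, one \<open>2 ^ k\<close> bounds the binomial coefficient
   and the other comes from \<open>l*s >= U/2\<close>.\<close>
 define E where "E = 4 ^ k * \<Lambda> ^ (k - 1) / U"
 have E: "0 <= E" using U \<Lambda> by (simp add: E_def)
 have coeff: "real (k choose l) / (real l * s) ^ k * (b - a) ^ (k - 1) <= E" if l: "l \<in> {1..k}" for l
 proof -
  have 1: "real (k choose l) <= 2 ^ k" using binomial_le_pow2[of k l] by (metis of_nat_le_iff of_nat_numeral of_nat_power)
  have "U / 2 <= real l * s" using l s U mult_mono[of 1 "real l" "U/2" s] by auto
  then have 2: "(U / 2) ^ k <= (real l * s) ^ k" using U by (intro power_mono) auto
  have 3: "(b - a) ^ (k - 1) <= (\<Lambda> * U) ^ (k - 1)" using ab by (intro power_mono) auto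
  have "real (k choose l) / (real l * s) ^ k * (b - a) ^ (k - 1) <= 2 ^ k / (U / 2) ^ k * (\<Lambda> * U) ^ (k - 1)"
   using 1 2 3 U ab by (intro mult_mono frac_le) auto
  also have "... = E"
  proof -
   obtain j where j: "k = Suc j" using k by (cases k) auto
   have "2 ^ k / (U / 2) ^ k = 4 ^ k / U ^ k" by (simp add: power_divide power_mult_distrib[symmetric])
   then show ?thesis using U by (simp add: E_def j power_mult_distrib)
  qed
  finally show ?thesis .
 qed
 show ?thesis
 proof (rule bexI[OF _ P(1)], rule ballI)
  fix x assume x: "x \<in> {a<..b}"
  have "ennreal (w x * \<bar>F x - poly P x\<bar>) = ennreal (w x) * ennreal \<bar>F x - poly P x\<bar>" using w0 by (simp add: ennreal_mult)
  also have "... <= ennreal (w x) * ((\<integral>u\<in>{0..real k}. ennreal \<bar>fdiff k (s * u) F x\<bar>)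
  + (\<Sum>l\<in>{1..k}. ennreal (real (k choose l) / (real l * s) ^ k * (b - a) ^ (k - 1)) * (\<integral>z\<in>{x..b}. ennreal \<bar>fdiff k (real l * s) F z\<bar>)))"
   by (intro mult_left_mono P(2) x) auto
  also have "... = ennreal (w x) * (\<integral>u\<in>{0..real k}. ennreal \<bar>fdiff k (s * u) F x\<bar>)
  + (\<Sum>l\<in>{1..k}. ennreal (real (k choose l) / (real l * s) ^ k * (b - a) ^ (k - 1)) * (ennreal (w x) * (\<integral>z\<in>{x..b}. ennreal \<bar>fdiff k (real l * s) F z\<bar>)))"
   by (simp add: distrib_left sum_distrib_left mult_ac)
  also have "... <= ennreal (2 / U) * (\<integral>v\<in>{0..real k * U}. ?M x v) + (\<Sum>l\<in>{1..k}. ennreal E * (ennreal Cw * (\<integral>z\<in>{a<..b}. ?M z (real l * s))))"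
  proof (intro add_mono sum_mono)
   have "(\<integral>v\<in>{0..real k * U}. ?M x v) = ennreal s * (\<integral>u. ?M x (s * u) * indicator {0..real k * U} (s * u))"
    using nn_integral_real_affine[of "\<lambda>v. ?M x v * indicator {0..real k * U} v" s 0] s0 by simp
   moreover have "(\<integral>u\<in>{0..real k}. ?M x (s * u)) <= (\<integral>u. ?M x (s * u) * indicator {0..real k * U} (s * u))"
   proof (rule nn_integral_mono)
    fix u :: real
    have "s * u \<in> {0..real k * U}" if "u \<in> {0..real k}"
     using that s s0 mult_mono[of s U u "real k"] U by (auto simp: mult.commute)
    then show "?M x (s * u) * indicator {0..real k} u <= ?M x (s * u) * indicator {0..real k * U} (s * u)"
     by (auto simp: indicator_def)
   qed
   moreover have "1 <= ennreal (2 / U) * ennreal s"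
    using s U by (simp add: ennreal_mult[symmetric] flip: ennreal_1)
   ultimately have "1 * (\<integral>u\<in>{0..real k}. ?M x (s * u)) <= (ennreal (2 / U) * ennreal s) * (\<integral>u. ?M x (s * u) * indicator {0..real k * U} (s * u))"
    by (intro mult_mono) auto
   moreover have "ennreal (w x) * (\<integral>u\<in>{0..real k}. ennreal \<bar>fdiff k (s * u) F x\<bar>) = (\<integral>u\<in>{0..real k}. ?M x (s * u))"
    using w0 by (subst nn_integral_cmult[symmetric]) (auto simp: ennreal_mult mult_ac intro!: nn_integral_cong)
   ultimately show "ennreal (w x) * (\<integral>u\<in>{0..real k}. ennreal \<bar>fdiff k (s * u) F x\<bar>) <= ennreal (2 / U) * (\<integral>v\<in>{0..real k * U}. ?M x v)"
    using \<open>(\<integral>v\<in>{0..real k * U}. ?M x v) = ennreal s * (\<integral>u. ?M x (s * u) * indicator {0..real k * U} (s * u))\<close>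
    by (simp add: mult.assoc)
  next
   fix l assume l: "l \<in> {1..k}"
   have cE: "ennreal (real (k choose l) / (real l * s) ^ k * (b - a) ^ (k - 1)) <= ennreal E" by (rule ennreal_leI[OF coeff[OF l]])
   have "ennreal (w x) * (\<integral>z\<in>{x..b}. ennreal \<bar>fdiff k (real l * s) F z\<bar>) = (\<integral>z. ennreal (w x) * (ennreal \<bar>fdiff k (real l * s) F z\<bar> * indicator {x..b} z))"
    by (rule nn_integral_cmult[symmetric]) measurable
   also have "... <= (\<integral>z. ennreal Cw * (?M z (real l * s) * indicator {a<..b} z))"
   proof (rule nn_integral_mono)
    fix z :: real
    have "ennreal (w x) * ennreal \<bar>fdiff k (real l * s) F z\<bar> <= ennreal Cw * ?M z (real l * s)" if "z \<in> {x..b}"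
    proof -
     have "w x * \<bar>fdiff k (real l * s) F z\<bar> <= Cw * w z * \<bar>fdiff k (real l * s) F z\<bar>"
      using w[of x z] x that by (intro mult_right_mono) auto
     then have "ennreal (w x * \<bar>fdiff k (real l * s) F z\<bar>) <= ennreal (Cw * (w z * \<bar>fdiff k (real l * s) F z\<bar>))"
      by (intro ennreal_leI) (simp add: mult.assoc)
     then show ?thesis using w0 Cw by (simp add: ennreal_mult)
    qed
    then show "ennreal (w x) * (ennreal \<bar>fdiff k (real l * s) F z\<bar> * indicator {x..b} z) <= ennreal Cw * (?M z (real l * s) * indicator {a<..b} z)"
     using x by (auto simp: indicator_def)
   qed
   also have "... = ennreal Cw * (\<integral>z\<in>{a<..b}. ?M z (real l * s))" by (rule nn_integral_cmult) measurable
   finally have "ennreal (w x) * (\<integral>z\<in>{x..b}. ennreal \<bar>fdiff k (real l * s) F z\<bar>) <= ennreal Cw * (\<integral>z\<in>{a<..b}. ?M z (real l * s))" .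
   with cE show "ennreal (real (k choose l) / (real l * s) ^ k * (b - a) ^ (k - 1)) * (ennreal (w x) * (\<integral>z\<in>{x..b}. ennreal \<bar>fdiff k (real l * s) F z\<bar>))
     <= ennreal E * (ennreal Cw * (\<integral>z\<in>{a<..b}. ?M z (real l * s)))"
    by (rule mult_mono) auto
  qed
  also have "(\<Sum>l\<in>{1..k}. ennreal E * (ennreal Cw * (\<integral>z\<in>{a<..b}. ?M z (real l * s)))) = ennreal E * ennreal Cw * S s"
   by (simp add: S_def sum_distrib_left mult.assoc)
  also have "ennreal (2 / U) * (\<integral>v\<in>{0..real k * U}. ?M x v) + ennreal E * ennreal Cw * S s
   <= ennreal (2 / U) * (\<integral>v\<in>{0..real k * U}. ?M x v) + ennreal E * ennreal Cw * (ennreal (2 / U) * (ennreal (real k) * ?X))"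
   by (intro add_left_mono mult_left_mono s(2)) auto
  also have "ennreal E * ennreal Cw * (ennreal (2 / U) * (ennreal (real k) * ?X)) = ennreal (E * Cw * (2 / U * real k)) * ?X"
  proof -
   have n: "0 <= E * Cw" "0 <= 2 / U * real k" "0 <= Cw" "0 <= 2 / U" "0 <= real k" using E Cw U by auto
   have "ennreal (E * Cw * (2 / U * real k)) = ennreal E * ennreal Cw * (ennreal (2 / U) * ennreal (real k))"
    by (simp only: ennreal_mult[OF n(1,2)] ennreal_mult[OF E n(3)] ennreal_mult[OF n(4,5)])
   then show ?thesis by (simp only: mult.assoc)
  qed
  also have "E * Cw * (2 / U * real k) = Cw * 4 ^ k * \<Lambda> ^ (k - 1) * 2 * real k / U\<^sup>2" by (simp add: E_def power2_eq_square)
  finally show "ennreal (w x * \<bar>F x - poly P x\<bar>) \<le>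
  ennreal (2 / U) * (\<integral>v\<in>{0..real k * U}. ?M x v)
  + ennreal (Cw * 4 ^ k * \<Lambda> ^ (k - 1) * 2 * real k / U\<^sup>2) * ?X" .
 qed
qed

section \<open>The local step size on the left half\<close>

text \<open>On \<open>[-1,1/2]\<close> this is comparable to the usual step
  \<open>\<phi>(x)/N + 1/N^2\<close>; the form with \<open>sqrt (1 + x)\<close> is monotone. The
  right half is reached by reflection.\<close>

definition locscale :: "nat => real => real" where
 "locscale N x = sqrt (1 + x) / real N + 1 / (real N)\<^sup>2"

text \<open>Up to a constant, the average over the admissible forward steps. The divisor
  \<open>16 * k\<close> keeps \<open>x + k*v\<close> at most \<open>3/4\<close> for
  \<open>x <= 1/2\<close> and the step below \<open>\<phi>/N\<close> at the centre of the
  difference.\<close>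

definition avdiff :: "nat => real => real => nat => (real => real) => real => ennreal" where
 "avdiff k \<xi> \<zeta> N F x = ennreal (1 / locscale N x) *
  (\<integral>v\<in>{0..locscale N x / (16 * real k)}. ennreal (jw \<xi> \<zeta> x * \<bar>fdiff k v F x\<bar>))"

lemma locscale_pos: "N >= 1 ==> -1 <= x ==> 0 < locscale N x"
 unfolding locscale_def by (intro add_nonneg_pos) auto

lemma locscale_mono: "x <= y ==> locscale N x <= locscale N y"
 unfolding locscale_def by (intro add_right_mono divide_right_mono) auto

lemma locscale_sqrt: assumes "N >= 1" "-1 <= x" shows "sqrt (locscale N x) <= real N * locscale N x"
proof (rule real_le_lsqrt)
 have N: "0 < real N" using assms by simp
 have e: "real N * locscale N x = sqrt (1 + x) + 1 / real N" using N by (simp add: locscale_def power2_eq_square field_simps)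
 have "locscale N x = (sqrt (1 + x) + 1 / real N) * (1 / real N)" using N by (simp add: locscale_def power2_eq_square field_simps)
 also have "... <= (sqrt (1 + x) + 1 / real N) * (sqrt (1 + x) + 1 / real N)"
  using assms N by (intro mult_left_mono) auto
 finally show "locscale N x <= (real N * locscale N x)\<^sup>2" unfolding e by (simp add: power2_eq_square)
qed (use locscale_pos[OF assms] in auto)

text \<open>The square root is subadditive, and
  \<open>sqrt (locscale N a) <= N * locscale N a\<close>, so the growth of
  \<open>sqrt (1 + x) / N\<close> over the interval is again a multiple of the scale.\<close>

lemma locscale_doubling:
 assumes "N >= 1" "-1 <= a" "a <= b" "b - a <= \<Lambda> * locscale N a" "0 <= \<Lambda>"
 shows "locscale N b <= (1 + sqrt \<Lambda>) * locscale N a"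
proof -
 have N: "0 < real N" using assms by simp
 have "sqrt (1 + b) <= sqrt (1 + a) + sqrt (b - a)" using assms sqrt_add_le_add_sqrt[of "1 + a" "b - a"] by simp
 also have "sqrt (b - a) <= sqrt (\<Lambda> * locscale N a)" using assms by simp
 also have "... = sqrt \<Lambda> * sqrt (locscale N a)" by (rule real_sqrt_mult)
 also have "... <= sqrt \<Lambda> * (real N * locscale N a)" using assms locscale_sqrt[of N a] by (intro mult_left_mono) auto
 finally have "sqrt (1 + b) / real N <= (sqrt (1 + a) + sqrt \<Lambda> * (real N * locscale N a)) / real N" using N by (intro divide_right_mono) auto
 also have "... = sqrt (1 + a) / real N + sqrt \<Lambda> * locscale N a" using N by (simp add: add_divide_distrib)
 finally have h: "sqrt (1 + b) / real N <= sqrt (1 + a) / real N + sqrt \<Lambda> * locscale N a" .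
 have "locscale N b = sqrt (1 + b) / real N + 1 / (real N)\<^sup>2" "locscale N a = sqrt (1 + a) / real N + 1 / (real N)\<^sup>2"
  by (simp_all add: locscale_def)
 then show ?thesis using h by (simp only: distrib_right mult_1)
qed

lemma locscale_le: assumes "N >= 1" "x <= 1/2" shows "locscale N x <= 9/4"
proof -
 have "sqrt (1 + x) <= 5/4" using assms by (intro real_le_lsqrt) (auto simp: power2_eq_square)
 moreover have "sqrt (1 + x) / real N <= 5/4 / 1" using assms calculation by (intro frac_le) auto
 moreover have "1 / (real N)\<^sup>2 <= 1" using assms by simp
 ultimately show ?thesis unfolding locscale_def by linarith
qed

lemma avdiff_measurable [measurable]:
 assumes [measurable]: "F \<in> \<B>"
 shows "avdiff k \<xi> \<zeta> N F \<in> \<B>"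
 unfolding avdiff_def locscale_def indicator_def atLeastAtMost_iff by measurable

text \<open>To the left of \<open>1/2\<close> the factor \<open>1 + x\<close> increases, and
  \<open>1 - x\<close> stays between \<open>1/2\<close> and 2, hence the 4.\<close>

lemma jacobi_left_monotone:
 assumes "0 <= \<xi>" "0 <= \<zeta>" "-1 < x" "x <= z" "z <= 1/2"
 shows "jw \<xi> \<zeta> x <= 4 powr \<xi> * jw \<xi> \<zeta> z"
proof -
 have "(1 - x) powr \<xi> <= (4 * (1 - z)) powr \<xi>" using assms by (intro powr_mono2) auto
 also have "... = 4 powr \<xi> * (1 - z) powr \<xi>" by (rule powr_mult)
 finally have "(1 - x) powr \<xi> * (1 + x) powr \<zeta> <= (4 powr \<xi> * (1 - z) powr \<xi>) * (1 + z) powr \<zeta>"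
  using assms by (intro mult_mono powr_mono2) auto
 then show ?thesis by (simp add: jacobi_weight_def)
qed

lemma whitney_local:
 assumes k: "k >= 1" and \<xi>: "0 <= \<xi>" and \<zeta>: "0 <= \<zeta>" and \<Lambda>: "0 <= \<Lambda>"
 shows "\<exists>C>0. \<forall>N\<ge>1. \<forall>F a b. F \<in> \<B> --> (\<forall>b<1. locint (-1) b F) --> -1 <= a --> a < b --> b <= 1/2 --> b - a <= \<Lambda> * locscale N a -->
  (\<exists>P\<in>polys k. \<forall>x\<in>{a<..b}. ennreal (jw \<xi> \<zeta> x * \<bar>F x - poly P x\<bar>) \<le>
   ennreal C * (avdiff k \<xi> \<zeta> N F x + ennreal (1 / locscale N a) * (\<integral>z\<in>{a<..b}. avdiff k \<xi> \<zeta> N F z)))"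
proof -
 \<comment> \<open>\<open>\<Lambda>'\<close> bounds the cell length in units of \<open>U\<close>,
   \<open>d\<close> is the doubling constant of the scale, and \<open>A\<close> and \<open>B\<close>
   collect the coefficients of the two terms of the Whitney bound.\<close>
 define \<Lambda>' where "\<Lambda>' = \<Lambda> * (16 * (real k)\<^sup>2)"
 define d where "d = 1 + sqrt \<Lambda>"
 define A where "A = 2 * (16 * (real k)\<^sup>2) * d"
 define B where "B = 4 powr \<xi> * 4 ^ k * \<Lambda>' ^ (k - 1) * 2 * real k * (16 * (real k)\<^sup>2)\<^sup>2 * d"
 have d: "1 <= d" using \<Lambda> by (simp add: d_def)
 have A0: "0 < A" and B0: "0 <= B" using k d \<Lambda> by (auto simp: A_def B_def \<Lambda>'_def)
 show ?thesis
 proof (intro exI[of _ "A + B"] conjI allI impI)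
  show "0 < A + B" using A0 B0 by simp
  fix N :: nat and F :: "real => real" and a b :: real
  assume N: "1 <= N" and [measurable]: "F \<in> \<B>" and F: "\<forall>b<1. locint (-1) b F" and a: "-1 <= a" and ab: "a < b" and b: "b <= 1/2" and len: "b - a <= \<Lambda> * locscale N a"
  let ?w = "jw \<xi> \<zeta>" let ?r = "locscale N a" let ?H = "avdiff k \<xi> \<zeta> N F"
  have r: "0 < ?r" by (rule locscale_pos[OF N a])
  have r2: "?r <= 9/4" using ab b by (intro locscale_le N) auto
  \<comment> \<open>With this \<open>U\<close> the largest step \<open>k*U\<close> is the averaging
    range at \<open>a\<close>, and hence lies within the range at every
    \<open>x >= a\<close>.\<close>
  define U where "U = ?r / (16 * (real k)\<^sup>2)"
  have kk: "0 < real k" using k by simp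
  have U: "0 < U" "real k * U = ?r / (16 * real k)" using r kk by (auto simp: U_def power2_eq_square)
  have U1: "1 / U = 16 * (real k)\<^sup>2 / ?r" by (simp add: U_def)
  have db: "locscale N x <= d * ?r" if "x \<in> {a<..b}" for x
   using locscale_mono[of x b N] locscale_doubling[OF N a less_imp_le[OF ab] len \<Lambda>] that by (auto simp: d_def)
  \<comment> \<open>Shifts beyond \<open>b <= 1/2\<close> therefore end below \<open>3/4\<close>,
    well inside \<open>(-1,1)\<close>.\<close>
  have "real k * (real k * U) <= 1/4" unfolding U(2) using r2 kk by (simp add: field_simps)
  then have li: "locint a (b + real k * (real k * U)) F"
  proof -
   have "locint (-1) (3/4) F" using F by simp
   then show ?thesis using \<open>real k * (real k * U) <= 1/4\<close> a b unfolding locint_def by (auto simp del: of_nat_le_iff)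
  qed
  have inner: "(\<integral>v\<in>{0..real k * U}. ennreal (?w x * \<bar>fdiff k v F x\<bar>)) <= ennreal (d * ?r) * ?H x" if x: "x \<in> {a<..b}" for x
  proof -
   have lx: "0 < locscale N x" "?r <= locscale N x" using x a by (auto intro!: locscale_pos N locscale_mono)
   let ?J = "\<integral>\<^sup>+v\<in>{0..locscale N x / (16 * real k)}. ennreal (?w x * \<bar>fdiff k v F x\<bar>) \<partial>lborel"
   have "(\<integral>v\<in>{0..real k * U}. ennreal (?w x * \<bar>fdiff k v F x\<bar>)) <= ?J"
   proof -
    have "real k * U <= locscale N x / (16 * real k)" unfolding U(2) using lx kk by (intro divide_right_mono) auto
    then show ?thesis by (intro nn_integral_mono mult_left_mono) (auto simp: indicator_def)
   qed
   also have "?J = ennreal (locscale N x) * ?H x"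
    unfolding avdiff_def using lx by (simp add: mult.assoc[symmetric] ennreal_mult[symmetric])
   also have "... <= ennreal (d * ?r) * ?H x" using db[OF x] by (intro mult_right_mono ennreal_leI) auto
   finally show ?thesis .
  qed
  obtain P where P: "P \<in> polys k" "\<And>x. x \<in> {a<..b} ==> ennreal (?w x * \<bar>F x - poly P x\<bar>) \<le>
  ennreal (2 / U) * (\<integral>v\<in>{0..real k * U}. ennreal (?w x * \<bar>fdiff k v F x\<bar>))
  + ennreal (4 powr \<xi> * 4 ^ k * \<Lambda>' ^ (k - 1) * 2 * real k / U\<^sup>2) * (\<integral>z\<in>{a<..b}. (\<integral>v\<in>{0..real k * U}. ennreal (?w z * \<bar>fdiff k v F z\<bar>)))"
  proof -
   have "b - a <= \<Lambda>' * U" using len kk by (simp add: \<Lambda>'_def U_def)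
   moreover have "0 <= \<Lambda>'" using \<Lambda> by (simp add: \<Lambda>'_def)
   moreover have "0 <= ?w x" for x by (simp add: jacobi_weight_def)
   moreover have "?w x <= 4 powr \<xi> * ?w z" if "a < x" "x <= z" "z <= b" for x z using that a b \<xi> \<zeta> by (intro jacobi_left_monotone) auto
   ultimately have "\<exists>P\<in>polys k. \<forall>x\<in>{a<..b}. ennreal (?w x * \<bar>F x - poly P x\<bar>) \<le>
  ennreal (2 / U) * (\<integral>v\<in>{0..real k * U}. ennreal (?w x * \<bar>fdiff k v F x\<bar>))
  + ennreal (4 powr \<xi> * 4 ^ k * \<Lambda>' ^ (k - 1) * 2 * real k / U\<^sup>2) * (\<integral>z\<in>{a<..b}. (\<integral>v\<in>{0..real k * U}. ennreal (?w z * \<bar>fdiff k v F z\<bar>)))"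
    by (intro whitney_cell k U(1) ab li) auto
   then show ?thesis using that by blast
  qed
  show "\<exists>P\<in>polys k. \<forall>x\<in>{a<..b}. ennreal (?w x * \<bar>F x - poly P x\<bar>) \<le>
   ennreal (A + B) * (?H x + ennreal (1 / ?r) * (\<integral>z\<in>{a<..b}. ?H z))"
  proof (rule bexI[OF _ P(1)], rule ballI)
   fix x assume x: "x \<in> {a<..b}"
   let ?I = "\<integral>\<^sup>+z\<in>{a<..b}. ?H z \<partial>lborel"
   let ?E = "4 powr \<xi> * 4 ^ k * \<Lambda>' ^ (k - 1) * 2 * real k / U\<^sup>2"
   have E0: "0 <= ?E" using \<Lambda> by (auto simp: \<Lambda>'_def)
   have "ennreal (?w x * \<bar>F x - poly P x\<bar>) <= ennreal (2 / U) * (ennreal (d * ?r) * ?H x) + ennreal ?E * (\<integral>z\<in>{a<..b}. ennreal (d * ?r) * ?H z)"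
    using inner x by (intro order_trans[OF P(2)[OF x]] add_mono mult_left_mono nn_integral_mono) (auto simp: indicator_def)
   also have "(\<integral>z\<in>{a<..b}. ennreal (d * ?r) * ?H z) = ennreal (d * ?r) * ?I"
    by (subst nn_integral_cmult[symmetric]) (auto simp: mult.assoc)
   also have "ennreal (2 / U) * (ennreal (d * ?r) * ?H x) = ennreal A * ?H x"
   proof -
    have "2 / U * (d * ?r) = A" using r kk by (simp add: A_def U_def)
    then show ?thesis using U d r by (simp add: mult.assoc[symmetric] ennreal_mult[symmetric])
   qed
   also have "ennreal ?E * (ennreal (d * ?r) * ?I) = ennreal B * (ennreal (1 / ?r) * ?I)"
   proof -
    have "?E * (d * ?r) = B * (1 / ?r)" using r kk by (simp add: B_def U_def power_divide power2_eq_square)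
    then show ?thesis using E0 B0 U d r by (simp add: mult.assoc[symmetric] ennreal_mult[symmetric] del: times_divide_eq_right times_divide_eq_left)
   qed
   also have "ennreal A * ?H x + ennreal B * (ennreal (1 / ?r) * ?I) <= ennreal (A + B) * ?H x + ennreal (A + B) * (ennreal (1 / ?r) * ?I)"
    using A0 B0 by (intro add_mono mult_right_mono ennreal_leI) auto
   also have "... = ennreal (A + B) * (?H x + ennreal (1 / ?r) * ?I)" by (simp add: distrib_left)
   finally show "ennreal (?w x * \<bar>F x - poly P x\<bar>) <= ennreal (A + B) * (?H x + ennreal (1 / ?r) * ?I)" .
  qed
 qed
qed

section \<open>Averaged differences and the modulus\<close>

lemma sym_diff_eq:
 "sym_diff k h g x = (if x + real k * h / 2 < x - real k * h / 2 \<or> -1 <= x - real k * h / 2 \<and> x + real k * h / 2 <= 1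
  then fdiff k h g (x - real k * h / 2) else 0)"
 unfolding sym_diff_def fdiff_def by auto

lemma sym_diff_measurable [measurable]:
 assumes [measurable]: "F \<in> \<B>" "f \<in> borel_measurable M" "g \<in> borel_measurable M"
 shows "(\<lambda>x. sym_diff k (f x) F (g x)) \<in> borel_measurable M"
 unfolding sym_diff_eq by measurable

lemma W_weight_measurable [measurable]:
 assumes [measurable]: "f \<in> borel_measurable M" "g \<in> borel_measurable M"
 shows "(\<lambda>x. W_weight (f x) \<xi> \<zeta> (g x)) \<in> borel_measurable M"
 unfolding W_weight_def by measurable

lemma locscale_measurable [measurable]: "locscale N \<in> \<B>"
 unfolding locscale_def by measurable

lemma varphi_lower: assumes "-1 <= y" "y <= 3/4" shows "sqrt (1 + y) <= 2 * varphi y"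
proof -
 have "(1/4) * (1 + y) <= (1 - y) * (1 + y)" using assms by (intro mult_right_mono) auto
 moreover have "1 - y\<^sup>2 = (1 - y) * (1 + y)" by (simp add: power2_eq_square algebra_simps)
 ultimately have "1 + y <= 4 * (1 - y\<^sup>2)" by simp
 then have "sqrt (1 + y) <= sqrt (4 * (1 - y\<^sup>2))" by (rule real_sqrt_le_mono)
 also have "... = sqrt 4 * varphi y" unfolding varphi_def by (rule real_sqrt_mult)
 also have "sqrt 4 = (2::real)" by simp
 finally show ?thesis .
qed

lemma varphi_upper: assumes "-1 <= y" "y <= 1" shows "varphi y <= 3/2 * sqrt (1 + y)"
proof -
 have "(1 - y) * (1 + y) <= 2 * (1 + y)" using assms by (intro mult_right_mono) auto
 moreover have "1 - y\<^sup>2 = (1 - y) * (1 + y)" by (simp add: power2_eq_square algebra_simps)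
 ultimately have "1 - y\<^sup>2 <= 9/4 * (1 + y)" using assms by simp
 then have "varphi y <= sqrt (9/4 * (1 + y))" unfolding varphi_def by (rule real_sqrt_le_mono)
 also have "... = sqrt (9/4) * sqrt (1 + y)" by (rule real_sqrt_mult)
 also have "sqrt (9/4) = (3/2::real)" by (rule real_sqrt_unique) (auto simp: power2_eq_square)
 finally show ?thesis .
qed

text \<open>A forward difference with start point \<open>x\<close> and step \<open>v\<close> is a symmetric difference with centre
  \<open>y = x + kv/2\<close> and step \<open>h\<phi>(y)\<close>; the bounds make \<open>h \<le> 1/N\<close> and \<open>dv/\<rho>(x)\<close> comparable to \<open>N dh\<close>.\<close>

lemma forward_centre:
 assumes N: "N >= 1" and k: "k >= 1" and x: "-1 < x" "x <= 1/2" and v: "0 <= v" "v <= locscale N x / (16 * real k)"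
 defines "y \<equiv> x + real k * v / 2"
 shows "x + real k * v <= 3/4" "y \<in> \<I>" "v <= varphi y / real N" "1 / locscale N x <= 3 * (real N / varphi y)"
proof -
 have kk: "1 <= real k" and NN: "1 <= real N" using k N by auto
 have r: "0 < locscale N x" "locscale N x <= 9/4" using N x locscale_pos[of N x] locscale_le[of N x] by auto
 have kv: "real k * v <= locscale N x / 16"
  using mult_left_mono[OF v(2), of "real k"] kk by simp
 then show x3: "x + real k * v <= 3/4" using r x by linarith
 have kv0: "0 <= real k * v" using v kk by auto
 show y: "y \<in> \<I>" using x kv0 x3 unfolding y_def by auto
 have vk: "v <= real k * v" using mult_right_mono[OF kk, of v] v by simp
 have vr: "v <= locscale N x / 16" using vk kv by (rule order_trans)
 have "y <= 3/4" using x3 kv0 unfolding y_def by linarith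
 then have ylow: "sqrt (1 + y) <= 2 * varphi y" using y by (intro varphi_lower) auto
 have vp: "0 < varphi y" by (rule varphi_pos[OF y])
 \<comment> \<open>Which of the two terms of the scale dominates decides the argument.\<close>
 show "v <= varphi y / real N"
 proof (cases "1 / real N <= sqrt (1 + x)")
  case True
  have "1 / (real N)\<^sup>2 = (1 / real N) / real N" by (simp add: power2_eq_square)
  also have "... <= sqrt (1 + x) / real N" using True by (rule divide_right_mono) simp
  finally have "locscale N x <= 2 * sqrt (1 + x) / real N" by (simp add: locscale_def)
  then have "v <= (2 * sqrt (1 + x) / real N) / 16" by (intro order_trans[OF vr] divide_right_mono) auto
  also have "... <= (2 * sqrt (1 + y) / real N) / 16"
   using kv0 NN unfolding y_def by (intro divide_right_mono mult_left_mono real_sqrt_le_mono) auto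
  also have "... <= (2 * (2 * varphi y) / real N) / 16" using ylow by (intro divide_right_mono mult_left_mono) auto
  also have "... <= varphi y / real N" using vp NN by (simp add: field_simps)
  finally show ?thesis .
 next
  case False
  have "sqrt (1 + x) / real N <= (1 / real N) / real N" using False by (intro divide_right_mono) auto
  then have "locscale N x <= 2 / (real N)\<^sup>2" by (simp add: locscale_def power2_eq_square)
  then have v1: "v <= (2 / (real N)\<^sup>2) / 16" by (intro order_trans[OF vr] divide_right_mono) auto
  have "real k * v / 2 <= 1 + y" using x unfolding y_def by simp
  then have "real k * v <= 2 * (1 + y)" by (simp add: field_simps)
  with vk have "v <= 2 * (1 + y)" by (rule order_trans)
  also have "1 + y = (sqrt (1 + y))\<^sup>2" using y by simp
  also have "... <= (2 * varphi y)\<^sup>2" using ylow y by (intro power_mono) auto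
  finally have v2: "v <= 8 * (varphi y)\<^sup>2" by (simp add: power_mult_distrib)
  \<comment> \<open>Near the endpoint two bounds are combined: \<open>v <= 8*\<phi>(y)^2\<close> and
    \<open>v <= 1/(8*N^2)\<close> multiply to the square of the desired one.\<close>
  have "v * v <= (8 * (varphi y)\<^sup>2) * ((2 / (real N)\<^sup>2) / 16)" using v v1 v2 by (intro mult_mono) auto
  also have "... = (varphi y / real N)\<^sup>2" by (simp add: power_divide)
  finally have vv: "v\<^sup>2 <= (varphi y / real N)\<^sup>2" by (simp add: power2_eq_square)
  have "0 <= varphi y / real N" using vp by simp
  with vv show ?thesis by (rule power2_le_imp_le)
 qed
 define L where "L = real N * locscale N x"
 have "varphi y <= 3/2 * sqrt (1 + y)" using y by (intro varphi_upper) auto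
 moreover have "sqrt (1 + y) <= sqrt (1 + x) + sqrt (real k * v / 2)"
  using sqrt_add_le_add_sqrt[of "1 + x" "real k * v / 2"] x kv0 by (simp add: y_def add.assoc)
 moreover have "sqrt (1 + x) <= L" using NN by (simp add: L_def locscale_def power2_eq_square field_simps)
 moreover have "sqrt (real k * v / 2) <= sqrt (locscale N x)" using kv kv0 r by (intro real_sqrt_le_mono) auto
 moreover have "sqrt (locscale N x) <= L" using N x unfolding L_def by (intro locscale_sqrt) auto
 ultimately have "varphi y <= 3 * L" by linarith
 then have "varphi y <= 3 * (real N * locscale N x)" by (simp add: L_def)
 then show "1 / locscale N x <= 3 * (real N / varphi y)" using vp r by (simp add: field_simps)
qed

text \<open>After Jensen in \<open>v\<close>, the variables \<open>(x,v)\<close> become the centre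
  \<open>y\<close> and the normalized step \<open>h = v/\<phi>(y)\<close>. There the modulus weight
  has the bases \<open>1 - x - k*v\<close> and \<open>1 + x\<close>, so it is taken at the extreme
  points of the difference; \<open>8 powr \<xi>\<close> moves the first one back to
  \<open>x\<close>.\<close>

lemma avdiff_Lp:
 assumes k: "k >= 1" and \<xi>: "0 <= \<xi>" and \<zeta>: "0 <= \<zeta>" and p: "1 <= p" and N: "N >= 1" and c: "0 < c"
  and F [measurable]: "F \<in> \<B>"
  and M: "(\<integral>h\<in>{0..1 / real N}. (\<integral>x\<in>\<I>. Phi p (ennreal \<bar>W_weight (real k * h) \<xi> \<zeta> x * sym_diff k (h * varphi x) F x\<bar> / ennreal c))) <= ennreal (1 / real N)"
 shows "Lp_le p (\<lambda>x. avdiff k \<xi> \<zeta> N F x * indicator {-1<..1/2} x) (3 * 8 powr \<xi> * c)"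
proof -
 have NN: "1 <= real N" and kk: "1 <= real k" using N k by auto
 let ?r = "locscale N" and ?w = "jw \<xi> \<zeta>"
 let ?c = "3 * 8 powr \<xi> * c"
 have cpos: "0 < ?c" using c by simp
 define R where "R x v = (1 - x - real k * v) powr \<xi> * (1 + x) powr \<zeta> * \<bar>fdiff k v F x\<bar>" for x v
 have R0: "0 <= R x v" for x v by (simp add: R_def)
 have Rm [measurable]: "(\<lambda>z. R (f z) (g z)) \<in> borel_measurable M" if [measurable]: "f \<in> borel_measurable M" "g \<in> borel_measurable M" for f g M
  unfolding R_def by measurable
 define T where "T h y = Phi p (ennreal \<bar>W_weight (real k * h) \<xi> \<zeta> y * sym_diff k (h * varphi y) F y\<bar> / ennreal c)" for h y
 have Tm [measurable]: "(\<lambda>z. T (f z) (g z)) \<in> borel_measurable M" if [measurable]: "f \<in> borel_measurable M" "g \<in> borel_measurable M" for f g M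
  unfolding T_def by measurable
 define G :: "real => real => ennreal" where "G x v = (if -1 < x \<and> x <= 1/2 \<and> 0 <= v \<and> v <= ?r x / (16 * real k) then ennreal (1 / (3 * ?r x)) * Phi p (ennreal (R x v) / ennreal c) else 0)" for x v
 have Gm [measurable]: "(\<lambda>z. G (f z) (g z)) \<in> borel_measurable M" if [measurable]: "f \<in> borel_measurable M" "g \<in> borel_measurable M" for f g M
  unfolding G_def by measurable
 have step1: "Phi p (avdiff k \<xi> \<zeta> N F x / ennreal ?c) <= (\<integral>v. G x v)" if x: "-1 < x" "x <= 1/2" for x
 proof -
  have r: "0 < ?r x" using N x by (intro locscale_pos) auto
  let ?k = "\<lambda>v. ennreal (1 / ?r x) * indicator {0..?r x / (16 * real k)} v"
  let ?u = "\<lambda>v. ennreal (?w x * \<bar>fdiff k v F x\<bar>) / ennreal ?c"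
  have "Phi p (avdiff k \<xi> \<zeta> N F x / ennreal ?c) = Phi p (\<integral>v. ?k v * ?u v)"
  proof (rule arg_cong[of _ _ "Phi p"])
   have "avdiff k \<xi> \<zeta> N F x / ennreal ?c = ennreal (1 / ?c) * (ennreal (1 / ?r x) * (\<integral>v\<in>{0..?r x / (16 * real k)}. ennreal (?w x * \<bar>fdiff k v F x\<bar>)))"
    unfolding avdiff_def using cpos by (rule divide_ennreal_mult)
   also have "... = (\<integral>v. ennreal (1 / ?c) * (ennreal (1 / ?r x) * (ennreal (?w x * \<bar>fdiff k v F x\<bar>) * indicator {0..?r x / (16 * real k)} v)))"
    by (simp add: nn_integral_cmult)
   also have "... = (\<integral>v. ?k v * ?u v)"
    unfolding divide_ennreal_mult[OF cpos] by (simp only: mult_ac)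
   finally show "avdiff k \<xi> \<zeta> N F x / ennreal ?c = (\<integral>v. ?k v * ?u v)" .
  qed
  also have "Phi p (\<integral>v. ?k v * ?u v) <= (\<integral>v. ?k v * Phi p (?u v))"
  proof (rule Phi_nn_integral[OF p])
   have "(\<integral>v. ?k v) = ennreal (1 / ?r x) * ennreal (?r x / (16 * real k))"
    using r by (simp add: nn_integral_cmult_indicator)
   also have "... = ennreal (1 / (16 * real k))" using r kk by (simp add: ennreal_mult[symmetric])
   also have "... <= 1" using kk by (simp flip: ennreal_1)
   finally show "(\<integral>v. ?k v) <= 1" .
  qed measurable
  also have "... <= (\<integral>v. G x v)"
  proof (rule nn_integral_mono)
   fix v
   show "?k v * Phi p (?u v) <= G x v"
   proof (cases "v \<in> {0..?r x / (16 * real k)}")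
    case True
    have "x + real k * v <= 3/4" using forward_centre(1)[OF N k x] True by auto
    then have "(1 - x) powr \<xi> <= (8 * (1 - x - real k * v)) powr \<xi>" using x \<xi> by (intro powr_mono2) auto
    also have "... = 8 powr \<xi> * (1 - x - real k * v) powr \<xi>" by (rule powr_mult)
    finally have "?w x * \<bar>fdiff k v F x\<bar> <= (8 powr \<xi> * (1 - x - real k * v) powr \<xi>) * (1 + x) powr \<zeta> * \<bar>fdiff k v F x\<bar>"
     unfolding jacobi_weight_def by (intro mult_right_mono) auto
    then have wR: "?w x * \<bar>fdiff k v F x\<bar> <= 8 powr \<xi> * R x v" by (simp add: R_def mult.assoc)
    have "?u v <= ennreal (8 powr \<xi> * R x v) / ennreal ?c" using wR by (intro divide_right_mono_ennreal ennreal_leI)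
    \<comment> \<open>The factor \<open>1/3\<close> leaves \<open>Phi\<close> by convexity and
      cancels the 3 in the comparison of \<open>1 / locscale\<close> with
      \<open>N/\<phi>(y)\<close>.\<close>
    also have "... = ennreal (1/3) * (ennreal (R x v) / ennreal c)"
    proof -
     have "ennreal (8 powr \<xi> * R x v) / ennreal ?c = ennreal (8 powr \<xi> * R x v / ?c)" using cpos R0 by (intro divide_ennreal) auto
     also have "8 powr \<xi> * R x v / ?c = 1/3 * (R x v / c)" using c by simp
     also have "ennreal (1/3 * (R x v / c)) = ennreal (1/3) * ennreal (R x v / c)" using R0 c by (intro ennreal_mult) auto
     also have "ennreal (R x v / c) = ennreal (R x v) / ennreal c" using c R0 by (simp add: divide_ennreal)
     finally show ?thesis .
    qed
    finally have "Phi p (?u v) <= Phi p (ennreal (1/3) * (ennreal (R x v) / ennreal c))" by (rule Phi_mono[OF p])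
    also have "... <= ennreal (1/3) * Phi p (ennreal (R x v) / ennreal c)" by (intro Phi_scale p) (simp flip: ennreal_1)
    finally have "ennreal (1 / ?r x) * Phi p (?u v) <= ennreal (1 / ?r x) * (ennreal (1/3) * Phi p (ennreal (R x v) / ennreal c))"
     by (rule mult_left_mono) simp
    also have "... = G x v"
     using True x r by (simp add: G_def mult.assoc[symmetric] ennreal_mult[symmetric] mult.commute)
    finally show ?thesis using True by simp
   qed simp
  qed
  finally show ?thesis .
 qed
 have step2: "G (y - real k * v / 2) v <= indicator \<I> y * (indicator {0..varphi y / real N} v * (ennreal (real N / varphi y) * T (v / varphi y) y))" for y v
 proof (cases "-1 < y - real k * v / 2 \<and> y - real k * v / 2 <= 1/2 \<and> 0 <= v \<and> v <= ?r (y - real k * v / 2) / (16 * real k)")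
  case True
  define x where "x = y - real k * v / 2"
  have yx: "y = x + real k * v / 2" by (simp add: x_def)
  have x: "-1 < x" "x <= 1/2" "0 <= v" "v <= ?r x / (16 * real k)" using True by (auto simp: x_def)
  note fc = forward_centre[OF N k x, folded yx]
  have vp: "0 < varphi y" by (rule varphi_pos[OF fc(2)])
  have r: "0 < ?r x" using N x by (intro locscale_pos) auto
  have hv: "v / varphi y * varphi y = v" using vp by simp
  have e1: "y - real k * v / 2 = x" by (simp add: x_def)
  have e2: "y + real k * v / 2 = x + real k * v" by (simp add: x_def)
  have "sym_diff k (v / varphi y * varphi y) F y = fdiff k v F x"
   unfolding hv sym_diff_eq e1 e2 using x fc(1) by simp
  \<comment> \<open>This exact evaluation is what the shifted arguments in the weight of the modulus
    provide.\<close>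
  moreover have "W_weight (real k * (v / varphi y)) \<xi> \<zeta> y = (1 - x - real k * v) powr \<xi> * (1 + x) powr \<zeta>"
  proof -
   have "real k * (v / varphi y) * varphi y / 2 = real k * v / 2" using vp by simp
   then show ?thesis unfolding W_weight_def yx[symmetric] by (simp add: x_def algebra_simps)
  qed
  ultimately have "\<bar>W_weight (real k * (v / varphi y)) \<xi> \<zeta> y * sym_diff k (v / varphi y * varphi y) F y\<bar> = R x v"
   by (simp add: R_def abs_mult)
  then have "T (v / varphi y) y = Phi p (ennreal (R x v) / ennreal c)" by (simp add: T_def)
  moreover have "1 / (3 * ?r x) <= real N / varphi y" using fc(4) r vp by (simp add: field_simps)
  ultimately have "ennreal (1 / (3 * ?r x)) * Phi p (ennreal (R x v) / ennreal c) <= ennreal (real N / varphi y) * T (v / varphi y) y"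
   by (auto intro!: mult_right_mono ennreal_leI)
  then show ?thesis using x fc by (simp add: G_def x_def[symmetric])
 next
  case False
  then have "G (y - real k * v / 2) v = 0" unfolding G_def by (rule if_not_P)
  then show ?thesis by simp
 qed
 have step3: "(\<integral>v. indicator {0..varphi y / real N} v * (ennreal (real N / varphi y) * T (v / varphi y) y))
  = ennreal (real N) * (\<integral>h\<in>{0..1 / real N}. T h y)" if y: "y \<in> \<I>" for y
 proof -
  have vp: "0 < varphi y" by (rule varphi_pos[OF y])
  let ?f = "\<lambda>v. indicator {0..varphi y / real N} v * (ennreal (real N / varphi y) * T (v / varphi y) y)"
  have "(\<integral>v. ?f v) = ennreal (varphi y) * (\<integral>h. ?f (varphi y * h))"
   using nn_integral_real_affine[of ?f "varphi y" 0] vp by simp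
  also have "... = (\<integral>h. ennreal (varphi y) * ?f (varphi y * h))" by (rule nn_integral_cmult[symmetric]) measurable
  also have "... = (\<integral>h. ennreal (real N) * (T h y * indicator {0..1 / real N} h))"
  proof (rule nn_integral_cong)
   fix h
   have "varphi y * h \<in> {0..varphi y / real N} \<longleftrightarrow> h \<in> {0..1 / real N}"
    using vp NN by (auto simp: field_simps zero_le_mult_iff)
   moreover have "ennreal (varphi y) * ennreal (real N / varphi y) = ennreal (real N)" using vp by (simp add: ennreal_mult[symmetric])
   ultimately show "ennreal (varphi y) * ?f (varphi y * h) = ennreal (real N) * (T h y * indicator {0..1 / real N} h)"
    using vp by (simp add: indicator_def mult.assoc[symmetric])
  qed
  also have "... = ennreal (real N) * (\<integral>h\<in>{0..1 / real N}. T h y)" by (rule nn_integral_cmult) measurable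
  finally show ?thesis .
 qed
 have "(\<integral>x\<in>\<I>. Phi p (avdiff k \<xi> \<zeta> N F x * indicator {-1<..1/2} x / ennreal ?c)) <= (\<integral>x. (\<integral>v. G x v))"
 proof (rule nn_integral_mono)
  fix x :: real
  show "Phi p (avdiff k \<xi> \<zeta> N F x * indicator {-1<..1/2} x / ennreal ?c) * indicator \<I> x <= (\<integral>v. G x v)"
   using step1[of x] by (cases "-1 < x \<and> x <= 1/2") (auto simp: indicator_def)
 qed
 also have "... = (\<integral>v. (\<integral>x. G x v))" by (rule lborel_pair.Fubini'[symmetric]) measurable
 also have "... = (\<integral>v. (\<integral>y. G (y - real k * v / 2) v))"
 proof (rule nn_integral_cong)
  fix v :: real
  show "(\<integral>x. G x v) = (\<integral>y. G (y - real k * v / 2) v)"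
   using nn_integral_real_affine[of "\<lambda>x. G x v" 1 "- (real k * v / 2)"] by (simp add: add.commute)
 qed
 also have "... = (\<integral>y. (\<integral>v. G (y - real k * v / 2) v))" by (rule lborel_pair.Fubini') measurable
 also have "... <= (\<integral>y. indicator \<I> y * (ennreal (real N) * (\<integral>h\<in>{0..1 / real N}. T h y)))"
 proof (rule nn_integral_mono)
  fix y :: real
  have "(\<integral>v. G (y - real k * v / 2) v) <= (\<integral>v. indicator \<I> y * (indicator {0..varphi y / real N} v * (ennreal (real N / varphi y) * T (v / varphi y) y)))"
   by (intro nn_integral_mono step2)
  also have "... = indicator \<I> y * (\<integral>v. indicator {0..varphi y / real N} v * (ennreal (real N / varphi y) * T (v / varphi y) y))"
   by (rule nn_integral_cmult) measurable
  also have "... = indicator \<I> y * (ennreal (real N) * (\<integral>h\<in>{0..1 / real N}. T h y))"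
   using step3[of y] by (auto simp: indicator_def)
  finally show "(\<integral>v. G (y - real k * v / 2) v) <= indicator \<I> y * (ennreal (real N) * (\<integral>h\<in>{0..1 / real N}. T h y))" .
 qed
 also have "... = ennreal (real N) * (\<integral>y. (\<integral>h. T h y * indicator {0..1 / real N} h * indicator \<I> y))"
  by (simp add: nn_integral_cmult[symmetric] nn_integral_multc[symmetric] mult_ac)
 also have "(\<integral>y. (\<integral>h. T h y * indicator {0..1 / real N} h * indicator \<I> y))
  = (\<integral>h. (\<integral>y. T h y * indicator {0..1 / real N} h * indicator \<I> y))"
  by (rule lborel_pair.Fubini') measurable
 also have "... = (\<integral>h\<in>{0..1 / real N}. (\<integral>x\<in>\<I>. T h x))"
  by (simp add: nn_integral_cmult[symmetric] nn_integral_multc[symmetric] mult_ac)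
 also have "ennreal (real N) * ... <= ennreal (real N) * ennreal (1 / real N)"
  using M unfolding T_def by (intro mult_left_mono) auto
 also have "... = 1" using NN by (simp add: ennreal_mult[symmetric])
 finally show ?thesis by (simp add: Lp_le_def)
qed

section \<open>Gluing the local polynomials\<close>

lemma exists_le_average_Icc:
 fixes g :: "real => ennreal"
 assumes d: "0 < d" and [measurable]: "g \<in> \<B>" and Y: "(\<integral>s\<in>{c..c + d}. g s) <= Y"
 shows "\<exists>s\<in>{c..c + d}. g s <= ennreal (1 / d) * Y"
proof -
 have "(\<integral>s\<in>{c..c + d}. g s) = (\<integral>s. g (c - d + s) * indicator {c..c + d} (c - d + s))"
  using nn_integral_real_affine[of "\<lambda>s. g s * indicator {c..c + d} s" 1 "c - d"] by simp
 also have "... = (\<integral>s\<in>{(2 * d)/2..2 * d}. g (c - d + s))"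
  by (intro nn_integral_cong) (auto simp: indicator_def)
 finally have "(\<integral>s\<in>{(2 * d)/2..2 * d}. g (c - d + s)) <= Y" using Y by simp
 moreover have "0 < 2 * d" using d by simp
 moreover have "(\<lambda>s. g (c - d + s)) \<in> \<B>" by measurable
 ultimately have "\<exists>s\<in>{(2 * d)/2..2 * d}. g (c - d + s) <= ennreal (2 / (2 * d)) * Y"
  by (intro exists_le_average)
 then obtain s where s: "s \<in> {(2 * d)/2..2 * d}" "g (c - d + s) <= ennreal (2 / (2 * d)) * Y" ..
 then have "g (c - d + s) <= ennreal (1 / d) * Y" by simp
 moreover have "c - d + s \<in> {c..c + d}" using s(1) by auto
 ultimately show ?thesis by (rule bexI)
qed

text \<open>Lagrange interpolation: every fundamental polynomial has \<open>k - 1\<close> factors,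
  each at most \<open>X / \<eta>\<close>.\<close>

lemma lagrange_bound:
 fixes q :: "real poly" and t :: "nat => real"
 assumes k: "k >= 1" and q: "q \<in> polys k" and e: "0 < \<eta>" and sep: "\<And>i j. i < k ==> j < k ==> i ~= j ==> \<eta> <= \<bar>t i - t j\<bar>"
  and X: "\<And>i. i < k ==> \<bar>x - t i\<bar> <= X" and B: "\<And>i. i < k ==> \<bar>poly q (t i)\<bar> <= B"
 shows "\<bar>poly q x\<bar> <= real k * (B * (X / \<eta>) ^ (k - 1))"
proof -
 define ell where "ell j = (\<Prod>i\<in>{..<k}-{j}. smult (1 / (t j - t i)) [:- t i, 1:])" for j
 have pe: "poly (ell j) y = (\<Prod>i\<in>{..<k}-{j}. (y - t i) / (t j - t i))" for j y
  unfolding ell_def poly_prod by (intro prod.cong refl) (simp add: divide_inverse algebra_simps)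
 have inj: "inj_on t {..<k}"
 proof (rule inj_onI)
  fix i j assume "i \<in> {..<k}" "j \<in> {..<k}" "t i = t j"
  then show "i = j" using sep[of i j] e by (cases "i = j") auto
 qed
 have dq: "degree q < k" using q k by (auto simp: polys_def)
 have de: "degree (ell j) < k" if j: "j < k" for j
 proof -
  have "degree (ell j) <= sum (degree \<circ> (\<lambda>i. smult (1 / (t j - t i)) [:- t i, 1:])) ({..<k}-{j})"
   unfolding ell_def by (rule degree_prod_sum_le) simp
  also have "... <= (\<Sum>i\<in>{..<k}-{j}. 1)" by (intro sum_mono) auto
  also have "... = k - 1" using j by simp
  finally show ?thesis using k by linarith
 qed
 define r where "r = (\<Sum>j<k. smult (poly q (t j)) (ell j))"
 have "r \<in> polys k" unfolding r_def by (intro polys_sum polys_smult) (auto simp: polys_def de)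
 then have dr: "degree r < k" using k by (auto simp: polys_def)
 have tc: "card (t ` {..<k}) = k" using card_image[OF inj] by simp
 have "q = r"
 proof (rule poly_eqI_degree[of "t ` {..<k}"])
  fix y assume "y \<in> t ` {..<k}"
  then obtain m where m: "m < k" "y = t m" by auto
  have el: "poly (ell j) (t m) = (if j = m then 1 else 0)" if "j < k" for j
  proof (cases "j = m")
   case True
   have "(\<Prod>i\<in>{..<k}-{m}. (t m - t i) / (t m - t i)) = (\<Prod>i\<in>{..<k}-{m}. 1)"
   proof (rule prod.cong)
    fix i assume i: "i \<in> {..<k}-{m}"
    then have "t m ~= t i" using inj_onD[OF inj, of m i] m by auto
    then show "(t m - t i) / (t m - t i) = 1" by simp
   qed simp
   then show ?thesis using True by (simp add: pe)
  next
   case False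
   have "(\<Prod>i\<in>{..<k}-{j}. (t m - t i) / (t j - t i)) = 0"
    by (rule prod_zero) (use m False in auto)
   then show ?thesis using False by (simp add: pe)
  qed
  have "poly r y = (\<Sum>j<k. poly q (t j) * (if j = m then 1 else 0))"
   unfolding r_def poly_sum m(2) by (intro sum.cong) (auto simp: el)
  also have "... = (\<Sum>j<k. if j = m then poly q (t j) else 0)" by (intro sum.cong) auto
  also have "... = poly q y" using m(1) unfolding m(2) by (simp add: sum.delta)
  finally show "poly q y = poly r y" by simp
 qed (use tc dq dr in simp_all)
 have X0: "0 <= X" using X[of 0] k by linarith
 have lb: "\<bar>poly (ell j) x\<bar> <= (X / \<eta>) ^ (k - 1)" if j: "j < k" for j
 proof -
  have "\<bar>poly (ell j) x\<bar> = (\<Prod>i\<in>{..<k}-{j}. \<bar>x - t i\<bar> / \<bar>t j - t i\<bar>)" unfolding pe abs_prod by simp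
  also have "... <= (\<Prod>i\<in>{..<k}-{j}. X / \<eta>)"
  proof (rule prod_mono, rule conjI)
   fix i assume i: "i \<in> {..<k}-{j}"
   show "\<bar>x - t i\<bar> / \<bar>t j - t i\<bar> <= X / \<eta>" using X[of i] sep[of j i] i j e X0 by (intro frac_le) auto
  qed auto
  also have "... = (X / \<eta>) ^ (k - 1)" using j by simp
  finally show ?thesis .
 qed
 have B0: "0 <= B" using B[of 0] k by linarith
 have "poly q x = poly r x" using \<open>q = r\<close> by (rule arg_cong)
 also have "... = (\<Sum>j<k. poly q (t j) * poly (ell j) x)" by (simp add: r_def poly_sum)
 finally have "\<bar>poly q x\<bar> = \<bar>\<Sum>j<k. poly q (t j) * poly (ell j) x\<bar>" by (rule arg_cong)
 also have "... <= (\<Sum>j<k. \<bar>poly q (t j) * poly (ell j) x\<bar>)" by (rule sum_abs)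
 also have "... <= (\<Sum>j<k. B * (X / \<eta>) ^ (k - 1))"
  unfolding abs_mult using B lb B0 by (intro sum_mono mult_mono) auto
 finally show ?thesis by simp
qed

text \<open>Only an integral of the bound \<open>g\<close> is controlled, so interpolation nodes are
  chosen by averaging, one in each of \<open>k\<close> separated slots of the interval.\<close>

lemma poly_growth:
 fixes q :: "real poly" and g :: "real => ennreal"
 assumes k: "k >= 1" and q: "q \<in> polys k" and d: "0 < d" and [measurable]: "g \<in> \<B>"
  and qg: "\<And>y. y \<in> {u<..<u + d} ==> ennreal \<bar>poly q y\<bar> <= g y"
 shows "ennreal \<bar>poly q x\<bar> <= ennreal (real k * (3 * real k) ^ k * (1 + \<bar>x - u\<bar> / d) ^ (k - 1)) * (ennreal (1 / d) * (\<integral>y\<in>{u<..<u + d}. g y))"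
proof -
 define Y where "Y = (\<integral>y\<in>{u<..<u + d}. g y)"
 define \<eta> where "\<eta> = d / (3 * real k)"
 have kk: "1 <= real k" using k by simp
 have e: "0 < \<eta>" using d kk by (simp add: \<eta>_def)
 have dk: "3 * real k * \<eta> = d" using kk by (simp add: \<eta>_def)
 define K where "K = real k * (3 * real k) ^ k * (1 + \<bar>x - u\<bar> / d) ^ (k - 1)"
 have K0: "0 < K"
 proof -
  have "0 < 1 + \<bar>x - u\<bar> / d" using d by (intro add_pos_nonneg) auto
  then show ?thesis unfolding K_def using kk by (intro mult_pos_pos zero_less_power) auto
 qed
 have "ennreal \<bar>poly q x\<bar> <= ennreal K * (ennreal (1 / d) * Y)"
 proof (cases "Y = \<infinity>")
  case True
  then show ?thesis using K0 d by (simp add: ennreal_mult_top)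
 next
  case False
  \<comment> \<open>The slots are the middle thirds of \<open>k\<close> equal pieces of length
    \<open>3*\<eta>\<close>, so nodes from different slots are at least \<open>\<eta>\<close>
    apart.\<close>
  have "\<exists>t\<in>{u + (3 * real j + 1) * \<eta>..u + (3 * real j + 1) * \<eta> + \<eta>}. g t <= ennreal (1 / \<eta>) * Y" if j: "j < k" for j
  proof (rule exists_le_average_Icc[OF e])
   have "(3 * real j + 2) * \<eta> < 3 * real k * \<eta>" using j e by (intro mult_strict_right_mono) auto
   moreover have "0 < (3 * real j + 1) * \<eta>" using e by (intro mult_pos_pos) auto
   ultimately have "{u + (3 * real j + 1) * \<eta>..u + (3 * real j + 1) * \<eta> + \<eta>} \<subseteq> {u<..<u + d}"
    unfolding dk by (auto simp: algebra_simps)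
   then show "(\<integral>s\<in>{u + (3 * real j + 1) * \<eta>..u + (3 * real j + 1) * \<eta> + \<eta>}. g s) <= Y"
    unfolding Y_def by (intro nn_integral_mono mult_left_mono) (auto simp: indicator_def)
  qed measurable
  then have "\<forall>j\<in>{..<k}. \<exists>t. t \<in> {u + (3 * real j + 1) * \<eta>..u + (3 * real j + 1) * \<eta> + \<eta>} \<and> g t <= ennreal (1 / \<eta>) * Y"
   by blast
  from bchoice[OF this] obtain t where t: "\<forall>j\<in>{..<k}. t j \<in> {u + (3 * real j + 1) * \<eta>..u + (3 * real j + 1) * \<eta> + \<eta>} \<and> g (t j) <= ennreal (1 / \<eta>) * Y" ..
  have tI: "u + (3 * real j + 1) * \<eta> <= t j" "t j <= u + (3 * real j + 2) * \<eta>" and tg: "g (t j) <= ennreal (1 / \<eta>) * Y" if "j < k" for j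
   using bspec[OF t, of j] that by (auto simp: algebra_simps)
  have tin: "t j \<in> {u<..<u + d}" if j: "j < k" for j
  proof -
   have "(3 * real j + 2) * \<eta> < 3 * real k * \<eta>" using j e by (intro mult_strict_right_mono) auto
   moreover have "0 < (3 * real j + 1) * \<eta>" using e by (intro mult_pos_pos) auto
   ultimately show ?thesis using tI[OF j] unfolding dk by auto
  qed
  obtain y where y: "0 <= y" "Y = ennreal y" using False by (cases Y) auto
  have B: "\<bar>poly q (t j)\<bar> <= 1 / \<eta> * y" if j: "j < k" for j
  proof -
   have "ennreal \<bar>poly q (t j)\<bar> <= ennreal (1 / \<eta>) * Y" using qg[OF tin[OF j]] tg[OF j] by (rule order_trans)
   also have "... = ennreal (1 / \<eta> * y)" using y e by (simp add: ennreal_mult[symmetric])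
   finally show ?thesis using y e by (subst (asm) ennreal_le_iff) auto
  qed
  have sep': "\<eta> <= t j - t i" if ij: "i < j" "j < k" for i j
  proof -
   have "(3 * real i + 3) * \<eta> <= (3 * real j) * \<eta>" using ij e by (intro mult_right_mono) auto
   then show ?thesis using tI(2)[of i] tI(1)[of j] ij e by (simp add: algebra_simps)
  qed
  have sep: "\<eta> <= \<bar>t i - t j\<bar>" if "i < k" "j < k" "i ~= j" for i j
   using sep'[of i j] sep'[of j i] that by (cases "i < j") auto
  have "\<bar>poly q x\<bar> <= real k * ((1 / \<eta> * y) * ((\<bar>x - u\<bar> + d) / \<eta>) ^ (k - 1))"
  proof (rule lagrange_bound[OF k q e sep _ B])
   fix i assume "i < k"
   then show "\<bar>x - t i\<bar> <= \<bar>x - u\<bar> + d" using tin[of i] by auto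
  qed auto
  also have "(\<bar>x - u\<bar> + d) / \<eta> = (3 * real k) * (1 + \<bar>x - u\<bar> / d)" using d kk by (simp add: \<eta>_def field_simps)
  also have "1 / \<eta> * y = 3 * real k * (1 / d * y)" by (simp add: \<eta>_def)
  also have "real k * (3 * real k * (1 / d * y) * (3 * real k * (1 + \<bar>x - u\<bar> / d)) ^ (k - 1)) = K * (1 / d * y)"
  proof -
   have "(3 * real k) ^ k = 3 * real k * (3 * real k) ^ (k - 1)" using k by (cases k) auto
   then show ?thesis unfolding K_def power_mult_distrib[of "3 * real k" "1 + \<bar>x - u\<bar> / d"] by simp
  qed
  finally have "ennreal \<bar>poly q x\<bar> <= ennreal (K * (1 / d * y))" by (rule ennreal_leI)
  also have "... = ennreal K * ennreal (1 / d * y)" using y K0 d by (intro ennreal_mult) auto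
  also have "ennreal (1 / d * y) = ennreal (1 / d) * Y" unfolding y(2) using y d by (intro ennreal_mult) auto
  finally show ?thesis .
 qed
 then show ?thesis by (simp add: K_def Y_def)
qed

section \<open>Chebyshev knots: cell lengths and angular distances\<close>

text \<open>\<open>8*N\<close> cells of equal angle, fine enough for two neighbours together to be
  no longer than twice the local scale.\<close>

definition knot :: "nat => nat => real" where
 "knot N i = - cos (real i * (pi / (8 * real N)))"

lemma knot_angle: "N >= 1 ==> i <= 8 * N ==> 0 <= real i * (pi / (8 * real N)) \<and> real i * (pi / (8 * real N)) <= pi"
proof -
 assume a: "N >= 1" "i <= 8 * N"
 then have "real i <= 8 * real N" by linarith
 then have "real i * (pi / (8 * real N)) <= (8 * real N) * (pi / (8 * real N))" by (intro mult_right_mono) auto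
 then show ?thesis using a by simp
qed

lemma knot_mono: assumes "N >= 1" "i < j" "j <= 8 * N" shows "knot N i < knot N j"
proof -
 have "real i * (pi / (8 * real N)) < real j * (pi / (8 * real N))" using assms by (intro mult_strict_right_mono) auto
 then show ?thesis unfolding knot_def using knot_angle[of N i] knot_angle[of N j] assms
  by (intro neg_less_iff_less[THEN iffD2] cos_monotone_0_pi) auto
qed

lemma knot_mono_le: "N >= 1 ==> i <= j ==> j <= 8 * N ==> knot N i <= knot N j"
 using knot_mono[of N i j] by (cases "i = j") auto

lemma knot_0 [simp]: "knot N 0 = -1"
 by (simp add: knot_def)

lemma knot_last [simp]: "N >= 1 ==> knot N (8 * N) = 1"
 by (simp add: knot_def)

lemma knot_in: "knot N i \<in> {-1..1}"
 by (simp add: knot_def)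

lemma knot_reflect: assumes "N >= 1" "i <= 8 * N" shows "- knot N i = knot N (8 * N - i)"
proof -
 have "real (8 * N - i) * (pi / (8 * real N)) = pi - real i * (pi / (8 * real N))"
  using assms by (simp add: of_nat_diff field_simps)
 then show ?thesis by (simp add: knot_def)
qed

lemma arccos_knot: assumes "N >= 1" "i <= 8 * N" shows "arccos (knot N i) = pi - real i * (pi / (8 * real N))"
 unfolding knot_def using knot_angle[OF assms] by (subst arccos_minus) (auto simp: arccos_cos)

lemma knot_diff: "knot N j - knot N i = 2 * sin ((real i + real j) * (pi / (16 * real N))) * sin ((real j - real i) * (pi / (16 * real N)))"
proof -
 define d where "d = pi / (8 * real N)"
 have e: "pi / (16 * real N) = d / 2" by (simp add: d_def)
 have "knot N j - knot N i = cos (real i * d) - cos (real j * d)" by (simp add: knot_def d_def)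
 also have "... = 2 * sin ((real i * d + real j * d) / 2) * sin ((real j * d - real i * d) / 2)" by (rule cos_diff_cos)
 also have "(real i * d + real j * d) / 2 = (real i + real j) * (d / 2)" by (simp add: field_simps)
 also have "(real j * d - real i * d) / 2 = (real j - real i) * (d / 2)" by (simp add: field_simps)
 finally show ?thesis unfolding e .
qed

lemma sin_lipschitz: "\<bar>sin a - sin b\<bar> <= \<bar>a - b\<bar>" for a b :: real
proof -
 have "\<bar>2 * a - 2 * b\<bar> = 2 * \<bar>a - b\<bar>" by (simp add: abs_if)
 then show ?thesis using sin_half_diff[of "2 * a" "2 * b"] by simp
qed

lemma pi_bounds: "3 < pi" "pi < 4"
 using pi_approx by auto

text \<open>With \<open>S\<close> the sine of half the angle, \<open>1 + knot N i = 2*S^2\<close>,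
  hence \<open>S <= sqrt (1 + knot N i)\<close>; the length of two cells is
  \<open>2 sin ((i+1)\<delta>) sin \<delta>\<close>, and the first sine is at most
  \<open>2*S + \<delta>\<close>.\<close>

lemma knot_gap_locscale:
 assumes N: "N >= 1" and i: "i + 2 <= 8 * N"
 shows "knot N (i + 2) - knot N i <= 2 * locscale N (knot N i)"
proof -
 define \<delta> where "\<delta> = pi / (8 * real N)"
 have NN: "1 <= real N" using N by simp
 have d: "0 < \<delta>" "\<delta> <= 1 / (2 * real N)" using NN pi_bounds by (auto simp: \<delta>_def field_simps)
 define S where "S = sin (real i * \<delta> / 2)"
 have ang: "0 <= real i * \<delta>" "real i * \<delta> <= pi" using knot_angle[of N i] N i by (auto simp: \<delta>_def)
 have S0: "0 <= S" unfolding S_def using ang by (intro sin_ge_zero) auto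
 have "cos (real i * \<delta>) = 1 - 2 * S\<^sup>2" using cos_double_sin[of "real i * \<delta> / 2"] by (simp add: S_def)
 moreover have "knot N i = - cos (real i * \<delta>)" by (simp add: knot_def \<delta>_def)
 ultimately have "1 + knot N i = 2 * S\<^sup>2" by simp
 then have "S <= sqrt (1 + knot N i)" using S0 by (intro real_le_rsqrt) simp
 then have rho: "S / real N + 1 / (real N)\<^sup>2 <= locscale N (knot N i)" unfolding locscale_def by (intro add_mono divide_right_mono) auto
 have "sin (real i * \<delta>) = 2 * S * cos (real i * \<delta> / 2)" using sin_double[of "real i * \<delta> / 2"] by (simp add: S_def)
 also have "... <= 2 * S * 1" using S0 by (intro mult_left_mono cos_le_one) auto
 finally have "sin ((real i + 1) * \<delta>) <= 2 * S + \<delta>"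
  using sin_lipschitz[of "(real i + 1) * \<delta>" "real i * \<delta>"] d by (simp add: algebra_simps abs_le_iff)
 moreover have "sin \<delta> <= \<delta>" using d by (intro sin_x_le_x) auto
 moreover have "0 <= sin \<delta>" using d NN pi_bounds by (intro sin_ge_zero) (auto simp: \<delta>_def field_simps)
 ultimately have "2 * sin ((real i + 1) * \<delta>) * sin \<delta> <= 2 * (2 * S + \<delta>) * \<delta>" using S0 d by (intro mult_mono[of "2 * sin ((real i + 1) * \<delta>)"]) auto
 also have "... <= 2 * (2 * S + 1 / (2 * real N)) * (1 / (2 * real N))" using S0 d by (intro mult_mono) auto
 also have "... = 2 * (S / real N) + 1 / 2 * (1 / (real N)\<^sup>2)" using NN by (simp add: field_simps power2_eq_square)
 also have "... <= 2 * (S / real N) + 2 * (1 / (real N)\<^sup>2)" by (intro add_left_mono mult_right_mono) auto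
 also have "... <= 2 * locscale N (knot N i)" using rho by simp
 finally have "2 * sin ((real i + 1) * \<delta>) * sin \<delta> <= 2 * locscale N (knot N i)" .
 moreover have h: "pi / (16 * real N) = \<delta> / 2" by (simp add: \<delta>_def)
 have "(real i + real (i + 2)) * (\<delta> / 2) = (real i + 1) * \<delta>" by (simp add: field_simps)
 moreover have "(real (i + 2) - real i) * (\<delta> / 2) = \<delta>" by simp
 ultimately show ?thesis unfolding knot_diff h by (simp only:)
qed

lemma knot_half: assumes "N >= 1" "j <= 4 * N + 1" shows "knot N j <= 1/2"
proof -
 have NN: "1 <= real N" using assms by simp
 have "knot N j <= knot N (4 * N + 1)" using assms by (intro knot_mono_le) auto
 also have "real (4 * N + 1) * (pi / (8 * real N)) = pi / 2 + pi / (8 * real N)" using NN by (simp add: field_simps)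
 then have "knot N (4 * N + 1) = sin (pi / (8 * real N))" by (simp add: knot_def cos_add)
 also have "... <= pi / (8 * real N)" using NN by (intro sin_x_le_x) auto
 also have "... <= 4 / 8" using NN pi_bounds by (intro frac_le) auto
 finally show ?thesis by simp
qed

text \<open>Cells \<open>[knot i, knot (i+1)]\<close> with \<open>1 \<le> i \<le> 8N - 2\<close>; \<open>s\<close> is the sine of the angle of the midpoint.\<close>

lemma knot_cell_size:
 assumes N: "N >= 1" and i: "1 <= i" "i + 2 <= 8 * N"
 defines "\<eta> \<equiv> pi / (16 * real N)" and "s \<equiv> sin ((2 * real i + 1) * (pi / (16 * real N)))"
 shows "0 < \<eta>" "\<eta> <= s" "s * \<eta> <= knot N (i + 1) - knot N i"
  "knot N (i + 2) - knot N (i - 1) <= 6 * (knot N (i + 1) - knot N i)"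
proof -
 have NN: "1 <= real N" using N by simp
 show e: "0 < \<eta>" using NN by (simp add: \<eta>_def)
 have e3: "3 * \<eta> <= pi / 2" using NN by (simp add: \<eta>_def field_simps)
 define m where "m = (2 * real i + 1) * \<eta>"
 have m1: "3 * \<eta> <= m" unfolding m_def using i e by (intro mult_right_mono) auto
 have "(2 * real i + 1) * \<eta> <= (16 * real N - 3) * \<eta>" using i e by (intro mult_right_mono) auto
 moreover have "16 * real N * \<eta> = pi" using NN by (simp add: \<eta>_def)
 ultimately have m2: "m <= pi - 3 * \<eta>" by (simp add: m_def left_diff_distrib)
 have base: "\<eta> <= sin y" if y: "3 * \<eta> <= y" "y <= pi / 2" for y
 proof -
  have "1 * \<eta> <= (2 / pi * 3) * \<eta>" using e pi_bounds by (intro mult_right_mono) (auto simp: field_simps)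
  also have "... = 2 / pi * (3 * \<eta>)" by simp
  also have "... <= 2 / pi * y" using y by (intro mult_left_mono) auto
  also have "... <= sin y" using y e by (intro jordan_sin) auto
  finally show ?thesis by simp
 qed
 have sm: "s = sin m" by (simp add: s_def m_def \<eta>_def)
 show es: "\<eta> <= s"
 proof (cases "m <= pi / 2")
  case True then show ?thesis unfolding sm using m1 by (intro base)
 next
  case False
  have "\<eta> <= sin (pi - m)" using False m2 by (intro base) auto
  then show ?thesis unfolding sm by simp
 qed
 have se: "\<eta> / 2 <= sin \<eta>"
 proof -
  have "1/2 * \<eta> <= 2 / pi * \<eta>" using e pi_bounds by (intro mult_right_mono) (auto simp: field_simps)
  also have "... <= sin \<eta>" using e e3 by (intro jordan_sin) auto
  finally show ?thesis by simp
 qed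
 have c: "knot N (i + 1) - knot N i = 2 * s * sin \<eta>"
  unfolding knot_diff s_def \<eta>_def by (simp add: algebra_simps)
 have "2 * s * (\<eta> / 2) <= 2 * s * sin \<eta>" using se es e by (intro mult_left_mono) auto
 then show "s * \<eta> <= knot N (i + 1) - knot N i" unfolding c by simp
 have "sin (3 * \<eta>) <= 3 * \<eta>" using e by (intro sin_x_le_x) auto
 then have "2 * s * sin (3 * \<eta>) <= 2 * s * (6 * sin \<eta>)" using se es e by (intro mult_left_mono) auto
 moreover have "knot N (i + 2) - knot N (i - 1) = 2 * s * sin (3 * \<eta>)"
 proof -
  have r: "real (i - 1) + real (i + 2) = 2 * real i + 1" "real (i + 2) - real (i - 1) = 3" using i by auto
  show ?thesis unfolding knot_diff s_def \<eta>_def r ..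
 qed
 ultimately show "knot N (i + 2) - knot N (i - 1) <= 6 * (knot N (i + 1) - knot N i)" unfolding c by simp
qed

text \<open>A difference of cosines is a product of two sines. One is at most half the angular
  distance \<open>T\<close>, the other differs from the sine \<open>s\<close> at the cell midpoint
  by at most \<open>T/2 + \<eta>\<close>; as \<open>T <= \<eta>*D\<close> and
  \<open>\<eta> <= s\<close>, the ratio to the cell length \<open>s*\<eta>\<close> is quadratic in
  \<open>D\<close>.\<close>

lemma knot_distance:
 assumes N: "N >= 1" and i: "1 <= i" "i + 2 <= 8 * N" and x: "x \<in> {-1..1}"
 shows "1 + \<bar>x - knot N i\<bar> / (knot N (i + 1) - knot N i) <= 4 * (dfac (8 * N) x (knot N i))\<^sup>2"
proof -
 define \<eta> where "\<eta> = pi / (16 * real N)"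
 define s where "s = sin ((2 * real i + 1) * (pi / (16 * real N)))"
 define D where "D = dfac (8 * N) x (knot N i)"
 define \<psi> where "\<psi> = pi - arccos x"
 define T where "T = \<bar>\<psi> - 2 * real i * \<eta>\<bar>"
 have NN: "1 <= real N" using N by simp
 note sz = knot_cell_size[OF N i, folded \<eta>_def s_def]
 have e: "0 < \<eta>" and es: "\<eta> <= s" using sz by auto
 have ie: "real i * (pi / (8 * real N)) = 2 * real i * \<eta>" by (simp add: \<eta>_def)
 have D1: "1 <= D" by (simp add: D_def dfac_ge1)
 have "arccos (knot N i) = pi - 2 * real i * \<eta>" using arccos_knot[OF N, of i] i unfolding ie by simp
 then have e1: "arccos x - arccos (knot N i) = - (\<psi> - 2 * real i * \<eta>)" by (simp add: \<psi>_def)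
 have "\<bar>arccos x - arccos (knot N i)\<bar> = T" unfolding T_def e1 by (rule abs_minus_cancel)
 then have DT: "D = 1 + 8 * real N * T" by (simp add: D_def dfac_def)
 have TD: "T <= \<eta> * D"
 proof -
  have "8 * real N * \<eta> = pi / 2" using NN by (simp add: \<eta>_def)
  then have "\<eta> * D = \<eta> + pi / 2 * T" unfolding DT by (simp add: algebra_simps)
  moreover have "1 * T <= pi / 2 * T" using pi_bounds by (intro mult_right_mono) (auto simp: T_def)
  ultimately show ?thesis using e by linarith
 qed
 have cx: "x = - cos \<psi>" using x by (simp add: \<psi>_def)
 have kc: "knot N i = - cos (2 * real i * \<eta>)" by (simp only: knot_def ie)
 have "x - knot N i = cos (2 * real i * \<eta>) - cos \<psi>" unfolding kc by (subst cx) simp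
 also have "... = 2 * sin ((2 * real i * \<eta> + \<psi>) / 2) * sin ((\<psi> - 2 * real i * \<eta>) / 2)" by (rule cos_diff_cos)
 finally have "\<bar>x - knot N i\<bar> = 2 * \<bar>sin ((2 * real i * \<eta> + \<psi>) / 2)\<bar> * \<bar>sin ((\<psi> - 2 * real i * \<eta>) / 2)\<bar>" by (simp add: abs_mult)
 also have "... <= 2 * (s + T / 2 + \<eta>) * (T / 2)"
 proof -
  have "\<bar>sin ((\<psi> - 2 * real i * \<eta>) / 2)\<bar> <= T / 2" using abs_sin_x_le_abs_x[of "(\<psi> - 2 * real i * \<eta>) / 2"] by (simp add: T_def)
  moreover have "\<bar>sin ((2 * real i * \<eta> + \<psi>) / 2)\<bar> <= s + T / 2 + \<eta>"
  proof -
   have "\<bar>sin ((2 * real i * \<eta> + \<psi>) / 2) - s\<bar> <= \<bar>(2 * real i * \<eta> + \<psi>) / 2 - (2 * real i + 1) * \<eta>\<bar>"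
    unfolding s_def \<eta>_def by (rule sin_lipschitz)
   also have "(2 * real i * \<eta> + \<psi>) / 2 - (2 * real i + 1) * \<eta> = (\<psi> - 2 * real i * \<eta>) / 2 - \<eta>" by (simp add: field_simps)
   also have "\<bar>A / 2 - \<eta>\<bar> <= \<bar>A\<bar> / 2 + \<eta>" for A :: real using e by linarith
   then have "\<bar>(\<psi> - 2 * real i * \<eta>) / 2 - \<eta>\<bar> <= T / 2 + \<eta>" unfolding T_def .
   finally show ?thesis using es e by linarith
  qed
  ultimately show ?thesis using es e by (intro mult_mono) (auto simp: T_def)
 qed
 also have "... = (s + T / 2 + \<eta>) * T" by simp
 also have "... <= (3 * s * D) * (\<eta> * D)"
 proof (rule mult_mono)
  have "T <= s * D" using TD mult_right_mono[OF es, of D] D1 by linarith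
  moreover have "s * 1 <= s * D" using es e D1 by (intro mult_left_mono) auto
  ultimately show "s + T / 2 + \<eta> <= 3 * s * D" using es e by linarith
 qed (use TD es e D1 in \<open>auto simp: T_def\<close>)
 also have "... = 3 * D\<^sup>2 * (s * \<eta>)" by (simp add: power2_eq_square)
 also have "... <= 3 * D\<^sup>2 * (knot N (i + 1) - knot N i)" using sz(3) by (intro mult_left_mono) auto
 finally have "\<bar>x - knot N i\<bar> <= 3 * D\<^sup>2 * (knot N (i + 1) - knot N i)" .
 moreover have "0 < knot N (i + 1) - knot N i" using knot_mono[OF N, of i "i + 1"] i by simp
 ultimately have "\<bar>x - knot N i\<bar> / (knot N (i + 1) - knot N i) <= 3 * D\<^sup>2" by (simp add: pos_divide_le_eq)
 moreover have "1 <= D\<^sup>2" using D1 by simp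
 ultimately show ?thesis unfolding D_def by linarith
qed

text \<open>At most two angular steps away, and \<open>1 + 2*\<pi> < 8\<close>.\<close>

lemma knot_near:
 assumes N: "N >= 1" and i: "1 <= i" "i + 2 <= 8 * N" and x: "x \<in> {knot N (i - 1)..knot N (i + 2)}"
 shows "dfac (8 * N) x (knot N i) <= 8"
proof -
 define d where "d = pi / (8 * real N)"
 have NN: "1 <= real N" using N by simp
 have xx: "-1 <= x" "x <= 1" using x knot_in[of N "i - 1"] knot_in[of N "i + 2"] by auto
 have "arccos x <= arccos (knot N (i - 1))" using x xx knot_in[of N "i - 1"] by (intro arccos_le_arccos) auto
 also have "... = pi - real (i - 1) * d" unfolding d_def using N i by (intro arccos_knot) auto
 also have "real (i - 1) = real i - 1" using i by simp
 finally have u: "arccos x <= pi - real i * d + d" by (simp add: algebra_simps)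
 have "pi - real (i + 2) * d = arccos (knot N (i + 2))" unfolding d_def using N i by (intro arccos_knot[symmetric]) auto
 also have "... <= arccos x" using x xx knot_in[of N "i + 2"] by (intro arccos_le_arccos) auto
 finally have l: "pi - real i * d - 2 * d <= arccos x" by (simp add: algebra_simps)
 have "arccos (knot N i) = pi - real i * d" unfolding d_def using N i by (intro arccos_knot) auto
 then have "\<bar>arccos x - arccos (knot N i)\<bar> <= 2 * d" using u l by (simp add: abs_le_iff)
 then have "8 * real N * \<bar>arccos x - arccos (knot N i)\<bar> <= 8 * real N * (2 * d)" using NN by (intro mult_left_mono) auto
 also have "... = 2 * pi" using NN by (simp add: d_def)
 finally show ?thesis using pi_approx unfolding dfac_def by simp
qed

text \<open>Within \<open>[i,i+1)\<close> the quantity \<open>1 + \<bar>a - s\<bar>\<close> is at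
  most twice its value at \<open>i\<close>, so the sum is at most 4 times an integral bounded by
  2.\<close>

lemma sum_decay: "(\<Sum>i<K. 1 / (1 + \<bar>a - real i\<bar>)\<^sup>2) <= 8"
proof -
 let ?f = "\<lambda>s. ennreal (4 / (1 + \<bar>a - s\<bar>)\<^sup>2)"
 have t: "ennreal (1 / (1 + \<bar>a - real i\<bar>)\<^sup>2) <= (\<integral>s. ?f s * indicator {real i..<real i + 1} s)" for i
 proof -
  have "ennreal (1 / (1 + \<bar>a - real i\<bar>)\<^sup>2) = (\<integral>s. ennreal (1 / (1 + \<bar>a - real i\<bar>)\<^sup>2) * indicator {real i..<real i + 1} s)"
   by (simp add: nn_integral_cmult_indicator)
  also have "... <= (\<integral>s. ?f s * indicator {real i..<real i + 1} s)"
  proof (rule nn_integral_mono)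
   fix s
   show "ennreal (1 / (1 + \<bar>a - real i\<bar>)\<^sup>2) * indicator {real i..<real i + 1} s <= ?f s * indicator {real i..<real i + 1} s"
   proof (cases "s \<in> {real i..<real i + 1}")
    case True
    have "\<bar>s - real i\<bar> <= 1" using True by (auto simp: abs_le_iff)
    moreover have "\<bar>a - s\<bar> <= \<bar>a - real i\<bar> + \<bar>s - real i\<bar>" using abs_triangle_ineq4[of "a - real i" "s - real i"] by simp
    moreover have "1 + u <= 2 * (1 + v)" if "w <= 1" "u <= v + w" "0 <= v" for u v w :: real using that by simp
    ultimately have "1 + \<bar>a - s\<bar> <= 2 * (1 + \<bar>a - real i\<bar>)" using abs_ge_zero by blast
    then have "(1 + \<bar>a - s\<bar>)\<^sup>2 <= (2 * (1 + \<bar>a - real i\<bar>))\<^sup>2" by (intro power_mono) auto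
    then have "4 / (2 * (1 + \<bar>a - real i\<bar>))\<^sup>2 <= 4 / (1 + \<bar>a - s\<bar>)\<^sup>2" by (intro divide_left_mono mult_pos_pos zero_less_power) auto
    moreover have "4 / (2 * (1 + \<bar>a - real i\<bar>))\<^sup>2 = 1 / (1 + \<bar>a - real i\<bar>)\<^sup>2" by (simp only: power_mult_distrib) simp
    ultimately show ?thesis using True by (simp add: ennreal_leI)
   qed simp
  qed
  finally show ?thesis .
 qed
 have one: "(\<Sum>i<K. indicator {real i..<real i + 1} s) <= (1::ennreal)" for s
 proof -
  have "(\<Sum>i<K. indicator {real i..<real i + 1} s) <= (\<Sum>i<K. if i = nat \<lfloor>s\<rfloor> then 1 else (0::ennreal))"
  proof (rule sum_mono)
   fix i
   have "i = nat \<lfloor>s\<rfloor>" if "s \<in> {real i..<real i + 1}"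
   proof -
    have "\<lfloor>s\<rfloor> = int i" using that by (intro floor_unique) auto
    then show ?thesis by simp
   qed
   then show "indicator {real i..<real i + 1} s <= (if i = nat \<lfloor>s\<rfloor> then 1 else (0::ennreal))"
    by (cases "s \<in> {real i..<real i + 1}") simp_all
  qed
  also have "... <= 1" by simp
  finally show ?thesis .
 qed
 have "ennreal (\<Sum>i<K. 1 / (1 + \<bar>a - real i\<bar>)\<^sup>2) = (\<Sum>i<K. ennreal (1 / (1 + \<bar>a - real i\<bar>)\<^sup>2))" by (rule sum_ennreal[symmetric]) simp
 also have "... <= (\<Sum>i<K. \<integral>\<^sup>+s. ?f s * indicator {real i..<real i + 1} s \<partial>lborel)" by (intro sum_mono t)
 also have "... = (\<integral>s. (\<Sum>i<K. ?f s * indicator {real i..<real i + 1} s))" by (rule nn_integral_sum[symmetric]) measurable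
 also have "... <= (\<integral>s. ennreal 4 * ennreal (1 / (1 + 1 * \<bar>a - s\<bar>)\<^sup>2))"
 proof (rule nn_integral_mono)
  fix s
  have "(\<Sum>i<K. ?f s * indicator {real i..<real i + 1} s) = ?f s * (\<Sum>i<K. indicator {real i..<real i + 1} s)" by (rule sum_distrib_left[symmetric])
  also have "... <= ?f s * 1" by (intro mult_left_mono one) auto
  also have "... = ennreal 4 * ennreal (1 / (1 + 1 * \<bar>a - s\<bar>)\<^sup>2)" by (subst ennreal_mult[symmetric]) auto
  finally show "(\<Sum>i<K. ?f s * indicator {real i..<real i + 1} s) <= ennreal 4 * ennreal (1 / (1 + 1 * \<bar>a - s\<bar>)\<^sup>2)" .
 qed
 also have "... = ennreal 4 * (\<integral>s. ennreal (1 / (1 + 1 * \<bar>a - s\<bar>)\<^sup>2))" by (rule nn_integral_cmult) measurable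
 also have "... <= ennreal 4 * 2" using nn_integral_decay[of 1 a] by (intro mult_left_mono) auto
 also have "... = ennreal 8" by (simp flip: ennreal_numeral ennreal_mult)
 finally show ?thesis by (subst (asm) ennreal_le_iff) auto
qed

lemma sum_knot_decay:
 assumes N: "N >= 1" and x: "x \<in> {-1..1}" and I: "I \<subseteq> {..<8 * N}"
 shows "(\<Sum>i\<in>I. 1 / (dfac (8 * N) x (knot N i))\<^sup>2) <= 8"
proof -
 have NN: "1 <= real N" using N by simp
 define b where "b = 8 * real N * (pi - arccos x) / pi"
 have "(\<Sum>i\<in>I. 1 / (dfac (8 * N) x (knot N i))\<^sup>2) <= (\<Sum>i<8 * N. 1 / (dfac (8 * N) x (knot N i))\<^sup>2)"
  using I by (intro sum_mono2) auto
 also have "... <= (\<Sum>i<8 * N. 1 / (1 + \<bar>b - real i\<bar>)\<^sup>2)"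
 proof (rule sum_mono)
  fix i assume i: "i \<in> {..<8 * N}"
  have a: "arccos (knot N i) = pi - real i * (pi / (8 * real N))" using N i by (intro arccos_knot) auto
  have "pi * (b - real i) = 8 * real N * (arccos (knot N i) - arccos x)" unfolding b_def a using NN by (simp add: field_simps)
  then have "pi * \<bar>b - real i\<bar> = 8 * real N * \<bar>arccos x - arccos (knot N i)\<bar>"
   by (metis abs_minus_commute abs_mult abs_of_nonneg mult_nonneg_nonneg of_nat_0_le_iff pi_ge_zero zero_le_numeral)
  moreover have "1 * \<bar>b - real i\<bar> <= pi * \<bar>b - real i\<bar>" using pi_bounds by (intro mult_right_mono) auto
  ultimately have "1 + \<bar>b - real i\<bar> <= dfac (8 * N) x (knot N i)" by (simp add: dfac_def)
  then have "(1 + \<bar>b - real i\<bar>)\<^sup>2 <= (dfac (8 * N) x (knot N i))\<^sup>2" by (intro power_mono) auto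
  then show "1 / (dfac (8 * N) x (knot N i))\<^sup>2 <= 1 / (1 + \<bar>b - real i\<bar>)\<^sup>2"
   using dfac_pos[of "8 * N" x "knot N i"] by (intro divide_left_mono mult_pos_pos zero_less_power) auto
 qed
 also have "... <= 8" by (rule sum_decay)
 finally show ?thesis .
qed

text \<open>Relative to the sine at the knot, \<open>sin v\<close> grows at most linearly in the
  angular distance. This costs one of the four powers, and two are integrated.\<close>

lemma nn_integral_knot_decay:
 assumes N: "N >= 1" and i: "1 <= i" "i + 2 <= 8 * N"
 shows "(\<integral>x\<in>\<I>. ennreal (1 / (dfac' (8 * N) x (knot N i)) ^ 4)) <= ennreal (6 * (knot N (i + 1) - knot N i))"
proof -
 define \<eta> where "\<eta> = pi / (16 * real N)"
 define s where "s = sin ((2 * real i + 1) * (pi / (16 * real N)))"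
 define a where "a = 8 * real N"
 define t where "t = arccos (knot N i)"
 have NN: "1 <= real N" using N by simp
 have a: "0 < a" using NN by (simp add: a_def)
 note sz = knot_cell_size[OF N i, folded \<eta>_def s_def]
 have ae: "1 / a <= \<eta>" using NN pi_bounds by (simp add: a_def \<eta>_def field_simps)
 have "t = pi - 2 * real i * \<eta>" using N i by (simp add: t_def arccos_knot \<eta>_def)
 then have "sin t = sin (2 * real i * \<eta>)" by simp
 moreover have "\<bar>sin (2 * real i * \<eta>) - s\<bar> <= \<bar>2 * real i * \<eta> - (2 * real i + 1) * \<eta>\<bar>" unfolding s_def \<eta>_def by (rule sin_lipschitz)
 moreover have "2 * real i * \<eta> - (2 * real i + 1) * \<eta> = - \<eta>" by (simp add: algebra_simps)
 ultimately have st: "sin t <= 2 * s" using sz by simp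
 have [measurable]: "(\<lambda>x. dfac' (8 * N) x (knot N i)) \<in> \<B>" unfolding dfac'_def by measurable
 have st0: "0 <= sin t" unfolding t_def using knot_in[of N i] by (intro sin_ge_zero arccos_lbound arccos_ubound) auto
 have "(\<integral>x\<in>\<I>. ennreal (1 / (dfac' (8 * N) x (knot N i)) ^ 4)) <= (\<integral>x\<in>{-1..1}. ennreal (1 / (dfac' (8 * N) x (knot N i)) ^ 4))"
  by (intro nn_integral_mono mult_left_mono) (auto simp: indicator_def)
 also have "... = (\<integral>v\<in>{0..pi}. ennreal (1 / (dfac' (8 * N) (cos v) (knot N i)) ^ 4) * ennreal (sin v))"
  by (rule nn_integral_cos_substitution) measurable
 also have "... <= (\<integral>v. ennreal ((sin t + 1 / a) / a) * ennreal (a / (1 + a * \<bar>t - v\<bar>)\<^sup>2))"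
 proof (rule nn_integral_mono)
  fix v
  show "ennreal (1 / (dfac' (8 * N) (cos v) (knot N i)) ^ 4) * ennreal (sin v) * indicator {0..pi} v <= ennreal ((sin t + 1 / a) / a) * ennreal (a / (1 + a * \<bar>t - v\<bar>)\<^sup>2)"
  proof (cases "v \<in> {0..pi}")
   case True
   define D where "D = 1 + a * \<bar>t - v\<bar>"
   have D1: "1 <= D" using a by (simp add: D_def)
   have Deq: "dfac' (8 * N) (cos v) (knot N i) = D"
    using dfac'_cos[OF knot_in[of N i] True, of "8 * N"] by (simp add: dfac'_commute D_def t_def a_def)
   have s1: "sin v <= sin t + \<bar>t - v\<bar>" using sin_lipschitz[of v t] by linarith
   also have "... <= (sin t + 1 / a) * D"
   proof -
    have "1 / a * D = 1 / a + \<bar>t - v\<bar>" using a by (simp add: D_def field_simps)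
    moreover have "sin t * 1 <= sin t * D" using st0 D1 by (intro mult_left_mono) auto
    moreover have "0 < 1 / a" using a by simp
    ultimately show ?thesis unfolding distrib_right by linarith
   qed
   finally have "1 / D ^ 4 * sin v <= 1 / D ^ 4 * ((sin t + 1 / a) * D)" using D1 by (intro mult_left_mono) auto
   also have "... = (sin t + 1 / a) / D ^ 3" using D1 by (simp add: power_numeral_reduce field_simps)
   also have "... <= (sin t + 1 / a) / D\<^sup>2" using st0 a D1 by (intro divide_left_mono power_increasing mult_pos_pos zero_less_power) auto
   also have "... = (sin t + 1 / a) / a * (a / D\<^sup>2)" using a by simp
   finally have "ennreal (1 / D ^ 4 * sin v) <= ennreal ((sin t + 1 / a) / a * (a / D\<^sup>2))" by (rule ennreal_leI)
   moreover have "ennreal (1 / D ^ 4) * ennreal (sin v) = ennreal (1 / D ^ 4 * sin v)"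
    using True D1 by (intro ennreal_mult[symmetric] sin_ge_zero) auto
   moreover have "ennreal ((sin t + 1 / a) / a * (a / D\<^sup>2)) = ennreal ((sin t + 1 / a) / a) * ennreal (a / D\<^sup>2)"
    using st0 a by (intro ennreal_mult) auto
   moreover have "indicator {0..pi} v = (1::ennreal)" using True by simp
   ultimately show ?thesis unfolding Deq D_def[symmetric] by (simp only: mult_1_right)
  qed simp
 qed
 also have "... = ennreal ((sin t + 1 / a) / a) * (\<integral>v. ennreal (a / (1 + a * \<bar>t - v\<bar>)\<^sup>2))" by (rule nn_integral_cmult) measurable
 also have "... <= ennreal ((sin t + 1 / a) / a) * 2" using nn_integral_decay[OF a, of t] by (intro mult_left_mono) auto
 also have "... = ennreal ((sin t + 1 / a) / a * 2)" using st0 a by (subst ennreal_mult) auto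
 also have "(sin t + 1 / a) / a * 2 = (sin t + 1 / a) * (1 / a) * 2" by simp
 also have "... <= ennreal (6 * (knot N (i + 1) - knot N i))"
 proof (rule ennreal_leI)
  have "(sin t + 1 / a) * (1 / a) * 2 <= (3 * s) * \<eta> * 2" using st st0 ae sz a by (intro mult_right_mono mult_mono) auto
  also have "... <= 6 * (knot N (i + 1) - knot N i)" using sz(3) by simp
  finally show "(sin t + 1 / a) * (1 / a) * 2 <= 6 * (knot N (i + 1) - knot N i)" .
 qed
 finally show ?thesis .
qed

section \<open>The kernel of the glued remainder\<close>

text \<open>Integrating a function against this kernel gives the sum over cells of decay times local
  average, so Schur's test applies to the sum. The interval from knot \<open>i-1\<close> to knot
  \<open>i+2\<close> covers both double cells that overlap in cell \<open>i\<close>.\<close>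

definition knot_kernel :: "nat => real => real => ennreal" where
 "knot_kernel N x y = (\<Sum>i\<in>{1..8 * N - 2}. ennreal (1 / (dfac' (8 * N) x (knot N i)) ^ 4) *
  (ennreal (1 / (knot N (i + 1) - knot N i)) * indicator {knot N (i - 1)..knot N (i + 2)} y))"

lemma knot_kernel_measurable [measurable]: "case_prod (knot_kernel N) \<in> borel_measurable (borel \<Otimes>\<^sub>M borel)"
proof -
 have [measurable]: "(\<lambda>p. dfac' (8 * N) (fst p) (knot N i)) \<in> borel_measurable (borel \<Otimes>\<^sub>M borel)" for i unfolding dfac'_def by measurable
 show ?thesis unfolding knot_kernel_def split_beta by measurable
qed

text \<open>The columns give the constant: a column is supported where \<open>dfac <= 8\<close>, so
  each term is at most \<open>6 * 8^2 = 384\<close> times the inverse square of \<open>dfac\<close>,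
  and these sum to at most 8. The rows stay below \<open>6 * 8\<close>.\<close>

lemma Lp_le_knot_kernel:
 assumes p: "1 <= p" and N: "N >= 1" and u: "Lp_le p u c" "c > 0" and [measurable]: "u \<in> \<B>"
 shows "Lp_le p (\<lambda>x. \<integral>\<^sup>+y\<in>\<I>. knot_kernel N x y * u y \<partial>lborel) (3072 * c)"
proof (rule Lp_le_kernel[OF p _ u])
 have [measurable]: "(\<lambda>x. dfac' (8 * N) x (knot N i)) \<in> \<B>" for i unfolding dfac'_def by measurable
 have I: "{1..8 * N - 2} \<subseteq> {..<8 * N}" using N by auto
 have ii: "1 <= i" "i + 2 <= 8 * N" if "i \<in> {1..8 * N - 2}" for i using that N by auto
 have cp: "0 < knot N (i + 1) - knot N i" if "i \<in> {1..8 * N - 2}" for i using knot_mono[OF N, of i "i + 1"] ii[OF that] by simp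
 show "(\<integral>y\<in>\<I>. knot_kernel N x y) <= ennreal 3072" if x: "x \<in> \<I>" for x
 proof -
  let ?D = "\<lambda>i. dfac' (8 * N) x (knot N i)"
  have "(\<integral>y\<in>\<I>. knot_kernel N x y) <= (\<integral>y. knot_kernel N x y)"
   by (intro nn_integral_mono) (auto simp: indicator_def)
  also have "... = (\<Sum>i\<in>{1..8 * N - 2}. ennreal (1 / ?D i ^ 4) * (ennreal (1 / (knot N (i + 1) - knot N i)) * emeasure lborel {knot N (i - 1)..knot N (i + 2)}))"
   unfolding knot_kernel_def by (simp add: nn_integral_sum nn_integral_cmult)
  also have "... <= (\<Sum>i\<in>{1..8 * N - 2}. ennreal (6 * (1 / (dfac (8 * N) x (knot N i))\<^sup>2)))"
  proof (rule sum_mono)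
   fix i assume i: "i \<in> {1..8 * N - 2}"
   have c: "0 < knot N (i + 1) - knot N i" by (rule cp[OF i])
   have l: "knot N (i - 1) <= knot N (i + 2)" using ii[OF i] by (intro knot_mono_le N) auto
   have em: "emeasure lborel {knot N (i - 1)..knot N (i + 2)} = ennreal (knot N (i + 2) - knot N (i - 1))"
    using l by (rule emeasure_lborel_Icc)
   have "ennreal (1 / (knot N (i + 1) - knot N i)) * emeasure lborel {knot N (i - 1)..knot N (i + 2)} = ennreal (1 / (knot N (i + 1) - knot N i) * (knot N (i + 2) - knot N (i - 1)))"
    unfolding em using c l by (intro ennreal_mult[symmetric]) auto
   also have "... <= ennreal 6"
    using knot_cell_size(4)[OF N ii[OF i]] c by (intro ennreal_leI) (simp add: pos_divide_le_eq)
   finally have "ennreal (1 / ?D i ^ 4) * (ennreal (1 / (knot N (i + 1) - knot N i)) * emeasure lborel {knot N (i - 1)..knot N (i + 2)}) <= ennreal (1 / ?D i ^ 4) * ennreal 6"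
    by (intro mult_left_mono) auto
   also have "... = ennreal (6 * (1 / ?D i ^ 4))" by (subst ennreal_mult[symmetric]) (auto simp: mult.commute dfac'_pos less_imp_le)
   also have "... <= ennreal (6 * (1 / (?D i)\<^sup>2))"
    using dfac'_ge1[of "8 * N" x "knot N i"] by (intro ennreal_leI mult_left_mono divide_left_mono power_increasing mult_pos_pos zero_less_power) auto
   also have "... = ennreal (6 * (1 / (dfac (8 * N) x (knot N i))\<^sup>2))" using x knot_in[of N i] by (subst dfac'_eq) auto
   finally show "ennreal (1 / ?D i ^ 4) * (ennreal (1 / (knot N (i + 1) - knot N i)) * emeasure lborel {knot N (i - 1)..knot N (i + 2)}) <= ennreal (6 * (1 / (dfac (8 * N) x (knot N i))\<^sup>2))" .
  qed
  also have "... = ennreal (6 * (\<Sum>i\<in>{1..8 * N - 2}. 1 / (dfac (8 * N) x (knot N i))\<^sup>2))"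
   unfolding sum_distrib_left by (rule sum_ennreal) simp
  also have "... <= ennreal 3072" using sum_knot_decay[OF N _ I, of x] x by (intro ennreal_leI) auto
  finally show ?thesis .
 qed
 show "(\<integral>x\<in>\<I>. knot_kernel N x y) <= ennreal 3072" if y: "y \<in> \<I>" for y
 proof -
  let ?g = "\<lambda>i. ennreal (1 / (knot N (i + 1) - knot N i)) * indicator {knot N (i - 1)..knot N (i + 2)} y"
  have "(\<integral>x\<in>\<I>. knot_kernel N x y) = (\<integral>x. (\<Sum>i\<in>{1..8 * N - 2}. ?g i * (ennreal (1 / (dfac' (8 * N) x (knot N i)) ^ 4) * indicator \<I> x)))"
   unfolding knot_kernel_def sum_distrib_right by (intro nn_integral_cong sum.cong) (auto simp: mult_ac)
  also have "... = (\<Sum>i\<in>{1..8 * N - 2}. ?g i * (\<integral>x\<in>\<I>. ennreal (1 / (dfac' (8 * N) x (knot N i)) ^ 4)))"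
   by (simp add: nn_integral_sum nn_integral_cmult)
  also have "... <= (\<Sum>i\<in>{1..8 * N - 2}. ennreal (384 * (1 / (dfac (8 * N) y (knot N i))\<^sup>2)))"
  proof (rule sum_mono)
   fix i assume i: "i \<in> {1..8 * N - 2}"
   have c: "0 < knot N (i + 1) - knot N i" by (rule cp[OF i])
   have "?g i * (\<integral>x\<in>\<I>. ennreal (1 / (dfac' (8 * N) x (knot N i)) ^ 4)) <= ?g i * ennreal (6 * (knot N (i + 1) - knot N i))"
    by (intro mult_left_mono nn_integral_knot_decay N ii[OF i]) auto
   also have "... = ennreal 6 * indicator {knot N (i - 1)..knot N (i + 2)} y"
   proof -
    have h: "ennreal (1 / \<gamma>) * ennreal (6 * \<gamma>) = ennreal 6" if "0 < \<gamma>" for \<gamma> :: real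
     using that by (simp add: ennreal_mult[symmetric])
    have "?g i * ennreal (6 * (knot N (i + 1) - knot N i)) = (ennreal (1 / (knot N (i + 1) - knot N i)) * ennreal (6 * (knot N (i + 1) - knot N i))) * indicator {knot N (i - 1)..knot N (i + 2)} y"
     by (simp only: mult_ac)
    then show ?thesis unfolding h[OF c] .
   qed
   also have "... <= ennreal (384 * (1 / (dfac (8 * N) y (knot N i))\<^sup>2))"
   proof (cases "y \<in> {knot N (i - 1)..knot N (i + 2)}")
    case True
    have "dfac (8 * N) y (knot N i) <= 8" by (rule knot_near[OF N ii[OF i] True])
    then have "(dfac (8 * N) y (knot N i))\<^sup>2 <= 8\<^sup>2" using dfac_pos[of "8 * N" y "knot N i"] by (intro power_mono) auto
    then have "6 <= 384 * (1 / (dfac (8 * N) y (knot N i))\<^sup>2)" using dfac_pos[of "8 * N" y "knot N i"] by (simp add: pos_le_divide_eq)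
    then show ?thesis using True by (simp only: indicator_simps mult_1_right ennreal_leI)
   qed simp
   finally show "?g i * (\<integral>x\<in>\<I>. ennreal (1 / (dfac' (8 * N) x (knot N i)) ^ 4)) <= ennreal (384 * (1 / (dfac (8 * N) y (knot N i))\<^sup>2))" .
  qed
  also have "... = ennreal (384 * (\<Sum>i\<in>{1..8 * N - 2}. 1 / (dfac (8 * N) y (knot N i))\<^sup>2))"
   unfolding sum_distrib_left by (rule sum_ennreal) simp
  also have "... <= ennreal 3072" using sum_knot_decay[OF N _ I, of y] y by (intro ennreal_leI) auto
  finally show ?thesis .
 qed
qed auto

section \<open>Reflection and the right half\<close>

lemma fdiff_reflect: "fdiff k h (\<lambda>x. F (- x)) y = (-1) ^ k * fdiff k h F (- y - real k * h)"
proof -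
 have "fdiff k h (\<lambda>x. F (- x)) y = (\<Sum>i\<le>k. (-1) ^ k * (real (k choose i) * (-1) ^ (k - i) * F (- y - real k * h + real i * h)))"
  unfolding fdiff_def
 proof (rule sum.reindex_bij_witness[of _ "\<lambda>i. k - i" "\<lambda>i. k - i"])
  fix i assume "i \<in> {..k}"
  then have i: "i <= k" by simp
  have "(-1::real) ^ k = (-1) ^ (k - i) * (-1) ^ i" using i by (simp flip: power_add)
  moreover have "(-1::real) ^ i * (-1) ^ i = 1" by (simp flip: power_add)
  ultimately have "(-1::real) ^ k * (-1) ^ (k - (k - i)) = (-1) ^ (k - i)" using i by (simp add: mult.assoc)
  moreover have "real (k choose (k - i)) = real (k choose i)" using binomial_symmetric[OF i] by simp
  moreover have "- y - real k * h + real (k - i) * h = - (y + real i * h)" using i by (simp add: of_nat_diff algebra_simps)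
  ultimately show "(-1) ^ k * (real (k choose (k - i)) * (-1) ^ (k - (k - i)) * F (- y - real k * h + real (k - i) * h)) = real (k choose i) * (-1) ^ (k - i) * F (- (y + real i * h))"
   by (simp only: mult.left_commute[of "(-1) ^ k"] mult.assoc[symmetric]) (simp add: mult_ac)
 qed auto
 then show ?thesis unfolding fdiff_def sum_distrib_left .
qed

lemma sym_diff_reflect: "\<bar>sym_diff k h (\<lambda>x. F (- x)) x\<bar> = \<bar>sym_diff k h F (- x)\<bar>"
proof -
 have e: "- (x - real k * h / 2) - real k * h = - x - real k * h / 2" by (simp add: field_simps)
 have "\<bar>fdiff k h (\<lambda>x. F (- x)) (x - real k * h / 2)\<bar> = \<bar>fdiff k h F (- x - real k * h / 2)\<bar>"
  unfolding fdiff_reflect e by (simp add: abs_mult)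
 moreover have "(x + real k * h / 2 < x - real k * h / 2 \<or> - 1 <= x - real k * h / 2 \<and> x + real k * h / 2 <= 1) \<longleftrightarrow>
  (- x + real k * h / 2 < - x - real k * h / 2 \<or> - 1 <= - x - real k * h / 2 \<and> - x + real k * h / 2 <= 1)" by linarith
 ultimately show ?thesis unfolding sym_diff_eq by simp
qed

lemma W_weight_reflect: "W_weight \<delta> \<xi> \<zeta> (- x) = W_weight \<delta> \<zeta> \<xi> x"
 by (simp add: W_weight_def varphi_reflect mult.commute)

text \<open>The mean over \<open>h\<close> in \<open>[0,1/N]\<close> of the modular of the weighted
  difference is at most 1. This is weaker than the bound \<open>c\<close> on the modulus.\<close>

definition modulus_avg :: "ennreal => nat => real => real => nat => (real => real) => real => bool" where
 "modulus_avg p k \<xi> \<zeta> N F c \<longleftrightarrow>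
  (\<integral>h\<in>{0..1 / real N}. (\<integral>x\<in>\<I>. Phi p (ennreal \<bar>W_weight (real k * h) \<xi> \<zeta> x * sym_diff k (h * varphi x) F x\<bar> / ennreal c)))
   <= ennreal (1 / real N)"

lemma nn_integral_reflect:
 fixes f :: "real => ennreal"
 assumes [measurable]: "f \<in> \<B>"
 shows "(\<integral>x. f (- x)) = (\<integral>x. f x)"
 using nn_integral_real_affine[of f "-1" 0] by simp

lemma modulus_avg_reflect:
 assumes [measurable]: "F \<in> \<B>" and M: "modulus_avg p k \<xi> \<zeta> N F c"
 shows "modulus_avg p k \<zeta> \<xi> N (\<lambda>x. F (- x)) c"
proof -
 have "(\<integral>x\<in>\<I>. Phi p (ennreal \<bar>W_weight (real k * h) \<zeta> \<xi> x * sym_diff k (h * varphi x) (\<lambda>x. F (- x)) x\<bar> / ennreal c))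
  = (\<integral>x\<in>\<I>. Phi p (ennreal \<bar>W_weight (real k * h) \<xi> \<zeta> x * sym_diff k (h * varphi x) F x\<bar> / ennreal c))" for h
 proof -
  let ?f = "\<lambda>x. Phi p (ennreal \<bar>W_weight (real k * h) \<xi> \<zeta> x * sym_diff k (h * varphi x) F x\<bar> / ennreal c) * indicator \<I> x"
  have "(\<integral>x\<in>\<I>. Phi p (ennreal \<bar>W_weight (real k * h) \<zeta> \<xi> x * sym_diff k (h * varphi x) (\<lambda>x. F (- x)) x\<bar> / ennreal c))
   = (\<integral>x. ?f (- x))"
   unfolding abs_mult sym_diff_reflect W_weight_reflect varphi_reflect
   by (intro nn_integral_cong) (auto simp: indicator_def)
  also have "... = (\<integral>x. ?f x)" by (rule nn_integral_reflect) measurable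
  finally show ?thesis .
 qed
 then show ?thesis using M unfolding modulus_avg_def by simp
qed

lemma Lp_le_reflect:
 assumes "1 <= p" and [measurable]: "u \<in> \<B>" and u: "Lp_le p u c"
 shows "Lp_le p (\<lambda>x. u (- x)) c"
proof -
 let ?f = "\<lambda>x. Phi p (u x / ennreal c) * indicator \<I> x"
 have "(\<integral>x\<in>\<I>. Phi p (u (- x) / ennreal c)) = (\<integral>x. ?f (- x))"
  by (intro nn_integral_cong) (auto simp: indicator_def)
 also have "... = (\<integral>x. ?f x)" by (rule nn_integral_reflect) measurable
 finally show ?thesis using u unfolding Lp_le_def by simp
qed

text \<open>Forward differences starting in \<open>(-1,1/2]\<close> together with reflected ones
  starting in \<open>[-1/2,1)\<close>; the overlap lets every double cell lie in one of the two
  ranges.\<close>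

definition havg :: "nat => real => real => nat => (real => real) => real => ennreal" where
 "havg k \<xi> \<zeta> N F x = avdiff k \<xi> \<zeta> N F x * indicator {-1<..1/2} x + avdiff k \<zeta> \<xi> N (\<lambda>x. F (- x)) (- x) * indicator {-1<..1/2} (- x)"

lemma havg_measurable [measurable]:
 assumes [measurable]: "F \<in> \<B>"
 shows "havg k \<xi> \<zeta> N F \<in> \<B>"
proof -
 have [measurable]: "(\<lambda>x. avdiff k \<zeta> \<xi> N (\<lambda>x. F (- x)) (- x)) \<in> \<B>"
  by (rule measurable_compose[of uminus borel borel]) measurable
 have [measurable]: "(\<lambda>x. avdiff k \<xi> \<zeta> N F x) \<in> \<B>" by (rule avdiff_measurable) measurable
 show ?thesis unfolding havg_def[abs_def] by measurable
qed

lemma havg_reflect: "havg k \<zeta> \<xi> N (\<lambda>x. F (- x)) (- x) = havg k \<xi> \<zeta> N F x"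
 by (simp add: havg_def add.commute)

lemma havg_outside: "havg k \<xi> \<zeta> N F x * indicator \<I> x = havg k \<xi> \<zeta> N F x"
 by (auto simp: havg_def indicator_def)

lemma havg_Lp:
 assumes k: "k >= 1" and \<xi>: "0 <= \<xi>" and \<zeta>: "0 <= \<zeta>" and p: "1 <= p" and N: "N >= 1" and c: "0 < c"
  and F [measurable]: "F \<in> \<B>" and M: "modulus_avg p k \<xi> \<zeta> N F c"
 shows "Lp_le p (havg k \<xi> \<zeta> N F) ((3 * 8 powr \<xi> + 3 * 8 powr \<zeta>) * c)"
proof -
 have G [measurable]: "(\<lambda>x. F (- x)) \<in> \<B>" by measurable
 have [measurable]: "avdiff k \<zeta> \<xi> N (\<lambda>x. F (- x)) \<in> \<B>" "avdiff k \<xi> \<zeta> N F \<in> \<B>"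
  by (rule avdiff_measurable, measurable)+
 have [measurable]: "(\<lambda>x. avdiff k \<zeta> \<xi> N (\<lambda>x. F (- x)) (- x)) \<in> \<B>"
  by (rule measurable_compose[of uminus borel borel]) measurable
 have 1: "Lp_le p (\<lambda>x. avdiff k \<xi> \<zeta> N F x * indicator {-1<..1/2} x) (3 * 8 powr \<xi> * c)"
  using M unfolding modulus_avg_def by (rule avdiff_Lp[OF k \<xi> \<zeta> p N c F])
 have "Lp_le p (\<lambda>x. avdiff k \<zeta> \<xi> N (\<lambda>x. F (- x)) x * indicator {-1<..1/2} x) (3 * 8 powr \<zeta> * c)"
  using modulus_avg_reflect[OF F M] unfolding modulus_avg_def by (rule avdiff_Lp[OF k \<zeta> \<xi> p N c G])
 then have 2: "Lp_le p (\<lambda>x. avdiff k \<zeta> \<xi> N (\<lambda>x. F (- x)) (- x) * indicator {-1<..1/2} (- x)) (3 * 8 powr \<zeta> * c)"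
  by (intro Lp_le_reflect[OF p, of "\<lambda>x. avdiff k \<zeta> \<xi> N (\<lambda>x. F (- x)) x * indicator {-1<..1/2} x"]) measurable
 have "Lp_le p (\<lambda>x. avdiff k \<xi> \<zeta> N F x * indicator {-1<..1/2} x + avdiff k \<zeta> \<xi> N (\<lambda>x. F (- x)) (- x) * indicator {-1<..1/2} (- x)) (3 * 8 powr \<xi> * c + 3 * 8 powr \<zeta> * c)"
 proof (rule Lp_le_add[OF p 1 _ 2])
  show "(\<lambda>x. avdiff k \<zeta> \<xi> N (\<lambda>x. F (- x)) (- x) * indicator {-1<..1/2} (- x)) \<in> \<B>" by measurable
 qed (use c in simp_all)
 then show ?thesis unfolding havg_def[abs_def] by (simp only: distrib_right)
qed

definition loc_integrable :: "(real => real) => bool" where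
 "loc_integrable F \<longleftrightarrow> (\<forall>x y. -1 < x \<and> x <= y \<and> y < 1 --> F integrable_on {x..y})"

lemma loc_integrable_reflect: "loc_integrable F ==> loc_integrable (\<lambda>x. F (- x))"
 unfolding loc_integrable_def
proof (intro allI impI)
 fix x y :: real assume F: "\<forall>x y. -1 < x \<and> x <= y \<and> y < 1 --> F integrable_on {x..y}" and xy: "-1 < x \<and> x <= y \<and> y < 1"
 have "F integrable_on {-y..-x}" using F xy by auto
 then show "(\<lambda>x. F (- x)) integrable_on {x..y}" by (subst Henstock_Kurzweil_Integration.integrable_reflect_real[symmetric]) simp
qed

text \<open>For \<open>i < 4*N\<close> the double cell ends at or before \<open>1/2\<close>, and its
  length is at most twice the scale at its left end, so the local estimate applies with
  \<open>\<Lambda> = 2\<close>.\<close>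

lemma whitney_knots_left:
 assumes k: "k >= 1" and \<xi>: "0 <= \<xi>" and \<zeta>: "0 <= \<zeta>"
 shows "\<exists>C>0. \<forall>N\<ge>1. \<forall>F i. F \<in> \<B> --> loc_integrable F --> i < 4 * N -->
  (\<exists>P\<in>polys k. \<forall>x\<in>{knot N i<..<knot N (i + 2)}. ennreal (jw \<xi> \<zeta> x * \<bar>F x - poly P x\<bar>) \<le>
   ennreal C * (havg k \<xi> \<zeta> N F x + ennreal (2 / (knot N (i + 2) - knot N i)) * (\<integral>z\<in>{knot N i..knot N (i + 2)}. havg k \<xi> \<zeta> N F z)))"
proof -
 have "\<exists>C>0. \<forall>N\<ge>1. \<forall>F a b. F \<in> \<B> --> (\<forall>b<1. locint (-1) b F) --> -1 <= a --> a < b --> b <= 1/2 --> b - a <= 2 * locscale N a -->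
  (\<exists>P\<in>polys k. \<forall>x\<in>{a<..b}. ennreal (jw \<xi> \<zeta> x * \<bar>F x - poly P x\<bar>) \<le>
   ennreal C * (avdiff k \<xi> \<zeta> N F x + ennreal (1 / locscale N a) * (\<integral>z\<in>{a<..b}. avdiff k \<xi> \<zeta> N F z)))"
  by (rule whitney_local[OF k \<xi> \<zeta>]) simp
 then obtain C where C: "C > 0" and W: "\<forall>N\<ge>1. \<forall>F a b. F \<in> \<B> --> (\<forall>b<1. locint (-1) b F) --> -1 <= a --> a < b --> b <= 1/2 --> b - a <= 2 * locscale N a -->
  (\<exists>P\<in>polys k. \<forall>x\<in>{a<..b}. ennreal (jw \<xi> \<zeta> x * \<bar>F x - poly P x\<bar>) \<le>
   ennreal C * (avdiff k \<xi> \<zeta> N F x + ennreal (1 / locscale N a) * (\<integral>z\<in>{a<..b}. avdiff k \<xi> \<zeta> N F z)))"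
  by (elim exE conjE)
 show ?thesis
 proof (intro exI[of _ C] conjI C allI impI)
  fix N :: nat and F :: "real => real" and i :: nat
  assume N: "1 <= N" and F: "F \<in> \<B>" and lF: "loc_integrable F" and i: "i < 4 * N"
  let ?a = "knot N i" and ?b = "knot N (i + 2)"
  have li: "\<forall>b<1. locint (-1) b F" using lF unfolding loc_integrable_def locint_def by auto
  have ab: "?a < ?b" using N i by (intro knot_mono) auto
  have b: "?b <= 1/2" using N i by (intro knot_half) auto
  have a: "-1 <= ?a" using knot_in[of N i] by simp
  have len: "?b - ?a <= 2 * locscale N ?a" using N i by (intro knot_gap_locscale) auto
  have "\<exists>P\<in>polys k. \<forall>x\<in>{?a<..?b}. ennreal (jw \<xi> \<zeta> x * \<bar>F x - poly P x\<bar>) \<le>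
   ennreal C * (avdiff k \<xi> \<zeta> N F x + ennreal (1 / locscale N ?a) * (\<integral>z\<in>{?a<..?b}. avdiff k \<xi> \<zeta> N F z))"
   using W[rule_format, OF N F _ a ab b len] li by simp
  then obtain P where P: "P \<in> polys k" and B: "\<forall>x\<in>{?a<..?b}. ennreal (jw \<xi> \<zeta> x * \<bar>F x - poly P x\<bar>) \<le>
   ennreal C * (avdiff k \<xi> \<zeta> N F x + ennreal (1 / locscale N ?a) * (\<integral>z\<in>{?a<..?b}. avdiff k \<xi> \<zeta> N F z))"
   by (elim bexE)
  have av: "avdiff k \<xi> \<zeta> N F x <= havg k \<xi> \<zeta> N F x" if x: "x \<in> {?a<..?b}" for x
  proof -
   have "x \<in> {-1<..1/2}" using x a b by auto
   then show ?thesis by (simp add: havg_def)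
  qed
  have J: "(\<integral>z\<in>{?a<..?b}. avdiff k \<xi> \<zeta> N F z) <= (\<integral>z\<in>{?a..?b}. havg k \<xi> \<zeta> N F z)"
  proof (rule nn_integral_mono)
   fix z show "avdiff k \<xi> \<zeta> N F z * indicator {?a<..?b} z <= havg k \<xi> \<zeta> N F z * indicator {?a..?b} z"
    using av[of z] by (cases "z \<in> {?a<..?b}") auto
  qed
  have ll: "1 / locscale N ?a <= 2 / (?b - ?a)" using len ab locscale_pos[OF N a] by (simp add: field_simps)
  show "\<exists>P\<in>polys k. \<forall>x\<in>{?a<..<?b}. ennreal (jw \<xi> \<zeta> x * \<bar>F x - poly P x\<bar>) \<le>
   ennreal C * (havg k \<xi> \<zeta> N F x + ennreal (2 / (?b - ?a)) * (\<integral>z\<in>{?a..?b}. havg k \<xi> \<zeta> N F z))"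
  proof (rule bexI[OF _ P], rule ballI)
   fix x assume "x \<in> {?a<..<?b}"
   then have x: "x \<in> {?a<..?b}" by auto
   note bspec[OF B x]
   also have "ennreal C * (avdiff k \<xi> \<zeta> N F x + ennreal (1 / locscale N ?a) * (\<integral>z\<in>{?a<..?b}. avdiff k \<xi> \<zeta> N F z))
    <= ennreal C * (havg k \<xi> \<zeta> N F x + ennreal (2 / (?b - ?a)) * (\<integral>z\<in>{?a..?b}. havg k \<xi> \<zeta> N F z))"
    by (rule mult_left_mono[OF add_mono[OF av[OF x] mult_mono[OF ennreal_leI[OF ll] J]]]) auto
   finally show "ennreal (jw \<xi> \<zeta> x * \<bar>F x - poly P x\<bar>) \<le>
    ennreal C * (havg k \<xi> \<zeta> N F x + ennreal (2 / (?b - ?a)) * (\<integral>z\<in>{?a..?b}. havg k \<xi> \<zeta> N F z))" .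
  qed
 qed
qed

text \<open>The remaining double cells are reflected: the index becomes \<open>8*N - (i+2)\<close>,
  the exponents are exchanged, and the polynomial is composed with \<open>-x\<close>.\<close>

lemma whitney_knots:
 assumes k: "k >= 1" and \<xi>: "0 <= \<xi>" and \<zeta>: "0 <= \<zeta>"
 shows "\<exists>C>0. \<forall>N\<ge>1. \<forall>F i. F \<in> \<B> --> loc_integrable F --> i + 2 <= 8 * N -->
  (\<exists>P\<in>polys k. \<forall>x\<in>{knot N i<..<knot N (i + 2)}. ennreal (jw \<xi> \<zeta> x * \<bar>F x - poly P x\<bar>) \<le>
   ennreal C * (havg k \<xi> \<zeta> N F x + ennreal (2 / (knot N (i + 2) - knot N i)) * (\<integral>z\<in>{knot N i..knot N (i + 2)}. havg k \<xi> \<zeta> N F z)))"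
proof -
 let ?B = "\<lambda>C \<xi> \<zeta> N F i. (\<exists>P\<in>polys k. \<forall>x\<in>{knot N i<..<knot N (i + 2)}. ennreal (jw \<xi> \<zeta> x * \<bar>F x - poly P x\<bar>) \<le>
   ennreal C * (havg k \<xi> \<zeta> N F x + ennreal (2 / (knot N (i + 2) - knot N i)) * (\<integral>z\<in>{knot N i..knot N (i + 2)}. havg k \<xi> \<zeta> N F z)))"
 obtain C1 where C1: "C1 > 0" and W1: "\<forall>N\<ge>1. \<forall>F i. F \<in> \<B> --> loc_integrable F --> i < 4 * N --> ?B C1 \<xi> \<zeta> N F i"
  using whitney_knots_left[OF k \<xi> \<zeta>] by (elim exE conjE)
 obtain C2 where C2: "C2 > 0" and W2: "\<forall>N\<ge>1. \<forall>F i. F \<in> \<B> --> loc_integrable F --> i < 4 * N --> ?B C2 \<zeta> \<xi> N F i"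
  using whitney_knots_left[OF k \<zeta> \<xi>] by (elim exE conjE)
 have up: "ennreal C1 * X <= ennreal (C1 + C2) * X" "ennreal C2 * X <= ennreal (C1 + C2) * X" for X
  using C1 C2 by (auto intro!: mult_right_mono ennreal_leI)
 show ?thesis
 proof (intro exI[of _ "C1 + C2"] conjI allI impI)
  show "0 < C1 + C2" using C1 C2 by simp
  fix N :: nat and F :: "real => real" and i :: nat
  assume N: "1 <= N" and F [measurable]: "F \<in> \<B>" and lF: "loc_integrable F" and i: "i + 2 <= 8 * N"
  show "?B (C1 + C2) \<xi> \<zeta> N F i"
  proof (cases "i < 4 * N")
   case True
   have "?B C1 \<xi> \<zeta> N F i" by (rule W1[rule_format, OF N F lF True])
   then obtain P where P: "P \<in> polys k" and B: "\<forall>x\<in>{knot N i<..<knot N (i + 2)}. ennreal (jw \<xi> \<zeta> x * \<bar>F x - poly P x\<bar>) \<le>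
   ennreal C1 * (havg k \<xi> \<zeta> N F x + ennreal (2 / (knot N (i + 2) - knot N i)) * (\<integral>z\<in>{knot N i..knot N (i + 2)}. havg k \<xi> \<zeta> N F z))"
    by (elim bexE)
   show ?thesis
   proof (rule bexI[OF _ P], rule ballI)
    fix x assume "x \<in> {knot N i<..<knot N (i + 2)}"
    note bspec[OF B this]
    also note up(1)
    finally show "ennreal (jw \<xi> \<zeta> x * \<bar>F x - poly P x\<bar>) \<le>
     ennreal (C1 + C2) * (havg k \<xi> \<zeta> N F x + ennreal (2 / (knot N (i + 2) - knot N i)) * (\<integral>z\<in>{knot N i..knot N (i + 2)}. havg k \<xi> \<zeta> N F z))" .
   qed
  next
   case False
   define G where "G = (\<lambda>x. F (- x))"
   have Gm: "G \<in> \<B>" unfolding G_def by measurable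
   have Gl: "loc_integrable G" unfolding G_def by (rule loc_integrable_reflect[OF lF])
   define i' where "i' = 8 * N - (i + 2)"
   have i': "i' < 4 * N" "i' + 2 = 8 * N - i" using False i by (auto simp: i'_def)
   have ka: "knot N i' = - knot N (i + 2)" unfolding i'_def using N i by (intro knot_reflect[symmetric]) auto
   have kb: "knot N (i' + 2) = - knot N i" unfolding i'(2) using N i by (intro knot_reflect[symmetric]) auto
   have "?B C2 \<zeta> \<xi> N G i'" by (rule W2[rule_format, OF N Gm Gl i'(1)])
   then obtain P' where P': "P' \<in> polys k" and B: "\<forall>x\<in>{knot N i'<..<knot N (i' + 2)}. ennreal (jw \<zeta> \<xi> x * \<bar>G x - poly P' x\<bar>) \<le>
   ennreal C2 * (havg k \<zeta> \<xi> N G x + ennreal (2 / (knot N (i' + 2) - knot N i')) * (\<integral>z\<in>{knot N i'..knot N (i' + 2)}. havg k \<zeta> \<xi> N G z))"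
    by (elim bexE)
   define P where "P = pcompose P' [:0, -1:]"
   have pP: "poly P x = poly P' (- x)" for x by (simp add: P_def poly_pcompose)
   have P: "P \<in> polys k" using P' unfolding P_def polys_def by (auto simp: degree_pcompose)
   have hG: "havg k \<zeta> \<xi> N G (- x) = havg k \<xi> \<zeta> N F x" for x unfolding G_def by (rule havg_reflect)
   have J: "(\<integral>z\<in>{knot N i'..knot N (i' + 2)}. havg k \<zeta> \<xi> N G z) = (\<integral>z\<in>{knot N i..knot N (i + 2)}. havg k \<xi> \<zeta> N F z)"
   proof -
    have [measurable]: "havg k \<zeta> \<xi> N G \<in> \<B>" by (rule havg_measurable[OF Gm])
    have "(\<integral>z\<in>{knot N i'..knot N (i' + 2)}. havg k \<zeta> \<xi> N G z) = (\<integral>z. havg k \<zeta> \<xi> N G (- z) * indicator {knot N i'..knot N (i' + 2)} (- z))"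
     by (rule nn_integral_reflect[symmetric]) measurable
    also have "... = (\<integral>z\<in>{knot N i..knot N (i + 2)}. havg k \<xi> \<zeta> N F z)"
     unfolding hG ka kb by (intro nn_integral_cong) (auto simp: indicator_def)
    finally show ?thesis .
   qed
   have le: "knot N (i' + 2) - knot N i' = knot N (i + 2) - knot N i" by (simp only: ka kb)
   show ?thesis
   proof (rule bexI[OF _ P], rule ballI)
    fix x assume "x \<in> {knot N i<..<knot N (i + 2)}"
    then have "- x \<in> {knot N i'<..<knot N (i' + 2)}" unfolding ka kb by auto
    note bspec[OF B this]
    then have "ennreal (jw \<xi> \<zeta> x * \<bar>F x - poly P x\<bar>) \<le>
     ennreal C2 * (havg k \<xi> \<zeta> N F x + ennreal (2 / (knot N (i + 2) - knot N i)) * (\<integral>z\<in>{knot N i..knot N (i + 2)}. havg k \<xi> \<zeta> N F z))"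
     unfolding hG J le jacobi_reflect pP by (simp add: G_def)
    then show "ennreal (jw \<xi> \<zeta> x * \<bar>F x - poly P x\<bar>) \<le>
     ennreal (C1 + C2) * (havg k \<xi> \<zeta> N F x + ennreal (2 / (knot N (i + 2) - knot N i)) * (\<integral>z\<in>{knot N i..knot N (i + 2)}. havg k \<xi> \<zeta> N F z))"
     using up(2) by (rule order_trans)
   qed
  qed
 qed
qed

section \<open>Gluing and the direct estimate for nonnegative exponents\<close>

text \<open>For fixed \<open>x\<close> the product \<open>w(x)*q\<close> is again a polynomial, so
  the growth bound applies to it. Comparing \<open>w(x)\<close> with the weight on the cell costs
  \<open>D^e\<close>, and the distance costs \<open>D^2\<close> per degree. The index range keeps
  the cell one angular step away from both endpoints, as the weight ratio requires.\<close>

lemma knot_poly_growth: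
 fixes u :: "real => ennreal"
 assumes k: "k >= 1" and \<xi>: "0 <= \<xi>" and \<zeta>: "0 <= \<zeta>" and e: "2 * \<xi> + 2 * \<zeta> <= real e"
  and N: "N >= 1" and i: "1 <= i" "i + 2 <= 8 * N" and q: "q \<in> polys k" and [measurable]: "u \<in> \<B>"
  and qu: "\<And>y. y \<in> {knot N i<..<knot N (i + 1)} ==> ennreal (jw \<xi> \<zeta> y * \<bar>poly q y\<bar>) <= u y"
  and a: "ennreal (1 / (knot N (i + 1) - knot N i)) * (\<integral>y\<in>{knot N i<..<knot N (i + 1)}. u y) <= a"
  and x: "x \<in> \<I>"
 shows "ennreal (jw \<xi> \<zeta> x * \<bar>poly q x\<bar>) \<le>
  ennreal (real k * (3 * real k) ^ k * 4 ^ (k - 1) * (24 * 32 ^ e) * (dfac (8 * N) x (knot N i)) ^ (2 * (k - 1) + e)) * a"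
proof -
 let ?w = "jw \<xi> \<zeta>"
 define D where "D = dfac (8 * N) x (knot N i)"
 define d where "d = knot N (i + 1) - knot N i"
 have NN: "1 <= real N" using N by simp
 have D1: "1 <= D" by (simp add: D_def dfac_ge1)
 have d: "0 < d" using knot_mono[OF N, of i "i + 1"] i by (simp add: d_def)
 have kd: "knot N i + d = knot N (i + 1)" by (simp add: d_def)
 have wx: "0 <= ?w x" using jacobi_pos[OF x, of \<xi> \<zeta>] by simp
 define W where "W = 24 * (32 * D) ^ e"
 have W0: "0 <= W" using D1 by (simp add: W_def)
 have ratio: "?w x <= W * ?w y" if y: "y \<in> {knot N i<..<knot N (i + 1)}" for y
 proof -
  have y1: "y \<in> \<I>" using y knot_in[of N i] knot_in[of N "i + 1"] by auto
  have "arccos (knot N (i + 1)) <= arccos y" using y y1 knot_in[of N "i + 1"] by (intro arccos_le_arccos) auto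
  moreover have "arccos (knot N (i + 1)) = pi - real (i + 1) * (pi / (8 * real N))" using N i by (intro arccos_knot) auto
  moreover have "real (i + 1) * (pi / (8 * real N)) <= (8 * real N - 1) * (pi / (8 * real N))"
   using i NN by (intro mult_right_mono) auto
  moreover have "(8 * real N - 1) * (pi / (8 * real N)) = pi - pi / (8 * real N)"
  proof -
   have "8 * real N * (pi / (8 * real N)) = pi" using NN by simp
   then show ?thesis by (simp only: left_diff_distrib mult_1_left)
  qed
  ultimately have l: "pi / (8 * real N) <= arccos y" by linarith
  have "arccos y <= arccos (knot N i)" using y y1 knot_in[of N i] by (intro arccos_le_arccos) auto
  moreover have "arccos (knot N i) = pi - real i * (pi / (8 * real N))" using N i by (intro arccos_knot) auto
  moreover have "1 * (pi / (8 * real N)) <= real i * (pi / (8 * real N))" using i by (intro mult_right_mono) auto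
  ultimately have r: "pi / (8 * real N) <= pi - arccos y" by linarith
  have n1: "1 <= real (8 * N) * z" if "pi / (8 * real N) <= z" for z
  proof -
   have "1 <= real (8 * N) * (pi / (8 * real N))" using NN pi_bounds by simp
   also have "... <= real (8 * N) * z" using that by (intro mult_left_mono) auto
   finally show ?thesis .
  qed
  have "?w x <= 24 * (4 * dfac (8 * N) x y) powr (2 * \<xi> + 2 * \<zeta>) * ?w y"
   using N by (intro jacobi_ratio_nonneg x y1 n1 l r \<xi> \<zeta>) auto
  also have "... <= W * ?w y"
  proof (rule mult_right_mono)
   have "dfac (8 * N) y (knot N i) <= 8"
   proof (rule knot_near[OF N i])
    have "knot N (i - 1) <= knot N i" "knot N (i + 1) <= knot N (i + 2)" using N i by (auto intro!: knot_mono_le)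
    then show "y \<in> {knot N (i - 1)..knot N (i + 2)}" using y by auto
   qed
   then have n: "8 * real N * \<bar>arccos y - arccos (knot N i)\<bar> <= 7" by (simp add: dfac_def)
   have "\<bar>arccos x - arccos y\<bar> <= \<bar>arccos x - arccos (knot N i)\<bar> + \<bar>arccos y - arccos (knot N i)\<bar>" by linarith
   then have "8 * real N * \<bar>arccos x - arccos y\<bar> <= 8 * real N * (\<bar>arccos x - arccos (knot N i)\<bar> + \<bar>arccos y - arccos (knot N i)\<bar>)"
    by (intro mult_left_mono) auto
   then have "dfac (8 * N) x y <= D + 7" using n by (simp add: dfac_def D_def distrib_left)
   \<comment> \<open>\<open>D + 7 <= 8*D\<close> because \<open>D >= 1\<close>; this is the origin
     of the 32.\<close>
   then have dd: "4 * dfac (8 * N) x y <= 32 * D" using D1 by linarith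
   have "(4 * dfac (8 * N) x y) powr (2 * \<xi> + 2 * \<zeta>) <= (32 * D) powr (2 * \<xi> + 2 * \<zeta>)"
    using dd \<xi> \<zeta> dfac_pos[of "8 * N" x y] by (intro powr_mono2) auto
   also have "... <= (32 * D) powr real e" using e D1 by (intro powr_mono) auto
   also have "... = (32 * D) ^ e" using D1 by (intro powr_realpow) auto
   finally show "24 * (4 * dfac (8 * N) x y) powr (2 * \<xi> + 2 * \<zeta>) <= W" by (simp add: W_def)
   show "0 <= ?w y" using jacobi_pos[OF y1, of \<xi> \<zeta>] by simp
  qed
  finally show ?thesis .
 qed
 have "ennreal \<bar>poly (smult (?w x) q) x\<bar> <= ennreal (real k * (3 * real k) ^ k * (1 + \<bar>x - knot N i\<bar> / d) ^ (k - 1)) *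
  (ennreal (1 / d) * (\<integral>y\<in>{knot N i<..<knot N i + d}. ennreal W * u y))"
 proof (rule poly_growth[OF k polys_smult[OF q] d])
  fix y assume "y \<in> {knot N i<..<knot N i + d}"
  then have y: "y \<in> {knot N i<..<knot N (i + 1)}" unfolding kd .
  have "\<bar>poly (smult (?w x) q) y\<bar> <= W * (?w y * \<bar>poly q y\<bar>)"
   using mult_right_mono[OF ratio[OF y], of "\<bar>poly q y\<bar>"] wx by (simp add: abs_mult mult.assoc)
  then have "ennreal \<bar>poly (smult (?w x) q) y\<bar> <= ennreal (W * (?w y * \<bar>poly q y\<bar>))" by (rule ennreal_leI)
  also have "... = ennreal W * ennreal (?w y * \<bar>poly q y\<bar>)" using W0 by (intro ennreal_mult) (auto simp: jacobi_weight_def)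
  also have "... <= ennreal W * u y" using qu[OF y] by (rule mult_left_mono) simp
  finally show "ennreal \<bar>poly (smult (?w x) q) y\<bar> <= ennreal W * u y" .
 qed measurable
 also have "(\<integral>y\<in>{knot N i<..<knot N i + d}. ennreal W * u y) = ennreal W * (\<integral>y\<in>{knot N i<..<knot N (i + 1)}. u y)"
  unfolding kd by (simp add: nn_integral_cmult mult.assoc)
 also have "ennreal (1 / d) * (ennreal W * (\<integral>y\<in>{knot N i<..<knot N (i + 1)}. u y)) = ennreal W * (ennreal (1 / d) * (\<integral>y\<in>{knot N i<..<knot N (i + 1)}. u y))"
  by (rule mult.left_commute)
 finally have 1: "ennreal \<bar>poly (smult (?w x) q) x\<bar> <= ennreal (real k * (3 * real k) ^ k * (1 + \<bar>x - knot N i\<bar> / d) ^ (k - 1)) *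
  (ennreal W * (ennreal (1 / d) * (\<integral>y\<in>{knot N i<..<knot N (i + 1)}. u y)))" .
 have 2: "real k * (3 * real k) ^ k * (1 + \<bar>x - knot N i\<bar> / d) ^ (k - 1) <= real k * (3 * real k) ^ k * (4 * D\<^sup>2) ^ (k - 1)"
  using knot_distance[OF N i, of x] x d unfolding D_def d_def by (intro mult_left_mono power_mono) auto
 have "ennreal \<bar>poly (smult (?w x) q) x\<bar> <= ennreal (real k * (3 * real k) ^ k * (4 * D\<^sup>2) ^ (k - 1)) * (ennreal W * a)"
  by (rule order_trans[OF 1 mult_mono[OF ennreal_leI[OF 2] mult_left_mono[OF a[folded d_def]]]]) auto
 also have "... = ennreal (real k * (3 * real k) ^ k * (4 * D\<^sup>2) ^ (k - 1) * W) * a"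
  unfolding mult.assoc[symmetric] using W0 D1 by (subst ennreal_mult) auto
 also have "real k * (3 * real k) ^ k * (4 * D\<^sup>2) ^ (k - 1) * W = real k * (3 * real k) ^ k * 4 ^ (k - 1) * (24 * 32 ^ e) * D ^ (2 * (k - 1) + e)"
  unfolding W_def power_mult_distrib power_add power_mult by simp
 finally show ?thesis using wx by (simp add: abs_mult D_def)
qed

text \<open>Double cells overlap, so \<open>x\<close> lies in an open one even if it is itself a
  knot; \<open>j\<close> then tells which of the steps have already jumped at
  \<open>x\<close>.\<close>

lemma knot_locate:
 assumes N: "N >= 1" and x: "x \<in> \<I>"
 shows "\<exists>j\<le>8 * N - 2. x \<in> {knot N j<..<knot N (j + 2)} \<and> (\<forall>i\<in>{1..8 * N - 2}. knot N i < x \<longleftrightarrow> i <= j)"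
proof -
 define S where "S = {i\<in>{0..8 * N - 2}. knot N i < x}"
 define j where "j = Max S"
 have fS: "finite S" by (simp add: S_def)
 have "0 \<in> S" using x by (simp add: S_def)
 then have "S ~= {}" by auto
 then have jS: "j \<in> S" unfolding j_def by (rule Max_in[OF fS])
 then have j: "j <= 8 * N - 2" "knot N j < x" by (auto simp: S_def)
 have iff: "knot N i < x \<longleftrightarrow> i <= j" if i: "i \<in> {1..8 * N - 2}" for i
 proof
  assume "knot N i < x"
  then have "i \<in> S" using i by (simp add: S_def)
  then show "i <= j" unfolding j_def by (rule Max_ge[OF fS])
 next
  assume "i <= j"
  then have "knot N i <= knot N j" using N j by (intro knot_mono_le) auto
  then show "knot N i < x" using j by simp
 qed
 have "x < knot N (j + 2)"
 proof (cases "j + 1 <= 8 * N - 2")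
  case True
  then have "\<not> knot N (j + 1) < x" using iff[of "j + 1"] by simp
  moreover have "knot N (j + 1) < knot N (j + 2)" using N True by (intro knot_mono) auto
  ultimately show ?thesis by simp
 next
  case False
  then have "j + 2 = 8 * N" using j N by simp
  then show ?thesis using x N by simp
 qed
 then show ?thesis using j iff by auto
qed

lemma polys_add: "a \<in> polys n ==> b \<in> polys n ==> a + b \<in> polys n"
 by (cases "a = 0"; cases "b = 0") (auto simp: polys_def intro: degree_add_less)

text \<open>With \<open>j\<close> the double cell of \<open>x\<close>, telescoping gives
  \<open>F - Q = (F - P j) + sum of q i * (step i - R i)\<close>. On cell \<open>i\<close> both
  local polynomials are close to \<open>F\<close>, so \<open>q i\<close> is small in the mean there;
  it grows at most like \<open>D^E\<close>, the Jackson error decays like \<open>D^(-E-4)\<close>,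
  and the kernel with \<open>D^(-4)\<close> remains. Knots live at scale \<open>N\<close> and
  polynomials at scale \<open>m\<close>; the assumption \<open>N <= K*m\<close> compares the two
  distances.\<close>

lemma direct_theorem_base:
 assumes k: "k >= 1" and \<xi>: "0 <= \<xi>" and \<zeta>: "0 <= \<zeta>" and p: "1 <= p" and K: "K >= 1"
 shows "\<exists>C>0. \<forall>N\<ge>1. \<forall>m\<ge>1. N <= K * m --> (\<forall>F c. 0 < c --> F \<in> \<B> --> loc_integrable F --> modulus_avg p k \<xi> \<zeta> N F c -->
  (\<exists>Q\<in>polys (m + k - 1). Lp_le p (\<lambda>x. ennreal (jw \<xi> \<zeta> x) * ennreal \<bar>F x - poly Q x\<bar>) (C * c)))"
proof -
 let ?w = "jw \<xi> \<zeta>"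
 obtain C1 where C1: "C1 > 0" and W: "\<forall>N\<ge>1. \<forall>F i. F \<in> \<B> --> loc_integrable F --> i + 2 <= 8 * N -->
  (\<exists>P\<in>polys k. \<forall>x\<in>{knot N i<..<knot N (i + 2)}. ennreal (?w x * \<bar>F x - poly P x\<bar>) \<le>
   ennreal C1 * (havg k \<xi> \<zeta> N F x + ennreal (2 / (knot N (i + 2) - knot N i)) * (\<integral>z\<in>{knot N i..knot N (i + 2)}. havg k \<xi> \<zeta> N F z)))"
  using whitney_knots[OF k \<xi> \<zeta>] by (elim exE conjE)
 define e where "e = nat \<lceil>2 * \<xi> + 2 * \<zeta>\<rceil>"
 have e: "2 * \<xi> + 2 * \<zeta> <= real e" unfolding e_def by (rule real_nat_ceiling_ge)
 define E where "E = 2 * (k - 1) + e"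
 obtain C2 where C2: "C2 > 0" and JS: "\<forall>n\<ge>1. \<forall>z\<in>{-1..1}. \<exists>R\<in>polys n. \<forall>x\<in>{-1..1}. \<bar>(if z < x then 1 else 0) - poly R x\<bar> <= C2 / dfac n x z ^ (E + 4)"
  using jackson_step[of "E + 4"] by (elim exE conjE)
 define B where "B = real k * (3 * real k) ^ k * 4 ^ (k - 1) * (24 * 32 ^ e)"
 have B0: "0 <= B" by (simp add: B_def)
 define C3 where "C3 = 8192 * C1 + B * C2 * (8 * real K) ^ (E + 4) * (6 * C1)"
 have C3: "0 < C3" unfolding C3_def using C1 C2 B0 by (intro add_pos_nonneg mult_nonneg_nonneg) auto
 define Ch where "Ch = 3 * 8 powr \<xi> + 3 * 8 powr \<zeta>"
 have Ch: "0 < Ch" by (simp add: Ch_def add_pos_pos)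
 define C where "C = C1 * Ch + C3 * (3072 * Ch)"
 have Cpos: "0 < C" using C1 C3 Ch by (simp add: C_def add_pos_pos)
 show ?thesis
 proof (rule exI[of _ C], intro conjI Cpos allI impI)
  fix N m :: nat and F :: "real => real" and c :: real
  assume N: "1 <= N" and m: "1 <= m" and NK: "N <= K * m" and c: "0 < c" and F [measurable]: "F \<in> \<B>"
   and lF: "loc_integrable F" and M: "modulus_avg p k \<xi> \<zeta> N F c"
  define H where "H = havg k \<xi> \<zeta> N F"
  have Hm [measurable]: "H \<in> \<B>" unfolding H_def by measurable
  have HL: "Lp_le p H (Ch * c)" unfolding H_def Ch_def by (rule havg_Lp[OF k \<xi> \<zeta> p N c F M])
  let ?I = "{1..8 * N - 2}"
  have ii: "1 <= i" "i + 2 <= 8 * N" if "i \<in> ?I" for i using that N by auto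
  define av where "av i = ennreal (1 / (knot N (i + 1) - knot N i)) * (\<integral>z\<in>{knot N (i - 1)..knot N (i + 2)}. H z)" for i
  define hd where "hd i = ennreal (2 / (knot N (i + 2) - knot N i)) * (\<integral>z\<in>{knot N i..knot N (i + 2)}. H z)" for i
  have "\<forall>i\<in>{0..8 * N - 2}. \<exists>P. P \<in> polys k \<and> (\<forall>x\<in>{knot N i<..<knot N (i + 2)}. ennreal (?w x * \<bar>F x - poly P x\<bar>) <= ennreal C1 * (H x + hd i))"
  proof
   fix i assume "i \<in> {0..8 * N - 2}"
   then have "i + 2 <= 8 * N" using N by auto
   from W[rule_format, OF N F lF this]
   show "\<exists>P. P \<in> polys k \<and> (\<forall>x\<in>{knot N i<..<knot N (i + 2)}. ennreal (?w x * \<bar>F x - poly P x\<bar>) <= ennreal C1 * (H x + hd i))"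
    unfolding H_def hd_def Bex_def .
  qed
  from bchoice[OF this] obtain P where P: "\<forall>i\<in>{0..8 * N - 2}. P i \<in> polys k \<and> (\<forall>x\<in>{knot N i<..<knot N (i + 2)}. ennreal (?w x * \<bar>F x - poly (P i) x\<bar>) <= ennreal C1 * (H x + hd i))" ..
  have Pk: "P i \<in> polys k" and PB: "x \<in> {knot N i<..<knot N (i + 2)} ==> ennreal (?w x * \<bar>F x - poly (P i) x\<bar>) <= ennreal C1 * (H x + hd i)" if "i <= 8 * N - 2" for i x
   using bspec[OF P, of i] that by auto
  have hd_av: "hd j <= ennreal 2 * av i" if i: "i \<in> ?I" and j: "j = i \<or> j = i - 1" for i j
  proof -
   have k1: "knot N (i - 1) <= knot N i" "knot N i < knot N (i + 1)" "knot N (i + 1) <= knot N (i + 2)"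
    using N ii[OF i] by (auto intro!: knot_mono_le knot_mono)
   have j2: "j + 2 = i + 2 \<or> j + 2 = i + 1" using j ii(1)[OF i] by auto
   have len: "knot N (i + 1) - knot N i <= knot N (j + 2) - knot N j"
    using j
   proof
    assume "j = i" then show ?thesis using k1 by simp
   next
    assume "j = i - 1"
    then have "j + 2 = i + 1" using ii(1)[OF i] by simp
    then show ?thesis using k1 \<open>j = i - 1\<close> by simp
   qed
   have sub: "{knot N j..knot N (j + 2)} \<subseteq> {knot N (i - 1)..knot N (i + 2)}"
    using j
   proof
    assume "j = i" then show ?thesis using k1 by auto
   next
    assume "j = i - 1"
    then have "j + 2 = i + 1" using ii(1)[OF i] by simp
    then show ?thesis using k1 \<open>j = i - 1\<close> by auto
   qed
   have "ennreal (2 / (knot N (j + 2) - knot N j)) <= ennreal 2 * ennreal (1 / (knot N (i + 1) - knot N i))"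
   proof -
    have "2 / (knot N (j + 2) - knot N j) <= 2 / (knot N (i + 1) - knot N i)"
     using len k1 by (intro divide_left_mono mult_pos_pos) auto
    then have "ennreal (2 / (knot N (j + 2) - knot N j)) <= ennreal (2 * (1 / (knot N (i + 1) - knot N i)))" by (intro ennreal_leI) simp
    also have "... = ennreal 2 * ennreal (1 / (knot N (i + 1) - knot N i))" using k1 by (intro ennreal_mult) auto
    finally show ?thesis .
   qed
   moreover have "(\<integral>z\<in>{knot N j..knot N (j + 2)}. H z) <= (\<integral>z\<in>{knot N (i - 1)..knot N (i + 2)}. H z)"
    using sub by (intro nn_integral_mono mult_left_mono) (auto simp: indicator_def)
   ultimately have "hd j <= (ennreal 2 * ennreal (1 / (knot N (i + 1) - knot N i))) * (\<integral>z\<in>{knot N (i - 1)..knot N (i + 2)}. H z)"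
    unfolding hd_def by (intro mult_mono) auto
   then show ?thesis by (simp only: av_def mult.assoc)
  qed
  define q where "q i = P i - P (i - 1)" for i
  have qk: "q i \<in> polys k" if i: "i \<in> ?I" for i
  proof -
   have "P i + smult (-1) (P (i - 1)) \<in> polys k" using i by (intro polys_add polys_smult Pk) auto
   then show ?thesis by (simp add: q_def)
  qed
  have qB: "ennreal (?w x * \<bar>poly (q i) x\<bar>) <= ennreal (B * (dfac (8 * N) x (knot N i)) ^ E) * (ennreal (6 * C1) * av i)"
   if i: "i \<in> ?I" and x: "x \<in> \<I>" for i x
  proof -
   have k1: "knot N (i - 1) <= knot N i" "knot N i < knot N (i + 1)" "knot N (i + 1) <= knot N (i + 2)"
    using N ii[OF i] by (auto intro!: knot_mono_le knot_mono)
   let ?d = "knot N (i + 1) - knot N i"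
   \<comment> \<open>Two local errors give \<open>2*C1*H\<close>, and each of the two averages is at
     most twice \<open>av i\<close>; averaging over the cell turns \<open>2 + 4\<close> into the 6
     of the bound.\<close>
   let ?u = "\<lambda>y. ennreal (2 * C1) * H y + ennreal (4 * C1) * av i"
   show ?thesis unfolding B_def E_def
   proof (rule knot_poly_growth[OF k \<xi> \<zeta> e N ii[OF i] qk[OF i] _ _ _ x, of ?u])
    fix y assume y: "y \<in> {knot N i<..<knot N (i + 1)}"
    have wy: "0 <= ?w y" by (simp add: jacobi_weight_def)
    have i1: "i - 1 + 2 = i + 1" using ii[OF i] by simp
    have "?w y * \<bar>poly (q i) y\<bar> <= ?w y * (\<bar>F y - poly (P i) y\<bar> + \<bar>F y - poly (P (i - 1)) y\<bar>)"
     using wy by (intro mult_left_mono) (auto simp: q_def)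
    then have "ennreal (?w y * \<bar>poly (q i) y\<bar>) <= ennreal (?w y * \<bar>F y - poly (P i) y\<bar> + ?w y * \<bar>F y - poly (P (i - 1)) y\<bar>)"
     by (intro ennreal_leI) (simp add: distrib_left)
    also have "... = ennreal (?w y * \<bar>F y - poly (P i) y\<bar>) + ennreal (?w y * \<bar>F y - poly (P (i - 1)) y\<bar>)"
     using wy by (intro ennreal_plus) auto
    also have "... <= ennreal C1 * (H y + hd i) + ennreal C1 * (H y + hd (i - 1))"
     using i y k1 i1 by (intro add_mono PB) auto
    also have "... <= ennreal C1 * (H y + ennreal 2 * av i) + ennreal C1 * (H y + ennreal 2 * av i)"
     by (intro add_mono mult_left_mono order_refl hd_av[OF i]) auto
    also have "... = ennreal C1 * (2 * H y) + ennreal C1 * (4 * av i)"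
     by (simp add: distrib_left mult_2[symmetric] algebra_simps flip: mult_2)
    also have "... = ?u y" using C1 by (simp add: ennreal_mult mult_ac)
    finally show "ennreal (?w y * \<bar>poly (q i) y\<bar>) <= ?u y" .
   next
    have em: "ennreal (1 / ?d) * emeasure lborel {knot N i<..<knot N (i + 1)} = 1"
     using k1 by (simp add: ennreal_mult[symmetric])
    have "ennreal (1 / ?d) * (\<integral>y\<in>{knot N i<..<knot N (i + 1)}. ?u y)
     = ennreal (2 * C1) * (ennreal (1 / ?d) * (\<integral>y\<in>{knot N i<..<knot N (i + 1)}. H y)) + ennreal (4 * C1) * av i * (ennreal (1 / ?d) * emeasure lborel {knot N i<..<knot N (i + 1)})"
    proof -
     have "(\<integral>y\<in>{knot N i<..<knot N (i + 1)}. ?u y) = (\<integral>y. ennreal (2 * C1) * (H y * indicator {knot N i<..<knot N (i + 1)} y) + ennreal (4 * C1) * av i * indicator {knot N i<..<knot N (i + 1)} y)"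
      by (intro nn_integral_cong) (simp only: distrib_right mult.assoc)
     also have "... = ennreal (2 * C1) * (\<integral>y\<in>{knot N i<..<knot N (i + 1)}. H y) + ennreal (4 * C1) * av i * emeasure lborel {knot N i<..<knot N (i + 1)}"
      by (subst nn_integral_add) (auto simp: nn_integral_cmult nn_integral_cmult_indicator)
     finally show ?thesis by (simp only: distrib_left mult_ac)
    qed
    also have "... <= ennreal (2 * C1) * av i + ennreal (4 * C1) * av i"
    proof -
     have "(\<integral>y\<in>{knot N i<..<knot N (i + 1)}. H y) <= (\<integral>y\<in>{knot N (i - 1)..knot N (i + 2)}. H y)"
      using k1 by (intro nn_integral_mono mult_left_mono) (auto simp: indicator_def)
     then have "ennreal (1 / ?d) * (\<integral>y\<in>{knot N i<..<knot N (i + 1)}. H y) <= av i" unfolding av_def by (rule mult_left_mono) simp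
     then show ?thesis unfolding em mult_1_right by (intro add_mono mult_left_mono) auto
    qed
    also have "... = ennreal (6 * C1) * av i"
    proof -
     have "ennreal (6 * C1) = ennreal (2 * C1) + ennreal (4 * C1)" using C1 by (subst ennreal_plus[symmetric]) auto
     then show ?thesis by (simp only: distrib_right)
    qed
    finally show "ennreal (1 / ?d) * (\<integral>y\<in>{knot N i<..<knot N (i + 1)}. ?u y) <= ennreal (6 * C1) * av i" .
   qed measurable
  qed
  have "\<forall>i\<in>?I. \<exists>R. R \<in> polys m \<and> (\<forall>x\<in>{-1..1}. \<bar>(if knot N i < x then 1 else 0) - poly R x\<bar> <= C2 / dfac m x (knot N i) ^ (E + 4))"
  proof
   fix i assume "i \<in> ?I"
   have "\<exists>R\<in>polys m. \<forall>x\<in>{-1..1}. \<bar>(if knot N i < x then 1 else 0) - poly R x\<bar> <= C2 / dfac m x (knot N i) ^ (E + 4)"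
    by (rule JS[rule_format, OF m knot_in])
   then show "\<exists>R. R \<in> polys m \<and> (\<forall>x\<in>{-1..1}. \<bar>(if knot N i < x then 1 else 0) - poly R x\<bar> <= C2 / dfac m x (knot N i) ^ (E + 4))"
    unfolding Bex_def .
  qed
  from bchoice[OF this] obtain R where R: "\<forall>i\<in>?I. R i \<in> polys m \<and> (\<forall>x\<in>{-1..1}. \<bar>(if knot N i < x then 1 else 0) - poly (R i) x\<bar> <= C2 / dfac m x (knot N i) ^ (E + 4))" ..
  \<comment> \<open>Each product has degree at most \<open>(k - 1) + (m - 1)\<close>.\<close>
  define Q where "Q = P 0 + (\<Sum>i\<in>?I. q i * R i)"
  have Qm: "Q \<in> polys (m + k - 1)"
  proof -
   have a: "q i * R i \<in> polys (m + k - 1)" if i: "i \<in> ?I" for i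
   proof -
    have "R i \<in> polys m" using bspec[OF R i] by simp
    then have "degree (R i) < m" using m by (auto simp: polys_def)
    moreover have "degree (q i) < k" using qk[OF i] k by (auto simp: polys_def)
    ultimately show ?thesis using degree_mult_le[of "q i" "R i"] by (auto simp: polys_def)
   qed
   have b: "P 0 \<in> polys (m + k - 1)" using Pk[of 0] m by (auto simp: polys_def)
   have "(\<Sum>i\<in>?I. q i * R i) \<in> polys (m + k - 1)" by (rule polys_sum[OF a])
   with b show ?thesis unfolding Q_def by (rule polys_add)
  qed
  let ?S = "\<lambda>x. \<integral>\<^sup>+y\<in>\<I>. knot_kernel N x y * H y \<partial>lborel"
  have S: "?S x = (\<Sum>i\<in>?I. ennreal (1 / (dfac' (8 * N) x (knot N i)) ^ 4) * av i)" for x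
  proof -
   have "?S x = (\<integral>y. (\<Sum>i\<in>?I. ennreal (1 / (dfac' (8 * N) x (knot N i)) ^ 4) * (ennreal (1 / (knot N (i + 1) - knot N i)) * (H y * indicator {knot N (i - 1)..knot N (i + 2)} y))))"
   proof (rule nn_integral_cong)
    fix y
    have "knot_kernel N x y * H y * indicator \<I> y = knot_kernel N x y * H y"
     unfolding H_def mult.assoc havg_outside ..
    also have "... = (\<Sum>i\<in>?I. ennreal (1 / (dfac' (8 * N) x (knot N i)) ^ 4) * (ennreal (1 / (knot N (i + 1) - knot N i)) * (H y * indicator {knot N (i - 1)..knot N (i + 2)} y)))"
     unfolding knot_kernel_def sum_distrib_right by (intro sum.cong refl) (simp only: mult_ac)
    finally show "knot_kernel N x y * H y * indicator \<I> y = (\<Sum>i\<in>?I. ennreal (1 / (dfac' (8 * N) x (knot N i)) ^ 4) * (ennreal (1 / (knot N (i + 1) - knot N i)) * (H y * indicator {knot N (i - 1)..knot N (i + 2)} y)))" .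
   qed
   also have "... = (\<Sum>i\<in>?I. ennreal (1 / (dfac' (8 * N) x (knot N i)) ^ 4) * av i)"
    unfolding av_def by (simp add: nn_integral_sum nn_integral_cmult)
   finally show ?thesis .
  qed
  have pw: "ennreal (?w x) * ennreal \<bar>F x - poly Q x\<bar> <= ennreal C1 * H x + ennreal C3 * ?S x" if x: "x \<in> \<I>" for x
  proof -
   have wx: "0 <= ?w x" by (simp add: jacobi_weight_def)
   have xx: "x \<in> {-1..1}" using x by auto
   obtain j where j: "j <= 8 * N - 2" "x \<in> {knot N j<..<knot N (j + 2)}" and ij: "\<forall>i\<in>?I. knot N i < x \<longleftrightarrow> i <= j"
    using knot_locate[OF N x] by (elim exE conjE)
   let ?D = "\<lambda>i. dfac (8 * N) x (knot N i)"
   have DD: "dfac' (8 * N) x (knot N i) = ?D i" for i by (rule dfac'_eq[OF xx knot_in])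
   define stp :: "nat => real" where "stp i = (if knot N i < x then 1 else 0)" for i
   have tele: "(\<Sum>i\<in>?I. poly (q i) x * stp i) = poly (P j) x - poly (P 0) x"
   proof -
    have "(\<Sum>i\<in>?I. poly (q i) x * stp i) = (\<Sum>i\<in>?I. if i \<in> {1..j} then poly (P i) x - poly (P (i - 1)) x else 0)"
     using ij by (intro sum.cong) (auto simp: stp_def q_def)
    also have "... = (\<Sum>i\<in>?I \<inter> {1..j}. poly (P i) x - poly (P (i - 1)) x)" by (rule sum.inter_restrict[symmetric]) simp
    also have "?I \<inter> {1..j} = {Suc 0..j}" using j by auto
    also have "(\<Sum>i\<in>{Suc 0..j}. poly (P i) x - poly (P (i - 1)) x) = poly (P j) x - poly (P 0) x" by (rule sum_telescope'') simp
    finally show ?thesis .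
   qed
   have "F x - poly Q x = (F x - poly (P j) x) + (\<Sum>i\<in>?I. poly (q i) x * stp i) - (\<Sum>i\<in>?I. poly (q i) x * poly (R i) x)"
    unfolding tele by (simp add: Q_def poly_sum)
   also have "... = (F x - poly (P j) x) + (\<Sum>i\<in>?I. poly (q i) x * (stp i - poly (R i) x))"
    by (simp add: right_diff_distrib sum_subtractf)
   finally have "\<bar>F x - poly Q x\<bar> <= \<bar>F x - poly (P j) x\<bar> + \<bar>\<Sum>i\<in>?I. poly (q i) x * (stp i - poly (R i) x)\<bar>" by (simp only: abs_triangle_ineq)
   also have "\<bar>\<Sum>i\<in>?I. poly (q i) x * (stp i - poly (R i) x)\<bar> <= (\<Sum>i\<in>?I. \<bar>poly (q i) x\<bar> * \<bar>stp i - poly (R i) x\<bar>)"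
    unfolding abs_mult[symmetric] by (rule sum_abs)
   finally have "?w x * \<bar>F x - poly Q x\<bar> <= ?w x * (\<bar>F x - poly (P j) x\<bar> + (\<Sum>i\<in>?I. \<bar>poly (q i) x\<bar> * \<bar>stp i - poly (R i) x\<bar>))"
    using wx by (intro mult_left_mono) auto
   also have "... = ?w x * \<bar>F x - poly (P j) x\<bar> + (\<Sum>i\<in>?I. (?w x * \<bar>poly (q i) x\<bar>) * \<bar>stp i - poly (R i) x\<bar>)"
    by (simp add: distrib_left sum_distrib_left mult.assoc)
   finally have "ennreal (?w x * \<bar>F x - poly Q x\<bar>) <= ennreal (?w x * \<bar>F x - poly (P j) x\<bar> + (\<Sum>i\<in>?I. (?w x * \<bar>poly (q i) x\<bar>) * \<bar>stp i - poly (R i) x\<bar>))" by (rule ennreal_leI)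
   also have "... = ennreal (?w x * \<bar>F x - poly (P j) x\<bar>) + ennreal (\<Sum>i\<in>?I. (?w x * \<bar>poly (q i) x\<bar>) * \<bar>stp i - poly (R i) x\<bar>)"
    using wx by (intro ennreal_plus sum_nonneg mult_nonneg_nonneg) auto
   also have "ennreal (\<Sum>i\<in>?I. (?w x * \<bar>poly (q i) x\<bar>) * \<bar>stp i - poly (R i) x\<bar>) = (\<Sum>i\<in>?I. ennreal ((?w x * \<bar>poly (q i) x\<bar>) * \<bar>stp i - poly (R i) x\<bar>))"
    using wx by (intro sum_ennreal[symmetric]) auto
   finally have 0: "ennreal (?w x * \<bar>F x - poly Q x\<bar>) <= ennreal (?w x * \<bar>F x - poly (P j) x\<bar>) + (\<Sum>i\<in>?I. ennreal ((?w x * \<bar>poly (q i) x\<bar>) * \<bar>stp i - poly (R i) x\<bar>))" .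
   have 1: "ennreal (?w x * \<bar>F x - poly (P j) x\<bar>) <= ennreal C1 * H x + ennreal (8192 * C1) * ?S x"
   proof -
    \<comment> \<open>For \<open>j = 0\<close> there is no cell \<open>j\<close> in the sum, but the
      neighbouring cell 1 serves as well.\<close>
    define i where "i = max j 1"
    have i: "i \<in> ?I" and ji: "j = i \<or> j = i - 1" using j N by (auto simp: i_def)
    have "hd j <= ennreal 2 * av i" by (rule hd_av[OF i ji])
    also have "... <= ennreal 8192 * (ennreal (1 / ?D i ^ 4) * av i)"
    proof -
     have "x \<in> {knot N (i - 1)..knot N (i + 2)}"
     proof -
      have "knot N (i - 1) <= knot N j" "knot N (j + 2) <= knot N (i + 2)" using ji N ii[OF i] by (auto intro!: knot_mono_le)
      then show ?thesis using j by auto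
     qed
     then have "?D i <= 8" by (rule knot_near[OF N ii[OF i]])
     then have "?D i ^ 4 <= 8 ^ 4" using dfac_pos[of "8 * N" x "knot N i"] by (intro power_mono) auto
     \<comment> \<open>\<open>8192 = 2 * 8^4\<close>: the factor of \<open>av i\<close> times the
       largest possible fourth power of \<open>dfac\<close>.\<close>
     then have "2 <= 8192 * (1 / ?D i ^ 4)" using dfac_pos[of "8 * N" x "knot N i"] by (simp add: pos_le_divide_eq)
     then have "ennreal 2 <= ennreal (8192 * (1 / ?D i ^ 4))" by (rule ennreal_leI)
     also have "... = ennreal 8192 * ennreal (1 / ?D i ^ 4)" using dfac_pos[of "8 * N" x "knot N i"] by (intro ennreal_mult) auto
     finally have "ennreal 2 * av i <= ennreal 8192 * ennreal (1 / ?D i ^ 4) * av i" by (rule mult_right_mono) simp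
     then show ?thesis by (simp only: mult.assoc)
    qed
    also have "ennreal (1 / ?D i ^ 4) * av i <= ?S x"
     unfolding S DD by (rule member_le_sum[OF i, of "\<lambda>i. ennreal (1 / ?D i ^ 4) * av i"]) auto
    finally have "hd j <= ennreal 8192 * ?S x" by (simp add: mult_left_mono)
    then have "ennreal C1 * (H x + hd j) <= ennreal C1 * (H x + ennreal 8192 * ?S x)" by (intro mult_left_mono add_left_mono) auto
    also have "... = ennreal C1 * H x + ennreal (8192 * C1) * ?S x"
    proof -
     have "ennreal (8192 * C1) = ennreal C1 * ennreal 8192" using C1 by (subst mult.commute) (intro ennreal_mult, auto)
     then show ?thesis by (simp only: distrib_left mult.assoc)
    qed
    finally show ?thesis using PB[OF j(1) j(2)] by (rule order_trans[rotated])
   qed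
   let ?c = "B * C2 * (8 * real K) ^ (E + 4) * (6 * C1)"
   have "ennreal ((?w x * \<bar>poly (q i) x\<bar>) * \<bar>stp i - poly (R i) x\<bar>) <= ennreal ?c * (ennreal (1 / ?D i ^ 4) * av i)" if i: "i \<in> ?I" for i
   proof -
    have Dp: "0 < ?D i" "0 < dfac m x (knot N i)" by (rule dfac_pos)+
    \<comment> \<open>The Jackson error is known in terms of \<open>m\<close>, the kernel in terms
      of \<open>8*N\<close>; the passage costs \<open>8*K\<close> per power.\<close>
    have D8: "?D i <= 8 * real K * dfac m x (knot N i)"
    proof -
     have "real N <= real K * real m" using NK by (simp flip: of_nat_mult)
     then have "8 * real N * \<bar>arccos x - arccos (knot N i)\<bar> <= 8 * (real K * real m) * \<bar>arccos x - arccos (knot N i)\<bar>" by (intro mult_right_mono mult_left_mono) auto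
     moreover have "1 <= real K" using K by simp
     ultimately show ?thesis by (simp add: dfac_def distrib_left mult.assoc)
    qed
    have "\<bar>stp i - poly (R i) x\<bar> <= C2 / dfac m x (knot N i) ^ (E + 4)" using bspec[OF R i] xx unfolding stp_def by blast
    also have "... <= C2 * (8 * real K) ^ (E + 4) / ?D i ^ (E + 4)"
    proof -
     have "?D i ^ (E + 4) <= (8 * real K * dfac m x (knot N i)) ^ (E + 4)" using D8 Dp by (intro power_mono) auto
     also have "... = (8 * real K) ^ (E + 4) * dfac m x (knot N i) ^ (E + 4)" by (rule power_mult_distrib)
     finally have "?D i ^ (E + 4) * C2 <= (8 * real K) ^ (E + 4) * dfac m x (knot N i) ^ (E + 4) * C2" using C2 by (intro mult_right_mono) auto
     moreover have "0 < ?D i ^ (E + 4)" "0 < dfac m x (knot N i) ^ (E + 4)" using Dp by auto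
     ultimately show ?thesis by (simp add: pos_divide_le_eq pos_le_divide_eq mult_ac)
    qed
    finally have r: "\<bar>stp i - poly (R i) x\<bar> <= C2 * (8 * real K) ^ (E + 4) / ?D i ^ (E + 4)" .
    have "ennreal ((?w x * \<bar>poly (q i) x\<bar>) * \<bar>stp i - poly (R i) x\<bar>) = ennreal (?w x * \<bar>poly (q i) x\<bar>) * ennreal \<bar>stp i - poly (R i) x\<bar>"
     using wx by (intro ennreal_mult) auto
    also have "... <= (ennreal (B * ?D i ^ E) * (ennreal (6 * C1) * av i)) * ennreal (C2 * (8 * real K) ^ (E + 4) / ?D i ^ (E + 4))"
     by (rule mult_mono[OF qB[OF i x] ennreal_leI[OF r]]) auto
    also have "... = (ennreal (B * ?D i ^ E) * ennreal (6 * C1) * ennreal (C2 * (8 * real K) ^ (E + 4) / ?D i ^ (E + 4))) * av i" by (simp only: mult_ac)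
    also have "ennreal (B * ?D i ^ E) * ennreal (6 * C1) * ennreal (C2 * (8 * real K) ^ (E + 4) / ?D i ^ (E + 4)) = ennreal (B * ?D i ^ E * (6 * C1) * (C2 * (8 * real K) ^ (E + 4) / ?D i ^ (E + 4)))"
     using B0 C1 C2 Dp by (subst ennreal_mult, (auto intro!: mult_nonneg_nonneg)[2], subst ennreal_mult) (auto intro!: mult_nonneg_nonneg)
    also have "B * ?D i ^ E * (6 * C1) * (C2 * (8 * real K) ^ (E + 4) / ?D i ^ (E + 4)) = ?c * (1 / ?D i ^ 4)"
    proof -
     have "?D i ^ (E + 4) = ?D i ^ E * ?D i ^ 4" by (rule power_add)
     moreover have "?D i ^ E ~= 0" using Dp by simp
     ultimately have "?D i ^ E / ?D i ^ (E + 4) = 1 / ?D i ^ 4" by simp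
     moreover have "B * ?D i ^ E * (6 * C1) * (C2 * (8 * real K) ^ (E + 4) / ?D i ^ (E + 4)) = ?c * (?D i ^ E / ?D i ^ (E + 4))" by simp
     ultimately show ?thesis by (simp only:)
    qed
    also have "ennreal (?c * (1 / ?D i ^ 4)) = ennreal ?c * ennreal (1 / ?D i ^ 4)" using B0 C1 C2 Dp by (intro ennreal_mult mult_nonneg_nonneg) auto
    finally show ?thesis by (simp only: mult.assoc)
   qed
   then have "(\<Sum>i\<in>?I. ennreal ((?w x * \<bar>poly (q i) x\<bar>) * \<bar>stp i - poly (R i) x\<bar>)) <= (\<Sum>i\<in>?I. ennreal ?c * (ennreal (1 / ?D i ^ 4) * av i))"
    by (rule sum_mono)
   also have "... = ennreal ?c * ?S x" unfolding S DD by (rule sum_distrib_left[symmetric])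
   finally have "ennreal (?w x * \<bar>F x - poly Q x\<bar>) <= (ennreal C1 * H x + ennreal (8192 * C1) * ?S x) + ennreal ?c * ?S x"
    by (intro order_trans[OF 0] add_mono 1)
   also have "... = ennreal C1 * H x + (ennreal (8192 * C1) + ennreal ?c) * ?S x" by (simp only: distrib_right add.assoc)
   also have "ennreal (8192 * C1) + ennreal ?c = ennreal C3" unfolding C3_def using B0 C1 C2 by (intro ennreal_plus[symmetric] mult_nonneg_nonneg) auto
   finally show ?thesis using wx by (simp add: ennreal_mult)
  qed
  have "Lp_le p (\<lambda>x. ennreal C1 * H x + ennreal C3 * ?S x) (C1 * (Ch * c) + C3 * (3072 * (Ch * c)))"
  proof (rule Lp_le_add[OF p])
   show "Lp_le p (\<lambda>x. ennreal C1 * H x) (C1 * (Ch * c))" using HL C1 Ch c by (intro Lp_le_cmult) auto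
   have "Lp_le p ?S (3072 * (Ch * c))" using Ch c by (intro Lp_le_knot_kernel p N HL) auto
   then show "Lp_le p (\<lambda>x. ennreal C3 * ?S x) (C3 * (3072 * (Ch * c)))" using C3 Ch c by (intro Lp_le_cmult) auto
   show "(\<lambda>x. ennreal C1 * H x) \<in> \<B>" by measurable
   show "(\<lambda>x. ennreal C3 * ?S x) \<in> \<B>" by measurable
  qed (use C1 C3 Ch c in simp_all)
  moreover have "C1 * (Ch * c) + C3 * (3072 * (Ch * c)) = C * c" by (simp add: C_def algebra_simps)
  ultimately have "Lp_le p (\<lambda>x. ennreal C1 * H x + ennreal C3 * ?S x) (C * c)" by (simp only:)
  moreover have "0 < C * c" using Cpos c by simp
  ultimately have "Lp_le p (\<lambda>x. ennreal (?w x) * ennreal \<bar>F x - poly Q x\<bar>) (C * c)"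
   by (rule Lp_le_mono[OF p _ _ order_refl pw])
  then show "\<exists>Q\<in>polys (m + k - 1). Lp_le p (\<lambda>x. ennreal (?w x) * ennreal \<bar>F x - poly Q x\<bar>) (C * c)"
   by (rule bexI[OF _ Qm])
 qed
qed

section \<open>Reduction to the highest derivative\<close>

lemma borel_measurable_lebesgue_on_AE:
 fixes f g :: "real => real"
 assumes g: "g \<in> \<B>" and ae: "AE x in lborel. x \<in> \<I> --> f x = g x"
 shows "f \<in> borel_measurable (lebesgue_on {-1..1})"
proof -
 have gm: "(\<lambda>x. indicator {-1..1} x *\<^sub>R g x) \<in> borel_measurable lebesgue"
  using g by (intro measurable_completion) (simp add: borel_measurable_times)
 have n: "AE x::real in lborel. x ~= -1 \<and> x ~= 1" by (intro AE_conjI AE_lborel_singleton)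
 with ae have "AE x in lborel. indicator {-1..1} x *\<^sub>R g x = indicator {-1..1} x *\<^sub>R f x"
  by eventually_elim (auto simp: indicator_def)
 then have "AE x in lebesgue. indicator {-1..1} x *\<^sub>R g x = indicator {-1..1} x *\<^sub>R f x" by (rule AE_completion)
 then have "(\<lambda>x. indicator {-1..1} x *\<^sub>R f x) \<in> borel_measurable lebesgue" by (rule borel_measurable_AE[OF gm])
 then show ?thesis by (subst borel_measurable_restrict_space_iff) auto
qed

lemma Lp_norm_le_iff_AE:
 assumes p: "1 <= p" and g: "g \<in> \<B>" and ae: "AE x in lborel. x \<in> \<I> --> f x = g x" and c: "c > 0"
 shows "Lp_norm p f <= ennreal c \<longleftrightarrow> Lp_le p (\<lambda>x. ennreal \<bar>g x\<bar>) c"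
proof -
 have "Lp_norm p f = Lp_norm p g"
  using borel_measurable_lebesgue_on_AE[OF g ae] borel_measurable_lebesgue_on[OF g] ae
  by (intro Lp_norm_cong_AE) (auto simp: AE_lebesgue_on_iff)
 then show ?thesis using Lp_norm_le_iff[OF p g c] by simp
qed

lemma poly_measurable [measurable]: "f \<in> borel_measurable M ==> (\<lambda>x. poly q (f x)) \<in> borel_measurable M" for q :: "real poly"
 by (rule measurable_compose[of f M borel]) (auto intro!: borel_measurable_continuous_onI continuous_intros)

lemma J_set_half: "\<alpha> \<in> J_set p ==> \<alpha> + 1/2 \<in> J_set p"
 by (auto simp: J_set_def split: if_splits)

text \<open>The approximation of \<open>G 1\<close>, whose weight has both exponents raised by
  \<open>1/2\<close>, is integrated and subtracted; Favard then treats the rest, since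
  \<open>w*\<phi>\<close> is exactly that raised weight. Integration raises the degree, so the
  derivative is approximated from \<open>polys (n - 1)\<close>.\<close>

lemma favard_iterate:
 assumes p: "1 <= p"
 shows "\<alpha> \<in> J_set p ==> \<beta> \<in> J_set p ==> \<exists>C>0. \<forall>n>r. \<forall>G c. 0 < c --> (\<forall>i\<le>r. (\<lambda>x. indicator \<I> x * G i x) \<in> \<B>) -->
  (\<forall>i<r. primitive_on \<I> (G i) (G (Suc i))) -->
  (\<forall>Q\<in>polys (n - r). Lp_le p (\<lambda>x. ennreal (jw (real r / 2 + \<alpha>) (real r / 2 + \<beta>) x) * ennreal \<bar>G r x - poly Q x\<bar>) c -->
   (\<exists>Q'\<in>polys n. Lp_le p (\<lambda>x. ennreal (jw \<alpha> \<beta> x) * ennreal \<bar>G 0 x - poly Q' x\<bar>) (C / real n ^ r * c)))"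
proof (induction r arbitrary: \<alpha> \<beta>)
 case 0
 show ?case by (rule exI[of _ 1]) auto
next
 case (Suc r)
 have J: "\<alpha> + 1/2 \<in> J_set p" "\<beta> + 1/2 \<in> J_set p" using Suc.prems by (auto intro: J_set_half)
 from Suc.IH[OF J] obtain C1 where C1: "C1 > 0" and I: "\<forall>n>r. \<forall>G c. 0 < c --> (\<forall>i\<le>r. (\<lambda>x. indicator \<I> x * G i x) \<in> \<B>) -->
  (\<forall>i<r. primitive_on \<I> (G i) (G (Suc i))) -->
  (\<forall>Q\<in>polys (n - r). Lp_le p (\<lambda>x. ennreal (jw (real r / 2 + (\<alpha> + 1/2)) (real r / 2 + (\<beta> + 1/2)) x) * ennreal \<bar>G r x - poly Q x\<bar>) c -->
   (\<exists>Q'\<in>polys n. Lp_le p (\<lambda>x. ennreal (jw (\<alpha> + 1/2) (\<beta> + 1/2) x) * ennreal \<bar>G 0 x - poly Q' x\<bar>) (C1 / real n ^ r * c)))"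
  by (elim exE conjE)
 from favard[OF p Suc.prems] obtain C2 where C2: "C2 > 0" and FV: "\<forall>n\<ge>1. \<forall>g D c. 0 < c --> D \<in> \<B> --> primitive_on \<I> g D -->
  Lp_le p (\<lambda>z. ennreal (jw \<alpha> \<beta> z * varphi z) * ennreal \<bar>D z\<bar>) c -->
  (\<exists>Q\<in>polys n. Lp_le p (\<lambda>x. ennreal (jw \<alpha> \<beta> x) * ennreal \<bar>g x - poly Q x\<bar>) (C2 / real n * c))"
  by (elim exE conjE)
 \<comment> \<open>\<open>2 ^ r\<close> absorbs the passage from \<open>n - 1\<close> to
   \<open>n\<close> in the \<open>r\<close> earlier factors.\<close>
 define C where "C = C2 * C1 * 2 ^ r"
 have Cp: "0 < C" using C1 C2 by (simp add: C_def)
 show ?case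
 proof (rule exI[of _ C], intro conjI Cp allI impI ballI)
  fix n :: nat and G :: "nat => real => real" and c :: real and Q :: "real poly"
  assume n: "Suc r < n" and c: "0 < c" and Gm: "\<forall>i\<le>Suc r. (\<lambda>x. indicator \<I> x * G i x) \<in> \<B>"
   and Gp: "\<forall>i<Suc r. primitive_on \<I> (G i) (G (Suc i))" and Q: "Q \<in> polys (n - Suc r)"
   and L: "Lp_le p (\<lambda>x. ennreal (jw (real (Suc r) / 2 + \<alpha>) (real (Suc r) / 2 + \<beta>) x) * ennreal \<bar>G (Suc r) x - poly Q x\<bar>) c"
  have rr: "real (Suc r) / 2 + a = real r / 2 + (a + 1/2)" for a by (simp add: add_divide_distrib)
  define n' where "n' = n - 1"
  have n': "r < n'" "1 <= n'" "n = Suc n'" using n by (auto simp: n'_def)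
  have "\<exists>Q'\<in>polys n'. Lp_le p (\<lambda>x. ennreal (jw (\<alpha> + 1/2) (\<beta> + 1/2) x) * ennreal \<bar>G (Suc 0) x - poly Q' x\<bar>) (C1 / real n' ^ r * c)"
  proof (rule I[rule_format, of n' c "\<lambda>i. G (Suc i)" Q])
   show "Lp_le p (\<lambda>x. ennreal (jw (real r / 2 + (\<alpha> + 1/2)) (real r / 2 + (\<beta> + 1/2)) x) * ennreal \<bar>G (Suc r) x - poly Q x\<bar>) c"
    using L unfolding rr .
   show "Q \<in> polys (n' - r)" using Q n' by simp
  qed (use n' c Gm Gp in auto)
  then obtain Q1 where Q1: "Q1 \<in> polys n'" and L1: "Lp_le p (\<lambda>x. ennreal (jw (\<alpha> + 1/2) (\<beta> + 1/2) x) * ennreal \<bar>G (Suc 0) x - poly Q1 x\<bar>) (C1 / real n' ^ r * c)"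
   by (elim bexE)
  have "\<exists>T\<in>polys n. poly T 0 = 0 \<and> (\<forall>x y. x <= y --> (poly Q1 has_integral (poly T y - poly T x)) {x..y})"
   unfolding n'(3) by (rule poly_primitive[OF Q1])
  then obtain T where T: "T \<in> polys n" and TI: "\<forall>x y. x <= y --> (poly Q1 has_integral (poly T y - poly T x)) {x..y}"
   by (elim bexE conjE)
  define D where "D = (\<lambda>x. indicator \<I> x * G (Suc 0) x - indicator \<I> x * poly Q1 x)"
  have Dm: "D \<in> \<B>"
  proof -
   have [measurable]: "(\<lambda>x. indicator \<I> x * G (Suc 0) x) \<in> \<B>" using Gm by simp
   show ?thesis unfolding D_def by measurable
  qed
  have Deq: "D x = G (Suc 0) x - poly Q1 x" if "x \<in> \<I>" for x using that by (simp add: D_def)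
  define g where "g = (\<lambda>x. G 0 x - poly T x)"
  have gD: "primitive_on \<I> g D"
   unfolding primitive_on_def
  proof (intro ballI impI)
   fix x y :: real assume xy: "x \<in> \<I>" "y \<in> \<I>" "x <= y"
   have "primitive_on \<I> (G 0) (G (Suc 0))" using Gp by simp
   then have "(G (Suc 0) has_integral (G 0 y - G 0 x)) {x..y}" using xy unfolding primitive_on_def by simp
   moreover have "(poly Q1 has_integral (poly T y - poly T x)) {x..y}" using TI xy by simp
   ultimately have "((\<lambda>z. G (Suc 0) z - poly Q1 z) has_integral ((G 0 y - G 0 x) - (poly T y - poly T x))) {x..y}" by (rule has_integral_diff)
   then have "((\<lambda>z. G (Suc 0) z - poly Q1 z) has_integral (g y - g x)) {x..y}" by (simp add: g_def algebra_simps)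
   then show "(D has_integral (g y - g x)) {x..y}"
    by (rule has_integral_eq[rotated]) (use xy Deq in auto)
  qed
  define c1 where "c1 = C1 / real n' ^ r * c"
  have c1: "0 < c1" using C1 c n' by (simp add: c1_def)
  have "Lp_le p (\<lambda>z. ennreal (jw \<alpha> \<beta> z * varphi z) * ennreal \<bar>D z\<bar>) c1"
   by (rule Lp_le_mono[OF p L1[folded c1_def] c1 order_refl]) (simp add: jacobi_varphi Deq)
  then have "\<exists>Q2\<in>polys n. Lp_le p (\<lambda>x. ennreal (jw \<alpha> \<beta> x) * ennreal \<bar>g x - poly Q2 x\<bar>) (C2 / real n * c1)"
   using FV[rule_format, of n c1 D g] n c1 Dm gD by simp
  then obtain Q2 where Q2: "Q2 \<in> polys n" and L2: "Lp_le p (\<lambda>x. ennreal (jw \<alpha> \<beta> x) * ennreal \<bar>g x - poly Q2 x\<bar>) (C2 / real n * c1)"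
   by (elim bexE)
  have nn: "0 < real n" "0 < real n'" using n' by auto
  have le: "C2 / real n * c1 <= C / real n ^ Suc r * c"
  proof -
   have "real n <= 2 * real n'" using n' by simp
   then have "real n ^ r <= (2 * real n') ^ r" using nn by (intro power_mono) auto
   also have "... = 2 ^ r * real n' ^ r" by (rule power_mult_distrib)
   finally have "1 / real n' ^ r <= 2 ^ r / real n ^ r" using nn by (simp add: pos_divide_le_eq pos_le_divide_eq mult.commute)
   then have "C2 * C1 * c / real n * (1 / real n' ^ r) <= C2 * C1 * c / real n * (2 ^ r / real n ^ r)"
    using C1 C2 c nn by (intro mult_left_mono) auto
   moreover have "C2 / real n * c1 = C2 * C1 * c / real n * (1 / real n' ^ r)" by (simp add: c1_def)
   moreover have "C / real n ^ Suc r * c = C2 * C1 * c / real n * (2 ^ r / real n ^ r)" by (simp add: C_def)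
   ultimately show ?thesis by (simp only:)
  qed
  have "Lp_le p (\<lambda>x. ennreal (jw \<alpha> \<beta> x) * ennreal \<bar>G 0 x - poly (T + Q2) x\<bar>) (C / real n ^ Suc r * c)"
  proof (rule Lp_le_mono[OF p L2 _ le])
   show "0 < C2 / real n * c1" using C2 nn c1 by simp
   fix x :: real
   have "G 0 x - poly (T + Q2) x = g x - poly Q2 x" by (simp add: g_def)
   then show "ennreal (jw \<alpha> \<beta> x) * ennreal \<bar>G 0 x - poly (T + Q2) x\<bar> <= ennreal (jw \<alpha> \<beta> x) * ennreal \<bar>g x - poly Q2 x\<bar>" by (simp only: order_refl)
  qed
  then show "\<exists>Q'\<in>polys n. Lp_le p (\<lambda>x. ennreal (jw \<alpha> \<beta> x) * ennreal \<bar>G 0 x - poly Q' x\<bar>) (C / real n ^ Suc r * c)"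
   by (rule bexI[OF _ polys_add[OF T Q2]])
 qed
qed

section \<open>From the supremum over steps to the average, and Borel representatives\<close>

text \<open>For fixed \<open>x\<close> in \<open>(-1,1)\<close> and \<open>a\<close> nonzero the
  point is a nonconstant affine function of \<open>h\<close>, so it avoids the null set for almost
  every \<open>h\<close>; Fubini exchanges the two quantifiers. For \<open>a = 0\<close> the point
  is \<open>x\<close> itself.\<close>

lemma AE_shifted_points:
 assumes N0: "N0 \<in> null_sets lborel"
 shows "AE h in lborel. AE x in lborel. x \<in> \<I> --> x + a * (h * varphi x) \<notin> N0"
proof -
 have [measurable]: "N0 \<in> sets borel" using N0 by (auto simp: null_sets_def)
 have n: "AE x in lborel. x \<notin> N0" using N0 by (rule AE_not_in)
 have "AE x in lborel. AE h in lborel. x \<in> \<I> --> x + a * (h * varphi x) \<notin> N0"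
 proof (cases "a = 0")
  case True
  show ?thesis using n by eventually_elim (simp add: True)
 next
  case False
  have "AE h in lborel. x \<in> \<I> --> x + a * (h * varphi x) \<notin> N0" for x
  proof (cases "x \<in> \<I>")
   case x: True
   have "a * varphi x ~= 0" using varphi_pos[OF x] False by simp
   then have "AE h in lborel. x + (a * varphi x) * h \<notin> N0" using n by (intro AE_borel_affine[of _ "\<lambda>y. y \<notin> N0"]) measurable
   then show ?thesis by eventually_elim (simp add: mult_ac)
  next
   case False
   then show ?thesis by (intro AE_I2) auto
  qed
  then show ?thesis by simp
 qed
 moreover have "(AE x in lborel. AE h in lborel. x \<in> \<I> --> x + a * (h * varphi x) \<notin> N0) \<longleftrightarrow> (AE h in lborel. AE x in lborel. x \<in> \<I> --> x + a * (h * varphi x) \<notin> N0)"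
  by (rule lborel_pair.AE_commute) measurable
 ultimately show ?thesis by simp
qed

text \<open>For almost every \<open>h\<close> all \<open>k + 1\<close> points of the difference
  avoid, for almost every \<open>x\<close>, the set where \<open>F\<close> and its Borel version
  differ. The supremum bounds the modular at each such \<open>h\<close> by 1, and the other steps do
  not affect the average.\<close>

lemma modulus_avg_from_dt_modulus:
 assumes p: "1 <= p" and n: "n >= 1" and F' [measurable]: "F' \<in> \<B>" and ae: "AE x in lborel. x \<in> \<I> --> F x = F' x"
  and c: "0 < c" and M: "dt_modulus k r F (1 / real n) \<alpha> \<beta> p <= ennreal c"
 shows "modulus_avg p k (real r / 2 + \<alpha>) (real r / 2 + \<beta>) n F' c"
proof -
 let ?W = "\<lambda>h. W_weight (real k * h) (real r / 2 + \<alpha>) (real r / 2 + \<beta>)"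
 have "AE x::real in lborel. x ~= -1 \<and> x ~= 1" by (intro AE_conjI AE_lborel_singleton)
 with ae have "AE x in lborel. x \<in> {-1..1} --> F x = F' x" by eventually_elim auto
 then obtain N0 where N0: "{x \<in> space lborel. \<not> (x \<in> {-1..1} --> F x = F' x)} \<subseteq> N0" "emeasure lborel N0 = 0" "N0 \<in> sets lborel"
  by (rule AE_E)
 have N0n: "N0 \<in> null_sets lborel" using N0 by auto
 have good: "F x = F' x" if "x \<notin> N0" "x \<in> {-1..1}" for x using that N0(1) by auto
 have "AE h in lborel. \<forall>i\<in>{..k}. AE x in lborel. x \<in> \<I> --> x + (real i - real k / 2) * (h * varphi x) \<notin> N0"
  by (rule AE_finite_allI[OF finite_atMost AE_shifted_points[OF N0n]])
 then have "AE h in lborel. h \<in> {0..1 / real n} --> Lp_le p (\<lambda>x. ennreal \<bar>?W h x * sym_diff k (h * varphi x) F' x\<bar>) c"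
 proof eventually_elim
  fix h
  assume A: "\<forall>i\<in>{..k}. AE x in lborel. x \<in> \<I> --> x + (real i - real k / 2) * (h * varphi x) \<notin> N0"
  show "h \<in> {0..1 / real n} --> Lp_le p (\<lambda>x. ennreal \<bar>?W h x * sym_diff k (h * varphi x) F' x\<bar>) c"
  proof
   assume h: "h \<in> {0..1 / real n}"
   have "AE x in lborel. \<forall>i\<in>{..k}. x \<in> \<I> --> x + (real i - real k / 2) * (h * varphi x) \<notin> N0"
    using A by (subst AE_finite_all) auto
   then have e: "AE x in lborel. x \<in> \<I> --> ?W h x * sym_diff k (h * varphi x) F x = ?W h x * sym_diff k (h * varphi x) F' x"
   proof eventually_elim
    fix x assume B: "\<forall>i\<in>{..k}. x \<in> \<I> --> x + (real i - real k / 2) * (h * varphi x) \<notin> N0"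
    show "x \<in> \<I> --> ?W h x * sym_diff k (h * varphi x) F x = ?W h x * sym_diff k (h * varphi x) F' x"
    proof
     assume x: "x \<in> \<I>"
     define s where "s = h * varphi x"
     have s0: "0 <= s" using h varphi_pos[OF x] by (simp add: s_def)
     have "sym_diff k s F x = sym_diff k s F' x"
     proof (cases "{x - real k * s / 2 .. x + real k * s / 2} \<subseteq> {-1..1}")
      case True
      have "F (x - real k * s / 2 + real i * s) = F' (x - real k * s / 2 + real i * s)" if i: "i \<in> {..k}" for i
      proof (rule good)
       have e: "x - real k * s / 2 + real i * s = x + (real i - real k / 2) * s" by (simp add: field_simps)
       show "x - real k * s / 2 + real i * s \<notin> N0" unfolding e using bspec[OF B i] x unfolding s_def by blast
       have "x - K / 2 + I \<in> {x - K / 2 .. x + K / 2}" if "0 <= I" "I <= K" for I K :: real using that by auto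
       moreover have "0 <= real i * s" "real i * s <= real k * s" using i s0 by (auto intro: mult_right_mono)
       ultimately have "x - real k * s / 2 + real i * s \<in> {x - real k * s / 2 .. x + real k * s / 2}" by blast
       then show "x - real k * s / 2 + real i * s \<in> {-1..1}" using True by (rule subsetD[rotated])
      qed
      then show ?thesis unfolding sym_diff_def by (auto intro!: sum.cong)
     next
      case False
      then show ?thesis unfolding sym_diff_def by (simp only: if_False)
     qed
     then show "?W h x * sym_diff k (h * varphi x) F x = ?W h x * sym_diff k (h * varphi x) F' x" by (simp add: s_def)
    qed
   qed
   have "Lp_norm p (\<lambda>x. ?W h x * sym_diff k (h * varphi x) F x) <= dt_modulus k r F (1 / real n) \<alpha> \<beta> p"
    unfolding dt_modulus_def by (rule SUP_upper[OF h])
   also have "... <= ennreal c" by (rule M)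
   finally have "Lp_norm p (\<lambda>x. ?W h x * sym_diff k (h * varphi x) F x) <= ennreal c" .
   moreover have "(\<lambda>x. ?W h x * sym_diff k (h * varphi x) F' x) \<in> \<B>" by measurable
   ultimately show "Lp_le p (\<lambda>x. ennreal \<bar>?W h x * sym_diff k (h * varphi x) F' x\<bar>) c"
    using Lp_norm_le_iff_AE[OF p _ e c] by simp
  qed
 qed
 then have "(\<integral>h\<in>{0..1 / real n}. (\<integral>x\<in>\<I>. Phi p (ennreal \<bar>?W h x * sym_diff k (h * varphi x) F' x\<bar> / ennreal c))) <= (\<integral>h. 1 * indicator {0..1 / real n} h)"
  by (intro nn_integral_mono_AE) (auto simp: Lp_le_def indicator_def elim!: eventually_mono)
 also have "... = ennreal (1 / real n)" by (simp add: nn_integral_cmult_indicator)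
 finally show ?thesis unfolding modulus_avg_def .
qed

text \<open>Inclusion of \<open>L_p\<close> in \<open>L_1\<close>: Jensen with the kernel
  \<open>1/2\<close> on an interval of length 2, together with
  \<open>Phi p \<infinity> = \<infinity>\<close>.\<close>

lemma Lp_le_nn_integral_finite:
 assumes p: "1 <= p" and [measurable]: "u \<in> \<B>" and L: "Lp_le p u c" and c: "0 < c"
 shows "(\<integral>x\<in>\<I>. u x) < \<infinity>"
proof -
 let ?k = "\<lambda>x::real. ennreal (1/2) * indicator \<I> x"
 have half: "ennreal (1/2) <= 1"
 proof -
  have "ennreal (1/2) <= ennreal 1" by (rule ennreal_leI) simp
  then show ?thesis by (simp only: ennreal_1)
 qed
 have "(\<integral>x. ?k x) = ennreal (1/2) * emeasure lborel \<I>" by (rule nn_integral_cmult_indicator) simp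
 also have "emeasure lborel \<I> = ennreal 2" by (subst emeasure_lborel_Ioo) auto
 also have "ennreal (1/2) * ennreal 2 = ennreal (1/2 * 2)" by (rule ennreal_mult[symmetric]) auto
 also have "... = 1" by simp
 finally have k: "(\<integral>x. ?k x) <= 1" by (rule eq_refl)
 have "Phi p (\<integral>x. ?k x * (u x / ennreal c)) <= (\<integral>x. ?k x * Phi p (u x / ennreal c))"
  by (rule Phi_nn_integral[OF p _ _ k]) measurable
 also have "... <= (\<integral>x\<in>\<I>. Phi p (u x / ennreal c))"
 proof (rule nn_integral_mono)
  fix x
  have "ennreal (1/2) * Phi p (u x / ennreal c) <= 1 * Phi p (u x / ennreal c)" by (rule mult_right_mono[OF half]) simp
  then show "?k x * Phi p (u x / ennreal c) <= Phi p (u x / ennreal c) * indicator \<I> x" by (cases "x \<in> \<I>") auto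
 qed
 also have "... <= 1" using L by (simp add: Lp_le_def)
 finally have "Phi p (\<integral>x. ?k x * (u x / ennreal c)) ~= \<infinity>" by (auto simp: top_unique)
 moreover have "Phi p \<infinity> = \<infinity>" by (simp add: Phi_def infinity_ennreal_def top_unique)
 ultimately have ne: "(\<integral>x. ?k x * (u x / ennreal c)) ~= \<infinity>" by metis
 have eq: "(\<integral>x. ?k x * (u x / ennreal c)) = ennreal (1/2) * (ennreal (1 / c) * (\<integral>x\<in>\<I>. u x))"
 proof -
  have "(\<integral>x. ?k x * (u x / ennreal c)) = (\<integral>x. ennreal (1/2) * (ennreal (1 / c) * (u x * indicator \<I> x)))"
   unfolding divide_ennreal_mult[OF c] by (simp only: mult_ac)
  also have "... = ennreal (1/2) * (ennreal (1 / c) * (\<integral>x\<in>\<I>. u x))" by (simp add: nn_integral_cmult)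
  finally show ?thesis .
 qed
 have "ennreal (1/2) * (ennreal (1 / c) * (\<integral>x\<in>\<I>. u x)) ~= top" using ne unfolding eq infinity_ennreal_def .
 moreover have "ennreal (1/2) ~= 0" "ennreal (1 / c) ~= 0" using c by auto
 ultimately have "(\<integral>x\<in>\<I>. u x) ~= top" unfolding ennreal_mult_eq_top_iff by blast
 then show ?thesis by (simp only: infinity_ennreal_def less_top)
qed

text \<open>On a compact subinterval of \<open>(-1,1)\<close> the weight times
  \<open>\<phi>^r\<close> is continuous and positive, hence bounded below.\<close>

lemma weighted_loc_integrable:
 assumes p: "1 <= p" and F [measurable]: "F \<in> \<B>"
  and L: "Lp_norm p (\<lambda>x. jw \<alpha> \<beta> x * (varphi x ^ r * F x)) < \<infinity>"
 shows "loc_integrable F"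
 unfolding loc_integrable_def
proof (intro allI impI)
 fix a b :: real assume ab: "-1 < a \<and> a <= b \<and> b < 1"
 let ?v = "\<lambda>x. jw \<alpha> \<beta> x * varphi x ^ r"
 let ?g = "\<lambda>x. jw \<alpha> \<beta> x * (varphi x ^ r * F x)"
 define c where "c = enn2real (Lp_norm p ?g) + 1"
 have c: "0 < c" by (simp add: c_def add_nonneg_pos)
 have "Lp_norm p ?g = ennreal (enn2real (Lp_norm p ?g))" using L by (simp add: ennreal_enn2real_if less_top)
 also have "... <= ennreal c" unfolding c_def by (intro ennreal_leI) simp
 finally have "Lp_le p (\<lambda>x. ennreal \<bar>?g x\<bar>) c" using Lp_norm_le_iff[OF p _ c, of ?g] by simp
 then have fin: "(\<integral>x\<in>\<I>. ennreal \<bar>?g x\<bar>) < \<infinity>" using c by (intro Lp_le_nn_integral_finite[OF p]) measurable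
 have vp: "0 < ?v x" if "x \<in> {a..b}" for x
  using that ab jacobi_pos[of x \<alpha> \<beta>] varphi_pos[of x] by auto
 have "continuous_on {a..b} ?v" unfolding jacobi_weight_def varphi_def using ab by (intro continuous_intros) auto
 then have "\<exists>x\<in>{a..b}. \<forall>y\<in>{a..b}. ?v x <= ?v y" using ab by (intro continuous_attains_inf) auto
 then obtain x0 where x0: "x0 \<in> {a..b}" "\<forall>y\<in>{a..b}. ?v x0 <= ?v y" by (elim bexE)
 define m where "m = ?v x0"
 have m: "0 < m" unfolding m_def by (rule vp[OF x0(1)])
 have "(\<integral>x\<in>{a..b}. ennreal \<bar>F x\<bar>) <= (\<integral>x. ennreal (1 / m) * (ennreal \<bar>?g x\<bar> * indicator \<I> x))"
 proof (rule nn_integral_mono)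
  fix x
  show "ennreal \<bar>F x\<bar> * indicator {a..b} x <= ennreal (1 / m) * (ennreal \<bar>?g x\<bar> * indicator \<I> x)"
  proof (cases "x \<in> {a..b}")
   case True
   have "m * \<bar>F x\<bar> <= ?v x * \<bar>F x\<bar>" using x0(2) True unfolding m_def by (intro mult_right_mono) auto
   also have "... = \<bar>?g x\<bar>" using vp[OF True] by (simp only: mult.assoc[symmetric] abs_mult[of "?v x"] abs_of_pos)
   finally have "\<bar>F x\<bar> <= 1 / m * \<bar>?g x\<bar>" using m by (simp add: pos_le_divide_eq mult.commute)
   then have "ennreal \<bar>F x\<bar> <= ennreal (1 / m * \<bar>?g x\<bar>)" by (rule ennreal_leI)
   also have "... = ennreal (1 / m) * ennreal \<bar>?g x\<bar>" using m by (intro ennreal_mult) auto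
   finally show ?thesis using True ab by simp
  qed simp
 qed
 also have "... = ennreal (1 / m) * (\<integral>x\<in>\<I>. ennreal \<bar>?g x\<bar>)" by (rule nn_integral_cmult) measurable
 also have "... < \<infinity>" using fin by (simp add: ennreal_mult_less_top)
 finally have "(\<integral>x\<in>{a..b}. ennreal \<bar>F x\<bar>) < \<infinity>" .
 moreover have "(\<integral>x. ennreal (norm (indicator {a..b} x *\<^sub>R F x))) = (\<integral>x\<in>{a..b}. ennreal \<bar>F x\<bar>)"
  by (intro nn_integral_cong) (auto simp: indicator_def)
 ultimately have "set_integrable lborel {a..b} F" unfolding set_integrable_def by (intro integrableI_bounded) auto
 then show "F integrable_on {a..b}" by (rule set_borel_integral_eq_integral(1))
qed

text \<open>Membership gives Lebesgue measurability of \<open>\<phi>^r f^(r)\<close>; its Borel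
  version is divided by \<open>\<phi>^r\<close>, which is positive on \<open>(-1,1)\<close>.\<close>

lemma B_space_borel_version:
 assumes f: "f \<in> B_space p r \<alpha> \<beta>"
 shows "\<exists>F'. F' \<in> \<B> \<and> (AE x in lborel. x \<in> \<I> --> rderiv r f x = F' x)"
  and "Lp_norm p (\<lambda>x. jw \<alpha> \<beta> x * (varphi x ^ r * rderiv r f x)) < \<infinity>"
proof -
 have W: "(\<lambda>x. varphi x ^ r * rderiv r f x) \<in> Lp_weighted p \<alpha> \<beta>"
  using f by (cases "r = 0") (auto simp: B_space_def rderiv_def)
 then show "Lp_norm p (\<lambda>x. jw \<alpha> \<beta> x * (varphi x ^ r * rderiv r f x)) < \<infinity>" by (simp add: Lp_weighted_def)
 have "(\<lambda>x. varphi x ^ r * rderiv r f x) \<in> borel_measurable (lebesgue_on {-1..1})" using W by (simp add: Lp_weighted_def)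
 then have "(\<lambda>x. indicator {-1..1} x *\<^sub>R (varphi x ^ r * rderiv r f x)) \<in> borel_measurable lebesgue"
  by (subst (asm) borel_measurable_restrict_space_iff) auto
 from completion_ex_borel_measurable_real[OF this]
 obtain u where u [measurable]: "u \<in> borel_measurable lborel" and ue: "AE x in lborel. indicator {-1..1} x *\<^sub>R (varphi x ^ r * rderiv r f x) = u x"
  by (elim bexE)
 have um: "(\<lambda>x. u x / varphi x ^ r) \<in> \<B>" using u by measurable
 moreover have "AE x in lborel. x \<in> \<I> --> rderiv r f x = u x / varphi x ^ r"
  using ue
 proof eventually_elim
  fix x assume e: "indicator {-1..1} x *\<^sub>R (varphi x ^ r * rderiv r f x) = u x"
  show "x \<in> \<I> --> rderiv r f x = u x / varphi x ^ r"
  proof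
   assume x: "x \<in> \<I>"
   then have "u x = varphi x ^ r * rderiv r f x" using e by (simp add: indicator_def)
   then show "rderiv r f x = u x / varphi x ^ r" using varphi_pos[OF x] by simp
  qed
 qed
 ultimately show "\<exists>F'. F' \<in> \<B> \<and> (AE x in lborel. x \<in> \<I> --> rderiv r f x = F' x)" by blast
qed

lemma primitive_on_open_borel:
 assumes "primitive_on \<I> g D"
 shows "(\<lambda>x. indicator \<I> x * g x) \<in> \<B>"
proof -
 have "continuous_on \<I> g"
 proof (subst continuous_on_eq_continuous_at)
  show "\<forall>x\<in>\<I>. isCont g x"
  proof
   fix x :: real assume x: "x \<in> \<I>"
   have "continuous_on {(x - 1) / 2..(x + 1) / 2} g" using x by (intro primitive_on_continuous[OF assms]) auto
   moreover have "x \<in> interior {(x - 1) / 2..(x + 1) / 2}" using x by (simp add: interior_atLeastAtMost_real)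
   ultimately show "isCont g x" by (rule continuous_on_interior)
  qed
 qed simp
 then have "(\<lambda>x. indicator \<I> x *\<^sub>R g x) \<in> \<B>"
  by (intro borel_measurable_continuous_on_indicator) auto
 then show ?thesis by simp
qed

text \<open>Below order \<open>r - 1\<close> the derivatives exist everywhere and the classical
  fundamental theorem links them. The last link uses local absolute continuity, and there the Borel
  version may replace \<open>f^(r)\<close> because gauge integrals ignore negligible sets.\<close>

lemma B_space_chain:
 assumes f: "f \<in> B_space p r \<alpha> \<beta>" and F' [measurable]: "F' \<in> \<B>"
  and ae: "AE x in lborel. x \<in> \<I> --> rderiv r f x = F' x"
 shows "\<exists>G. G r = F' \<and> (AE x in lborel. x \<in> \<I> --> f x = G 0 x) \<and>
  (\<forall>i\<le>r. (\<lambda>x. indicator \<I> x * G i x) \<in> \<B>) \<and> (\<forall>i<r. primitive_on \<I> (G i) (G (Suc i)))"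
proof (cases "r = 0")
 case True
 have "AE x in lborel. x \<in> \<I> --> f x = F' x" using ae by (simp add: True rderiv_def)
 moreover have "(\<lambda>x. indicator \<I> x * F' x) \<in> \<B>" by measurable
 ultimately show ?thesis using True by (intro exI[of _ "\<lambda>_. F'"]) simp
next
 case r: False
 define g where "g = (SOME g. g \<in> AC_reps r f)"
 have "AC_reps r f ~= {}" using f r by (simp add: B_space_def)
 then have g: "g \<in> AC_reps r f" unfolding g_def by (rule some_in_eq[THEN iffD2])
 have fg: "AE x in lborel. x \<in> \<I> --> f x = g x" and gd: "\<forall>i<r - 1. \<forall>x\<in>\<I>. (deriv ^^ i) g differentiable at x"
  and gA: "(deriv ^^ (r - 1)) g \<in> AC_loc"
  using g by (auto simp: AC_reps_def AE_lebesgue_on_iff)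
 have rd: "rderiv r f = (deriv ^^ r) g" using r by (simp add: rderiv_def g_def)
 define G where "G i = (if i < r then (deriv ^^ i) g else F')" for i
 have prim: "primitive_on \<I> (G i) (G (Suc i))" if i: "i < r" for i
 proof (cases "i < r - 1")
  case True
  have G1: "G i = (deriv ^^ i) g" "G (Suc i) = deriv ((deriv ^^ i) g)" using True i by (auto simp: G_def)
  show ?thesis unfolding primitive_on_def G1
  proof (intro ballI impI)
   fix x y :: real assume xy: "x \<in> \<I>" "y \<in> \<I>" "x <= y"
   show "(deriv ((deriv ^^ i) g) has_integral ((deriv ^^ i) g y - (deriv ^^ i) g x)) {x..y}"
   proof (rule fundamental_theorem_of_calculus[OF xy(3)])
    fix z assume "z \<in> {x..y}"
    then have "(deriv ^^ i) g differentiable at z" using gd True xy by auto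
    then have "((deriv ^^ i) g has_real_derivative deriv ((deriv ^^ i) g) z) (at z)" by (simp add: DERIV_deriv_iff_real_differentiable)
    then show "((deriv ^^ i) g has_vector_derivative deriv ((deriv ^^ i) g) z) (at z within {x..y})"
     by (simp add: has_real_derivative_iff_has_vector_derivative has_vector_derivative_at_within)
   qed
  qed
 next
  case False
  then have ir: "i = r - 1" "Suc i = r" using i by auto
  have G1: "G i = (deriv ^^ (r - 1)) g" "G (Suc i) = F'" using ir i by (auto simp: G_def)
  have rd': "rderiv r f = deriv ((deriv ^^ (r - 1)) g)" using ir(2) unfolding rd by (metis funpow.simps(2) comp_apply ir(1))
  obtain N0 where N0: "{x \<in> space lborel. \<not> (x \<in> \<I> --> rderiv r f x = F' x)} \<subseteq> N0" "emeasure lborel N0 = 0" "N0 \<in> sets lborel"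
   using ae by (rule AE_E)
  then have "N0 \<in> null_sets lborel" by auto
  then have neg: "negligible N0" unfolding negligible_iff_null_sets by (rule null_sets_completionI)
  show ?thesis unfolding primitive_on_def G1
  proof (intro ballI impI)
   fix x y :: real assume xy: "x \<in> \<I>" "y \<in> \<I>" "x <= y"
   have int: "(rderiv r f has_integral ((deriv ^^ (r - 1)) g y - (deriv ^^ (r - 1)) g x)) {x..y}"
    unfolding rd' using xy by (intro AC_loc_has_integral_deriv gA) auto
   have eqz: "F' z = rderiv r f z" if z: "z \<in> {x..y} - N0" for z
   proof (rule ccontr)
    assume "F' z ~= rderiv r f z"
    then have "z \<in> N0" using z xy by (intro subsetD[OF N0(1)]) auto
    then show False using z by simp
   qed
   show "(F' has_integral ((deriv ^^ (r - 1)) g y - (deriv ^^ (r - 1)) g x)) {x..y}"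
    by (rule has_integral_spike[OF neg eqz int])
  qed
 qed
 have "(\<lambda>x. indicator \<I> x * G i x) \<in> \<B>" if "i <= r" for i
 proof (cases "i < r")
  case True
  show ?thesis by (rule primitive_on_open_borel[OF prim[OF True]])
 next
  case False
  then have "G i = F'" by (simp add: G_def)
  then show ?thesis by simp
 qed
 moreover have "G r = F'" "G 0 = g" using r by (auto simp: G_def)
 ultimately show ?thesis using prim fg by (intro exI[of _ G]) auto
qed

section \<open>Combination of the direct estimate with iterated Favard inequalities\<close>

theorem theorem1p5:
  fixes k r :: nat and p :: ennreal and \<alpha> \<beta> :: real
  assumes "k \<ge> 1"
    and "1 \<le> p"
    and "\<alpha> \<in> J_set p" and "\<beta> \<in> J_set p"
    and "real r / 2 + \<alpha> \<ge> 0" and "real r / 2 + \<beta> \<ge> 0"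
  shows "\<exists>c::real. c > 0 \<and>
    (\<forall>f\<in>B_space p r \<alpha> \<beta>. \<forall>n::nat. n \<ge> k + r \<longrightarrow>
      best_approx n f \<alpha> \<beta> p
        \<le> ennreal (c / real n ^ r) * dt_modulus k r (rderiv r f) (1 / real n) \<alpha> \<beta> p)"
proof -
 let ?\<xi> = "real r / 2 + \<alpha>" and ?\<zeta> = "real r / 2 + \<beta>"
 note p = \<open>1 <= p\<close>
 have "r + k >= 1" using \<open>k >= 1\<close> by simp
 from direct_theorem_base[OF \<open>k >= 1\<close> assms(5,6) p this]
 obtain C1 where C1: "C1 > 0" and D: "\<forall>N\<ge>1. \<forall>m\<ge>1. N <= (r + k) * m --> (\<forall>F c. 0 < c --> F \<in> \<B> --> loc_integrable F --> modulus_avg p k ?\<xi> ?\<zeta> N F c -->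
  (\<exists>Q\<in>polys (m + k - 1). Lp_le p (\<lambda>x. ennreal (jw ?\<xi> ?\<zeta> x) * ennreal \<bar>F x - poly Q x\<bar>) (C1 * c)))"
  by (elim exE conjE)
 from favard_iterate[OF p assms(3,4), of r]
 obtain C2 where C2: "C2 > 0" and FI: "\<forall>n>r. \<forall>G c. 0 < c --> (\<forall>i\<le>r. (\<lambda>x. indicator \<I> x * G i x) \<in> \<B>) -->
  (\<forall>i<r. primitive_on \<I> (G i) (G (Suc i))) -->
  (\<forall>Q\<in>polys (n - r). Lp_le p (\<lambda>x. ennreal (jw ?\<xi> ?\<zeta> x) * ennreal \<bar>G r x - poly Q x\<bar>) c -->
   (\<exists>Q'\<in>polys n. Lp_le p (\<lambda>x. ennreal (jw \<alpha> \<beta> x) * ennreal \<bar>G 0 x - poly Q' x\<bar>) (C2 / real n ^ r * c)))"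
  by (elim exE conjE)
 define C where "C = C2 * C1"
 have C: "0 < C" using C1 C2 by (simp add: C_def)
 show ?thesis
 proof (rule exI[of _ C], intro conjI C ballI allI impI)
  fix f and n :: nat assume f: "f \<in> B_space p r \<alpha> \<beta>" and n: "k + r <= n"
  define \<Omega> where "\<Omega> = dt_modulus k r (rderiv r f) (1 / real n) \<alpha> \<beta> p"
  have n1: "n >= 1" "r < n" using n \<open>k >= 1\<close> by auto
  \<comment> \<open>Chosen so that the glued polynomial for \<open>f^(r)\<close> lies in
    \<open>polys (n - r)\<close>.\<close>
  define m where "m = n - r - k + 1"
  have m: "m >= 1" "m + k - 1 = n - r" "n = m + (r + k) - 1" using n \<open>k >= 1\<close> by (auto simp: m_def)
  \<comment> \<open>\<open>m + (r + k) - 1 <= (r + k) * m\<close> since both factors are at least 1;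
    so the knots can be taken at scale \<open>n\<close> with a comparison constant independent of
    \<open>n\<close>.\<close>
  have "n <= (r + k) * m"
  proof -
   obtain m' s where "m = Suc m'" "r + k = Suc s" using m(1) \<open>r + k >= 1\<close> by (metis Suc_le_D One_nat_def)
   then show ?thesis using m(3) by simp
  qed
  obtain F' where F'm: "F' \<in> \<B>" and ae: "AE x in lborel. x \<in> \<I> --> rderiv r f x = F' x"
   using B_space_borel_version(1)[OF f] by (elim exE conjE)
  have li: "loc_integrable F'"
  proof (rule weighted_loc_integrable[OF p F'm])
   have [measurable]: "F' \<in> \<B>" by (rule F'm)
   have gm: "(\<lambda>x. jw \<alpha> \<beta> x * (varphi x ^ r * F' x)) \<in> \<B>" by measurable
   have e: "AE x in lborel. x \<in> \<I> --> jw \<alpha> \<beta> x * (varphi x ^ r * rderiv r f x) = jw \<alpha> \<beta> x * (varphi x ^ r * F' x)"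
    using ae by eventually_elim auto
   have "Lp_norm p (\<lambda>x. jw \<alpha> \<beta> x * (varphi x ^ r * rderiv r f x)) = Lp_norm p (\<lambda>x. jw \<alpha> \<beta> x * (varphi x ^ r * F' x))"
    using e by (intro Lp_norm_cong_AE borel_measurable_lebesgue_on_AE[OF gm e] borel_measurable_lebesgue_on[OF gm]) (simp add: AE_lebesgue_on_iff)
   then show "Lp_norm p (\<lambda>x. jw \<alpha> \<beta> x * (varphi x ^ r * F' x)) < \<infinity>" using B_space_borel_version(2)[OF f] by simp
  qed
  obtain G where G: "G r = F'" "AE x in lborel. x \<in> \<I> --> f x = G 0 x"
   "\<forall>i\<le>r. (\<lambda>x. indicator \<I> x * G i x) \<in> \<B>" "\<forall>i<r. primitive_on \<I> (G i) (G (Suc i))"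
   using B_space_chain[OF f F'm ae] by (elim exE conjE)
  have bound: "best_approx n f \<alpha> \<beta> p <= ennreal (C / real n ^ r * c)" if c: "0 < c" and M: "\<Omega> <= ennreal c" for c
  proof -
   have MA: "modulus_avg p k ?\<xi> ?\<zeta> n F' c"
    using M unfolding \<Omega>_def by (rule modulus_avg_from_dt_modulus[OF p n1(1) F'm ae c])
   have "\<exists>Q\<in>polys (m + k - 1). Lp_le p (\<lambda>x. ennreal (jw ?\<xi> ?\<zeta> x) * ennreal \<bar>F' x - poly Q x\<bar>) (C1 * c)"
    by (rule D[rule_format, OF n1(1) m(1) \<open>n <= (r + k) * m\<close> c F'm li MA])
   then obtain Q where Q: "Q \<in> polys (n - r)" and QL: "Lp_le p (\<lambda>x. ennreal (jw ?\<xi> ?\<zeta> x) * ennreal \<bar>G r x - poly Q x\<bar>) (C1 * c)"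
    unfolding m(2) G(1) by (elim bexE)
   have c1: "0 < C1 * c" using C1 c by simp
   have "\<exists>Q'\<in>polys n. Lp_le p (\<lambda>x. ennreal (jw \<alpha> \<beta> x) * ennreal \<bar>G 0 x - poly Q' x\<bar>) (C2 / real n ^ r * (C1 * c))"
    using FI[rule_format, OF n1(2) c1, of G Q] G(3,4) Q QL by blast
   then obtain Q' where Q': "Q' \<in> polys n" and L': "Lp_le p (\<lambda>x. ennreal (jw \<alpha> \<beta> x) * ennreal \<bar>G 0 x - poly Q' x\<bar>) (C2 / real n ^ r * (C1 * c))"
    by (elim bexE)
   have cc: "C2 / real n ^ r * (C1 * c) = C / real n ^ r * c" by (simp add: C_def)
   define d where "d = C / real n ^ r * c"
   have d: "0 < d" using C c n1 by (simp add: d_def)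
   \<comment> \<open>The indicator is there because \<open>G 0\<close> is known to be measurable on
     \<open>(-1,1)\<close> only.\<close>
   let ?g = "\<lambda>x. jw \<alpha> \<beta> x * (indicator \<I> x * G 0 x - poly Q' x)"
   have [measurable]: "(\<lambda>x. indicator \<I> x * G 0 x) \<in> \<B>" using G(3) by simp
   have gm: "?g \<in> \<B>" by measurable
   have e: "AE x in lborel. x \<in> \<I> --> jw \<alpha> \<beta> x * (f x - poly Q' x) = ?g x"
    using G(2) by eventually_elim simp
   have "Lp_le p (\<lambda>x. ennreal \<bar>?g x\<bar>) d"
   proof (rule Lp_le_mono[OF p L'[unfolded cc, folded d_def] d order_refl])
    fix x :: real assume x: "x \<in> \<I>"
    have "0 <= jw \<alpha> \<beta> x" using jacobi_pos[OF x, of \<alpha> \<beta>] by simp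
    then show "ennreal \<bar>?g x\<bar> <= ennreal (jw \<alpha> \<beta> x) * ennreal \<bar>G 0 x - poly Q' x\<bar>" using x by (simp add: abs_mult ennreal_mult)
   qed
   then have "Lp_norm p (\<lambda>x. jw \<alpha> \<beta> x * (f x - poly Q' x)) <= ennreal d" using Lp_norm_le_iff_AE[OF p gm e d] by simp
   then show ?thesis unfolding best_approx_def d_def by (rule INF_lower2[OF Q'])
  qed
  define \<gamma> where "\<gamma> = C / real n ^ r"
  have Cn: "0 < \<gamma>" using C n1 by (simp add: \<gamma>_def)
  have "best_approx n f \<alpha> \<beta> p <= ennreal \<gamma> * \<Omega>"
  proof (cases "\<Omega> = \<infinity>")
   case True
   then show ?thesis using Cn by (simp add: ennreal_mult_top)
  next
   case False
   then obtain w where w: "0 <= w" "\<Omega> = ennreal w" by (cases \<Omega>) auto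
   show ?thesis
   proof (rule ennreal_le_epsilon)
    fix e :: real assume e: "0 < e"
    \<comment> \<open>The bound needs a positive \<open>c\<close>, while the modulus may vanish; the
      surplus \<open>e / \<gamma>\<close> contributes exactly \<open>e\<close> and is sent to
      0.\<close>
    define c where "c = w + e / \<gamma>"
    have eg: "0 < e / \<gamma>" using e Cn by simp
    then have c: "0 < c" unfolding c_def using w(1) by simp
    have "\<Omega> <= ennreal c" unfolding w(2) c_def using eg by (intro ennreal_leI) simp
    then have "best_approx n f \<alpha> \<beta> p <= ennreal (\<gamma> * c)" unfolding \<gamma>_def by (rule bound[OF c])
    also have "\<gamma> * c = \<gamma> * w + e" unfolding c_def distrib_left using Cn by simp
    also have "ennreal (\<gamma> * w + e) = ennreal (\<gamma> * w) + ennreal e" using Cn w(1) e by (intro ennreal_plus) auto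
    also have "ennreal (\<gamma> * w) = ennreal \<gamma> * ennreal w" using Cn w(1) by (intro ennreal_mult) auto
    finally show "best_approx n f \<alpha> \<beta> p <= ennreal \<gamma> * \<Omega> + ennreal e" unfolding w(2) .
   qed
  qed
  then show "best_approx n f \<alpha> \<beta> p <= ennreal (C / real n ^ r) * dt_modulus k r (rderiv r f) (1 / real n) \<alpha> \<beta> p"
   by (simp only: \<Omega>_def \<gamma>_def)
 qed
qed

end
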